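(* Let $A$ be a finite dimensional $k$-algebra of finite CM-type over a field $k$, and let $\mathcal{G}p(A)$ be its relative Auslander algebra. Then $$\mathrm{Grepdim}\,A\ \ge\ \dim D^{b}_{gp}(A)\ \ge\ \dim\mathcal{G}p(A)-1.$$
   Context: $A\text{-}\mathrm{mod}$ is the category of finitely generated left $A$-modules, $A\text{-}\mathrm{proj}$ the finitely generated projective ones. A module $M\in A\text{-}\mathrm{mod}$ is Gorenstein projective if there is an exact complex $P^\bullet=\cdots\to P^{-1}\to P^0\xrightarrow{d^0}P^1\to\cdots$ in $A\text{-}\mathrm{proj}$ with $\mathrm{Hom}_A(P^\bullet,Q)$ exact for all $Q\in A\text{-}\mathrm{proj}$ and $M\cong\ker d^0$; $A\text{-}\mathcal{G}\mathrm{proj}$ denotes the full subcategory of these. $A$ is of finite CM-type if there are only finitely many indecomposables in $A\text{-}\mathcal{G}\mathrm{proj}$ up to isomorphism; let $G_1,\dots,G_m$ be representatives and $G=\bigoplus_i G_i$. The relative Auslander algebra of $A$ is $\mathcal{G}p(A)=\mathrm{End}_A(G)^{\mathrm{op}}$, a finite dimensional $k$-algebra. $\dim\mathcal{G}p(A)$ denotes its Krull dimension, i.e. the Krull dimension of (the support of) $\mathcal{G}p(A)$ as a finitely generated module over the base ring $k$. $\nu$ is the Nakayama functor $D\,\mathrm{Hom}_A(-,A)$, with $D$ the standard duality. For $M,X\in A\text{-}\mathrm{mod}$, $M\text{-}\mathrm{resol.dim}\,X$ is the least $n\ge 0$ such that there is an exact sequence $0\to M_n\to\cdots\to M_0\to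 X\to 0$ with all $M_i\in\mathrm{add}\,M$ which stays exact under $\mathrm{Hom}_A(M,-)$ (and $\infty$ if none exists), and $M\text{-}\mathrm{resol.dim}(A\text{-}\mathrm{mod})$ is the supremum over $X\in A\text{-}\mathrm{mod}$. The Gorenstein representation dimension is $$\mathrm{Grepdim}\,A=\min\{M\text{-}\mathrm{resol.dim}(A\text{-}\mathrm{mod})\mid M\in A\text{-}\mathrm{mod},\ G\oplus\nu(G)\in\mathrm{add}\,M\}+2.$$ A complex $C^\bullet$ in $A\text{-}\mathrm{mod}$ is $A\text{-}\mathcal{G}\mathrm{proj}$-acyclic if $\mathrm{Hom}_A(G',C^\bullet)$ is exact for all $G'\in A\text{-}\mathcal{G}\mathrm{proj}$. The bounded Gorenstein derived category $D^b_{gp}(A)$ is the Verdier quotient of $K^b(A\text{-}\mathrm{mod})$ by the subcategory of $A\text{-}\mathcal{G}\mathrm{proj}$-acyclic complexes. For an object $M$ of a triangulated category $\mathcal{T}$: $\langle M\rangle=\langle M\rangle_1=\mathrm{add}\{M[i]\mid i\in\mathbb{Z}\}$, and $\langle M\rangle_{n+1}=\mathrm{add}\{X\mid \exists\text{ a distinguished triangle } M'\to X\to M''\to M'[1]\text{ with }M'\in\langle M\rangle,\ M''\in\langle M\rangle_n\}$, where $\mathrm{add}$ means direct summands of finite direct sums. The dimension of $\mathcal{T}$ is $\dim\mathcal{T}=\inf\{n\in\mathbb{N}\mid \exists M\in\mathcal{T}:\ \langle M\rangle_{n+1}=\mathcal{T}\}$. *)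

theory Defs
  imports "HOL-Algebra.Module" "HOL-Algebra.Ideal" "HOL-Library.Extended_Real"
begin

section \<open>Categories, direct sums, triangulated categories\<close>

text \<open>
  Categories are records; \<open>cmp C X Y Z g f\<close> is the composite of
  \<open>f : X \<rightarrow> Y\<close> and \<open>g : Y \<rightarrow> Z\<close>.  All hom sets and compositions that are used below come
  from additive categories.
\<close>

record ('o, 'm) cat =
  Ob :: "'o set"
  Hm :: "'o \<Rightarrow> 'o \<Rightarrow> 'm set"
  idt :: "'o \<Rightarrow> 'm"
  cmp :: "'o \<Rightarrow> 'o \<Rightarrow> 'o \<Rightarrow> 'm \<Rightarrow> 'm \<Rightarrow> 'm"

definition is_iso :: "('o, 'm, 'z) cat_scheme \<Rightarrow> 'o \<Rightarrow> 'o \<Rightarrow> 'm \<Rightarrow> bool" where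
  "is_iso C X Y f \<longleftrightarrow> f \<in> Hm C X Y \<and>
     (\<exists>g\<in>Hm C Y X. cmp C X Y X g f = idt C X \<and> cmp C Y X Y f g = idt C Y)"

text \<open>
  \<open>S\<close>, with the injections \<open>\<iota> j\<close>, is the direct sum of the family \<open>X j\<close>, \<open>j \<in> J\<close>.  In an
  additive category and for finite \<open>J\<close>, direct sums, biproducts and coproducts agree; we use
  the universal property of the coproduct.
\<close>

definition direct_sum ::
  "('o, 'm, 'z) cat_scheme \<Rightarrow> nat set \<Rightarrow> (nat \<Rightarrow> 'o) \<Rightarrow> 'o \<Rightarrow> (nat \<Rightarrow> 'm) \<Rightarrow> bool" where
  "direct_sum C J X S \<iota> \<longleftrightarrow>
     S \<in> Ob C \<and> (\<forall>j\<in>J. X j \<in> Ob C \<and> \<iota> j \<in> Hm C (X j) S) \<and>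
     (\<forall>T\<in>Ob C. \<forall>f. (\<forall>j\<in>J. f j \<in> Hm C (X j) T) \<longrightarrow>
        (\<exists>!h. h \<in> Hm C S T \<and> (\<forall>j\<in>J. cmp C (X j) S T h (\<iota> j) = f j)))"

definition direct_sum2 :: "('o, 'm, 'z) cat_scheme \<Rightarrow> 'o \<Rightarrow> 'o \<Rightarrow> 'o \<Rightarrow> bool" where
  "direct_sum2 C X Y S \<longleftrightarrow> (\<exists>\<iota>. direct_sum C {0, 1} (\<lambda>j. if j = 0 then X else Y) S \<iota>)"

definition add_closure :: "('o, 'm, 'z) cat_scheme \<Rightarrow> 'o set \<Rightarrow> 'o set" where
  "add_closure C \<X> = {X \<in> Ob C. \<exists>(n::nat) Y S \<iota> X'.
      (\<forall>j<n. Y j \<in> \<X>) \<and> direct_sum C {..<n} Y S \<iota> \<and> X' \<in> Ob C \<and> direct_sum2 C X X' S}"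

text \<open>
  \<open>shO C i X\<close> is \<open>X[i]\<close> and \<open>shM C i f\<close> is \<open>f[i]\<close>.
  A triangle \<open>(X, Y, Z, u, v, w)\<close> stands for
  \<open>X \<rightarrow> Y \<rightarrow> Z \<rightarrow> X[1]\<close> with arrows \<open>u\<close>, \<open>v\<close>, \<open>w\<close>.
\<close>

record ('o, 'm) shift_cat = "('o, 'm) cat" +
  shO :: "int \<Rightarrow> 'o \<Rightarrow> 'o"
  shM :: "int \<Rightarrow> 'm \<Rightarrow> 'm"

type_synonym ('o, 'm) triangle = "'o \<times> 'o \<times> 'o \<times> 'm \<times> 'm \<times> 'm"

record ('o, 'm) tri_cat = "('o, 'm) shift_cat" +
  Tri :: "('o, 'm) triangle set"

definition triangle_iso ::
  "('o, 'm, 'z) shift_cat_scheme \<Rightarrow> ('o, 'm) triangle \<Rightarrow> ('o, 'm) triangle \<Rightarrow> bool" where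
  "triangle_iso C = (\<lambda>(X, Y, Z, u, v, w) (X', Y', Z', u', v', w').
     X \<in> Ob C \<and> Y \<in> Ob C \<and> Z \<in> Ob C \<and>
     u \<in> Hm C X Y \<and> v \<in> Hm C Y Z \<and> w \<in> Hm C Z (shO C 1 X) \<and>
     (\<exists>\<alpha> \<beta> \<gamma>. is_iso C X X' \<alpha> \<and> is_iso C Y Y' \<beta> \<and> is_iso C Z Z' \<gamma> \<and>
        cmp C X Y Y' \<beta> u = cmp C X X' Y' u' \<alpha> \<and>
        cmp C Y Z Z' \<gamma> v = cmp C Y Y' Z' v' \<beta> \<and>
        cmp C Z (shO C 1 X) (shO C 1 X') (shM C 1 \<alpha>) w = cmp C Z Z' (shO C 1 X') w' \<gamma>))"

text \<open>\<open>tri_gen T M n\<close> is \<open>\<langle>M\<rangle>\<close> with index \<open>n + 1\<close>.\<close>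

primrec tri_gen :: "('o, 'm, 'z) tri_cat_scheme \<Rightarrow> 'o \<Rightarrow> nat \<Rightarrow> 'o set" where
  "tri_gen T M 0 = add_closure T {shO T i M | i. True}"
| "tri_gen T M (Suc n) = add_closure T
     {X. \<exists>M' M'' u v w. (M', X, M'', u, v, w) \<in> Tri T \<and>
           M' \<in> add_closure T {shO T i M | i. True} \<and> M'' \<in> tri_gen T M n}"

definition tri_dim :: "('o, 'm, 'z) tri_cat_scheme \<Rightarrow> enat" where
  "tri_dim T = Inf {enat n | n. \<exists>M\<in>Ob T. tri_gen T M n = Ob T}"

subsection \<open>Verdier quotients\<close>

text \<open>
  The quotient of \<open>T\<close> by a triangulated subcategory with object set \<open>N\<close>, by calculus of
  fractions.  A morphism \<open>X \<rightarrow> Y\<close> is a class of roofs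
  \<open>X \<leftarrow> Z \<rightarrow> Y\<close>, written \<open>(Z, s, f)\<close>, where \<open>s\<close> has its cone in \<open>N\<close>.
\<close>

type_synonym ('o, 'm) roof = "'o \<times> 'm \<times> 'm"

definition cone_in :: "('o, 'm, 'z) tri_cat_scheme \<Rightarrow> 'o set \<Rightarrow> 'o \<Rightarrow> 'o \<Rightarrow> 'm set" where
  "cone_in T N X Y = {s \<in> Hm T X Y. \<exists>Z v w. Z \<in> N \<and> (X, Y, Z, s, v, w) \<in> Tri T}"

definition roofs :: "('o, 'm, 'z) tri_cat_scheme \<Rightarrow> 'o set \<Rightarrow> 'o \<Rightarrow> 'o \<Rightarrow> ('o, 'm) roof set" where
  "roofs T N X Y = {(Z, s, f). Z \<in> Ob T \<and> s \<in> cone_in T N Z X \<and> f \<in> Hm T Z Y}"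

definition roof_rel ::
  "('o, 'm, 'z) tri_cat_scheme \<Rightarrow> 'o set \<Rightarrow> 'o \<Rightarrow> 'o \<Rightarrow> (('o, 'm) roof \<times> ('o, 'm) roof) set" where
  "roof_rel T N X Y = {((Z, s, f), (Z', s', f')).
     (Z, s, f) \<in> roofs T N X Y \<and> (Z', s', f') \<in> roofs T N X Y \<and>
     (\<exists>W a b. W \<in> Ob T \<and> a \<in> Hm T W Z \<and> b \<in> Hm T W Z' \<and>
        cmp T W Z X s a = cmp T W Z' X s' b \<and>
        cmp T W Z X s a \<in> cone_in T N W X \<and>
        cmp T W Z Y f a = cmp T W Z' Y f' b)}"

definition roof_image :: "('o, 'm, 'z) tri_cat_scheme \<Rightarrow> 'o set \<Rightarrow> 'o \<Rightarrow> 'o \<Rightarrow> 'm \<Rightarrow> ('o, 'm) roof set" where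
  "roof_image T N X Y f = roof_rel T N X Y `` {(X, idt T X, f)}"

text \<open>
  The class of a composite consists of all roofs equivalent to \<open>(P, s u, g v)\<close> for some
  representatives \<open>(Z, s, f)\<close>, \<open>(W, t, g)\<close> and some completion \<open>f u = t v\<close> of the inner
  square.
\<close>

definition roof_comp ::
  "('o, 'm, 'z) tri_cat_scheme \<Rightarrow> 'o set \<Rightarrow> 'o \<Rightarrow> 'o \<Rightarrow> 'o \<Rightarrow>
     ('o, 'm) roof set \<Rightarrow> ('o, 'm) roof set \<Rightarrow> ('o, 'm) roof set" where
  "roof_comp T N X Y V \<psi> \<phi> = {r. \<exists>Z s f W t g P u v.
     (Z, s, f) \<in> \<phi> \<and> (W, t, g) \<in> \<psi> \<and>
     P \<in> Ob T \<and> u \<in> cone_in T N P Z \<and> v \<in> Hm T P W \<and> cmp T P Z Y f u = cmp T P W Y t v \<and>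
     ((P, cmp T P Z X s u, cmp T P W V g v), r) \<in> roof_rel T N X V}"

definition verdier_shift_cat ::
  "('o, 'm, 'z) tri_cat_scheme \<Rightarrow> 'o set \<Rightarrow> ('o, ('o, 'm) roof set) shift_cat" where
  "verdier_shift_cat T N = \<lparr>
     Ob = Ob T,
     Hm = (\<lambda>X Y. roofs T N X Y // roof_rel T N X Y),
     idt = (\<lambda>X. roof_image T N X X (idt T X)),
     cmp = roof_comp T N,
     shO = shO T,
     shM = (\<lambda>i \<phi>. (\<lambda>(Z, s, f). (shO T i Z, shM T i s, shM T i f)) ` \<phi>) \<rparr>"

definition verdier_quotient ::
  "('o, 'm, 'z) tri_cat_scheme \<Rightarrow> 'o set \<Rightarrow> ('o, ('o, 'm) roof set) tri_cat" where
  "verdier_quotient T N = shift_cat.extend (verdier_shift_cat T N) (tri_cat.fields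
     {t. \<exists>X Y Z u v w. (X, Y, Z, u, v, w) \<in> Tri T \<and>
        triangle_iso (verdier_shift_cat T N) t
          (X, Y, Z, roof_image T N X Y u, roof_image T N Y Z v, roof_image T N Z (shO T 1 X) w)})"

section \<open>Modules over a noncommutative ring\<close>

text \<open>
  The record type of \<^theory>\<open>HOL-Algebra.Module\<close> is used for left modules; as there, the
  fields \<open>mult\<close> and \<open>one\<close> of a module play no role (the locale \<^locale>\<open>Module.module\<close> itself is
  restricted to commutative base rings).
\<close>

definition left_module :: "('a, 'z) ring_scheme \<Rightarrow> ('a, 'm, 'y) module_scheme \<Rightarrow> bool" where
  "left_module A M \<longleftrightarrow> ring A \<and> abelian_group M \<and>
     (\<forall>a\<in>carrier A. \<forall>x\<in>carrier M. a \<odot>\<^bsub>M\<^esub> x \<in> carrier M) \<and>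
     (\<forall>a\<in>carrier A. \<forall>b\<in>carrier A. \<forall>x\<in>carrier M.
        (a \<oplus>\<^bsub>A\<^esub> b) \<odot>\<^bsub>M\<^esub> x = a \<odot>\<^bsub>M\<^esub> x \<oplus>\<^bsub>M\<^esub> b \<odot>\<^bsub>M\<^esub> x) \<and>
     (\<forall>a\<in>carrier A. \<forall>x\<in>carrier M. \<forall>y\<in>carrier M.
        a \<odot>\<^bsub>M\<^esub> (x \<oplus>\<^bsub>M\<^esub> y) = a \<odot>\<^bsub>M\<^esub> x \<oplus>\<^bsub>M\<^esub> a \<odot>\<^bsub>M\<^esub> y) \<and>
     (\<forall>a\<in>carrier A. \<forall>b\<in>carrier A. \<forall>x\<in>carrier M.
        (a \<otimes>\<^bsub>A\<^esub> b) \<odot>\<^bsub>M\<^esub> x = a \<odot>\<^bsub>M\<^esub> (b \<odot>\<^bsub>M\<^esub> x)) \<and>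
     (\<forall>x\<in>carrier M. \<one>\<^bsub>A\<^esub> \<odot>\<^bsub>M\<^esub> x = x)"

definition fin_gen :: "('a, 'z) ring_scheme \<Rightarrow> ('a, 'm, 'y) module_scheme \<Rightarrow> bool" where
  "fin_gen A M \<longleftrightarrow> (\<exists>S. finite S \<and> S \<subseteq> carrier M \<and>
     (\<forall>x\<in>carrier M. \<exists>c\<in>S \<rightarrow> carrier A. x = finsum M (\<lambda>s. c s \<odot>\<^bsub>M\<^esub> s) S))"

definition fin_dim_algebra :: "'k ring \<Rightarrow> ('k, 'a) module \<Rightarrow> bool" where
  "fin_dim_algebra K A \<longleftrightarrow> field K \<and> ring A \<and> Module.module K A \<and>
     (\<forall>c\<in>carrier K. \<forall>x\<in>carrier A. \<forall>y\<in>carrier A.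
        (c \<odot>\<^bsub>A\<^esub> x) \<otimes>\<^bsub>A\<^esub> y = c \<odot>\<^bsub>A\<^esub> (x \<otimes>\<^bsub>A\<^esub> y) \<and> x \<otimes>\<^bsub>A\<^esub> (c \<odot>\<^bsub>A\<^esub> y) = c \<odot>\<^bsub>A\<^esub> (x \<otimes>\<^bsub>A\<^esub> y)) \<and>
     fin_gen K A"

text \<open>Homomorphisms are extensional functions, so that equal maps are equal functions.\<close>

definition lhom ::
  "('a, 'z) ring_scheme \<Rightarrow> ('a, 'm, 'x) module_scheme \<Rightarrow> ('a, 'n, 'y) module_scheme \<Rightarrow> ('m \<Rightarrow> 'n) set" where
  "lhom A M N = {f \<in> carrier M \<rightarrow>\<^sub>E carrier N.
     (\<forall>x\<in>carrier M. \<forall>y\<in>carrier M. f (x \<oplus>\<^bsub>M\<^esub> y) = f x \<oplus>\<^bsub>N\<^esub> f y) \<and>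
     (\<forall>a\<in>carrier A. \<forall>x\<in>carrier M. f (a \<odot>\<^bsub>M\<^esub> x) = a \<odot>\<^bsub>N\<^esub> f x)}"

definition lmod_iso ::
  "('a, 'z) ring_scheme \<Rightarrow> ('a, 'm, 'x) module_scheme \<Rightarrow> ('a, 'n, 'y) module_scheme \<Rightarrow> bool" where
  "lmod_iso A M N \<longleftrightarrow> (\<exists>f\<in>lhom A M N. bij_betw f (carrier M) (carrier N))"

definition zero_module :: "('a, 'm, 'y) module_scheme \<Rightarrow> bool" where
  "zero_module M \<longleftrightarrow> carrier M = {\<zero>\<^bsub>M\<^esub>}"

definition regular_module :: "('k, 'a) module \<Rightarrow> ('a, 'a) module" where
  "regular_module A = \<lparr>carrier = carrier A, mult = mult A, one = \<one>\<^bsub>A\<^esub>,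
     zero = \<zero>\<^bsub>A\<^esub>, add = add A, smult = mult A\<rparr>"

text \<open>
  \<open>Amod A\<close> is the category of finitely generated left modules over \<open>A\<close>.  To have a set of
  objects, the underlying sets are taken inside the type \<open>nat \<Rightarrow> 'a\<close>; this loses nothing,
  since every finitely generated module, over whatever type, is isomorphic to one of these
  (lemma \<open>Amod_universal\<close> below).
\<close>

type_synonym 'a umod = "('a, nat \<Rightarrow> 'a) module"
type_synonym 'a umap = "(nat \<Rightarrow> 'a) \<Rightarrow> (nat \<Rightarrow> 'a)"

definition Amod :: "('a, 'z) ring_scheme \<Rightarrow> ('a umod, 'a umap) cat" where
  "Amod A = \<lparr>
     Ob = {M. left_module A M \<and> fin_gen A M},
     Hm = lhom A,
     idt = (\<lambda>M. \<lambda>x\<in>carrier M. x),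
     cmp = (\<lambda>M N P g f. compose (carrier M) g f) \<rparr>"

lemma Amod_universal:
  fixes M :: "('a, 'm, 'y) module_scheme"
  assumes M: "left_module A M" and fg: "fin_gen A M"
  shows "\<exists>N\<in>Ob (Amod A). lmod_iso A N M"
proof -
  interpret M: abelian_group M using M by (simp add: left_module_def)
  have smc: "a \<odot>\<^bsub>M\<^esub> x \<in> carrier M" if "a \<in> carrier A" "x \<in> carrier M" for a x
    using M that by (simp add: left_module_def)
  obtain S where S: "finite S" "S \<subseteq> carrier M"
    and gen: "\<And>x. x \<in> carrier M \<Longrightarrow> \<exists>c\<in>S \<rightarrow> carrier A. x = finsum M (\<lambda>s. c s \<odot>\<^bsub>M\<^esub> s) S"
    using fg unfolding fin_gen_def by blast
  obtain c where c: "\<And>x. x \<in> carrier M \<Longrightarrow> c x \<in> S \<rightarrow> carrier A"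
    "\<And>x. x \<in> carrier M \<Longrightarrow> x = finsum M (\<lambda>s. c x s \<odot>\<^bsub>M\<^esub> s) S"
    using gen by metis
  obtain e :: "'m \<Rightarrow> nat" where e: "inj_on e S"
    using finite_imp_inj_to_nat_seg[OF S(1)] by blast
  define \<phi> where "\<phi> x = (\<lambda>n. c x (inv_into S e n))" for x
  have phi_inj: "inj_on \<phi> (carrier M)"
  proof (rule inj_onI)
    fix x y assume xy: "x \<in> carrier M" "y \<in> carrier M" "\<phi> x = \<phi> y"
    have "c x s = c y s" if "s \<in> S" for s
      using fun_cong[OF xy(3), of "e s"] that e by (simp add: \<phi>_def)
    then have "finsum M (\<lambda>s. c x s \<odot>\<^bsub>M\<^esub> s) S = finsum M (\<lambda>s. c y s \<odot>\<^bsub>M\<^esub> s) S"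
      using c(1)[OF xy(2)] S by (intro M.finsum_cong') (auto intro!: smc)
    then show "x = y" using c(2) xy by metis
  qed
  define \<psi> where "\<psi> = inv_into (carrier M) \<phi>"
  have psi[simp]: "\<psi> (\<phi> x) = x" if "x \<in> carrier M" for x
    using that phi_inj by (simp add: \<psi>_def)
  define N :: "'a umod" where "N = \<lparr>carrier = \<phi> ` carrier M, mult = undefined, one = undefined,
     zero = \<phi> \<zero>\<^bsub>M\<^esub>, add = (\<lambda>u v. \<phi> (\<psi> u \<oplus>\<^bsub>M\<^esub> \<psi> v)), smult = (\<lambda>a u. \<phi> (a \<odot>\<^bsub>M\<^esub> \<psi> u))\<rparr>"
  have Ns: "carrier N = \<phi> ` carrier M" "\<zero>\<^bsub>N\<^esub> = \<phi> \<zero>\<^bsub>M\<^esub>"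
    "\<And>u v. u \<oplus>\<^bsub>N\<^esub> v = \<phi> (\<psi> u \<oplus>\<^bsub>M\<^esub> \<psi> v)" "\<And>a u. a \<odot>\<^bsub>N\<^esub> u = \<phi> (a \<odot>\<^bsub>M\<^esub> \<psi> u)"
    by (simp_all add: N_def)
  have ab: "abelian_group N"
  proof (rule abelian_groupI)
    fix u assume "u \<in> carrier N"
    then obtain x where x: "x \<in> carrier M" "u = \<phi> x" by (auto simp: Ns)
    then have "\<phi> (\<ominus>\<^bsub>M\<^esub> x) \<in> carrier N" "\<phi> (\<ominus>\<^bsub>M\<^esub> x) \<oplus>\<^bsub>N\<^esub> u = \<zero>\<^bsub>N\<^esub>"
      by (auto simp: Ns M.l_neg)
    then show "\<exists>y\<in>carrier N. y \<oplus>\<^bsub>N\<^esub> u = \<zero>\<^bsub>N\<^esub>" by blast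
  qed (auto simp: Ns M.a_ac)
  interpret N: abelian_group N by (rule ab)
  have lm: "left_module A N"
    using M ab unfolding left_module_def by (auto simp: Ns)
  have fgN: "fin_gen A N"
    unfolding fin_gen_def
  proof (intro exI[of _ "\<phi> ` S"] conjI ballI)
    show "finite (\<phi> ` S)" "\<phi> ` S \<subseteq> carrier N" using S by (auto simp: Ns)
    fix u assume "u \<in> carrier N"
    then obtain x where x: "x \<in> carrier M" "u = \<phi> x" by (auto simp: Ns)
    have "finsum N (\<lambda>t. (c x \<circ> \<psi>) t \<odot>\<^bsub>N\<^esub> t) (\<phi> ` T) = \<phi> (finsum M (\<lambda>s. c x s \<odot>\<^bsub>M\<^esub> s) T)"
      if "T \<subseteq> S" for T
      using finite_subset[OF that S(1)] that
    proof (induction T rule: finite_induct)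
      case empty
      show ?case by (simp add: Ns(2))
    next
      case (insert s T)
      have sT: "s \<in> carrier M" "T \<subseteq> carrier M" "c x s \<in> carrier A"
        using insert.prems S c(1)[OF x(1)] by auto
      have cT: "c x t \<in> carrier A" if "t \<in> T" for t
        using insert.prems that c(1)[OF x(1)] by auto
      have ni: "\<phi> s \<notin> \<phi> ` T" 
        using insert.hyps sT phi_inj by (auto simp: inj_on_def)
      have m: "(\<lambda>s. c x s \<odot>\<^bsub>M\<^esub> s) \<in> T \<rightarrow> carrier M" using cT sT by (auto intro!: smc)
      have "finsum N (\<lambda>t. (c x \<circ> \<psi>) t \<odot>\<^bsub>N\<^esub> t) (insert (\<phi> s) (\<phi> ` T)) =
        (c x \<circ> \<psi>) (\<phi> s) \<odot>\<^bsub>N\<^esub> \<phi> s \<oplus>\<^bsub>N\<^esub> finsum N (\<lambda>t. (c x \<circ> \<psi>) t \<odot>\<^bsub>N\<^esub> t) (\<phi> ` T)"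
        using insert.hyps ni sT cT
        by (intro N.finsum_insert) (auto simp: Ns subset_eq intro!: imageI smc)
      also have "\<dots> = \<phi> (c x s \<odot>\<^bsub>M\<^esub> s \<oplus>\<^bsub>M\<^esub> finsum M (\<lambda>s. c x s \<odot>\<^bsub>M\<^esub> s) T)"
        using insert sT M.finsum_closed[OF m] by (simp add: Ns smc)
      finally show ?case
        using insert.hyps sT m by (simp add: M.finsum_insert smc)
    qed
    from this[of S] have "u = finsum N (\<lambda>t. (c x \<circ> \<psi>) t \<odot>\<^bsub>N\<^esub> t) (\<phi> ` S)"
      using c(2)[OF x(1)] x(2) by simp
    moreover have "c x \<circ> \<psi> \<in> \<phi> ` S \<rightarrow> carrier A"
      using c(1)[OF x(1)] S(2) by (auto simp: subset_eq)
    ultimately show "\<exists>d\<in>\<phi> ` S \<rightarrow> carrier A. u = finsum N (\<lambda>t. d t \<odot>\<^bsub>N\<^esub> t) (\<phi> ` S)" by blast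
  qed
  have "restrict \<psi> (carrier N) \<in> lhom A N M"
    by (auto simp: lhom_def Ns smc)
  moreover have "bij_betw (restrict \<psi> (carrier N)) (carrier N) (carrier M)"
    by (auto simp: bij_betw_def Ns inj_on_def image_image)
  ultimately have "lmod_iso A N M" unfolding lmod_iso_def by blast
  then show ?thesis using lm fgN by (auto simp: Amod_def)
qed

definition addM :: "('a, 'z) ring_scheme \<Rightarrow> 'a umod \<Rightarrow> 'a umod set" where
  "addM A M = add_closure (Amod A) {M}"

definition indecomposable :: "('a, 'z) ring_scheme \<Rightarrow> 'a umod \<Rightarrow> bool" where
  "indecomposable A M \<longleftrightarrow> M \<in> Ob (Amod A) \<and> \<not> zero_module M \<and>
     (\<forall>X\<in>Ob (Amod A). \<forall>Y\<in>Ob (Amod A).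
        direct_sum2 (Amod A) X Y M \<longrightarrow> zero_module X \<or> zero_module Y)"

text \<open>\<open>A\<close>-proj: the projective objects, defined by lifting along surjections in \<open>Amod A\<close>.\<close>

definition Aproj :: "('a, 'z) ring_scheme \<Rightarrow> 'a umod set" where
  "Aproj A = {P \<in> Ob (Amod A). \<forall>N\<in>Ob (Amod A). \<forall>N'\<in>Ob (Amod A).
     \<forall>p\<in>lhom A N N'. \<forall>f\<in>lhom A P N'. p ` carrier N = carrier N' \<longrightarrow>
       (\<exists>g\<in>lhom A P N. compose (carrier P) p g = f)}"

section \<open>Complexes\<close>

record 'a cochain =
  cob :: "int \<Rightarrow> 'a umod"
  dif :: "int \<Rightarrow> 'a umap"

definition is_complex :: "('a, 'z) ring_scheme \<Rightarrow> 'a cochain \<Rightarrow> bool" where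
  "is_complex A C \<longleftrightarrow> (\<forall>i. cob C i \<in> Ob (Amod A) \<and> dif C i \<in> lhom A (cob C i) (cob C (i + 1)) \<and>
     (\<forall>x\<in>carrier (cob C i). dif C (i + 1) (dif C i x) = \<zero>\<^bsub>cob C (i + 2)\<^esub>))"

definition exact_complex :: "('a, 'z) ring_scheme \<Rightarrow> 'a cochain \<Rightarrow> bool" where
  "exact_complex A C \<longleftrightarrow> is_complex A C \<and>
     (\<forall>i. {x \<in> carrier (cob C i). dif C i x = \<zero>\<^bsub>cob C (i + 1)\<^esub>}
          = dif C (i - 1) ` carrier (cob C (i - 1)))"

text \<open>Exactness of \<open>Hom\<^sub>A(N, C)\<close> and of \<open>Hom\<^sub>A(C, Q)\<close>, at the spot \<open>Hom\<^sub>A(N, C\<^sup>i)\<close>,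
  respectively \<open>Hom\<^sub>A(C\<^sup>i, Q)\<close>.\<close>

definition hom_from_exact :: "('a, 'z) ring_scheme \<Rightarrow> 'a umod \<Rightarrow> 'a cochain \<Rightarrow> bool" where
  "hom_from_exact A N C \<longleftrightarrow>
     (\<forall>i. {f \<in> lhom A N (cob C i). \<forall>x\<in>carrier N. dif C i (f x) = \<zero>\<^bsub>cob C (i + 1)\<^esub>}
          = (\<lambda>g. compose (carrier N) (dif C (i - 1)) g) ` lhom A N (cob C (i - 1)))"

definition hom_to_exact :: "('a, 'z) ring_scheme \<Rightarrow> 'a cochain \<Rightarrow> 'a umod \<Rightarrow> bool" where
  "hom_to_exact A C Q \<longleftrightarrow>
     (\<forall>i. {f \<in> lhom A (cob C i) Q. \<forall>x\<in>carrier (cob C (i - 1)). f (dif C (i - 1) x) = \<zero>\<^bsub>Q\<^esub>}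
          = (\<lambda>g. compose (carrier (cob C i)) g (dif C i)) ` lhom A (cob C (i + 1)) Q)"

section \<open>Gorenstein projective modules, relative Auslander algebra\<close>

definition AGproj :: "('a, 'z) ring_scheme \<Rightarrow> 'a umod set" where
  "AGproj A = {M \<in> Ob (Amod A). \<exists>P. exact_complex A P \<and> (\<forall>i. cob P i \<in> Aproj A) \<and>
     (\<forall>Q\<in>Aproj A. hom_to_exact A P Q) \<and>
     lmod_iso A M ((cob P 0)\<lparr>carrier := {x \<in> carrier (cob P 0). dif P 0 x = \<zero>\<^bsub>cob P 1\<^esub>}\<rparr>)}"

definition finite_CM_type :: "('a, 'z) ring_scheme \<Rightarrow> bool" where
  "finite_CM_type A \<longleftrightarrow> (\<exists>\<F> :: 'a umod set. finite \<F> \<and>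
     (\<forall>M\<in>AGproj A. indecomposable A M \<longrightarrow> (\<exists>N\<in>\<F>. lmod_iso A M N)))"

text \<open>\<open>Gs 0, \<dots>, Gs (m - 1)\<close> represent the isomorphism classes of indecomposable Gorenstein
  projective modules, each exactly once.\<close>

definition Gproj_representatives :: "('a, 'z) ring_scheme \<Rightarrow> nat \<Rightarrow> (nat \<Rightarrow> 'a umod) \<Rightarrow> bool" where
  "Gproj_representatives A m Gs \<longleftrightarrow>
     (\<forall>j<m. Gs j \<in> AGproj A \<and> indecomposable A (Gs j)) \<and>
     (\<forall>i<m. \<forall>j<m. lmod_iso A (Gs i) (Gs j) \<longrightarrow> i = j) \<and>
     (\<forall>M\<in>AGproj A. indecomposable A M \<longrightarrow> (\<exists>j<m. lmod_iso A M (Gs j)))"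

text \<open>\<open>End\<^sub>A(G)\<^sup>o\<^sup>p\<close> with its structure of a \<open>K\<close>-algebra; the field acts on \<open>A\<close>-modules via
  \<open>c \<mapsto> c \<cdot> 1\<^sub>A\<close>.\<close>

definition rel_auslander :: "('k, 'a) module \<Rightarrow> 'a umod \<Rightarrow> ('k, 'a umap) module" where
  "rel_auslander A G = \<lparr>
     carrier = lhom A G G,
     mult = (\<lambda>f g. compose (carrier G) g f),
     one = (\<lambda>x\<in>carrier G. x),
     zero = (\<lambda>x\<in>carrier G. \<zero>\<^bsub>G\<^esub>),
     add = (\<lambda>f g. \<lambda>x\<in>carrier G. f x \<oplus>\<^bsub>G\<^esub> g x),
     smult = (\<lambda>c f. \<lambda>x\<in>carrier G. (c \<odot>\<^bsub>A\<^esub> \<one>\<^bsub>A\<^esub>) \<odot>\<^bsub>G\<^esub> f x) \<rparr>"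

text \<open>\<open>Hom\<^sub>A(M, A)\<close> is a right module.  Here, as in \<open>k_dual\<close>, the field \<open>smult\<close> with first
  argument \<open>a\<close> encodes the right action \<open>f \<mapsto> f a\<close>.\<close>

definition hom_to_ring :: "('k, 'a) module \<Rightarrow> ('a, 'm) module \<Rightarrow> ('a, 'm \<Rightarrow> 'a) module" where
  "hom_to_ring A M = \<lparr>
     carrier = lhom A M (regular_module A),
     mult = undefined, one = undefined,
     zero = (\<lambda>x\<in>carrier M. \<zero>\<^bsub>A\<^esub>),
     add = (\<lambda>f g. \<lambda>x\<in>carrier M. f x \<oplus>\<^bsub>A\<^esub> g x),
     smult = (\<lambda>a f. \<lambda>x\<in>carrier M. f x \<otimes>\<^bsub>A\<^esub> a) \<rparr>"

text \<open>The standard duality \<open>D = Hom\<^sub>K(-, K)\<close> from right to left modules: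
  \<open>(a \<phi>)(n) = \<phi>(n a)\<close>.\<close>

definition k_dual :: "'k ring \<Rightarrow> ('k, 'a) module \<Rightarrow> ('a, 'n) module \<Rightarrow> ('a, 'n \<Rightarrow> 'k) module" where
  "k_dual K A N = \<lparr>
     carrier = {\<phi> \<in> carrier N \<rightarrow>\<^sub>E carrier K.
        (\<forall>x\<in>carrier N. \<forall>y\<in>carrier N. \<phi> (x \<oplus>\<^bsub>N\<^esub> y) = \<phi> x \<oplus>\<^bsub>K\<^esub> \<phi> y) \<and>
        (\<forall>c\<in>carrier K. \<forall>x\<in>carrier N. \<phi> ((c \<odot>\<^bsub>A\<^esub> \<one>\<^bsub>A\<^esub>) \<odot>\<^bsub>N\<^esub> x) = c \<otimes>\<^bsub>K\<^esub> \<phi> x)},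
     mult = undefined, one = undefined,
     zero = (\<lambda>x\<in>carrier N. \<zero>\<^bsub>K\<^esub>),
     add = (\<lambda>\<phi> \<psi>. \<lambda>x\<in>carrier N. \<phi> x \<oplus>\<^bsub>K\<^esub> \<psi> x),
     smult = (\<lambda>a \<phi>. \<lambda>x\<in>carrier N. \<phi> (a \<odot>\<^bsub>N\<^esub> x)) \<rparr>"

definition nakayama :: "'k ring \<Rightarrow> ('k, 'a) module \<Rightarrow> ('a, 'm) module \<Rightarrow> ('a, ('m \<Rightarrow> 'a) \<Rightarrow> 'k) module" where
  "nakayama K A M = k_dual K A (hom_to_ring A M)"

section \<open>Gorenstein representation dimension\<close>

text \<open>The resolution \<open>0 \<rightarrow> M\<^sub>n \<rightarrow> \<dots> \<rightarrow> M\<^sub>0 \<rightarrow> X \<rightarrow> 0\<close> is a complex with \<open>X\<close> in degree \<open>1\<close>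
  and \<open>M\<^sub>i\<close> in degree \<open>-i\<close>.\<close>

definition is_resolution ::
  "('a, 'z) ring_scheme \<Rightarrow> 'a umod \<Rightarrow> 'a umod \<Rightarrow> nat \<Rightarrow> 'a cochain \<Rightarrow> bool" where
  "is_resolution A M X n C \<longleftrightarrow> exact_complex A C \<and> hom_from_exact A M C \<and> cob C 1 = X \<and>
     (\<forall>i\<le>n. cob C (- int i) \<in> addM A M) \<and>
     (\<forall>j. j > 1 \<or> j < - int n \<longrightarrow> zero_module (cob C j))"

definition resol_dim :: "('a, 'z) ring_scheme \<Rightarrow> 'a umod \<Rightarrow> 'a umod \<Rightarrow> enat" where
  "resol_dim A M X = Inf {enat n | n. \<exists>C. is_resolution A M X n C}"

definition resol_dim_mod :: "('a, 'z) ring_scheme \<Rightarrow> 'a umod \<Rightarrow> enat" where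
  "resol_dim_mod A M = (SUP X\<in>Ob (Amod A). resol_dim A M X)"

text \<open>\<open>G\<close> is the direct sum of the indecomposable Gorenstein projectives; \<open>N\<close> is a copy of
  \<open>\<nu>(G)\<close> in \<open>Amod A\<close>.  The infimum of a nonempty set of extended naturals is its minimum.\<close>

definition Grepdim :: "'k ring \<Rightarrow> ('k, 'a) module \<Rightarrow> 'a umod \<Rightarrow> enat" where
  "Grepdim K A G = Inf {resol_dim_mod A M | M. M \<in> Ob (Amod A) \<and>
     (\<exists>N\<in>Ob (Amod A). lmod_iso A N (nakayama K A G) \<and>
        (\<exists>S\<in>addM A M. direct_sum2 (Amod A) G N S))} + 2"

section \<open>The bounded Gorenstein derived category\<close>

definition bounded_complexes :: "('a, 'z) ring_scheme \<Rightarrow> 'a cochain set" where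
  "bounded_complexes A = {C. is_complex A C \<and> (\<exists>n::nat. \<forall>i. \<bar>i\<bar> > int n \<longrightarrow> zero_module (cob C i))}"

definition chain_maps :: "('a, 'z) ring_scheme \<Rightarrow> 'a cochain \<Rightarrow> 'a cochain \<Rightarrow> (int \<Rightarrow> 'a umap) set" where
  "chain_maps A X Y = {f. \<forall>i. f i \<in> lhom A (cob X i) (cob Y i) \<and>
     (\<forall>x\<in>carrier (cob X i). dif Y i (f i x) = f (i + 1) (dif X i x))}"

definition homotopy_rel ::
  "('a, 'z) ring_scheme \<Rightarrow> 'a cochain \<Rightarrow> 'a cochain \<Rightarrow> ((int \<Rightarrow> 'a umap) \<times> (int \<Rightarrow> 'a umap)) set" where
  "homotopy_rel A X Y = {(f, g). f \<in> chain_maps A X Y \<and> g \<in> chain_maps A X Y \<and>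
     (\<exists>h. (\<forall>i. h i \<in> lhom A (cob X i) (cob Y (i - 1))) \<and>
        (\<forall>i. \<forall>x\<in>carrier (cob X i). f i x =
           g i x \<oplus>\<^bsub>cob Y i\<^esub> (dif Y (i - 1) (h i x) \<oplus>\<^bsub>cob Y i\<^esub> h (i + 1) (dif X i x))))}"

definition shift_cx :: "int \<Rightarrow> 'a cochain \<Rightarrow> 'a cochain" where
  "shift_cx n X = \<lparr>
     cob = (\<lambda>i. cob X (i + n)),
     dif = (\<lambda>i. if even n then dif X (i + n)
                else (\<lambda>x\<in>carrier (cob X (i + n)). \<ominus>\<^bsub>cob X (i + n + 1)\<^esub> dif X (i + n) x)) \<rparr>"

text \<open>
  \<open>dsum M N\<close> realises the set of pairs inside \<open>nat \<Rightarrow> 'a\<close>: the pair \<open>(u, v)\<close> becomes the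
  interleaved sequence \<open>u\<^sub>0, v\<^sub>0, u\<^sub>1, v\<^sub>1, \<dots>\<close>.
\<close>

definition seq_pair :: "(nat \<Rightarrow> 'a) \<Rightarrow> (nat \<Rightarrow> 'a) \<Rightarrow> nat \<Rightarrow> 'a" where
  "seq_pair u v = (\<lambda>n. if even n then u (n div 2) else v (n div 2))"

definition seq_fst :: "(nat \<Rightarrow> 'a) \<Rightarrow> nat \<Rightarrow> 'a" where
  "seq_fst w = (\<lambda>n. w (2 * n))"

definition seq_snd :: "(nat \<Rightarrow> 'a) \<Rightarrow> nat \<Rightarrow> 'a" where
  "seq_snd w = (\<lambda>n. w (2 * n + 1))"

definition dsum :: "'a umod \<Rightarrow> 'a umod \<Rightarrow> 'a umod" where
  "dsum M N = \<lparr>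
     carrier = {w. seq_fst w \<in> carrier M \<and> seq_snd w \<in> carrier N},
     mult = undefined, one = undefined,
     zero = seq_pair \<zero>\<^bsub>M\<^esub> \<zero>\<^bsub>N\<^esub>,
     add = (\<lambda>w w'. seq_pair (seq_fst w \<oplus>\<^bsub>M\<^esub> seq_fst w') (seq_snd w \<oplus>\<^bsub>N\<^esub> seq_snd w')),
     smult = (\<lambda>a w. seq_pair (a \<odot>\<^bsub>M\<^esub> seq_fst w) (a \<odot>\<^bsub>N\<^esub> seq_snd w)) \<rparr>"

text \<open>The cone has \<open>X\<^sup>i\<^sup>+\<^sup>1 \<oplus> Y\<^sup>i\<close> in degree \<open>i\<close> and differential
  \<open>(x, y) \<mapsto> (- d x, f x + d y)\<close>.\<close>

definition cone :: "'a cochain \<Rightarrow> 'a cochain \<Rightarrow> (int \<Rightarrow> 'a umap) \<Rightarrow> 'a cochain" where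
  "cone X Y f = \<lparr>
     cob = (\<lambda>i. dsum (cob X (i + 1)) (cob Y i)),
     dif = (\<lambda>i. \<lambda>w\<in>carrier (dsum (cob X (i + 1)) (cob Y i)).
        seq_pair (\<ominus>\<^bsub>cob X (i + 2)\<^esub> dif X (i + 1) (seq_fst w))
                 (f (i + 1) (seq_fst w) \<oplus>\<^bsub>cob Y (i + 1)\<^esub> dif Y i (seq_snd w))) \<rparr>"

definition cone_inj :: "'a cochain \<Rightarrow> 'a cochain \<Rightarrow> int \<Rightarrow> 'a umap" where
  "cone_inj X Y = (\<lambda>i. \<lambda>y\<in>carrier (cob Y i). seq_pair \<zero>\<^bsub>cob X (i + 1)\<^esub> y)"

definition cone_proj :: "'a cochain \<Rightarrow> 'a cochain \<Rightarrow> int \<Rightarrow> 'a umap" where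
  "cone_proj X Y = (\<lambda>i. \<lambda>w\<in>carrier (dsum (cob X (i + 1)) (cob Y i)). seq_fst w)"

text \<open>\<open>Kb A\<close> is the bounded homotopy category of \<open>Amod A\<close>; morphisms are homotopy classes, and
  the distinguished triangles are those isomorphic to
  \<open>X \<rightarrow> Y \<rightarrow> cone f \<rightarrow> X[1]\<close>.\<close>

definition hclass :: "('a, 'z) ring_scheme \<Rightarrow> 'a cochain \<Rightarrow> 'a cochain \<Rightarrow> (int \<Rightarrow> 'a umap) \<Rightarrow>
    (int \<Rightarrow> 'a umap) set" where
  "hclass A X Y f = homotopy_rel A X Y `` {f}"

definition Kb_shift_cat :: "('a, 'z) ring_scheme \<Rightarrow> ('a cochain, (int \<Rightarrow> 'a umap) set) shift_cat" where
  "Kb_shift_cat A = \<lparr>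
     Ob = bounded_complexes A,
     Hm = (\<lambda>X Y. chain_maps A X Y // homotopy_rel A X Y),
     idt = (\<lambda>X. hclass A X X (\<lambda>i. \<lambda>x\<in>carrier (cob X i). x)),
     cmp = (\<lambda>X Y Z \<psi> \<phi>. \<Union>f\<in>\<phi>. \<Union>g\<in>\<psi>. hclass A X Z (\<lambda>i. compose (carrier (cob X i)) (g i) (f i))),
     shO = shift_cx,
     shM = (\<lambda>n \<phi>. (\<lambda>f i. f (i + n)) ` \<phi>) \<rparr>"

definition Kb :: "('a, 'z) ring_scheme \<Rightarrow> ('a cochain, (int \<Rightarrow> 'a umap) set) tri_cat" where
  "Kb A = shift_cat.extend (Kb_shift_cat A) (tri_cat.fields
     {t. \<exists>X\<in>bounded_complexes A. \<exists>Y\<in>bounded_complexes A. \<exists>f\<in>chain_maps A X Y.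
        triangle_iso (Kb_shift_cat A) t
          (X, Y, cone X Y f, hclass A X Y f, hclass A Y (cone X Y f) (cone_inj X Y),
           hclass A (cone X Y f) (shift_cx 1 X) (cone_proj X Y))})"

definition Gproj_acyclic :: "('a, 'z) ring_scheme \<Rightarrow> 'a cochain set" where
  "Gproj_acyclic A = {C \<in> bounded_complexes A. \<forall>G\<in>AGproj A. hom_from_exact A G C}"

definition Dbgp ::
  "('a, 'z) ring_scheme \<Rightarrow> ('a cochain, ('a cochain, (int \<Rightarrow> 'a umap) set) roof set) tri_cat" where
  "Dbgp A = verdier_quotient (Kb A) (Gproj_acyclic A)"

section \<open>Krull dimension of a module over a commutative ring\<close>

definition loc_rel :: "('k, 'z) ring_scheme \<Rightarrow> ('k, 'm, 'y) module_scheme \<Rightarrow> 'k set \<Rightarrow>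
    (('m \<times> 'k) \<times> ('m \<times> 'k)) set" where
  "loc_rel R M P = {((x, s), (y, t)).
     x \<in> carrier M \<and> y \<in> carrier M \<and> s \<in> carrier R - P \<and> t \<in> carrier R - P \<and>
     (\<exists>u\<in>carrier R - P. u \<odot>\<^bsub>M\<^esub> (t \<odot>\<^bsub>M\<^esub> x) = u \<odot>\<^bsub>M\<^esub> (s \<odot>\<^bsub>M\<^esub> y))}"

definition localization :: "('k, 'z) ring_scheme \<Rightarrow> ('k, 'm, 'y) module_scheme \<Rightarrow> 'k set \<Rightarrow>
    ('m \<times> 'k) set set" where
  "localization R M P = (carrier M \<times> (carrier R - P)) // loc_rel R M P"

definition support :: "('k, 'z) ring_scheme \<Rightarrow> ('k, 'm, 'y) module_scheme \<Rightarrow> 'k set set" where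
  "support R M = {P. primeideal P R \<and>
     localization R M P \<noteq> {loc_rel R M P `` {(\<zero>\<^bsub>M\<^esub>, \<one>\<^bsub>R\<^esub>)}}}"

text \<open>The supremum of the lengths of chains of primes in the support; the zero module has
  dimension \<open>-\<infinity>\<close>.\<close>

definition krull_dim :: "('k, 'z) ring_scheme \<Rightarrow> ('k, 'm, 'y) module_scheme \<Rightarrow> ereal" where
  "krull_dim R M = Sup {ereal (real n) | n. \<exists>P. (\<forall>i\<le>n. P i \<in> support R M) \<and> (\<forall>i<n. P i \<subset> P (Suc i))}"

end

theory Submission
  imports Defs
begin

text \<open>
  Let \<open>M\<close> be a module with \<open>G \<in> add M\<close> over which every module has a \<open>Hom(M, -)\<close>-exact
  \<open>add M\<close>-resolution of length at most \<open>d\<close>.  For a bounded complex \<open>X\<close>, cover the cycles in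
  every degree by \<open>Hom(M, -)\<close>-epimorphisms from \<open>add M\<close>.  These covers form a chain map from
  a complex with zero differential, a finite direct sum of shifts of objects of \<open>add M\<close>, to
  \<open>X\<close>.  Passing to its cone twice, the cohomology of \<open>Hom(M, X)\<close> becomes representable, by
  modules \<open>H\<close>; passing to further cones of this kind replaces these modules by their successive
  syzygies, so after \<open>d + 1\<close> more steps the complex is \<open>Hom(M, -)\<close>-exact.

  Every Gorenstein projective module is a direct sum of indecomposable ones (a summand of a
  Gorenstein projective module is Gorenstein projective), hence \<open>Hom(M, -)\<close>-exact complexes
  vanish in the derived category, and \<open>d + 2\<close> cones generate everything from \<open>M\<close>.

  The second inequality is trivial, because the spectrum of a field has dimension \<open>0\<close>.
\<close>

section \<open>Finitely generated modules\<close>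

text \<open>The two extra cones, and with them the summand 2 in \<open>Grepdim\<close>, have this
  origin. The cohomology of Hom(M, X) in degree i is the cokernel of Hom(M, X^(i-1)) -> Hom(M, Z^i).
  Hom(M, -) is only left exact, so this cokernel need not be of the form Hom(M, H). It is presented
  by two modules; two kernels later it has been replaced by Hom(M, H) for a kernel H of a map in mod
  A, and resolutions apply to H. Kernels stay in mod A because A is finite dimensional, and the same
  finiteness yields the strictly monotone measure on submodules that serves as length.

  The quotient category is handled by fractions alone: a chain map has acyclic cone iff it is
  bijective on the cohomology of Hom(G', -) for all Gorenstein projective G', and Ore squares and
  cancellation come from homotopy fibres.

  For summands of Gorenstein projective modules, an idempotent on the cycles of a complete
  resolution extends to a chain map that need not be idempotent; Fitting's decomposition in every
  degree repairs this.\<close>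

inductive_set spanned :: "('a, 'z) ring_scheme \<Rightarrow> ('a, 'm, 'y) module_scheme \<Rightarrow> 'm set \<Rightarrow> 'm set"
  for R M S where
  zero: "\<zero>\<^bsub>M\<^esub> \<in> spanned R M S"
| gen: "s \<in> S \<Longrightarrow> a \<in> carrier R \<Longrightarrow> a \<odot>\<^bsub>M\<^esub> s \<in> spanned R M S"
| add: "x \<in> spanned R M S \<Longrightarrow> y \<in> spanned R M S \<Longrightarrow> x \<oplus>\<^bsub>M\<^esub> y \<in> spanned R M S"

lemma spanned_mono: "S \<subseteq> T \<Longrightarrow> x \<in> spanned R M S \<Longrightarrow> x \<in> spanned R M T"
  by (rotate_tac, induction rule: spanned.induct) (auto intro: spanned.intros)

lemma finsum_in_spanned:
  assumes "abelian_group M" "finite S" "S \<subseteq> carrier M" "c \<in> S \<rightarrow> carrier R"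
    and sm: "\<And>a x. a \<in> carrier R \<Longrightarrow> x \<in> carrier M \<Longrightarrow> a \<odot>\<^bsub>M\<^esub> x \<in> carrier M"
  shows "finsum M (\<lambda>s. c s \<odot>\<^bsub>M\<^esub> s) S \<in> spanned R M S"
proof -
  interpret M: abelian_group M by fact
  show ?thesis using assms(2-4)
  proof (induction S rule: finite_induct)
    case empty
    show ?case by (simp add: spanned.zero)
  next
    case (insert s S)
    have "finsum M (\<lambda>s. c s \<odot>\<^bsub>M\<^esub> s) (insert s S) = c s \<odot>\<^bsub>M\<^esub> s \<oplus>\<^bsub>M\<^esub> finsum M (\<lambda>s. c s \<odot>\<^bsub>M\<^esub> s) S"
      using insert by (intro M.finsum_insert) (auto intro!: sm)
    moreover have "finsum M (\<lambda>s. c s \<odot>\<^bsub>M\<^esub> s) S \<in> spanned R M (insert s S)"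
      by (rule spanned_mono[OF _ insert.IH]) (use insert.prems in auto)
    moreover have "c s \<odot>\<^bsub>M\<^esub> s \<in> spanned R M (insert s S)"
      using insert.prems by (intro spanned.gen) auto
    ultimately show ?case by (simp add: spanned.add)
  qed
qed

text \<open>Closure under negatives is implied, since -x is (-1)x.\<close>

definition submod :: "('a, 'z) ring_scheme \<Rightarrow> ('a, 'm, 'y) module_scheme \<Rightarrow> 'm set \<Rightarrow> bool" where
  "submod A M U \<longleftrightarrow> U \<subseteq> carrier M \<and> \<zero>\<^bsub>M\<^esub> \<in> U \<and> (\<forall>x\<in>U. \<forall>y\<in>U. x \<oplus>\<^bsub>M\<^esub> y \<in> U) \<and>
     (\<forall>a\<in>carrier A. \<forall>x\<in>U. a \<odot>\<^bsub>M\<^esub> x \<in> U)"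

section \<open>Arithmetic of left modules and their homomorphisms\<close>

locale fda =
  fixes K :: "'k ring" and A :: "('k, 'a) module"
  assumes fda: "fin_dim_algebra K A"
begin

abbreviation lm :: "('a, 'm, 'y) module_scheme \<Rightarrow> bool" where "lm M \<equiv> left_module A M"
abbreviation fg :: "'a umod \<Rightarrow> bool" where "fg M \<equiv> M \<in> Ob (Amod A)"

lemma ringA: "ring A" and fieldK: "field K" and modKA: "Module.module K A" and fgKA: "fin_gen K A"
  using fda by (auto simp: fin_dim_algebra_def)

lemma lm_ag: "lm M \<Longrightarrow> abelian_group M"
  by (simp add: left_module_def)

lemma lmI:
  assumes "abelian_group M"
    "\<And>a x. a \<in> carrier A \<Longrightarrow> x \<in> carrier M \<Longrightarrow> a \<odot>\<^bsub>M\<^esub> x \<in> carrier M"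
    "\<And>a b x. a \<in> carrier A \<Longrightarrow> b \<in> carrier A \<Longrightarrow> x \<in> carrier M \<Longrightarrow>
      (a \<oplus>\<^bsub>A\<^esub> b) \<odot>\<^bsub>M\<^esub> x = a \<odot>\<^bsub>M\<^esub> x \<oplus>\<^bsub>M\<^esub> b \<odot>\<^bsub>M\<^esub> x"
    "\<And>a x y. a \<in> carrier A \<Longrightarrow> x \<in> carrier M \<Longrightarrow> y \<in> carrier M \<Longrightarrow>
      a \<odot>\<^bsub>M\<^esub> (x \<oplus>\<^bsub>M\<^esub> y) = a \<odot>\<^bsub>M\<^esub> x \<oplus>\<^bsub>M\<^esub> a \<odot>\<^bsub>M\<^esub> y"
    "\<And>a b x. a \<in> carrier A \<Longrightarrow> b \<in> carrier A \<Longrightarrow> x \<in> carrier M \<Longrightarrow>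
      (a \<otimes>\<^bsub>A\<^esub> b) \<odot>\<^bsub>M\<^esub> x = a \<odot>\<^bsub>M\<^esub> (b \<odot>\<^bsub>M\<^esub> x)"
    "\<And>x. x \<in> carrier M \<Longrightarrow> \<one>\<^bsub>A\<^esub> \<odot>\<^bsub>M\<^esub> x = x"
  shows "lm M"
  unfolding left_module_def using assms ringA by blast

lemma fg_iff: "fg M \<longleftrightarrow> lm M \<and> fin_gen A M"
  by (simp add: Amod_def)

lemma fg_lm: "fg M \<Longrightarrow> lm M"
  by (simp add: fg_iff)

lemma lm_add [simp]: "lm M \<Longrightarrow> x \<in> carrier M \<Longrightarrow> y \<in> carrier M \<Longrightarrow> x \<oplus>\<^bsub>M\<^esub> y \<in> carrier M"
  and lm_zero [simp]: "lm M \<Longrightarrow> \<zero>\<^bsub>M\<^esub> \<in> carrier M"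
  and lm_neg [simp]: "lm M \<Longrightarrow> x \<in> carrier M \<Longrightarrow> \<ominus>\<^bsub>M\<^esub> x \<in> carrier M"
  and lm_sm [simp]: "lm M \<Longrightarrow> a \<in> carrier A \<Longrightarrow> x \<in> carrier M \<Longrightarrow> a \<odot>\<^bsub>M\<^esub> x \<in> carrier M"
  and lm_l0 [simp]: "lm M \<Longrightarrow> x \<in> carrier M \<Longrightarrow> \<zero>\<^bsub>M\<^esub> \<oplus>\<^bsub>M\<^esub> x = x"
  and lm_r0 [simp]: "lm M \<Longrightarrow> x \<in> carrier M \<Longrightarrow> x \<oplus>\<^bsub>M\<^esub> \<zero>\<^bsub>M\<^esub> = x"
  and lm_lneg [simp]: "lm M \<Longrightarrow> x \<in> carrier M \<Longrightarrow> \<ominus>\<^bsub>M\<^esub> x \<oplus>\<^bsub>M\<^esub> x = \<zero>\<^bsub>M\<^esub>"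
  and lm_rneg [simp]: "lm M \<Longrightarrow> x \<in> carrier M \<Longrightarrow> x \<oplus>\<^bsub>M\<^esub> \<ominus>\<^bsub>M\<^esub> x = \<zero>\<^bsub>M\<^esub>"
  and lm_negneg [simp]: "lm M \<Longrightarrow> x \<in> carrier M \<Longrightarrow> \<ominus>\<^bsub>M\<^esub> (\<ominus>\<^bsub>M\<^esub> x) = x"
  and lm_neg0 [simp]: "lm M \<Longrightarrow> \<ominus>\<^bsub>M\<^esub> \<zero>\<^bsub>M\<^esub> = \<zero>\<^bsub>M\<^esub>"
  and lm_negadd [simp]: "lm M \<Longrightarrow> x \<in> carrier M \<Longrightarrow> y \<in> carrier M \<Longrightarrow>
    \<ominus>\<^bsub>M\<^esub> (x \<oplus>\<^bsub>M\<^esub> y) = \<ominus>\<^bsub>M\<^esub> x \<oplus>\<^bsub>M\<^esub> \<ominus>\<^bsub>M\<^esub> y"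
  and lm_assoc: "lm M \<Longrightarrow> x \<in> carrier M \<Longrightarrow> y \<in> carrier M \<Longrightarrow> z \<in> carrier M \<Longrightarrow>
    (x \<oplus>\<^bsub>M\<^esub> y) \<oplus>\<^bsub>M\<^esub> z = x \<oplus>\<^bsub>M\<^esub> (y \<oplus>\<^bsub>M\<^esub> z)"
  and lm_comm: "lm M \<Longrightarrow> x \<in> carrier M \<Longrightarrow> y \<in> carrier M \<Longrightarrow> x \<oplus>\<^bsub>M\<^esub> y = y \<oplus>\<^bsub>M\<^esub> x"
  and lm_lcomm: "lm M \<Longrightarrow> x \<in> carrier M \<Longrightarrow> y \<in> carrier M \<Longrightarrow> z \<in> carrier M \<Longrightarrow>
    x \<oplus>\<^bsub>M\<^esub> (y \<oplus>\<^bsub>M\<^esub> z) = y \<oplus>\<^bsub>M\<^esub> (x \<oplus>\<^bsub>M\<^esub> z)"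
  and lm_rneg1 [simp]: "lm M \<Longrightarrow> x \<in> carrier M \<Longrightarrow> y \<in> carrier M \<Longrightarrow> \<ominus>\<^bsub>M\<^esub> x \<oplus>\<^bsub>M\<^esub> (x \<oplus>\<^bsub>M\<^esub> y) = y"
  and lm_rneg2 [simp]: "lm M \<Longrightarrow> x \<in> carrier M \<Longrightarrow> y \<in> carrier M \<Longrightarrow> x \<oplus>\<^bsub>M\<^esub> (\<ominus>\<^bsub>M\<^esub> x \<oplus>\<^bsub>M\<^esub> y) = y"
  unfolding left_module_def
  by (auto simp: abelian_group.minus_add abelian_group.r_neg abelian_group.l_neg abelian_group.minus_minus
      abelian_group.a_inv_closed abelian_group.r_neg1 abelian_group.r_neg2
      abelian_monoid.zero_closed abelian_monoid.a_closed abelian_monoid.l_zero abelian_monoid.r_zero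
      abelian_monoid.a_assoc abelian_monoid.a_lcomm abelian_group.axioms(1)
      intro: abelian_monoid.a_comm abelian_monoid.a_lcomm abelian_group.minus_equality)

text \<open>Associative-commutative rewriting can leave x and -x with one or two terms between them,
  out of reach of the adjacent cancellation rules. These rules finish the computations done with
  \<open>lm_ac\<close>.\<close>

lemma lm_cancel_far [simp]:
  assumes "lm M" "x \<in> carrier M" "y \<in> carrier M"
  shows "x \<oplus>\<^bsub>M\<^esub> (y \<oplus>\<^bsub>M\<^esub> \<ominus>\<^bsub>M\<^esub> x) = y" "\<ominus>\<^bsub>M\<^esub> x \<oplus>\<^bsub>M\<^esub> (y \<oplus>\<^bsub>M\<^esub> x) = y"
    "z \<in> carrier M \<Longrightarrow> x \<oplus>\<^bsub>M\<^esub> (y \<oplus>\<^bsub>M\<^esub> (\<ominus>\<^bsub>M\<^esub> x \<oplus>\<^bsub>M\<^esub> z)) = y \<oplus>\<^bsub>M\<^esub> z"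
    "z \<in> carrier M \<Longrightarrow> \<ominus>\<^bsub>M\<^esub> x \<oplus>\<^bsub>M\<^esub> (y \<oplus>\<^bsub>M\<^esub> (x \<oplus>\<^bsub>M\<^esub> z)) = y \<oplus>\<^bsub>M\<^esub> z"
    "z \<in> carrier M \<Longrightarrow> x \<oplus>\<^bsub>M\<^esub> (y \<oplus>\<^bsub>M\<^esub> (z \<oplus>\<^bsub>M\<^esub> \<ominus>\<^bsub>M\<^esub> x)) = y \<oplus>\<^bsub>M\<^esub> z"
    "z \<in> carrier M \<Longrightarrow> \<ominus>\<^bsub>M\<^esub> x \<oplus>\<^bsub>M\<^esub> (y \<oplus>\<^bsub>M\<^esub> (z \<oplus>\<^bsub>M\<^esub> x)) = y \<oplus>\<^bsub>M\<^esub> z"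
    "z \<in> carrier M \<Longrightarrow> w \<in> carrier M \<Longrightarrow>
      x \<oplus>\<^bsub>M\<^esub> (y \<oplus>\<^bsub>M\<^esub> (z \<oplus>\<^bsub>M\<^esub> (\<ominus>\<^bsub>M\<^esub> x \<oplus>\<^bsub>M\<^esub> w))) = y \<oplus>\<^bsub>M\<^esub> (z \<oplus>\<^bsub>M\<^esub> w)"
    "z \<in> carrier M \<Longrightarrow> w \<in> carrier M \<Longrightarrow>
      \<ominus>\<^bsub>M\<^esub> x \<oplus>\<^bsub>M\<^esub> (y \<oplus>\<^bsub>M\<^esub> (z \<oplus>\<^bsub>M\<^esub> (x \<oplus>\<^bsub>M\<^esub> w))) = y \<oplus>\<^bsub>M\<^esub> (z \<oplus>\<^bsub>M\<^esub> w)"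
  using assms by (simp_all add: lm_lcomm[of M x] lm_lcomm[of M "\<ominus>\<^bsub>M\<^esub> x"])

lemmas lm_ac = lm_assoc lm_comm lm_lcomm

lemma lm_eq_neg_iff:
  assumes "lm M" "x \<in> carrier M" "y \<in> carrier M"
  shows "x \<oplus>\<^bsub>M\<^esub> y = \<zero>\<^bsub>M\<^esub> \<longleftrightarrow> x = \<ominus>\<^bsub>M\<^esub> y"
proof
  assume "x \<oplus>\<^bsub>M\<^esub> y = \<zero>\<^bsub>M\<^esub>"
  then have "(x \<oplus>\<^bsub>M\<^esub> y) \<oplus>\<^bsub>M\<^esub> \<ominus>\<^bsub>M\<^esub> y = \<zero>\<^bsub>M\<^esub> \<oplus>\<^bsub>M\<^esub> \<ominus>\<^bsub>M\<^esub> y" by simp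
  then show "x = \<ominus>\<^bsub>M\<^esub> y" using assms by (simp add: lm_assoc)
qed (use assms in simp)

lemma lm_cancel_left [simp]:
  assumes "lm M" "x \<in> carrier M" "y \<in> carrier M" "z \<in> carrier M"
  shows "x \<oplus>\<^bsub>M\<^esub> y = x \<oplus>\<^bsub>M\<^esub> z \<longleftrightarrow> y = z"
  using assms by (metis lm_rneg1)

lemma lm_move:
  assumes "lm M" "x \<in> carrier M" "y \<in> carrier M" "z \<in> carrier M"
  shows "x = y \<oplus>\<^bsub>M\<^esub> z \<longleftrightarrow> x \<oplus>\<^bsub>M\<^esub> \<ominus>\<^bsub>M\<^esub> z = y" "x = y \<oplus>\<^bsub>M\<^esub> z \<longleftrightarrow> \<ominus>\<^bsub>M\<^esub> y \<oplus>\<^bsub>M\<^esub> x = z"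
proof -
  have "(y \<oplus>\<^bsub>M\<^esub> z) \<oplus>\<^bsub>M\<^esub> \<ominus>\<^bsub>M\<^esub> z = y" "(x \<oplus>\<^bsub>M\<^esub> \<ominus>\<^bsub>M\<^esub> z) \<oplus>\<^bsub>M\<^esub> z = x"
    using assms by (simp_all add: lm_assoc)
  then show "x = y \<oplus>\<^bsub>M\<^esub> z \<longleftrightarrow> x \<oplus>\<^bsub>M\<^esub> \<ominus>\<^bsub>M\<^esub> z = y" by metis
  have "\<ominus>\<^bsub>M\<^esub> y \<oplus>\<^bsub>M\<^esub> (y \<oplus>\<^bsub>M\<^esub> z) = z" "y \<oplus>\<^bsub>M\<^esub> (\<ominus>\<^bsub>M\<^esub> y \<oplus>\<^bsub>M\<^esub> x) = x"
    using assms by simp_all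
  then show "x = y \<oplus>\<^bsub>M\<^esub> z \<longleftrightarrow> \<ominus>\<^bsub>M\<^esub> y \<oplus>\<^bsub>M\<^esub> x = z" by metis
qed

lemma lm_four:
  "lm M \<Longrightarrow> a \<in> carrier M \<Longrightarrow> b \<in> carrier M \<Longrightarrow> c \<in> carrier M \<Longrightarrow> d \<in> carrier M \<Longrightarrow>
    (a \<oplus>\<^bsub>M\<^esub> b) \<oplus>\<^bsub>M\<^esub> (c \<oplus>\<^bsub>M\<^esub> d) = (a \<oplus>\<^bsub>M\<^esub> c) \<oplus>\<^bsub>M\<^esub> (b \<oplus>\<^bsub>M\<^esub> d)"
  by (simp add: lm_ac)

lemma lm_distr: "lm M \<Longrightarrow> a \<in> carrier A \<Longrightarrow> b \<in> carrier A \<Longrightarrow> x \<in> carrier M \<Longrightarrow>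
    (a \<oplus>\<^bsub>A\<^esub> b) \<odot>\<^bsub>M\<^esub> x = a \<odot>\<^bsub>M\<^esub> x \<oplus>\<^bsub>M\<^esub> b \<odot>\<^bsub>M\<^esub> x"
  and lm_sm_add [simp]: "lm M \<Longrightarrow> a \<in> carrier A \<Longrightarrow> x \<in> carrier M \<Longrightarrow> y \<in> carrier M \<Longrightarrow>
    a \<odot>\<^bsub>M\<^esub> (x \<oplus>\<^bsub>M\<^esub> y) = a \<odot>\<^bsub>M\<^esub> x \<oplus>\<^bsub>M\<^esub> a \<odot>\<^bsub>M\<^esub> y"
  and lm_sm_sm: "lm M \<Longrightarrow> a \<in> carrier A \<Longrightarrow> b \<in> carrier A \<Longrightarrow> x \<in> carrier M \<Longrightarrow>
    (a \<otimes>\<^bsub>A\<^esub> b) \<odot>\<^bsub>M\<^esub> x = a \<odot>\<^bsub>M\<^esub> (b \<odot>\<^bsub>M\<^esub> x)"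
  and lm_one [simp]: "lm M \<Longrightarrow> x \<in> carrier M \<Longrightarrow> \<one>\<^bsub>A\<^esub> \<odot>\<^bsub>M\<^esub> x = x"
  by (simp_all add: left_module_def)

lemma lm_sm_zero [simp]:
  assumes "lm M" "a \<in> carrier A" shows "a \<odot>\<^bsub>M\<^esub> \<zero>\<^bsub>M\<^esub> = \<zero>\<^bsub>M\<^esub>"
proof -
  have "a \<odot>\<^bsub>M\<^esub> (\<zero>\<^bsub>M\<^esub> \<oplus>\<^bsub>M\<^esub> \<zero>\<^bsub>M\<^esub>) = a \<odot>\<^bsub>M\<^esub> \<zero>\<^bsub>M\<^esub> \<oplus>\<^bsub>M\<^esub> a \<odot>\<^bsub>M\<^esub> \<zero>\<^bsub>M\<^esub>"
    by (rule lm_sm_add) (use assms in auto)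
  then have "a \<odot>\<^bsub>M\<^esub> \<zero>\<^bsub>M\<^esub> \<oplus>\<^bsub>M\<^esub> \<zero>\<^bsub>M\<^esub> = a \<odot>\<^bsub>M\<^esub> \<zero>\<^bsub>M\<^esub> \<oplus>\<^bsub>M\<^esub> a \<odot>\<^bsub>M\<^esub> \<zero>\<^bsub>M\<^esub>"
    using assms by simp
  then show ?thesis using assms by (subst (asm) lm_cancel_left) auto
qed

lemma lm_zero_sm [simp]:
  assumes "lm M" "x \<in> carrier M" shows "\<zero>\<^bsub>A\<^esub> \<odot>\<^bsub>M\<^esub> x = \<zero>\<^bsub>M\<^esub>"
proof -
  interpret A: ring A by (rule ringA)
  have "(\<zero>\<^bsub>A\<^esub> \<oplus>\<^bsub>A\<^esub> \<zero>\<^bsub>A\<^esub>) \<odot>\<^bsub>M\<^esub> x = \<zero>\<^bsub>A\<^esub> \<odot>\<^bsub>M\<^esub> x \<oplus>\<^bsub>M\<^esub> \<zero>\<^bsub>A\<^esub> \<odot>\<^bsub>M\<^esub> x"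
    by (rule lm_distr) (use assms in auto)
  then have "\<zero>\<^bsub>A\<^esub> \<odot>\<^bsub>M\<^esub> x \<oplus>\<^bsub>M\<^esub> \<zero>\<^bsub>M\<^esub> = \<zero>\<^bsub>A\<^esub> \<odot>\<^bsub>M\<^esub> x \<oplus>\<^bsub>M\<^esub> \<zero>\<^bsub>A\<^esub> \<odot>\<^bsub>M\<^esub> x"
    using assms by simp
  then show ?thesis using assms by (subst (asm) lm_cancel_left) auto
qed

lemma lm_sm_neg [simp]:
  assumes "lm M" "a \<in> carrier A" "x \<in> carrier M"
  shows "a \<odot>\<^bsub>M\<^esub> (\<ominus>\<^bsub>M\<^esub> x) = \<ominus>\<^bsub>M\<^esub> (a \<odot>\<^bsub>M\<^esub> x)"
proof -
  have "a \<odot>\<^bsub>M\<^esub> (\<ominus>\<^bsub>M\<^esub> x \<oplus>\<^bsub>M\<^esub> x) = a \<odot>\<^bsub>M\<^esub> (\<ominus>\<^bsub>M\<^esub> x) \<oplus>\<^bsub>M\<^esub> a \<odot>\<^bsub>M\<^esub> x"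
    by (rule lm_sm_add) (use assms in auto)
  then show ?thesis using assms lm_eq_neg_iff[of M "a \<odot>\<^bsub>M\<^esub> (\<ominus>\<^bsub>M\<^esub> x)" "a \<odot>\<^bsub>M\<^esub> x"] by simp
qed

lemma lm_neg_sm:
  assumes "lm M" "x \<in> carrier M"
  shows "(\<ominus>\<^bsub>A\<^esub> \<one>\<^bsub>A\<^esub>) \<odot>\<^bsub>M\<^esub> x = \<ominus>\<^bsub>M\<^esub> x"
proof -
  interpret A: ring A by (rule ringA)
  have "(\<ominus>\<^bsub>A\<^esub> \<one>\<^bsub>A\<^esub> \<oplus>\<^bsub>A\<^esub> \<one>\<^bsub>A\<^esub>) \<odot>\<^bsub>M\<^esub> x = (\<ominus>\<^bsub>A\<^esub> \<one>\<^bsub>A\<^esub>) \<odot>\<^bsub>M\<^esub> x \<oplus>\<^bsub>M\<^esub> \<one>\<^bsub>A\<^esub> \<odot>\<^bsub>M\<^esub> x"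
    by (rule lm_distr) (use assms in auto)
  then show ?thesis using assms lm_eq_neg_iff[of M "(\<ominus>\<^bsub>A\<^esub> \<one>\<^bsub>A\<^esub>) \<odot>\<^bsub>M\<^esub> x" x] by (simp add: A.l_neg)
qed

lemma lh_closed: "f \<in> lhom A M N \<Longrightarrow> x \<in> carrier M \<Longrightarrow> f x \<in> carrier N"
  and lh_add: "f \<in> lhom A M N \<Longrightarrow> x \<in> carrier M \<Longrightarrow> y \<in> carrier M \<Longrightarrow> f (x \<oplus>\<^bsub>M\<^esub> y) = f x \<oplus>\<^bsub>N\<^esub> f y"
  and lh_sm: "f \<in> lhom A M N \<Longrightarrow> a \<in> carrier A \<Longrightarrow> x \<in> carrier M \<Longrightarrow> f (a \<odot>\<^bsub>M\<^esub> x) = a \<odot>\<^bsub>N\<^esub> f x"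
  and lh_ext: "f \<in> lhom A M N \<Longrightarrow> x \<notin> carrier M \<Longrightarrow> f x = undefined"
  unfolding lhom_def by (blast intro: PiE_mem PiE_arb)+

lemma lh_zero:
  assumes "f \<in> lhom A M N" "lm M" "lm N" shows "f \<zero>\<^bsub>M\<^esub> = \<zero>\<^bsub>N\<^esub>"
proof -
  have "f (\<zero>\<^bsub>A\<^esub> \<odot>\<^bsub>M\<^esub> \<zero>\<^bsub>M\<^esub>) = \<zero>\<^bsub>A\<^esub> \<odot>\<^bsub>N\<^esub> f \<zero>\<^bsub>M\<^esub>"
    using assms ring.ring_simprules(2)[OF ringA] by (intro lh_sm) auto
  then show ?thesis using assms by (simp add: lh_closed)
qed

lemma lh_neg:
  assumes "f \<in> lhom A M N" "lm M" "lm N" "x \<in> carrier M" shows "f (\<ominus>\<^bsub>M\<^esub> x) = \<ominus>\<^bsub>N\<^esub> f x"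
proof -
  interpret A: ring A by (rule ringA)
  show ?thesis
    using assms lh_sm[OF assms(1), of "\<ominus>\<^bsub>A\<^esub> \<one>\<^bsub>A\<^esub>" x] by (simp add: lm_neg_sm lh_closed)
qed

lemma lhI:
  assumes "\<And>x. x \<in> carrier M \<Longrightarrow> f x \<in> carrier N"
    "\<And>x y. x \<in> carrier M \<Longrightarrow> y \<in> carrier M \<Longrightarrow> f (x \<oplus>\<^bsub>M\<^esub> y) = f x \<oplus>\<^bsub>N\<^esub> f y"
    "\<And>a x. a \<in> carrier A \<Longrightarrow> x \<in> carrier M \<Longrightarrow> f (a \<odot>\<^bsub>M\<^esub> x) = a \<odot>\<^bsub>N\<^esub> f x"
    "\<And>x. x \<notin> carrier M \<Longrightarrow> f x = undefined"
  shows "f \<in> lhom A M N"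
  using assms by (auto simp: lhom_def PiE_def extensional_def)

lemma lh_restrict:
  assumes "lm M" "\<And>x. x \<in> carrier M \<Longrightarrow> f x \<in> carrier N"
    "\<And>x y. x \<in> carrier M \<Longrightarrow> y \<in> carrier M \<Longrightarrow> f (x \<oplus>\<^bsub>M\<^esub> y) = f x \<oplus>\<^bsub>N\<^esub> f y"
    "\<And>a x. a \<in> carrier A \<Longrightarrow> x \<in> carrier M \<Longrightarrow> f (a \<odot>\<^bsub>M\<^esub> x) = a \<odot>\<^bsub>N\<^esub> f x"
  shows "(\<lambda>x\<in>carrier M. f x) \<in> lhom A M N"
  using assms by (intro lhI) auto

lemma lh_eqI:
  "f \<in> lhom A M N \<Longrightarrow> g \<in> lhom A M N' \<Longrightarrow> (\<And>x. x \<in> carrier M \<Longrightarrow> f x = g x) \<Longrightarrow> f = g"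
  by (rule ext) (metis lh_ext)

lemma lh_id: "lm M \<Longrightarrow> (\<lambda>x\<in>carrier M. x) \<in> lhom A M M"
  and lh_0: "lm M \<Longrightarrow> lm N \<Longrightarrow> (\<lambda>x\<in>carrier M. \<zero>\<^bsub>N\<^esub>) \<in> lhom A M N"
  by (auto intro!: lh_restrict)

lemma lh_comp:
  assumes "lm M" and f: "f \<in> lhom A M N" and g: "g \<in> lhom A N P"
  shows "compose (carrier M) g f \<in> lhom A M P"
  unfolding compose_def
  by (rule lh_restrict) (use assms(1) in \<open>simp_all add: lh_closed[OF f] lh_add[OF f] lh_sm[OF f]
      lh_closed[OF g] lh_add[OF g] lh_sm[OF g]\<close>)

lemma lh_plus:
  assumes "lm M" "lm N" and f: "f \<in> lhom A M N" and g: "g \<in> lhom A M N"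
  shows "(\<lambda>x\<in>carrier M. f x \<oplus>\<^bsub>N\<^esub> g x) \<in> lhom A M N"
  by (rule lh_restrict) (use assms(1,2) in \<open>simp_all add: lh_closed[OF f] lh_add[OF f] lh_sm[OF f]
      lh_closed[OF g] lh_add[OF g] lh_sm[OF g] lm_four\<close>)

lemma lh_uminus:
  assumes "lm M" "lm N" and f: "f \<in> lhom A M N"
  shows "(\<lambda>x\<in>carrier M. \<ominus>\<^bsub>N\<^esub> f x) \<in> lhom A M N"
  by (rule lh_restrict) (use assms(1,2) in \<open>simp_all add: lh_closed[OF f] lh_add[OF f] lh_sm[OF f]\<close>)

lemma submod_lm:
  assumes M: "lm M" and U: "submod A M U"
  shows "lm (M\<lparr>carrier := U\<rparr>)"
proof -
  have c: "\<And>x. x \<in> U \<Longrightarrow> x \<in> carrier M" using U by (auto simp: submod_def)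
  have n: "\<ominus>\<^bsub>M\<^esub> x \<in> U" if "x \<in> U" for x
    using U that lm_neg_sm[OF M c[OF that]] ring.ring_simprules(3,6)[OF ringA]
    by (metis submod_def)
  have "abelian_group (M\<lparr>carrier := U\<rparr>)"
  proof (rule abelian_groupI)
    fix x assume "x \<in> carrier (M\<lparr>carrier := U\<rparr>)"
    then show "\<exists>y\<in>carrier (M\<lparr>carrier := U\<rparr>). y \<oplus>\<^bsub>M\<lparr>carrier := U\<rparr>\<^esub> x = \<zero>\<^bsub>M\<lparr>carrier := U\<rparr>\<^esub>"
      using n M c by (intro bexI[of _ "\<ominus>\<^bsub>M\<^esub> x"]) auto
  qed (use U M c in \<open>simp_all add: submod_def lm_ac\<close>)
  moreover have "a \<odot>\<^bsub>M\<^esub> x \<in> U" if "a \<in> carrier A" "x \<in> U" for a x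
    using U that by (simp add: submod_def)
  ultimately show ?thesis
    using M c by (intro lmI) (simp_all add: lm_distr lm_sm_sm)
qed

text \<open>The inverse of a ring record is selected inside its carrier, so the negative in a
  submodule is a different term from that in M. Both equal the scalar multiple by -1, which does not
  depend on the carrier.\<close>

lemma submod_neg:
  assumes M: "lm M" and U: "submod A M U" and x: "x \<in> U"
  shows "\<ominus>\<^bsub>M\<lparr>carrier := U\<rparr>\<^esub> x = \<ominus>\<^bsub>M\<^esub> x" "\<ominus>\<^bsub>M\<^esub> x \<in> U"
proof -
  have xM: "x \<in> carrier M" using U x by (auto simp: submod_def)
  interpret A: ring A by (rule ringA)
  show "\<ominus>\<^bsub>M\<lparr>carrier := U\<rparr>\<^esub> x = \<ominus>\<^bsub>M\<^esub> x"
    using lm_neg_sm[OF submod_lm[OF M U], of x] lm_neg_sm[OF M xM] x by simp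
  then show "\<ominus>\<^bsub>M\<^esub> x \<in> U"
    using lm_neg[OF submod_lm[OF M U], of x] x by simp
qed

lemma submod_spanned:
  assumes M: "lm M" and S: "S \<subseteq> carrier M"
  shows "submod A M (spanned A M S)"
proof -
  interpret A: ring A by (rule ringA)
  have c: "x \<in> carrier M" if "x \<in> spanned A M S" for x
    using that by induction (use M S in auto)
  moreover have "a \<odot>\<^bsub>M\<^esub> x \<in> spanned A M S" if a: "a \<in> carrier A" and "x \<in> spanned A M S" for a x
    using that(2)
  proof induction
    case (gen s b)
    have "a \<odot>\<^bsub>M\<^esub> (b \<odot>\<^bsub>M\<^esub> s) = (a \<otimes>\<^bsub>A\<^esub> b) \<odot>\<^bsub>M\<^esub> s"
      using M S a gen by (subst lm_sm_sm) auto
    then show ?case using gen a by (simp add: spanned.gen)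
  qed (use M a c in \<open>auto intro: spanned.intros\<close>)
  ultimately show ?thesis by (auto simp: submod_def intro: spanned.intros)
qed

lemma spanned_least:
  assumes "submod A M U" "S \<subseteq> U" shows "spanned A M S \<subseteq> U"
proof
  fix x assume "x \<in> spanned A M S"
  then show "x \<in> U" by induction (use assms in \<open>auto simp: submod_def\<close>)
qed

lemma in_spanned: "lm M \<Longrightarrow> S \<subseteq> carrier M \<Longrightarrow> S \<subseteq> spanned A M S"
proof
  fix x assume "lm M" "S \<subseteq> carrier M" "x \<in> S"
  moreover have "\<one>\<^bsub>A\<^esub> \<in> carrier A" by (simp add: ring.ring_simprules(6)[OF ringA])
  ultimately show "x \<in> spanned A M S" using spanned.gen[of x S "\<one>\<^bsub>A\<^esub>" A M] by auto
qed

text \<open>\<open>fin_gen\<close> speaks of coefficient functions and \<open>finsum\<close>,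
  whereas closure properties are proved by rule induction on the span. From span to coefficients, a
  generator contributes a function supported at one point, and a sum adds coefficients
  pointwise.\<close>

lemma fin_gen_iff:
  assumes M: "lm M"
  shows "fin_gen A M \<longleftrightarrow> (\<exists>S. finite S \<and> S \<subseteq> carrier M \<and> carrier M = spanned A M S)"
proof
  interpret M: abelian_group M by (rule lm_ag[OF M])
  interpret A: ring A by (rule ringA)
  {
    assume "fin_gen A M"
    then obtain S where S: "finite S" "S \<subseteq> carrier M"
      "\<And>x. x \<in> carrier M \<Longrightarrow> \<exists>c\<in>S \<rightarrow> carrier A. x = finsum M (\<lambda>s. c s \<odot>\<^bsub>M\<^esub> s) S"
      unfolding fin_gen_def by blast
    have "carrier M \<subseteq> spanned A M S"
    proof
      fix x assume "x \<in> carrier M"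
      from S(3)[OF this] obtain c where "c \<in> S \<rightarrow> carrier A" "x = finsum M (\<lambda>s. c s \<odot>\<^bsub>M\<^esub> s) S" by blast
      then show "x \<in> spanned A M S"
        using finsum_in_spanned[OF lm_ag[OF M] S(1,2), of c A] M by auto
    qed
    moreover have "spanned A M S \<subseteq> carrier M"
      using submod_spanned[OF M S(2)] by (auto simp: submod_def)
    ultimately show "\<exists>S. finite S \<and> S \<subseteq> carrier M \<and> carrier M = spanned A M S"
      using S by blast
  next
    assume "\<exists>S. finite S \<and> S \<subseteq> carrier M \<and> carrier M = spanned A M S"
    then obtain S where S: "finite S" "S \<subseteq> carrier M" and S3: "carrier M = spanned A M S" by blast
    have "\<exists>c\<in>S \<rightarrow> carrier A. x = finsum M (\<lambda>s. c s \<odot>\<^bsub>M\<^esub> s) S" if "x \<in> spanned A M S" for x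
      using that
    proof induction
      case zero
      have "finsum M (\<lambda>s. \<zero>\<^bsub>A\<^esub> \<odot>\<^bsub>M\<^esub> s) S = finsum M (\<lambda>s. \<zero>\<^bsub>M\<^esub>) S"
        using S M by (intro M.finsum_cong') auto
      then show ?case by (intro bexI[of _ "\<lambda>_. \<zero>\<^bsub>A\<^esub>"]) auto
    next
      case (gen s a)
      let ?c = "\<lambda>t. if s = t then a else \<zero>\<^bsub>A\<^esub>"
      have "finsum M (\<lambda>t. ?c t \<odot>\<^bsub>M\<^esub> t) S = finsum M (\<lambda>t. if s = t then a \<odot>\<^bsub>M\<^esub> t else \<zero>\<^bsub>M\<^esub>) S"
        using S(1) lm_sm[OF M gen(2)] lm_zero_sm[OF M] gen S(2) lm_zero[OF M]
        by (intro M.finsum_cong') auto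
      also have "\<dots> = a \<odot>\<^bsub>M\<^esub> s"
        using S(1) lm_sm[OF M gen(2)] gen S(2) by (intro M.finsum_singleton) auto
      finally show ?case using gen by (intro bexI[of _ ?c]) auto
    next
      case (add x y)
      then obtain c d where cd: "c \<in> S \<rightarrow> carrier A" "x = finsum M (\<lambda>s. c s \<odot>\<^bsub>M\<^esub> s) S"
        "d \<in> S \<rightarrow> carrier A" "y = finsum M (\<lambda>s. d s \<odot>\<^bsub>M\<^esub> s) S" by blast
      have "finsum M (\<lambda>s. (c s \<oplus>\<^bsub>A\<^esub> d s) \<odot>\<^bsub>M\<^esub> s) S = finsum M (\<lambda>s. c s \<odot>\<^bsub>M\<^esub> s \<oplus>\<^bsub>M\<^esub> d s \<odot>\<^bsub>M\<^esub> s) S"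
        using S M cd by (intro M.finsum_cong') (auto simp: Pi_iff subset_eq lm_distr)
      also have "\<dots> = x \<oplus>\<^bsub>M\<^esub> y"
        unfolding cd(2,4) using S M cd(1,3) by (intro M.finsum_addf) (auto simp: Pi_iff subset_eq)
      finally show ?case
        using cd by (intro bexI[of _ "\<lambda>s. c s \<oplus>\<^bsub>A\<^esub> d s"]) (auto simp: Pi_iff)
    qed
    then show "fin_gen A M" unfolding fin_gen_def using S S3 by blast
  }
qed

section \<open>Finite length: a measure on submodules and the Noetherian property\<close>

abbreviation ks :: "'k \<Rightarrow> 'a" where "ks c \<equiv> c \<odot>\<^bsub>A\<^esub> \<one>\<^bsub>A\<^esub>"

lemma ks_mult:
  assumes "c \<in> carrier K" "a \<in> carrier A" shows "c \<odot>\<^bsub>A\<^esub> a = ks c \<otimes>\<^bsub>A\<^esub> a"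
proof -
  interpret A: ring A by (rule ringA)
  have "(c \<odot>\<^bsub>A\<^esub> \<one>\<^bsub>A\<^esub>) \<otimes>\<^bsub>A\<^esub> a = c \<odot>\<^bsub>A\<^esub> (\<one>\<^bsub>A\<^esub> \<otimes>\<^bsub>A\<^esub> a)"
    using fda assms by (simp add: fin_dim_algebra_def)
  then show ?thesis using assms by simp
qed

lemma ks_facts:
  shows "c \<in> carrier K \<Longrightarrow> ks c \<in> carrier A"
    "c \<in> carrier K \<Longrightarrow> d \<in> carrier K \<Longrightarrow> ks (c \<oplus>\<^bsub>K\<^esub> d) = ks c \<oplus>\<^bsub>A\<^esub> ks d"
    "c \<in> carrier K \<Longrightarrow> d \<in> carrier K \<Longrightarrow> ks (c \<otimes>\<^bsub>K\<^esub> d) = ks c \<otimes>\<^bsub>A\<^esub> ks d"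
    "ks \<one>\<^bsub>K\<^esub> = \<one>\<^bsub>A\<^esub>" "ks \<zero>\<^bsub>K\<^esub> = \<zero>\<^bsub>A\<^esub>"
proof -
  interpret KA: Module.module K A by (rule modKA)
  interpret A: ring A by (rule ringA)
  show kc: "\<And>c. c \<in> carrier K \<Longrightarrow> ks c \<in> carrier A" and "ks \<one>\<^bsub>K\<^esub> = \<one>\<^bsub>A\<^esub>" "ks \<zero>\<^bsub>K\<^esub> = \<zero>\<^bsub>A\<^esub>" by auto
  assume cd: "c \<in> carrier K" "d \<in> carrier K"
  then show "ks (c \<oplus>\<^bsub>K\<^esub> d) = ks c \<oplus>\<^bsub>A\<^esub> ks d" by (simp add: KA.smult_l_distr)
  show "ks (c \<otimes>\<^bsub>K\<^esub> d) = ks c \<otimes>\<^bsub>A\<^esub> ks d"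
    using cd ks_mult[OF cd(1) kc[OF cd(2)]] by (simp add: KA.smult_assoc1)
qed

text \<open>A list instead of a set, because the spans of its tails form the flag along which
  leading terms are counted.\<close>

primrec kspan :: "('a, 'm, 'y) module_scheme \<Rightarrow> 'm list \<Rightarrow> 'm set" where
  "kspan M [] = {\<zero>\<^bsub>M\<^esub>}"
| "kspan M (v # vs) = {ks c \<odot>\<^bsub>M\<^esub> v \<oplus>\<^bsub>M\<^esub> w | c w. c \<in> carrier K \<and> w \<in> kspan M vs}"

lemma kspan_facts:
  assumes M: "lm M" and vs: "set vs \<subseteq> carrier M"
  shows "kspan M vs \<subseteq> carrier M" "\<zero>\<^bsub>M\<^esub> \<in> kspan M vs"
    "x \<in> kspan M vs \<Longrightarrow> y \<in> kspan M vs \<Longrightarrow> x \<oplus>\<^bsub>M\<^esub> y \<in> kspan M vs"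
    "c \<in> carrier K \<Longrightarrow> x \<in> kspan M vs \<Longrightarrow> ks c \<odot>\<^bsub>M\<^esub> x \<in> kspan M vs"
    "set vs \<subseteq> kspan M vs"
proof -
  interpret K: field K by (rule fieldK)
  note k = ks_facts
  have *: "kspan M vs \<subseteq> carrier M \<and> \<zero>\<^bsub>M\<^esub> \<in> kspan M vs \<and>
    (\<forall>x y. x \<in> kspan M vs \<longrightarrow> y \<in> kspan M vs \<longrightarrow> x \<oplus>\<^bsub>M\<^esub> y \<in> kspan M vs) \<and>
    (\<forall>c x. c \<in> carrier K \<longrightarrow> x \<in> kspan M vs \<longrightarrow> ks c \<odot>\<^bsub>M\<^esub> x \<in> kspan M vs) \<and> set vs \<subseteq> kspan M vs"
    using vs
  proof (induction vs)
    case Nil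
    then show ?case using M by (auto simp: k)
  next
    case (Cons v vs)
    then have v: "v \<in> carrier M" and
      IH: "kspan M vs \<subseteq> carrier M" "\<zero>\<^bsub>M\<^esub> \<in> kspan M vs"
      "\<And>x y. x \<in> kspan M vs \<Longrightarrow> y \<in> kspan M vs \<Longrightarrow> x \<oplus>\<^bsub>M\<^esub> y \<in> kspan M vs"
      "\<And>c x. c \<in> carrier K \<Longrightarrow> x \<in> kspan M vs \<Longrightarrow> ks c \<odot>\<^bsub>M\<^esub> x \<in> kspan M vs" "set vs \<subseteq> kspan M vs"
      by auto
    have sub: "kspan M (v # vs) \<subseteq> carrier M" using M v IH(1) by (auto simp: k)
    have inc: "w \<in> kspan M (v # vs)" if "w \<in> kspan M vs" for w
      using that M v IH(1) k by (auto intro!: exI[of _ "\<zero>\<^bsub>K\<^esub>"] exI[of _ w])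
    have "v \<in> kspan M (v # vs)"
      using M v IH(2) k by (auto intro!: exI[of _ "\<one>\<^bsub>K\<^esub>"] exI[of _ "\<zero>\<^bsub>M\<^esub>"])
    moreover have "x \<oplus>\<^bsub>M\<^esub> y \<in> kspan M (v # vs)" if xy: "x \<in> kspan M (v # vs)" "y \<in> kspan M (v # vs)" for x y
    proof -
      from xy obtain c w d z where cd: "c \<in> carrier K" "w \<in> kspan M vs" "x = ks c \<odot>\<^bsub>M\<^esub> v \<oplus>\<^bsub>M\<^esub> w"
        "d \<in> carrier K" "z \<in> kspan M vs" "y = ks d \<odot>\<^bsub>M\<^esub> v \<oplus>\<^bsub>M\<^esub> z" by auto
      have wz: "w \<in> carrier M" "z \<in> carrier M" using cd IH(1) by auto
      have "x \<oplus>\<^bsub>M\<^esub> y = ks (c \<oplus>\<^bsub>K\<^esub> d) \<odot>\<^bsub>M\<^esub> v \<oplus>\<^bsub>M\<^esub> (w \<oplus>\<^bsub>M\<^esub> z)"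
        using cd M v wz by (simp add: k lm_distr lm_ac)
      then show ?thesis using cd IH(3) by auto
    qed
    moreover have "ks c \<odot>\<^bsub>M\<^esub> x \<in> kspan M (v # vs)" if c: "c \<in> carrier K" and x: "x \<in> kspan M (v # vs)" for c x
    proof -
      from x obtain d w where cd: "d \<in> carrier K" "w \<in> kspan M vs" "x = ks d \<odot>\<^bsub>M\<^esub> v \<oplus>\<^bsub>M\<^esub> w" by auto
      then have "w \<in> carrier M" using IH(1) by auto
      then have "ks c \<odot>\<^bsub>M\<^esub> x = ks (c \<otimes>\<^bsub>K\<^esub> d) \<odot>\<^bsub>M\<^esub> v \<oplus>\<^bsub>M\<^esub> ks c \<odot>\<^bsub>M\<^esub> w"
        using cd M v c by (simp add: k lm_sm_sm)
      then show ?thesis using cd c IH(4) by auto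
    qed
    ultimately show ?case using sub inc IH(2,5) by auto
  qed
  show "kspan M vs \<subseteq> carrier M" "\<zero>\<^bsub>M\<^esub> \<in> kspan M vs" "set vs \<subseteq> kspan M vs"
    "x \<in> kspan M vs \<Longrightarrow> y \<in> kspan M vs \<Longrightarrow> x \<oplus>\<^bsub>M\<^esub> y \<in> kspan M vs"
    "c \<in> carrier K \<Longrightarrow> x \<in> kspan M vs \<Longrightarrow> ks c \<odot>\<^bsub>M\<^esub> x \<in> kspan M vs"
    using * by blast+
qed

text \<open>If b runs through K-generators of A and s through A-generators of M, the products b s
  span M over K.\<close>

lemma ex_kspan:
  assumes M: "lm M" and fgM: "fin_gen A M"
  shows "\<exists>vs. set vs \<subseteq> carrier M \<and> carrier M = kspan M vs"
proof -
  interpret A: ring A by (rule ringA)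
  interpret KA: Module.module K A by (rule modKA)
  obtain S where S: "finite S" "S \<subseteq> carrier M" "carrier M = spanned A M S"
    using fgM fin_gen_iff[OF M] by auto
  obtain B where B: "finite B" "B \<subseteq> carrier A"
    "\<And>x. x \<in> carrier A \<Longrightarrow> \<exists>c\<in>B \<rightarrow> carrier K. x = finsum A (\<lambda>s. c s \<odot>\<^bsub>A\<^esub> s) B"
    using fgKA unfolding fin_gen_def by blast
  have spA: "x \<in> spanned K A B" if "x \<in> carrier A" for x
    using B(3)[OF that] finsum_in_spanned[OF A.is_abelian_group B(1,2)] by auto
  obtain vs where vs: "set vs = (\<lambda>(b, s). b \<odot>\<^bsub>M\<^esub> s) ` (B \<times> S)"
    using finite_list[of "(\<lambda>(b, s). b \<odot>\<^bsub>M\<^esub> s) ` (B \<times> S)"] B S by auto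
  have vsM: "set vs \<subseteq> carrier M" using vs B S(2) lm_sm[OF M] by (auto simp: subset_eq )
  note ksp = kspan_facts[OF M vsM]
  \<comment> \<open>Membership of a in A is carried through the induction because the sum case needs
    it for distributivity.\<close>
  have "a \<odot>\<^bsub>M\<^esub> s \<in> kspan M vs \<and> a \<in> carrier A" if s: "s \<in> S" and a: "a \<in> spanned K A B" for a s
    using a
  proof induction
    case zero
    show ?case using s S M ksp by auto
  next
    case (gen b c)
    have "(c \<odot>\<^bsub>A\<^esub> b) \<odot>\<^bsub>M\<^esub> s = ks c \<odot>\<^bsub>M\<^esub> (b \<odot>\<^bsub>M\<^esub> s)"
      using gen B S s M ks_mult[OF gen(2), of b] ks_facts(1)[OF gen(2)]
      by (auto simp: lm_sm_sm subset_eq)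
    moreover have "b \<odot>\<^bsub>M\<^esub> s \<in> set vs" using gen s vs by auto
    ultimately show ?case using ksp(4,5) gen B by (auto simp: subset_eq)
  next
    case (add x y)
    then show ?case using ksp S s M by (auto simp: lm_distr subset_eq)
  qed
  note as = this
  have "x \<in> kspan M vs" if "x \<in> spanned A M S" for x
    using that by induction (use as spA ksp in auto)
  then show ?thesis using vsM ksp(1) S(3) by blast
qed

text \<open>\<open>pivots M U vs\<close> counts the leading terms of elements of \<open>U\<close> with respect to the flag
  spanned by the tails of \<open>vs\<close>; on submodules it is a strictly monotone measure.\<close>

primrec pivots :: "('a, 'm, 'y) module_scheme \<Rightarrow> 'm set \<Rightarrow> 'm list \<Rightarrow> nat" where
  "pivots M U [] = 0"
| "pivots M U (v # vs) = pivots M U vs + (if \<exists>w\<in>kspan M vs. v \<oplus>\<^bsub>M\<^esub> w \<in> U then 1 else 0)"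

lemma pivots_mono: "U \<subseteq> V \<Longrightarrow> pivots M U vs \<le> pivots M V vs"
  by (induction vs) (auto intro: add_mono)

text \<open>Gaussian elimination. Equal counts mean that every leading term occurring in V already
  occurs in U, so an element of V can be reduced by elements of U until nothing is left.\<close>

lemma pivots_eq:
  assumes M: "lm M" and U: "submod A M U" and V: "submod A M V" and UV: "U \<subseteq> V"
    and vs: "set vs \<subseteq> carrier M" and eq: "pivots M U vs = pivots M V vs"
  shows "V \<inter> kspan M vs \<subseteq> U"
  using vs eq
proof (induction vs)
  case Nil
  then show ?case using U by (auto simp: submod_def)
next
  case (Cons v vs)
  interpret K: field K by (rule fieldK)
  note k = ks_facts
  from Cons.prems have v: "v \<in> carrier M" and vs: "set vs \<subseteq> carrier M" by auto
  note ksp = kspan_facts[OF M vs]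
  have le: "pivots M U vs \<le> pivots M V vs" by (rule pivots_mono[OF UV])
  \<comment> \<open>The counts for U are at most those for V, both on the tail and at v; equality of
    the sums forces equality of both.\<close>
  have eq1: "pivots M U vs = pivots M V vs"
    and eq2: "(\<exists>w\<in>kspan M vs. v \<oplus>\<^bsub>M\<^esub> w \<in> V) \<longrightarrow> (\<exists>w\<in>kspan M vs. v \<oplus>\<^bsub>M\<^esub> w \<in> U)"
    using Cons.prems(2) le UV by (auto split: if_splits)
  have IH: "V \<inter> kspan M vs \<subseteq> U" using Cons.IH vs eq1 by simp
  have addV: "x \<in> V \<Longrightarrow> y \<in> V \<Longrightarrow> x \<oplus>\<^bsub>M\<^esub> y \<in> V" and smV: "a \<in> carrier A \<Longrightarrow> x \<in> V \<Longrightarrow> a \<odot>\<^bsub>M\<^esub> x \<in> V"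
    and addU: "x \<in> U \<Longrightarrow> y \<in> U \<Longrightarrow> x \<oplus>\<^bsub>M\<^esub> y \<in> U" and smU: "a \<in> carrier A \<Longrightarrow> x \<in> U \<Longrightarrow> a \<odot>\<^bsub>M\<^esub> x \<in> U"
    for x y a using U V by (auto simp: submod_def)
  have negk: "\<ominus>\<^bsub>M\<^esub> w \<in> kspan M vs" if "w \<in> kspan M vs" for w
  proof -
    have "ks \<one>\<^bsub>K\<^esub> = \<one>\<^bsub>A\<^esub>" "ks \<zero>\<^bsub>K\<^esub> = \<zero>\<^bsub>A\<^esub>" using k(4,5) by auto
    interpret A: ring A by (rule ringA)
    have "ks (\<ominus>\<^bsub>K\<^esub> \<one>\<^bsub>K\<^esub>) \<oplus>\<^bsub>A\<^esub> \<one>\<^bsub>A\<^esub> = \<zero>\<^bsub>A\<^esub>"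
      using k(2)[of "\<ominus>\<^bsub>K\<^esub> \<one>\<^bsub>K\<^esub>" "\<one>\<^bsub>K\<^esub>"] k(4,5) by (simp add: K.l_neg)
    then have "ks (\<ominus>\<^bsub>K\<^esub> \<one>\<^bsub>K\<^esub>) = \<ominus>\<^bsub>A\<^esub> \<one>\<^bsub>A\<^esub>"
      using k(1)[of "\<ominus>\<^bsub>K\<^esub> \<one>\<^bsub>K\<^esub>"] A.minus_equality by fastforce
    then have "ks (\<ominus>\<^bsub>K\<^esub> \<one>\<^bsub>K\<^esub>) \<odot>\<^bsub>M\<^esub> w = \<ominus>\<^bsub>M\<^esub> w"
      using lm_neg_sm[OF M, of w] that ksp(1) by auto
    then show ?thesis using ksp(4)[of "\<ominus>\<^bsub>K\<^esub> \<one>\<^bsub>K\<^esub>" w] that by simp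
  qed
  show ?case
  proof
    fix x assume x: "x \<in> V \<inter> kspan M (v # vs)"
    then obtain c w where cw: "c \<in> carrier K" "w \<in> kspan M vs" "x = ks c \<odot>\<^bsub>M\<^esub> v \<oplus>\<^bsub>M\<^esub> w" by auto
    have wM: "w \<in> carrier M" using cw ksp(1) by auto
    show "x \<in> U"
    proof (cases "c = \<zero>\<^bsub>K\<^esub>")
      case True
      then show ?thesis using x cw IH M v wM k(5) by auto
    next
      case False
      \<comment> \<open>Division by the leading coefficient shows that v is a leading term of V,
        hence of U by \<open>eq2\<close>.\<close>
      define d where "d = inv\<^bsub>K\<^esub> c"
      have d: "d \<in> carrier K" "d \<otimes>\<^bsub>K\<^esub> c = \<one>\<^bsub>K\<^esub>" "c \<otimes>\<^bsub>K\<^esub> d = \<one>\<^bsub>K\<^esub>"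
        using False cw(1) K.field_Units by (auto simp: d_def)
      have "ks d \<odot>\<^bsub>M\<^esub> (ks c \<odot>\<^bsub>M\<^esub> v) = v"
        using k(3)[OF d(1) cw(1)] k(4) d(2) lm_sm_sm[OF M k(1)[OF d(1)] k(1)[OF cw(1)] v] M v by simp
      then have "ks d \<odot>\<^bsub>M\<^esub> x = v \<oplus>\<^bsub>M\<^esub> ks d \<odot>\<^bsub>M\<^esub> w"
        using cw M v wM k(1) d(1) by simp
      moreover have "ks d \<odot>\<^bsub>M\<^esub> x \<in> V" using smV k(1)[OF d(1)] x by auto
      moreover have "ks d \<odot>\<^bsub>M\<^esub> w \<in> kspan M vs" using ksp(4) d cw by auto
      ultimately have "\<exists>w\<in>kspan M vs. v \<oplus>\<^bsub>M\<^esub> w \<in> V" by auto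
      then obtain z where z: "z \<in> kspan M vs" "v \<oplus>\<^bsub>M\<^esub> z \<in> U" using eq2 by auto
      have zM: "z \<in> carrier M" using z ksp(1) by auto
      \<comment> \<open>c(v + z) lies in U and has the same leading term as x. The difference is in
        V and in the span of the tail, where the induction hypothesis applies.\<close>
      let ?u = "ks c \<odot>\<^bsub>M\<^esub> (v \<oplus>\<^bsub>M\<^esub> z)"
      have u: "?u \<in> U" using smU k(1) cw z by auto
      have eqx: "w \<oplus>\<^bsub>M\<^esub> \<ominus>\<^bsub>M\<^esub> (ks c \<odot>\<^bsub>M\<^esub> z) = x \<oplus>\<^bsub>M\<^esub> \<ominus>\<^bsub>M\<^esub> ?u"
        using M v wM zM cw k(1)[OF cw(1)] by (simp add: lm_ac)
      have "w \<oplus>\<^bsub>M\<^esub> \<ominus>\<^bsub>M\<^esub> (ks c \<odot>\<^bsub>M\<^esub> z) \<in> kspan M vs"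
        using ksp(3) cw negk ksp(4) z by auto
      moreover have "x \<oplus>\<^bsub>M\<^esub> \<ominus>\<^bsub>M\<^esub> ?u \<in> V"
        using addV x submod_neg(2)[OF M V] u UV by auto
      ultimately have "x \<oplus>\<^bsub>M\<^esub> \<ominus>\<^bsub>M\<^esub> ?u \<in> U" using IH eqx by auto
      then have "(x \<oplus>\<^bsub>M\<^esub> \<ominus>\<^bsub>M\<^esub> ?u) \<oplus>\<^bsub>M\<^esub> ?u \<in> U" using addU u by auto
      moreover have "x \<in> carrier M" "?u \<in> carrier M" using x V u U by (auto simp: submod_def)
      ultimately show ?thesis using M by (simp add: lm_assoc)
    qed
  qed
qed

text \<open>Up to an additive constant depending on the spanning list, the measure is the
  K-dimension. It replaces composition length in three places: finite generation of submodules,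
  Fitting's lemma, and the decomposition into indecomposables.\<close>

lemma ex_measure:
  assumes M: "lm M" and fgM: "fin_gen A M"
  shows "\<exists>\<mu> :: _ \<Rightarrow> nat. \<forall>U V. submod A M U \<longrightarrow> submod A M V \<longrightarrow> U \<subset> V \<longrightarrow> \<mu> U < \<mu> V"
proof -
  obtain vs where vs: "set vs \<subseteq> carrier M" "carrier M = kspan M vs" using ex_kspan[OF assms] by auto
  show ?thesis
  proof (intro exI[of _ "\<lambda>U. pivots M U vs"] allI impI)
    fix U V assume UV: "submod A M U" "submod A M V" "U \<subset> V"
    have "pivots M U vs \<noteq> pivots M V vs"
    proof
      assume "pivots M U vs = pivots M V vs"
      from pivots_eq[OF M UV(1,2) _ vs(1) this] have "V \<inter> carrier M \<subseteq> U" using UV(3) vs(2) by blast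
      moreover have "V \<subseteq> carrier M" using UV(2) by (simp add: submod_def)
      ultimately have "V \<subseteq> U" by blast
      then show False using UV(3) by blast
    qed
    then show "pivots M U vs < pivots M V vs" using pivots_mono[of U V M vs] UV(3) by auto
  qed
qed

lemma spanned_submod_eq:
  assumes "submod A M U" "S \<subseteq> U"
  shows "spanned A (M\<lparr>carrier := U\<rparr>) S = spanned A M S"
proof (intro equalityI subsetI)
  fix x assume "x \<in> spanned A (M\<lparr>carrier := U\<rparr>) S"
  then show "x \<in> spanned A M S" by induction (auto intro: spanned.intros)
next
  fix x assume "x \<in> spanned A M S"
  then show "x \<in> spanned A (M\<lparr>carrier := U\<rparr>) S"
  proof induction
    case zero
    show ?case using spanned.zero[of "M\<lparr>carrier := U\<rparr>"] by simp
  next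
    case (gen s a)
    then show ?case using spanned.gen[of s S a A "M\<lparr>carrier := U\<rparr>"] by simp
  next
    case (add x y)
    then show ?case using spanned.add[of x A "M\<lparr>carrier := U\<rparr>" S y] by simp
  qed
qed

text \<open>A finite subset of U whose span has the largest measure must span U, since adjoining any
  missing element would enlarge the measure.\<close>

lemma fg_submod:
  assumes M: "fg M" and U: "submod A M U"
  shows "fg (M\<lparr>carrier := U\<rparr>)"
proof -
  have lM: "lm M" using M by (rule fg_lm)
  obtain \<mu> :: "_ \<Rightarrow> nat" where \<mu>: "\<And>U V. submod A M U \<Longrightarrow> submod A M V \<Longrightarrow> U \<subset> V \<Longrightarrow> \<mu> U < \<mu> V"
    using ex_measure[of M] M by (auto simp: fg_iff)
  let ?P = "\<lambda>S. finite S \<and> S \<subseteq> U"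
  have UM: "U \<subseteq> carrier M" using U by (auto simp: submod_def)
  have bnd: "\<mu> (spanned A M S) \<le> \<mu> U" if "?P S" for S
  proof (cases "spanned A M S = U")
    case False
    then have "spanned A M S \<subset> U" using that spanned_least[OF U, of S] by auto
    then show ?thesis using \<mu>[OF submod_spanned[OF lM] U, of S] that UM by (meson less_imp_le subset_trans)
  qed simp
  \<comment> \<open>\<open>ex_has_greatest_nat\<close> takes a strict bound, hence the successor of
    the measure of U.\<close>
  obtain S where S: "?P S" "\<And>T. ?P T \<Longrightarrow> \<mu> (spanned A M T) \<le> \<mu> (spanned A M S)"
    using ex_has_greatest_nat[of ?P "{}" "\<lambda>S. \<mu> (spanned A M S)" "Suc (\<mu> U)"] bnd
    by (auto simp: less_Suc_eq_le)
  have "spanned A M S = U"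
  proof (rule ccontr)
    assume "spanned A M S \<noteq> U"
    then obtain x where x: "x \<in> U" "x \<notin> spanned A M S" using spanned_least[OF U, of S] S by auto
    have 1: "insert x S \<subseteq> carrier M" "S \<subseteq> carrier M" using x S UM by auto
    have "spanned A M S \<subset> spanned A M (insert x S)"
      using x in_spanned[OF lM 1(1)] spanned_mono[of S "insert x S" _ A M] by auto
    then have "\<mu> (spanned A M S) < \<mu> (spanned A M (insert x S))"
      using \<mu> submod_spanned[OF lM] 1 by auto
    then show False using S(2)[of "insert x S"] S(1) x by auto
  qed
  then have "U = spanned A (M\<lparr>carrier := U\<rparr>) S" using spanned_submod_eq[OF U] S by simp
  then have "fin_gen A (M\<lparr>carrier := U\<rparr>)"
    using fin_gen_iff[OF submod_lm[OF lM U]] S by auto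
  then show ?thesis using submod_lm[OF lM U] by (simp add: fg_iff)
qed

end

section \<open>Direct sums in categories\<close>

text \<open>\<open>Hm\<close> is defined for arbitrary arguments, objects or not. Bundling both ends
  with the arrow keeps the side conditions of the category laws in one predicate.\<close>

definition arr :: "('o, 'm, 'z) cat_scheme \<Rightarrow> 'o \<Rightarrow> 'o \<Rightarrow> 'm \<Rightarrow> bool" where
  "arr C X Y f \<longleftrightarrow> X \<in> Ob C \<and> Y \<in> Ob C \<and> f \<in> Hm C X Y"

text \<open>The half of the zero object that matters for coproducts: it is the sum of the empty
  family, and adding it to X changes nothing.\<close>

definition initial :: "('o, 'm, 'z) cat_scheme \<Rightarrow> 'o \<Rightarrow> bool" where
  "initial C Z \<longleftrightarrow> Z \<in> Ob C \<and> (\<forall>T\<in>Ob C. \<exists>!h. h \<in> Hm C Z T)"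

text \<open>The category records carry no axioms. The laws are stated once here and instantiated for
  \<open>Amod A\<close>, for \<open>Kb A\<close> and for the quotient category, so that facts about
  direct sums are shared by all three.\<close>

locale precat =
  fixes C :: "('o, 'm, 'z) cat_scheme"
  assumes arr_id: "X \<in> Ob C \<Longrightarrow> arr C X X (idt C X)"
    and arr_cmp: "arr C X Y f \<Longrightarrow> arr C Y Z g \<Longrightarrow> arr C X Z (cmp C X Y Z g f)"
    and id_left: "arr C X Y f \<Longrightarrow> cmp C X Y Y (idt C Y) f = f"
    and id_right: "arr C X Y f \<Longrightarrow> cmp C X X Y f (idt C X) = f"
    and assoc: "arr C W X e \<Longrightarrow> arr C X Y f \<Longrightarrow> arr C Y Z g \<Longrightarrow>
      cmp C W X Z (cmp C X Y Z g f) e = cmp C W Y Z g (cmp C W X Y f e)"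
begin

lemma arrD: "arr C X Y f \<Longrightarrow> X \<in> Ob C" "arr C X Y f \<Longrightarrow> Y \<in> Ob C" "arr C X Y f \<Longrightarrow> f \<in> Hm C X Y"
  by (auto simp: arr_def)

lemma direct_sumI:
  assumes "S \<in> Ob C" "\<And>j. j \<in> J \<Longrightarrow> arr C (X j) S (\<iota> j)"
    and "\<And>T f. T \<in> Ob C \<Longrightarrow> (\<And>j. j \<in> J \<Longrightarrow> arr C (X j) T (f j)) \<Longrightarrow>
      \<exists>h. arr C S T h \<and> (\<forall>j\<in>J. cmp C (X j) S T h (\<iota> j) = f j)"
    and "\<And>T h h'. arr C S T h \<Longrightarrow> arr C S T h' \<Longrightarrow>
      (\<And>j. j \<in> J \<Longrightarrow> cmp C (X j) S T h (\<iota> j) = cmp C (X j) S T h' (\<iota> j)) \<Longrightarrow> h = h'"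
  shows "direct_sum C J X S \<iota>"
  unfolding direct_sum_def
proof (intro conjI ballI allI impI)
  fix T f assume T: "T \<in> Ob C" and f: "\<forall>j\<in>J. f j \<in> Hm C (X j) T"
  have fa: "j \<in> J \<Longrightarrow> arr C (X j) T (f j)" for j using f T assms(2) by (auto simp: arr_def)
  obtain h where h: "arr C S T h" "\<forall>j\<in>J. cmp C (X j) S T h (\<iota> j) = f j"
    using assms(3)[OF T fa] by auto
  show "\<exists>!h. h \<in> Hm C S T \<and> (\<forall>j\<in>J. cmp C (X j) S T h (\<iota> j) = f j)"
  proof (rule ex1I[of _ h])
    fix h' assume "h' \<in> Hm C S T \<and> (\<forall>j\<in>J. cmp C (X j) S T h' (\<iota> j) = f j)"
    then show "h' = h" using assms(4)[of T h' h] h by (auto simp: arr_def)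
  qed (use h in \<open>auto simp: arr_def\<close>)
qed (use assms(1,2) in \<open>auto simp: arr_def\<close>)

lemma direct_sumD:
  assumes "direct_sum C J X S \<iota>"
  shows "S \<in> Ob C" "\<And>j. j \<in> J \<Longrightarrow> arr C (X j) S (\<iota> j)"
    "\<And>T f. T \<in> Ob C \<Longrightarrow> (\<And>j. j \<in> J \<Longrightarrow> arr C (X j) T (f j)) \<Longrightarrow>
      \<exists>h. arr C S T h \<and> (\<forall>j\<in>J. cmp C (X j) S T h (\<iota> j) = f j)"
    "\<And>T h h'. arr C S T h \<Longrightarrow> arr C S T h' \<Longrightarrow>
      (\<And>j. j \<in> J \<Longrightarrow> cmp C (X j) S T h (\<iota> j) = cmp C (X j) S T h' (\<iota> j)) \<Longrightarrow> h = h'"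
proof -
  show S: "S \<in> Ob C" and i: "\<And>j. j \<in> J \<Longrightarrow> arr C (X j) S (\<iota> j)"
    using assms by (auto simp: direct_sum_def arr_def)
  have u: "\<And>T f. T \<in> Ob C \<Longrightarrow> (\<forall>j\<in>J. f j \<in> Hm C (X j) T) \<Longrightarrow>
      (\<exists>!h. h \<in> Hm C S T \<and> (\<forall>j\<in>J. cmp C (X j) S T h (\<iota> j) = f j))"
    using assms by (auto simp: direct_sum_def)
  show "\<exists>h. arr C S T h \<and> (\<forall>j\<in>J. cmp C (X j) S T h (\<iota> j) = f j)"
    if "T \<in> Ob C" "\<And>j. j \<in> J \<Longrightarrow> arr C (X j) T (f j)" for T f
    using u[OF that(1), of f] that S by (auto simp: arr_def)
  show "h = h'" if h: "arr C S T h" "arr C S T h'"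
    "\<And>j. j \<in> J \<Longrightarrow> cmp C (X j) S T h (\<iota> j) = cmp C (X j) S T h' (\<iota> j)" for T h h'
  proof -
    have "T \<in> Ob C" "\<forall>j\<in>J. cmp C (X j) S T h (\<iota> j) \<in> Hm C (X j) T"
      using h i arr_cmp by (auto simp: arr_def)
    from u[OF this] have "\<exists>!k. k \<in> Hm C S T \<and> (\<forall>j\<in>J. cmp C (X j) S T k (\<iota> j) = cmp C (X j) S T h (\<iota> j))" .
    moreover have "h \<in> Hm C S T" "h' \<in> Hm C S T" using h by (simp_all add: arr_def)
    moreover have "\<forall>j\<in>J. cmp C (X j) S T h' (\<iota> j) = cmp C (X j) S T h (\<iota> j)" using h(3) by simp
    ultimately show ?thesis by blast
  qed
qed

lemma direct_sum_cong:
  assumes "direct_sum C J X S \<iota>" "\<And>j. j \<in> J \<Longrightarrow> X j = X' j" "\<And>j. j \<in> J \<Longrightarrow> \<iota> j = \<iota>' j"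
  shows "direct_sum C J X' S \<iota>'"
  using assms by (simp add: direct_sum_def)

lemma is_isoE:
  assumes "is_iso C X Y f" "X \<in> Ob C" "Y \<in> Ob C"
  obtains g where "arr C X Y f" "arr C Y X g" "cmp C X Y X g f = idt C X" "cmp C Y X Y f g = idt C Y"
  using assms by (auto simp: is_iso_def arr_def)

lemma is_isoI:
  "arr C X Y f \<Longrightarrow> arr C Y X g \<Longrightarrow> cmp C X Y X g f = idt C X \<Longrightarrow> cmp C Y X Y f g = idt C Y \<Longrightarrow> is_iso C X Y f"
  by (auto simp: is_iso_def arr_def)

lemma is_iso_idt: "X \<in> Ob C \<Longrightarrow> is_iso C X X (idt C X)"
  by (rule is_isoI[of _ _ _ "idt C X"]) (auto simp: arr_id id_left)

lemma direct_sum_iso: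
  assumes ds: "direct_sum C J X S \<iota>" and iso: "is_iso C S S' \<theta>" and S': "S' \<in> Ob C"
  shows "direct_sum C J X S' (\<lambda>j. cmp C (X j) S S' \<theta> (\<iota> j))"
proof -
  note D = direct_sumD[OF ds]
  from is_isoE[OF iso D(1) S'] obtain g where
    g: "arr C S S' \<theta>" "arr C S' S g" "cmp C S S' S g \<theta> = idt C S" "cmp C S' S S' \<theta> g = idt C S'" by metis
  show ?thesis
  proof (rule direct_sumI)
    fix j assume "j \<in> J"
    then show "arr C (X j) S' (cmp C (X j) S S' \<theta> (\<iota> j))" using D(2) g(1) arr_cmp by blast
  next
    fix T f assume T: "T \<in> Ob C" and f: "\<And>j. j \<in> J \<Longrightarrow> arr C (X j) T (f j)"
    from D(3)[OF this] obtain h where h: "arr C S T h" "\<forall>j\<in>J. cmp C (X j) S T h (\<iota> j) = f j" by auto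
    have "cmp C (X j) S' T (cmp C S' S T h g) (cmp C (X j) S S' \<theta> (\<iota> j)) = f j" if "j \<in> J" for j
    proof -
      have i: "arr C (X j) S (\<iota> j)" using D(2) that .
      have "cmp C (X j) S' T (cmp C S' S T h g) (cmp C (X j) S S' \<theta> (\<iota> j)) =
        cmp C (X j) S T h (cmp C (X j) S' S g (cmp C (X j) S S' \<theta> (\<iota> j)))"
        by (rule assoc[OF arr_cmp[OF i g(1)] g(2) h(1)])
      also have "cmp C (X j) S' S g (cmp C (X j) S S' \<theta> (\<iota> j)) = \<iota> j"
        using assoc[OF i g(1,2)] g(3) id_left[OF i] by simp
      finally show ?thesis using h(2) that by simp
    qed
    then show "\<exists>h. arr C S' T h \<and> (\<forall>j\<in>J. cmp C (X j) S' T h (cmp C (X j) S S' \<theta> (\<iota> j)) = f j)"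
      using arr_cmp[OF g(2) h(1)] by blast
  next
    fix T h h' assume h: "arr C S' T h" "arr C S' T h'"
      and eq: "\<And>j. j \<in> J \<Longrightarrow> cmp C (X j) S' T h (cmp C (X j) S S' \<theta> (\<iota> j)) =
        cmp C (X j) S' T h' (cmp C (X j) S S' \<theta> (\<iota> j))"
    have "cmp C S S' T h \<theta> = cmp C S S' T h' \<theta>"
      by (rule D(4)) (use eq h arr_cmp[OF g(1)] assoc[OF D(2) g(1)] in auto)
    then have "cmp C S' S T (cmp C S S' T h \<theta>) g = cmp C S' S T (cmp C S S' T h' \<theta>) g" by simp
    then show "h = h'" using assoc[OF g(2) g(1)] h g(4) id_right by simp
  qed (rule S')
qed

lemma direct_sum_iso_source:
  assumes ds: "direct_sum C J X S \<iota>" and X': "\<And>j. j \<in> J \<Longrightarrow> X' j \<in> Ob C"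
    and iso: "\<And>j. j \<in> J \<Longrightarrow> is_iso C (X' j) (X j) (\<alpha> j)"
  shows "direct_sum C J X' S (\<lambda>j. cmp C (X' j) (X j) S (\<iota> j) (\<alpha> j))"
proof -
  note D = direct_sumD[OF ds]
  have "\<forall>j\<in>J. \<exists>b. arr C (X' j) (X j) (\<alpha> j) \<and> arr C (X j) (X' j) b \<and>
      cmp C (X' j) (X j) (X' j) b (\<alpha> j) = idt C (X' j) \<and> cmp C (X j) (X' j) (X j) (\<alpha> j) b = idt C (X j)"
    using is_isoE[OF iso X'] D(2) by (metis arrD(1))
  then obtain \<beta> where g: "\<And>j. j \<in> J \<Longrightarrow> arr C (X' j) (X j) (\<alpha> j)" "\<And>j. j \<in> J \<Longrightarrow> arr C (X j) (X' j) (\<beta> j)"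
    "\<And>j. j \<in> J \<Longrightarrow> cmp C (X' j) (X j) (X' j) (\<beta> j) (\<alpha> j) = idt C (X' j)"
    "\<And>j. j \<in> J \<Longrightarrow> cmp C (X j) (X' j) (X j) (\<alpha> j) (\<beta> j) = idt C (X j)" by metis
  show ?thesis
  proof (rule direct_sumI)
    fix j assume "j \<in> J"
    then show "arr C (X' j) S (cmp C (X' j) (X j) S (\<iota> j) (\<alpha> j))" using D(2) g(1) arr_cmp by blast
  next
    fix T f assume T: "T \<in> Ob C" and f: "\<And>j. j \<in> J \<Longrightarrow> arr C (X' j) T (f j)"
    have "\<exists>h. arr C S T h \<and> (\<forall>j\<in>J. cmp C (X j) S T h (\<iota> j) = cmp C (X j) (X' j) T (f j) (\<beta> j))"
      by (rule D(3)[OF T]) (use arr_cmp g(2) f in blast)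
    then obtain h where h: "arr C S T h"
      "\<And>j. j \<in> J \<Longrightarrow> cmp C (X j) S T h (\<iota> j) = cmp C (X j) (X' j) T (f j) (\<beta> j)" by auto
    have "cmp C (X' j) S T h (cmp C (X' j) (X j) S (\<iota> j) (\<alpha> j)) = f j" if j: "j \<in> J" for j
    proof -
      have "cmp C (X' j) S T h (cmp C (X' j) (X j) S (\<iota> j) (\<alpha> j)) =
        cmp C (X' j) (X j) T (cmp C (X j) (X' j) T (f j) (\<beta> j)) (\<alpha> j)"
        using assoc[OF g(1)[OF j] D(2)[OF j] h(1)] h(2)[OF j] by simp
      also have "\<dots> = f j"
        using assoc[OF g(1)[OF j] g(2)[OF j] f[OF j]] g(3)[OF j] id_right[OF f[OF j]] by simp
      finally show ?thesis .
    qed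
    then show "\<exists>h. arr C S T h \<and> (\<forall>j\<in>J. cmp C (X' j) S T h (cmp C (X' j) (X j) S (\<iota> j) (\<alpha> j)) = f j)"
      using h(1) by blast
  next
    fix T h h' assume h: "arr C S T h" "arr C S T h'"
      and eq: "\<And>j. j \<in> J \<Longrightarrow> cmp C (X' j) S T h (cmp C (X' j) (X j) S (\<iota> j) (\<alpha> j)) =
        cmp C (X' j) S T h' (cmp C (X' j) (X j) S (\<iota> j) (\<alpha> j))"
    show "h = h'"
    proof (rule D(4)[OF h])
      fix j assume j: "j \<in> J"
      have *: "cmp C (X j) (X' j) T (cmp C (X' j) S T h'' (cmp C (X' j) (X j) S (\<iota> j) (\<alpha> j))) (\<beta> j) =
        cmp C (X j) S T h'' (\<iota> j)" if h'': "arr C S T h''" for h''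
        using assoc[OF g(2)[OF j] g(1)[OF j] arr_cmp[OF D(2)[OF j] h'']] assoc[OF g(1)[OF j] D(2)[OF j] h'']
          g(4)[OF j] id_right[OF arr_cmp[OF D(2)[OF j] h'']] by simp
      show "cmp C (X j) S T h (\<iota> j) = cmp C (X j) S T h' (\<iota> j)"
        using *[OF h(1)] *[OF h(2)] eq[OF j] by simp
    qed
  qed (rule D(1))
qed

text \<open>Finite sums are built from binary ones, one summand at a time; \<open>bigsum\<close>
  gets its universal property this way.\<close>

lemma direct_sum_Suc:
  assumes ds: "direct_sum C {..<n} X S \<iota>"
    and ds2: "direct_sum C {0, 1} (\<lambda>j. if j = 0 then S else X n) T \<kappa>"
  shows "direct_sum C {..<Suc n} X T (\<lambda>j. if j < n then cmp C (X j) S T (\<kappa> 0) (\<iota> j) else \<kappa> 1)"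
    (is "direct_sum C _ _ _ ?\<iota>")
proof -
  note D = direct_sumD[OF ds] and E = direct_sumD[OF ds2]
  have k0: "arr C S T (\<kappa> 0)" and k1: "arr C (X n) T (\<kappa> 1)" using E(2)[of 0] E(2)[of 1] by auto
  have i: "arr C (X j) S (\<iota> j)" if "j < n" for j using D(2) that by simp
  show ?thesis
  proof (rule direct_sumI)
    fix j assume "j \<in> {..<Suc n}"
    then show "arr C (X j) T (?\<iota> j)" using arr_cmp[OF i k0] k1 by (auto simp: less_Suc_eq)
  next
    fix U f assume U: "U \<in> Ob C" and f: "\<And>j. j \<in> {..<Suc n} \<Longrightarrow> arr C (X j) U (f j)"
    obtain h where h: "arr C S U h" "\<And>j. j < n \<Longrightarrow> cmp C (X j) S U h (\<iota> j) = f j"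
      using D(3)[OF U, of f] f by auto
    have "\<exists>k. arr C T U k \<and> (\<forall>j\<in>{0, 1}. cmp C (if j = 0 then S else X n) T U k (\<kappa> j) = (if j = 0 then h else f n))"
      by (rule E(3)[OF U]) (use h f[of n] in auto)
    then obtain k where k: "arr C T U k" "cmp C S T U k (\<kappa> 0) = h" "cmp C (X n) T U k (\<kappa> 1) = f n" by auto
    have "cmp C (X j) T U k (?\<iota> j) = f j" if "j < Suc n" for j
    proof (cases "j < n")
      case True
      then show ?thesis using assoc[OF i[OF True] k0 k(1)] k(2) h(2) by simp
    next
      case False
      then have "j = n" using that by auto
      then show ?thesis using k(3) by simp
    qed
    then show "\<exists>h. arr C T U h \<and> (\<forall>j\<in>{..<Suc n}. cmp C (X j) T U h (?\<iota> j) = f j)" using k(1) by (intro exI[of _ k]) simp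
  next
    fix U h h' assume h: "arr C T U h" "arr C T U h'"
      and eq: "\<And>j. j \<in> {..<Suc n} \<Longrightarrow> cmp C (X j) T U h (?\<iota> j) = cmp C (X j) T U h' (?\<iota> j)"
    have "cmp C S T U h (\<kappa> 0) = cmp C S T U h' (\<kappa> 0)"
    proof (rule D(4))
      fix j assume j: "j \<in> {..<n}"
      then show "cmp C (X j) S U (cmp C S T U h (\<kappa> 0)) (\<iota> j) = cmp C (X j) S U (cmp C S T U h' (\<kappa> 0)) (\<iota> j)"
        using eq[of j] assoc[OF i k0 h(1), of j] assoc[OF i k0 h(2), of j] by simp
    qed (use h k0 arr_cmp in auto)
    moreover have "cmp C (X n) T U h (\<kappa> 1) = cmp C (X n) T U h' (\<kappa> 1)" using eq[of n] by simp
    ultimately show "h = h'" by (intro E(4)[OF h]) auto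
  qed (rule E(1))
qed

lemma direct_sum_unique:
  assumes ds: "direct_sum C J X S \<iota>" and ds': "direct_sum C J X S' \<iota>'"
  shows "\<exists>\<theta>. is_iso C S S' \<theta>"
proof -
  note D = direct_sumD[OF ds] and E = direct_sumD[OF ds']
  obtain a where a: "arr C S S' a" "\<And>j. j \<in> J \<Longrightarrow> cmp C (X j) S S' a (\<iota> j) = \<iota>' j"
    using D(3)[OF E(1), of \<iota>'] E(2) by auto
  obtain b where b: "arr C S' S b" "\<And>j. j \<in> J \<Longrightarrow> cmp C (X j) S' S b (\<iota>' j) = \<iota> j"
    using E(3)[OF D(1), of \<iota>] D(2) by auto
  have "cmp C S S' S b a = idt C S"
    by (rule D(4)[OF arr_cmp[OF a(1) b(1)] arr_id[OF D(1)]])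
      (use assoc[OF D(2) a(1) b(1)] a(2) b(2) id_left[OF D(2)] in simp)
  moreover have "cmp C S' S S' a b = idt C S'"
    by (rule E(4)[OF arr_cmp[OF b(1) a(1)] arr_id[OF E(1)]])
      (use assoc[OF E(2) b(1) a(1)] a(2) b(2) id_left[OF E(2)] in simp)
  ultimately show ?thesis using is_isoI[OF a(1) b(1)] by blast
qed

lemma direct_sum_empty: "initial C Z \<Longrightarrow> direct_sum C {..<0} X Z \<iota>"
  by (auto simp: direct_sum_def initial_def)

lemma direct_sum_single:
  assumes X: "X \<in> Ob C" shows "direct_sum C {..<Suc 0} (\<lambda>_. X) X (\<lambda>_. idt C X)"
  by (rule direct_sumI) (use X arr_id id_right in \<open>auto simp: lessThan_Suc\<close>)

lemma direct_sum2_zero: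
  assumes X: "X \<in> Ob C" and Z: "initial C Z"
  shows "direct_sum2 C X Z X"
proof -
  have ZO: "Z \<in> Ob C" and Zu: "T \<in> Ob C \<Longrightarrow> \<exists>!h. h \<in> Hm C Z T" for T
    using Z by (auto simp: initial_def)
  obtain z where z: "z \<in> Hm C Z X" using Zu[OF X] by auto
  have za: "arr C Z X z" using z X ZO by (simp add: arr_def)
  have "direct_sum C {0, 1} (\<lambda>j. if j = 0 then X else Z) X (\<lambda>j. if j = 0 then idt C X else z)"
  proof (rule direct_sumI)
    fix T f assume T: "T \<in> Ob C" and "\<And>j. j \<in> {0::nat, 1} \<Longrightarrow> arr C (if j = 0 then X else Z) T (f j)"
    from this(2)[of 0] this(2)[of 1] have f: "arr C X T (f 0)" "arr C Z T (f 1)" by auto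
    have "cmp C Z X T (f 0) z = f 1"
      using Zu[OF T] arr_cmp[OF za f(1)] f(2) by (auto simp: arr_def)
    then show "\<exists>h. arr C X T h \<and> (\<forall>j\<in>{0, 1}. cmp C (if j = 0 then X else Z) X T h (if j = 0 then idt C X else z) = f j)"
      using f id_right by auto
  next
    fix T h h' assume "arr C X T h" "arr C X T h'"
      and "\<And>j. j \<in> {0::nat, 1} \<Longrightarrow> cmp C (if j = 0 then X else Z) X T h (if j = 0 then idt C X else z) =
        cmp C (if j = 0 then X else Z) X T h' (if j = 0 then idt C X else z)"
    from this(1,2) this(3)[of 0] show "h = h'" using id_right[of X T] by simp
  qed (use X arr_id za in auto)
  then show ?thesis unfolding direct_sum2_def by blast
qed

text \<open>A family with one member, and an initial object as complement.\<close>

lemma add_closure_incl: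
  assumes "X \<in> \<X>" "X \<in> Ob C" "initial C Z" shows "X \<in> add_closure C \<X>"
proof -
  have "direct_sum C {..<Suc 0} (\<lambda>_. X) X (\<lambda>_. idt C X)" "direct_sum2 C X Z X" "Z \<in> Ob C"
    using assms direct_sum_single direct_sum2_zero by (auto simp: initial_def)
  then show ?thesis using assms(1,2) unfolding add_closure_def
    by (intro CollectI conjI exI[of _ "Suc 0"] exI[of _ "\<lambda>_. X"] exI[of _ X] exI[of _ "\<lambda>_. idt C X"] exI[of _ Z]) auto
qed

end

section \<open>The category of finitely generated modules\<close>

definition zero_mod :: "'a umod" where
  "zero_mod = \<lparr>carrier = {undefined}, mult = undefined, one = undefined, zero = undefined,
     add = (\<lambda>_ _. undefined), smult = (\<lambda>_ _. undefined)\<rparr>"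

lemma seq_pair_simps [simp]:
  "seq_fst (seq_pair u v) = u" "seq_snd (seq_pair u v) = v" "seq_pair (seq_fst w) (seq_snd w) = w"
  by (auto simp: seq_fst_def seq_snd_def seq_pair_def fun_eq_iff elim!: evenE oddE)

lemma seq_pair_eq_iff [simp]: "seq_pair u v = seq_pair u' v' \<longleftrightarrow> u = u' \<and> v = v'"
  by (metis seq_pair_simps(1,2))

lemma dsum_simps [simp]:
  "seq_pair x y \<in> carrier (dsum M N) \<longleftrightarrow> x \<in> carrier M \<and> y \<in> carrier N"
  "\<zero>\<^bsub>dsum M N\<^esub> = seq_pair \<zero>\<^bsub>M\<^esub> \<zero>\<^bsub>N\<^esub>"
  "seq_pair x y \<oplus>\<^bsub>dsum M N\<^esub> seq_pair x' y' = seq_pair (x \<oplus>\<^bsub>M\<^esub> x') (y \<oplus>\<^bsub>N\<^esub> y')"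
  "a \<odot>\<^bsub>dsum M N\<^esub> seq_pair x y = seq_pair (a \<odot>\<^bsub>M\<^esub> x) (a \<odot>\<^bsub>N\<^esub> y)"
  by (auto simp: dsum_def)

lemma dsum_carrier_iff: "w \<in> carrier (dsum M N) \<longleftrightarrow> seq_fst w \<in> carrier M \<and> seq_snd w \<in> carrier N"
  by (auto simp: dsum_def)

lemma dsum_ops:
  "seq_fst (w \<oplus>\<^bsub>dsum M N\<^esub> w') = seq_fst w \<oplus>\<^bsub>M\<^esub> seq_fst w'"
  "seq_snd (w \<oplus>\<^bsub>dsum M N\<^esub> w') = seq_snd w \<oplus>\<^bsub>N\<^esub> seq_snd w'"
  "seq_fst (a \<odot>\<^bsub>dsum M N\<^esub> w) = a \<odot>\<^bsub>M\<^esub> seq_fst w"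
  "seq_snd (a \<odot>\<^bsub>dsum M N\<^esub> w) = a \<odot>\<^bsub>N\<^esub> seq_snd w"
  by (auto simp: dsum_def)

lemma dsum_ballI: "(\<And>x y. x \<in> carrier M \<Longrightarrow> y \<in> carrier N \<Longrightarrow> P (seq_pair x y)) \<Longrightarrow> w \<in> carrier (dsum M N) \<Longrightarrow> P w"
  by (metis dsum_carrier_iff seq_pair_simps(3))

context fda
begin

lemma lm_dsum:
  assumes M: "lm M" and N: "lm N" shows "lm (dsum M N)"
proof (rule lmI)
  show "abelian_group (dsum M N)"
  proof (rule abelian_groupI)
    fix w assume "w \<in> carrier (dsum M N)"
    then show "\<exists>y\<in>carrier (dsum M N). y \<oplus>\<^bsub>dsum M N\<^esub> w = \<zero>\<^bsub>dsum M N\<^esub>"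
    proof (rule dsum_ballI[rotated])
      fix x y assume "x \<in> carrier M" "y \<in> carrier N"
      then show "\<exists>z\<in>carrier (dsum M N). z \<oplus>\<^bsub>dsum M N\<^esub> seq_pair x y = \<zero>\<^bsub>dsum M N\<^esub>"
        using M N by (intro bexI[of _ "seq_pair (\<ominus>\<^bsub>M\<^esub> x) (\<ominus>\<^bsub>N\<^esub> y)"]) auto
    qed
  qed (use M N in \<open>auto simp: dsum_def lm_ac\<close>)
qed (use M N in \<open>auto simp: dsum_def lm_distr lm_sm_sm\<close>)

lemma dsum_neg [simp]:
  assumes "lm M" "lm N" "x \<in> carrier M" "y \<in> carrier N"
  shows "\<ominus>\<^bsub>dsum M N\<^esub> (seq_pair x y) = seq_pair (\<ominus>\<^bsub>M\<^esub> x) (\<ominus>\<^bsub>N\<^esub> y)"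
  using assms lm_neg_sm[OF lm_dsum[of M N], of "seq_pair x y"] by (simp add: lm_neg_sm)

lemma fg_dsum:
  assumes M: "fg M" and N: "fg N" shows "fg (dsum M N)"
proof -
  have lM: "lm M" and lN: "lm N" using M N fg_lm by auto
  obtain S where S: "finite S" "S \<subseteq> carrier M" and S3: "carrier M = spanned A M S"
    using M fin_gen_iff[OF lM] by (auto simp: fg_iff)
  obtain T where T: "finite T" "T \<subseteq> carrier N" and T3: "carrier N = spanned A N T"
    using N fin_gen_iff[OF lN] by (auto simp: fg_iff)
  let ?U = "(\<lambda>x. seq_pair x \<zero>\<^bsub>N\<^esub>) ` S \<union> (\<lambda>y. seq_pair \<zero>\<^bsub>M\<^esub> y) ` T"
  have U: "?U \<subseteq> carrier (dsum M N)" using S T lM lN by auto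
  have 1: "seq_pair x \<zero>\<^bsub>N\<^esub> \<in> spanned A (dsum M N) ?U" if "x \<in> spanned A M S" for x
    using that
  proof induction
    case zero
    show ?case using spanned.zero[of "dsum M N"] by simp
  next
    case (gen s a)
    then show ?case using spanned.gen[of "seq_pair s \<zero>\<^bsub>N\<^esub>" ?U a A "dsum M N"] lN by simp
  next
    case (add x y)
    then show ?case using spanned.add[of "seq_pair x \<zero>\<^bsub>N\<^esub>" A "dsum M N" ?U "seq_pair y \<zero>\<^bsub>N\<^esub>"] lN by simp
  qed
  have 2: "seq_pair \<zero>\<^bsub>M\<^esub> x \<in> spanned A (dsum M N) ?U" if "x \<in> spanned A N T" for x
    using that
  proof induction
    case zero
    show ?case using spanned.zero[of "dsum M N"] by simp
  next
    case (gen s a)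
    then show ?case using spanned.gen[of "seq_pair \<zero>\<^bsub>M\<^esub> s" ?U a A "dsum M N"] lM by simp
  next
    case (add x y)
    then show ?case using spanned.add[of "seq_pair \<zero>\<^bsub>M\<^esub> x" A "dsum M N" ?U "seq_pair \<zero>\<^bsub>M\<^esub> y"] lM by simp
  qed
  have "w \<in> spanned A (dsum M N) ?U" if w: "w \<in> carrier (dsum M N)" for w
    using w
  proof (rule dsum_ballI[rotated])
    fix x y assume xy: "x \<in> carrier M" "y \<in> carrier N"
    then have "seq_pair x y = seq_pair x \<zero>\<^bsub>N\<^esub> \<oplus>\<^bsub>dsum M N\<^esub> seq_pair \<zero>\<^bsub>M\<^esub> y" using lM lN by simp
    then show "seq_pair x y \<in> spanned A (dsum M N) ?U" using 1[of x] 2[of y] xy S3 T3 spanned.add by metis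
  qed
  moreover have "spanned A (dsum M N) ?U \<subseteq> carrier (dsum M N)"
    using submod_spanned[OF lm_dsum[OF lM lN] U] by (simp add: submod_def)
  ultimately have "carrier (dsum M N) = spanned A (dsum M N) ?U" by blast
  moreover have "finite ?U" using S T by simp
  ultimately show ?thesis
    using fin_gen_iff[OF lm_dsum[OF lM lN]] lm_dsum[OF lM lN] U unfolding fg_iff by blast
qed

lemma fg_zero_mod: "fg (zero_mod :: 'a umod)" and zero_zero_mod: "zero_module (zero_mod :: 'a umod)"
proof -
  have "lm (zero_mod :: 'a umod)"
    by (intro lmI abelian_groupI) (auto simp: zero_mod_def)
  moreover have "carrier (zero_mod :: 'a umod) = spanned A zero_mod {}"
    using spanned.zero[of "zero_mod :: 'a umod" A "{}"] submod_spanned[OF calculation, of "{}"]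
    by (auto simp: zero_mod_def submod_def)
  ultimately show "fg (zero_mod :: 'a umod)"
    using fin_gen_iff[of "zero_mod :: 'a umod"] by (auto simp: fg_iff)
qed (simp add: zero_module_def zero_mod_def)

lemma arr_Amod: "arr (Amod A) M N f \<longleftrightarrow> fg M \<and> fg N \<and> f \<in> lhom A M N"
  by (auto simp: arr_def Amod_def)

lemma cmp_Amod [simp]: "cmp (Amod A) M N P g f = compose (carrier M) g f"
  and idt_Amod [simp]: "idt (Amod A) M = (\<lambda>x\<in>carrier M. x)"
  and Hm_Amod [simp]: "Hm (Amod A) M N = lhom A M N"
  by (simp_all add: Amod_def)

sublocale Am: precat "Amod A"
proof
  fix M N and f :: "'a umap" assume f: "arr (Amod A) M N f"
  have f': "f \<in> lhom A M N" and l: "lm M" "lm N" using f fg_lm by (auto simp: arr_Amod)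
  show "cmp (Amod A) M N N (idt (Amod A) N) f = f" "cmp (Amod A) M M N f (idt (Amod A) M) = f"
    using lh_ext[OF f'] lh_closed[OF f'] by (auto simp: compose_def fun_eq_iff)
next
  fix M N P Q and e f g :: "'a umap"
  assume e: "arr (Amod A) M N e" and "arr (Amod A) N P f" "arr (Amod A) P Q g"
  then show "cmp (Amod A) M N Q (cmp (Amod A) N P Q g f) e = cmp (Amod A) M P Q g (cmp (Amod A) M N P f e)"
    using lh_closed[of e M N] by (auto simp: arr_Amod compose_def fun_eq_iff)
qed (auto simp: arr_Amod intro: lh_id lh_comp fg_lm)

lemma zero_lh:
  assumes "zero_module Z" "lm Z" "lm N" "f \<in> lhom A Z N" shows "f = (\<lambda>x\<in>carrier Z. \<zero>\<^bsub>N\<^esub>)"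
  using assms lh_zero[of f Z N] lh_ext[of f Z N] by (auto simp: zero_module_def fun_eq_iff)

lemma initial_zero: "fg Z \<Longrightarrow> zero_module Z \<Longrightarrow> initial (Amod A) Z"
  unfolding initial_def
proof (intro conjI ballI)
  fix T assume "fg Z" "zero_module Z" "fg T"
  then show "\<exists>!h. h \<in> Hm (Amod A) Z T"
    using zero_lh[of Z T] lh_0[of Z T] fg_lm[of Z] fg_lm[of T] by auto
qed

lemma lhom_inv:
  assumes "lm M" "lm N" and f: "f \<in> lhom A M N" and bij: "bij_betw f (carrier M) (carrier N)"
  shows "\<exists>g\<in>lhom A N M. (\<forall>x\<in>carrier M. g (f x) = x) \<and> (\<forall>y\<in>carrier N. f (g y) = y)"
proof -
  define g where "g = (\<lambda>y\<in>carrier N. inv_into (carrier M) f y)"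
  have gc: "g y \<in> carrier M" "f (g y) = y" if "y \<in> carrier N" for y
    using that bij bij_betw_inv_into[OF bij] by (auto simp: g_def bij_betw_def f_inv_into_f inv_into_into)
  have gf: "g (f x) = x" if "x \<in> carrier M" for x
    using that bij lh_closed[OF f] by (auto simp: g_def bij_betw_def)
  have "g \<in> lhom A N M"
  proof (rule lhI)
    fix x y assume xy: "x \<in> carrier N" "y \<in> carrier N"
    have "f (g x \<oplus>\<^bsub>M\<^esub> g y) = x \<oplus>\<^bsub>N\<^esub> y" using xy gc lh_add[OF f] by simp
    then show "g (x \<oplus>\<^bsub>N\<^esub> y) = g x \<oplus>\<^bsub>M\<^esub> g y" using gf[of "g x \<oplus>\<^bsub>M\<^esub> g y"] gc xy assms by simp
  next
    fix a x assume xy: "a \<in> carrier A" "x \<in> carrier N"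
    have "f (a \<odot>\<^bsub>M\<^esub> g x) = a \<odot>\<^bsub>N\<^esub> x" using xy gc lh_sm[OF f] by simp
    then show "g (a \<odot>\<^bsub>N\<^esub> x) = a \<odot>\<^bsub>M\<^esub> g x" using gf[of "a \<odot>\<^bsub>M\<^esub> g x"] gc xy assms by simp
  qed (use gc in \<open>auto simp: g_def\<close>)
  then show ?thesis using gc gf by blast
qed

lemma is_iso_AmodE:
  assumes "is_iso (Amod A) M N f"
  obtains g where "f \<in> lhom A M N" "g \<in> lhom A N M" "\<And>x. x \<in> carrier M \<Longrightarrow> g (f x) = x"
    "\<And>y. y \<in> carrier N \<Longrightarrow> f (g y) = y"
proof -
  from assms obtain g where "f \<in> lhom A M N" "g \<in> lhom A N M" "compose (carrier M) g f = (\<lambda>x\<in>carrier M. x)"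
    "compose (carrier N) f g = (\<lambda>x\<in>carrier N. x)" by (auto simp: is_iso_def)
  then show ?thesis using that[of g] by (metis compose_eq restrict_apply')
qed

section \<open>Biproducts of modules, retracts and lifting problems\<close>

definition inl :: "'a umod \<Rightarrow> 'a umod \<Rightarrow> 'a umap" where "inl M N = (\<lambda>x\<in>carrier M. seq_pair x \<zero>\<^bsub>N\<^esub>)"
definition inr :: "'a umod \<Rightarrow> 'a umod \<Rightarrow> 'a umap" where "inr M N = (\<lambda>y\<in>carrier N. seq_pair \<zero>\<^bsub>M\<^esub> y)"

lemma lh_inl: "lm M \<Longrightarrow> lm N \<Longrightarrow> inl M N \<in> lhom A M (dsum M N)"
  and lh_inr: "lm M \<Longrightarrow> lm N \<Longrightarrow> inr M N \<in> lhom A N (dsum M N)"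
  unfolding inl_def inr_def by (auto intro!: lh_restrict)

lemma lh_copair:
  assumes M: "lm M" "lm N" "lm T" and f: "f \<in> lhom A M T" and g: "g \<in> lhom A N T"
  shows "(\<lambda>w\<in>carrier (dsum M N). f (seq_fst w) \<oplus>\<^bsub>T\<^esub> g (seq_snd w)) \<in> lhom A (dsum M N) T"
proof (rule lh_restrict[OF lm_dsum[OF M(1,2)]])
  note s = lh_closed[OF f] lh_closed[OF g] lh_add[OF f] lh_add[OF g] lh_sm[OF f] lh_sm[OF g]
  fix w assume w: "w \<in> carrier (dsum M N)"
  show "f (seq_fst w) \<oplus>\<^bsub>T\<^esub> g (seq_snd w) \<in> carrier T" using w M by (simp add: dsum_carrier_iff s)
  show "f (seq_fst (a \<odot>\<^bsub>dsum M N\<^esub> w)) \<oplus>\<^bsub>T\<^esub> g (seq_snd (a \<odot>\<^bsub>dsum M N\<^esub> w)) =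
    a \<odot>\<^bsub>T\<^esub> (f (seq_fst w) \<oplus>\<^bsub>T\<^esub> g (seq_snd w))" if "a \<in> carrier A" for a
    using w that M by (simp add: dsum_carrier_iff s dsum_ops)
  fix w' assume w': "w' \<in> carrier (dsum M N)"
  show "f (seq_fst (w \<oplus>\<^bsub>dsum M N\<^esub> w')) \<oplus>\<^bsub>T\<^esub> g (seq_snd (w \<oplus>\<^bsub>dsum M N\<^esub> w')) =
      (f (seq_fst w) \<oplus>\<^bsub>T\<^esub> g (seq_snd w)) \<oplus>\<^bsub>T\<^esub> (f (seq_fst w') \<oplus>\<^bsub>T\<^esub> g (seq_snd w'))"
    using w w' M by (simp add: dsum_carrier_iff s dsum_ops lm_four)
qed

lemma direct_sum_dsum:
  assumes M: "fg M" and N: "fg N"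
  shows "direct_sum (Amod A) {0, 1} (\<lambda>j. if j = 0 then M else N) (dsum M N) (\<lambda>j. if j = 0 then inl M N else inr M N)"
proof (rule Am.direct_sumI)
  have l: "lm M" "lm N" using M N fg_lm by auto
  show "dsum M N \<in> Ob (Amod A)" by (rule fg_dsum[OF M N])
  fix j :: nat assume "j \<in> {0, 1}"
  then show "arr (Amod A) (if j = 0 then M else N) (dsum M N) (if j = 0 then inl M N else inr M N)"
    using l M N fg_dsum lh_inl lh_inr by (auto simp: arr_Amod)
next
  have l: "lm M" "lm N" using M N fg_lm by auto
  fix T f assume T: "T \<in> Ob (Amod A)" and "\<And>j. j \<in> {0::nat, 1} \<Longrightarrow> arr (Amod A) (if j = 0 then M else N) T (f j)"
  from this(2)[of 0] this(2)[of 1] have f: "f 0 \<in> lhom A M T" "f 1 \<in> lhom A N T" by (auto simp: arr_Amod)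
  let ?h = "\<lambda>w\<in>carrier (dsum M N). f 0 (seq_fst w) \<oplus>\<^bsub>T\<^esub> f 1 (seq_snd w)"
  have "compose (carrier M) ?h (inl M N) = f 0" "compose (carrier N) ?h (inr M N) = f 1"
    using l fg_lm[OF T] lh_ext[OF f(1)] lh_ext[OF f(2)] lh_closed[OF f(1)] lh_closed[OF f(2)]
      lh_zero[OF f(1)] lh_zero[OF f(2)]
    by (auto simp: compose_def inl_def inr_def intro!: ext)
  then show "\<exists>h. arr (Amod A) (dsum M N) T h \<and>
    (\<forall>j\<in>{0, 1}. cmp (Amod A) (if j = 0 then M else N) (dsum M N) T h (if j = 0 then inl M N else inr M N) = f j)"
    using lh_copair[OF l fg_lm[OF T] f] T fg_dsum[OF M N] by (intro exI[of _ ?h]) (auto simp: arr_Amod)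
next
  have l: "lm M" "lm N" using M N fg_lm by auto
  fix T h h' assume h: "arr (Amod A) (dsum M N) T h" "arr (Amod A) (dsum M N) T h'" and
    "\<And>j. j \<in> {0::nat, 1} \<Longrightarrow> cmp (Amod A) (if j = 0 then M else N) (dsum M N) T h (if j = 0 then inl M N else inr M N) =
      cmp (Amod A) (if j = 0 then M else N) (dsum M N) T h' (if j = 0 then inl M N else inr M N)"
  from this(3)[of 0] this(3)[of 1]
  have e: "compose (carrier M) h (inl M N) = compose (carrier M) h' (inl M N)"
    "compose (carrier N) h (inr M N) = compose (carrier N) h' (inr M N)" by auto
  have h': "h \<in> lhom A (dsum M N) T" "h' \<in> lhom A (dsum M N) T" using h by (auto simp: arr_Amod)
  have eq: "h (seq_pair x \<zero>\<^bsub>N\<^esub>) = h' (seq_pair x \<zero>\<^bsub>N\<^esub>)" if "x \<in> carrier M" for x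
    using fun_cong[OF e(1), of x] that by (simp add: compose_def inl_def)
  have eq': "h (seq_pair \<zero>\<^bsub>M\<^esub> x) = h' (seq_pair \<zero>\<^bsub>M\<^esub> x)" if "x \<in> carrier N" for x
    using fun_cong[OF e(2), of x] that by (simp add: compose_def inr_def)
  show "h = h'"
  proof (rule lh_eqI[OF h'])
    fix w assume "w \<in> carrier (dsum M N)"
    then show "h w = h' w"
    proof (rule dsum_ballI[rotated])
      fix x y assume xy: "x \<in> carrier M" "y \<in> carrier N"
      have "h'' (seq_pair x y) = h'' (seq_pair x \<zero>\<^bsub>N\<^esub>) \<oplus>\<^bsub>T\<^esub> h'' (seq_pair \<zero>\<^bsub>M\<^esub> y)"
        if "h'' \<in> lhom A (dsum M N) T" for h''
        using lh_add[OF that, of "seq_pair x \<zero>\<^bsub>N\<^esub>" "seq_pair \<zero>\<^bsub>M\<^esub> y"] xy l by simp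
      then show "h (seq_pair x y) = h' (seq_pair x y)" using eq[OF xy(1)] eq'[OF xy(2)] h' by metis
    qed
  qed
qed

text \<open>The universal property evaluated at elements, which spares the extensional composites in
  later calculations.\<close>

lemma direct_sum_liftE:
  assumes ds: "direct_sum (Amod A) J X S \<iota>" and T: "fg T" and f: "\<And>j. j \<in> J \<Longrightarrow> f j \<in> lhom A (X j) T"
  obtains h where "h \<in> lhom A S T" "\<And>j x. j \<in> J \<Longrightarrow> x \<in> carrier (X j) \<Longrightarrow> h (\<iota> j x) = f j x"
proof -
  note D = Am.direct_sumD[OF ds]
  obtain h where h: "arr (Amod A) S T h" "\<forall>j\<in>J. cmp (Amod A) (X j) S T h (\<iota> j) = f j"
    using D(3)[OF T, of f] D(2) f T by (auto simp: arr_Amod)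
  show ?thesis
  proof (rule that[of h])
    fix j x assume "j \<in> J" "x \<in> carrier (X j)"
    then show "h (\<iota> j x) = f j x" using h(2) by (metis cmp_Amod compose_eq)
  qed (use h in \<open>auto simp: arr_Amod\<close>)
qed

lemma direct_sum_eqI:
  assumes ds: "direct_sum (Amod A) J X S \<iota>" and T: "fg T" and h: "h \<in> lhom A S T" "h' \<in> lhom A S T"
    and eq: "\<And>j x. j \<in> J \<Longrightarrow> x \<in> carrier (X j) \<Longrightarrow> h (\<iota> j x) = h' (\<iota> j x)"
  shows "h = h'"
proof -
  note D = Am.direct_sumD[OF ds]
  show ?thesis
    by (rule D(4)) (use h T D(1) eq in \<open>auto simp: arr_Amod compose_def fun_eq_iff\<close>)
qed

lemma direct_sum_mem:
  assumes "direct_sum (Amod A) J X S \<iota>"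
  shows "fg S" "j \<in> J \<Longrightarrow> fg (X j)" "j \<in> J \<Longrightarrow> \<iota> j \<in> lhom A (X j) S"
  using Am.direct_sumD(1,2)[OF assms] by (auto simp: arr_Amod)

text \<open>A direct summand without a named complement; a split injection is all that lifting
  arguments need.\<close>

definition retract :: "'a umod \<Rightarrow> 'a umod \<Rightarrow> bool" where
  "retract X S \<longleftrightarrow> (\<exists>i\<in>lhom A X S. \<exists>p\<in>lhom A S X. \<forall>x\<in>carrier X. p (i x) = x)"

text \<open>The projections are induced by the Kronecker family: the identity on one summand and
  zero on the others.\<close>

lemma direct_sum_projections:
  assumes ds: "direct_sum (Amod A) J X S \<iota>"
  shows "\<exists>\<pi>. \<forall>j\<in>J. \<pi> j \<in> lhom A S (X j) \<and>
    (\<forall>k\<in>J. \<forall>x\<in>carrier (X k). \<pi> j (\<iota> k x) = (if j = k then x else \<zero>\<^bsub>X j\<^esub>))"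
proof -
  note D = direct_sum_mem[OF ds]
  have "\<exists>p. p \<in> lhom A S (X j) \<and> (\<forall>k\<in>J. \<forall>x\<in>carrier (X k). p (\<iota> k x) = (if j = k then x else \<zero>\<^bsub>X j\<^esub>))"
    if j: "j \<in> J" for j
  proof -
    let ?f = "\<lambda>k. if j = k then (\<lambda>x\<in>carrier (X k). x) else (\<lambda>x\<in>carrier (X k). \<zero>\<^bsub>X j\<^esub>)"
    have "?f k \<in> lhom A (X k) (X j)" if "k \<in> J" for k
      using lh_id[OF fg_lm[OF D(2)[OF j]]] lh_0[OF fg_lm[OF D(2)[OF that]] fg_lm[OF D(2)[OF j]]] by auto
    from direct_sum_liftE[OF ds D(2)[OF j], of ?f, OF this] obtain h where
      "h \<in> lhom A S (X j)" "\<And>k x. k \<in> J \<Longrightarrow> x \<in> carrier (X k) \<Longrightarrow> h (\<iota> k x) = ?f k x" by auto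
    then show ?thesis by (intro exI[of _ h]) auto
  qed
  then show ?thesis by metis
qed

lemma direct_sum_retract:
  assumes ds: "direct_sum (Amod A) J X S \<iota>" and j: "j \<in> J"
  shows "retract (X j) S"
proof -
  obtain \<pi> where "\<pi> j \<in> lhom A S (X j)" "\<forall>x\<in>carrier (X j). \<pi> j (\<iota> j x) = x"
    using direct_sum_projections[OF ds] j by (metis (full_types))
  then show ?thesis unfolding retract_def using direct_sum_mem(3)[OF ds j] by blast
qed

lemma direct_sum2_retract:
  assumes "direct_sum2 (Amod A) X Y S"
  shows "retract X S" "retract Y S" "fg X" "fg Y" "fg S"
proof -
  obtain \<iota> where ds: "direct_sum (Amod A) {0, 1} (\<lambda>j. if j = 0 then X else Y) S \<iota>"
    using assms by (auto simp: direct_sum2_def)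
  show "retract X S" "retract Y S" using direct_sum_retract[OF ds, of 0] direct_sum_retract[OF ds, of 1] by auto
  show "fg X" "fg Y" "fg S" using direct_sum_mem(2)[OF ds, of 0] direct_sum_mem(2)[OF ds, of 1] direct_sum_mem(1)[OF ds] by auto
qed

lemma iso_retract: "fg M \<Longrightarrow> fg N \<Longrightarrow> lmod_iso A M N \<Longrightarrow> retract M N"
  using lhom_inv[of M N] fg_lm by (fastforce simp: lmod_iso_def retract_def)

text \<open>\<open>lifts Q P H p\<close>: the map \<open>Hom(Q, P) \<rightarrow> Hom(Q, H)\<close> induced by \<open>p\<close> is onto.\<close>

definition lifts :: "'a umod \<Rightarrow> 'a umod \<Rightarrow> 'a umod \<Rightarrow> 'a umap \<Rightarrow> bool" where
  "lifts Q P H p \<longleftrightarrow> (\<forall>\<phi>\<in>lhom A Q H. \<exists>\<psi>\<in>lhom A Q P. \<forall>x\<in>carrier Q. p (\<psi> x) = \<phi> x)"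

lemma liftsE:
  assumes "lifts Q P H p" "\<phi> \<in> lhom A Q H"
  obtains \<psi> where "\<psi> \<in> lhom A Q P" "\<And>x. x \<in> carrier Q \<Longrightarrow> p (\<psi> x) = \<phi> x"
  using assms unfolding lifts_def by blast

text \<open>Extend a map on X to S by the projection, lift it there, and restrict the lift along the
  inclusion.\<close>

lemma lifts_retract:
  assumes "retract X S" "fg X" "fg S" and L: "lifts S P H p"
  shows "lifts X P H p"
  unfolding lifts_def
proof
  fix \<phi> assume \<phi>: "\<phi> \<in> lhom A X H"
  obtain i q where i: "i \<in> lhom A X S" and q: "q \<in> lhom A S X" and qi: "\<forall>x\<in>carrier X. q (i x) = x"
    using assms(1) by (auto simp: retract_def)
  have "compose (carrier S) \<phi> q \<in> lhom A S H" by (rule lh_comp[OF fg_lm[OF assms(3)] q \<phi>])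
  from liftsE[OF L this] obtain \<psi> where \<psi>: "\<psi> \<in> lhom A S P" "\<And>x. x \<in> carrier S \<Longrightarrow> p (\<psi> x) = \<phi> (q x)"
    by (auto simp: compose_eq)
  have "compose (carrier X) \<psi> i \<in> lhom A X P" by (rule lh_comp[OF fg_lm[OF assms(2)] i \<psi>(1)])
  moreover have "\<forall>x\<in>carrier X. p (compose (carrier X) \<psi> i x) = \<phi> x"
    using \<psi>(2) qi lh_closed[OF i] by (auto simp: compose_eq)
  ultimately show "\<exists>\<psi>\<in>lhom A X P. \<forall>x\<in>carrier X. p (\<psi> x) = \<phi> x" by blast
qed

text \<open>Lifts on the summands are glued by existence in the universal property; uniqueness shows
  that the glued map lifts the given one.\<close>

lemma lifts_direct_sum:
  assumes ds: "direct_sum (Amod A) J X S \<iota>" and P: "fg P" and H: "fg H" and p: "p \<in> lhom A P H"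
    and L: "\<And>j. j \<in> J \<Longrightarrow> lifts (X j) P H p"
  shows "lifts S P H p"
  unfolding lifts_def
proof
  note D = direct_sum_mem[OF ds]
  fix \<phi> assume \<phi>: "\<phi> \<in> lhom A S H"
  have "\<exists>\<psi>. \<psi> \<in> lhom A (X j) P \<and> (\<forall>x\<in>carrier (X j). p (\<psi> x) = \<phi> (\<iota> j x))" if j: "j \<in> J" for j
  proof -
    have "compose (carrier (X j)) \<phi> (\<iota> j) \<in> lhom A (X j) H" by (rule lh_comp[OF fg_lm[OF D(2)[OF j]] D(3)[OF j] \<phi>])
    from liftsE[OF L[OF j] this] obtain \<psi> where "\<psi> \<in> lhom A (X j) P" "\<And>x. x \<in> carrier (X j) \<Longrightarrow> p (\<psi> x) = \<phi> (\<iota> j x)"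
      by (auto simp: compose_eq)
    then show ?thesis by blast
  qed
  then obtain \<psi> where \<psi>: "\<And>j. j \<in> J \<Longrightarrow> \<psi> j \<in> lhom A (X j) P"
    "\<And>j x. j \<in> J \<Longrightarrow> x \<in> carrier (X j) \<Longrightarrow> p (\<psi> j x) = \<phi> (\<iota> j x)" by metis
  from direct_sum_liftE[OF ds P \<psi>(1)] obtain h where
    h: "h \<in> lhom A S P" "\<And>j x. j \<in> J \<Longrightarrow> x \<in> carrier (X j) \<Longrightarrow> h (\<iota> j x) = \<psi> j x" by auto
  have "compose (carrier S) p h = \<phi>"
  proof (rule direct_sum_eqI[OF ds H _ \<phi>])
    show "compose (carrier S) p h \<in> lhom A S H" using lh_comp[OF _ h(1) p] D(1) fg_lm by auto
    fix j x assume "j \<in> J" "x \<in> carrier (X j)"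
    then show "compose (carrier S) p h (\<iota> j x) = \<phi> (\<iota> j x)"
      using lh_closed[OF D(3)] h(2) \<psi>(2) by (simp add: compose_eq)
  qed
  then show "\<exists>\<psi>\<in>lhom A S P. \<forall>x\<in>carrier S. p (\<psi> x) = \<phi> x" using h(1) by (metis compose_eq)
qed

lemma addM_fg: "Q \<in> addM A M \<Longrightarrow> fg Q"
  by (auto simp: addM_def add_closure_def)

lemma addME:
  assumes "Q \<in> addM A M"
  obtains n S \<iota> Q' where "direct_sum (Amod A) {..<n::nat} (\<lambda>_. M) S \<iota>" "fg Q'" "direct_sum2 (Amod A) Q Q' S"
proof -
  from assms obtain n Y S \<iota> Q' where "\<forall>j<n. Y j = M" "direct_sum (Amod A) {..<n::nat} Y S \<iota>" "fg Q'" "direct_sum2 (Amod A) Q Q' S"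
    by (auto simp: addM_def add_closure_def)
  then show ?thesis using that[of n S \<iota> Q'] Am.direct_sum_cong[of "{..<n}" Y S \<iota> "\<lambda>_. M" \<iota>] by auto
qed

text \<open>Testing on M suffices for add M, because lifting passes to finite sums and to
  summands.\<close>

lemma lifts_addM:
  assumes "Q \<in> addM A M" "fg P" "fg H" "p \<in> lhom A P H" "lifts M P H p"
  shows "lifts Q P H p"
proof -
  obtain n S \<iota> Q' where ds: "direct_sum (Amod A) {..<n::nat} (\<lambda>_. M) S \<iota>" "fg Q'" "direct_sum2 (Amod A) Q Q' S"
    using addME[OF assms(1)] .
  show ?thesis
    using lifts_retract[OF direct_sum2_retract(1,3,5)[OF ds(3)] lifts_direct_sum[OF ds(1)]] assms by auto
qed

lemma zero_addM:
  assumes Z: "fg Z" "zero_module Z" shows "Z \<in> addM A M"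
proof -
  have "direct_sum (Amod A) {..<0} (\<lambda>_. M) Z (\<lambda>_. undefined)" "direct_sum2 (Amod A) Z Z Z"
    using Am.direct_sum_empty[OF initial_zero[OF Z]] Am.direct_sum2_zero[OF Z(1) initial_zero[OF Z]] by auto
  then show ?thesis unfolding addM_def add_closure_def using Z(1) by blast
qed

section \<open>Complexes and their cycles\<close>

text \<open>The same record update as the kernel in \<open>AGproj\<close>, so that
  \<open>cyc P 0\<close> is that module up to arithmetic in the index.\<close>

definition cyc :: "'a cochain \<Rightarrow> int \<Rightarrow> 'a umod" where
  "cyc C i = (cob C i)\<lparr>carrier := {x \<in> carrier (cob C i). dif C i x = \<zero>\<^bsub>cob C (i + 1)\<^esub>}\<rparr>"

lemma cx_fg [simp]: "is_complex A C \<Longrightarrow> fg (cob C i)"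
  and cx_lm [simp]: "is_complex A C \<Longrightarrow> lm (cob C i)"
  and cx_lh [simp]: "is_complex A C \<Longrightarrow> dif C i \<in> lhom A (cob C i) (cob C (i + 1))"
  and cx_dd: "is_complex A C \<Longrightarrow> x \<in> carrier (cob C i) \<Longrightarrow> dif C (i + 1) (dif C i x) = \<zero>\<^bsub>cob C (i + 2)\<^esub>"
  by (auto simp: is_complex_def fg_lm)

text \<open>Instantiating a rule at degree i - 1 produces the target degree i - 1 + 1. The primed
  variants state the target as i, which is the form that occurs in exactness conditions.\<close>

lemma cx_lh' [simp]: "is_complex A C \<Longrightarrow> dif C (i - 1) \<in> lhom A (cob C (i - 1)) (cob C i)"
  using cx_lh[of C "i - 1"] by simp

lemma cx_dd' [simp]: "is_complex A C \<Longrightarrow> x \<in> carrier (cob C (i - 1)) \<Longrightarrow> dif C i (dif C (i - 1) x) = \<zero>\<^bsub>cob C (i + 1)\<^esub>"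
  using cx_dd[of C x "i - 1"] by (simp add: add.commute)

lemma cx_closed [simp]: "is_complex A C \<Longrightarrow> x \<in> carrier (cob C i) \<Longrightarrow> dif C i x \<in> carrier (cob C (i + 1))"
  by (rule lh_closed[OF cx_lh])

lemma cx_closed' [simp]: "is_complex A C \<Longrightarrow> x \<in> carrier (cob C (i - 1)) \<Longrightarrow> dif C (i - 1) x \<in> carrier (cob C i)"
  by (rule lh_closed[OF cx_lh'])

lemma cx_add [simp]: "is_complex A C \<Longrightarrow> x \<in> carrier (cob C i) \<Longrightarrow> y \<in> carrier (cob C i) \<Longrightarrow>
    dif C i (x \<oplus>\<^bsub>cob C i\<^esub> y) = dif C i x \<oplus>\<^bsub>cob C (i + 1)\<^esub> dif C i y"
  by (rule lh_add[OF cx_lh])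

lemma cx_neg [simp]: "is_complex A C \<Longrightarrow> x \<in> carrier (cob C i) \<Longrightarrow>
    dif C i (\<ominus>\<^bsub>cob C i\<^esub> x) = \<ominus>\<^bsub>cob C (i + 1)\<^esub> dif C i x"
  by (rule lh_neg[OF cx_lh cx_lm cx_lm])

lemma cx_zero [simp]: "is_complex A C \<Longrightarrow> dif C i \<zero>\<^bsub>cob C i\<^esub> = \<zero>\<^bsub>cob C (i + 1)\<^esub>"
  by (rule lh_zero[OF cx_lh cx_lm cx_lm])

lemma cx_zero' [simp]: "is_complex A C \<Longrightarrow> dif C (i - 1) \<zero>\<^bsub>cob C (i - 1)\<^esub> = \<zero>\<^bsub>cob C i\<^esub>"
  by (rule lh_zero[OF cx_lh' cx_lm cx_lm])

lemma cyc_carrier [simp]: "x \<in> carrier (cyc C i) \<longleftrightarrow> x \<in> carrier (cob C i) \<and> dif C i x = \<zero>\<^bsub>cob C (i + 1)\<^esub>"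
  and cyc_ops [simp]: "add (cyc C i) = add (cob C i)" "zero (cyc C i) = zero (cob C i)" "smult (cyc C i) = smult (cob C i)"
  by (auto simp: cyc_def)

lemma submod_kernel:
  assumes M: "lm M" and N: "lm N" and f: "f \<in> lhom A M N"
  shows "submod A M {x \<in> carrier M. f x = \<zero>\<^bsub>N\<^esub>}"
  unfolding submod_def using lh_add[OF f] lh_sm[OF f] lh_zero[OF f M N] M N by simp

lemma submod_range:
  assumes M: "lm M" and N: "lm N" and f: "f \<in> lhom A M N"
  shows "submod A N (f ` carrier M)"
  unfolding submod_def
proof (intro conjI ballI)
  show "f ` carrier M \<subseteq> carrier N" using lh_closed[OF f] by auto
  show "\<zero>\<^bsub>N\<^esub> \<in> f ` carrier M" using lh_zero[OF f M N] M by (metis image_eqI lm_zero)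
  fix x assume "x \<in> f ` carrier M"
  then obtain u where u: "u \<in> carrier M" "x = f u" by auto
  then show "a \<odot>\<^bsub>N\<^esub> x \<in> f ` carrier M" if "a \<in> carrier A" for a
    using lh_sm[OF f that u(1)] M that by (metis image_eqI lm_sm)
  fix y assume "y \<in> f ` carrier M"
  then obtain v where "v \<in> carrier M" "y = f v" by auto
  then show "x \<oplus>\<^bsub>N\<^esub> y \<in> f ` carrier M" using u lh_add[OF f] M by (metis image_eqI lm_add)
qed

lemma fg_cyc: "is_complex A C \<Longrightarrow> fg (cyc C i)"
  unfolding cyc_def by (rule fg_submod[OF cx_fg submod_kernel]) auto

lemma lh_cyc_iff: "f \<in> lhom A N (cyc C i) \<longleftrightarrow> f \<in> lhom A N (cob C i) \<and> (\<forall>x\<in>carrier N. dif C i (f x) = \<zero>\<^bsub>cob C (i + 1)\<^esub>)"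
  by (auto simp: lhom_def PiE_iff)

lemma dif_lh_cyc: "is_complex A C \<Longrightarrow> dif C (i - 1) \<in> lhom A (cob C (i - 1)) (cyc C i)"
  by (simp add: lh_cyc_iff)

text \<open>The cocycles of Hom(N, C) in degree i are exactly the maps from N to
  \<open>cyc C i\<close>, so exactness at that spot is a lifting problem along the preceding
  differential. This makes the closure properties of \<open>lifts\<close> available for
  exactness.\<close>

lemma hom_from_exact_iff:
  assumes C: "is_complex A C" and N: "lm N"
  shows "hom_from_exact A N C \<longleftrightarrow> (\<forall>i. lifts N (cob C (i - 1)) (cyc C i) (dif C (i - 1)))"
proof -
  have "{f \<in> lhom A N (cob C i). \<forall>x\<in>carrier N. dif C i (f x) = \<zero>\<^bsub>cob C (i + 1)\<^esub>}
          = (\<lambda>g. compose (carrier N) (dif C (i - 1)) g) ` lhom A N (cob C (i - 1)) \<longleftrightarrow>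
        lifts N (cob C (i - 1)) (cyc C i) (dif C (i - 1))" for i
  proof -
    have 1: "{f \<in> lhom A N (cob C i). \<forall>x\<in>carrier N. dif C i (f x) = \<zero>\<^bsub>cob C (i + 1)\<^esub>} = lhom A N (cyc C i)"
      by (auto simp: lh_cyc_iff)
    have 2: "compose (carrier N) (dif C (i - 1)) g \<in> lhom A N (cyc C i)" if "g \<in> lhom A N (cob C (i - 1))" for g
      using lh_comp[OF N that dif_lh_cyc[OF C]] .
    have 3: "compose (carrier N) (dif C (i - 1)) g = f \<longleftrightarrow> (\<forall>x\<in>carrier N. dif C (i - 1) (g x) = f x)"
      if "f \<in> lhom A N (cyc C i)" for f g
    proof
      assume *: "\<forall>x\<in>carrier N. dif C (i - 1) (g x) = f x"
      show "compose (carrier N) (dif C (i - 1)) g = f"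
      proof
        fix x show "compose (carrier N) (dif C (i - 1)) g x = f x"
          using * lh_ext[OF that, of x] by (cases "x \<in> carrier N") (auto simp: compose_def)
      qed
    qed (auto simp: compose_eq)
    have "S = k ` T \<longleftrightarrow> (\<forall>f\<in>S. \<exists>g\<in>T. R f g)"
      if "\<And>g. g \<in> T \<Longrightarrow> k g \<in> S" "\<And>f g. f \<in> S \<Longrightarrow> k g = f \<longleftrightarrow> R f g"
      for S :: "'a umap set" and T :: "'a umap set" and k R
    proof
      assume S: "S = k ` T"
      show "\<forall>f\<in>S. \<exists>g\<in>T. R f g"
      proof
        fix f assume f: "f \<in> S"
        then obtain g where "g \<in> T" "f = k g" using S by auto
        then show "\<exists>g\<in>T. R f g" using that(2)[OF f, of g] by auto
      qed
    next
      assume R: "\<forall>f\<in>S. \<exists>g\<in>T. R f g"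
      show "S = k ` T"
      proof (intro equalityI subsetI)
        fix f assume f: "f \<in> S"
        with R obtain g where "g \<in> T" "R f g" by auto
        then show "f \<in> k ` T" using that(2)[OF f, of g] by auto
      qed (use that(1) in auto)
    qed
    from this[of "lhom A N (cob C (i - 1))", OF 2 3] show ?thesis unfolding 1 lifts_def .
  qed
  then show ?thesis by (simp add: hom_from_exact_def)
qed

end

section \<open>Gorenstein projective modules are closed under direct summands\<close>

context fda
begin

text \<open>The intersection of the images of all powers, and below it the union of their kernels.
  No exponent is fixed, which makes both natural in the pair (M, f); the exponents at which powers
  stabilise may differ between the degrees of a complex.\<close>

definition stable_image :: "'a umod \<Rightarrow> 'a umap \<Rightarrow> (nat \<Rightarrow> 'a) set" where
  "stable_image M f = {x \<in> carrier M. \<forall>n. \<exists>y\<in>carrier M. x = (f ^^ n) y}"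

definition stable_kernel :: "'a umod \<Rightarrow> 'a umap \<Rightarrow> (nat \<Rightarrow> 'a) set" where
  "stable_kernel M f = {x \<in> carrier M. \<exists>n. (f ^^ n) x = \<zero>\<^bsub>M\<^esub>}"

lemma funpow_lh:
  assumes M: "lm M" and f: "f \<in> lhom A M M"
  shows "x \<in> carrier M \<Longrightarrow> (f ^^ n) x \<in> carrier M"
    "x \<in> carrier M \<Longrightarrow> y \<in> carrier M \<Longrightarrow> (f ^^ n) (x \<oplus>\<^bsub>M\<^esub> y) = (f ^^ n) x \<oplus>\<^bsub>M\<^esub> (f ^^ n) y"
    "a \<in> carrier A \<Longrightarrow> x \<in> carrier M \<Longrightarrow> (f ^^ n) (a \<odot>\<^bsub>M\<^esub> x) = a \<odot>\<^bsub>M\<^esub> (f ^^ n) x"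
    "(f ^^ n) \<zero>\<^bsub>M\<^esub> = \<zero>\<^bsub>M\<^esub>"
    "x \<in> carrier M \<Longrightarrow> (f ^^ n) (\<ominus>\<^bsub>M\<^esub> x) = \<ominus>\<^bsub>M\<^esub> (f ^^ n) x"
proof -
  show c: "(f ^^ n) x \<in> carrier M" if "x \<in> carrier M" for x n
    using that by (induction n) (auto intro: lh_closed[OF f])
  show "x \<in> carrier M \<Longrightarrow> y \<in> carrier M \<Longrightarrow> (f ^^ n) (x \<oplus>\<^bsub>M\<^esub> y) = (f ^^ n) x \<oplus>\<^bsub>M\<^esub> (f ^^ n) y"
    by (induction n) (auto simp: c lh_add[OF f])
  show "a \<in> carrier A \<Longrightarrow> x \<in> carrier M \<Longrightarrow> (f ^^ n) (a \<odot>\<^bsub>M\<^esub> x) = a \<odot>\<^bsub>M\<^esub> (f ^^ n) x"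
    by (induction n) (auto simp: c lh_sm[OF f])
  show "(f ^^ n) \<zero>\<^bsub>M\<^esub> = \<zero>\<^bsub>M\<^esub>"
    by (induction n) (auto simp: lh_zero[OF f M M])
  show "x \<in> carrier M \<Longrightarrow> (f ^^ n) (\<ominus>\<^bsub>M\<^esub> x) = \<ominus>\<^bsub>M\<^esub> (f ^^ n) x"
    by (induction n) (auto simp: c lh_neg[OF f M M])
qed

lemma submod_stable:
  assumes M: "lm M" and f: "f \<in> lhom A M M"
  shows "submod A M (stable_image M f)" "submod A M (stable_kernel M f)"
proof -
  note F = funpow_lh[OF M f]
  show "submod A M (stable_image M f)"
    unfolding submod_def
  proof (intro conjI ballI)
    show "\<zero>\<^bsub>M\<^esub> \<in> stable_image M f" using M F(4)[symmetric] unfolding stable_image_def by (auto intro!: bexI[of _ "\<zero>\<^bsub>M\<^esub>"])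
    fix x assume x: "x \<in> stable_image M f"
    show "a \<odot>\<^bsub>M\<^esub> x \<in> stable_image M f" if "a \<in> carrier A" for a
      unfolding stable_image_def
    proof (intro CollectI conjI allI)
      show "a \<odot>\<^bsub>M\<^esub> x \<in> carrier M" using x that M by (auto simp: stable_image_def)
      fix n
      obtain u where "u \<in> carrier M" "x = (f ^^ n) u" using x by (auto simp: stable_image_def)
      then show "\<exists>w\<in>carrier M. a \<odot>\<^bsub>M\<^esub> x = (f ^^ n) w"
        using M that F(3) by (intro bexI[of _ "a \<odot>\<^bsub>M\<^esub> u"]) auto
    qed
    fix y assume y: "y \<in> stable_image M f"
    show "x \<oplus>\<^bsub>M\<^esub> y \<in> stable_image M f"
      unfolding stable_image_def
    proof (intro CollectI conjI allI)
      show "x \<oplus>\<^bsub>M\<^esub> y \<in> carrier M" using x y M by (auto simp: stable_image_def)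
      fix n
      obtain u v where "u \<in> carrier M" "x = (f ^^ n) u" "v \<in> carrier M" "y = (f ^^ n) v"
        using x y unfolding stable_image_def by blast
      then show "\<exists>w\<in>carrier M. x \<oplus>\<^bsub>M\<^esub> y = (f ^^ n) w"
        using M F(2) by (intro bexI[of _ "u \<oplus>\<^bsub>M\<^esub> v"]) auto
    qed
  qed (auto simp: stable_image_def)
  show "submod A M (stable_kernel M f)"
    unfolding submod_def
  proof (intro conjI ballI)
    show "\<zero>\<^bsub>M\<^esub> \<in> stable_kernel M f" using M F(4) by (auto simp: stable_kernel_def)
    fix x assume x: "x \<in> stable_kernel M f"
    show "a \<odot>\<^bsub>M\<^esub> x \<in> stable_kernel M f" if "a \<in> carrier A" for a
    proof -
      obtain n where "x \<in> carrier M" "(f ^^ n) x = \<zero>\<^bsub>M\<^esub>" using x by (auto simp: stable_kernel_def)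
      then show ?thesis using that M F(3)[of a x n] by (auto simp: stable_kernel_def intro!: exI[of _ n])
    qed
    fix y assume y: "y \<in> stable_kernel M f"
    obtain n where n: "x \<in> carrier M" "(f ^^ n) x = \<zero>\<^bsub>M\<^esub>" using x by (auto simp: stable_kernel_def)
    obtain k where k: "y \<in> carrier M" "(f ^^ k) y = \<zero>\<^bsub>M\<^esub>" using y by (auto simp: stable_kernel_def)
    have "(f ^^ (n + k)) x = \<zero>\<^bsub>M\<^esub>" "(f ^^ (n + k)) y = \<zero>\<^bsub>M\<^esub>"
      using n k F(4) by (metis add.commute comp_apply funpow_add, metis comp_apply funpow_add)
    then show "x \<oplus>\<^bsub>M\<^esub> y \<in> stable_kernel M f"
      using n k M F(2)[of x y "n + k"] by (auto simp: stable_kernel_def intro!: exI[of _ "n + k"])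
  qed (auto simp: stable_kernel_def)
qed

text \<open>The images of the powers of f decrease and the kernels increase; the measure makes both
  sequences stationary, and a common exponent N computes both stable parts.\<close>

lemma fitting:
  assumes M: "fg M" and f: "f \<in> lhom A M M"
  shows "stable_image M f \<inter> stable_kernel M f = {\<zero>\<^bsub>M\<^esub>}"
    "x \<in> carrier M \<Longrightarrow> \<exists>y\<in>stable_image M f. x \<oplus>\<^bsub>M\<^esub> \<ominus>\<^bsub>M\<^esub> y \<in> stable_kernel M f"
proof -
  have l: "lm M" by (rule fg_lm[OF M])
  note F = funpow_lh[OF l f]
  have Fl: "(\<lambda>x\<in>carrier M. (f ^^ n) x) \<in> lhom A M M" for n
    by (rule lh_restrict[OF l]) (use F in auto)
  define I where "I n = (f ^^ n) ` carrier M" for n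
  define K where "K n = {x \<in> carrier M. (f ^^ n) x = \<zero>\<^bsub>M\<^esub>}" for n
  have sI: "submod A M (I n)" for n
    using submod_range[OF l l Fl[of n]] by (simp add: I_def)
  have sK: "submod A M (K n)" for n
    using submod_kernel[OF l l Fl[of n]] by (simp add: K_def cong: conj_cong)
  obtain \<mu> :: "_ \<Rightarrow> nat" where \<mu>: "\<And>U V. submod A M U \<Longrightarrow> submod A M V \<Longrightarrow> U \<subset> V \<Longrightarrow> \<mu> U < \<mu> V"
    using ex_measure[OF l] M by (auto simp: fg_iff)
  have I_anti: "I (n + k) \<subseteq> I n" for n k
    using F(1) by (auto simp: I_def funpow_add)
  have K_mono: "K n \<subseteq> K (k + n)" for n k
    using F(4) by (auto simp: K_def funpow_add)
  have sC: "submod A M (carrier M)" using l by (auto simp: submod_def)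
  \<comment> \<open>An index with image of least measure: later images are contained in it and
    cannot be strictly smaller.\<close>
  obtain N1 where N1: "\<And>n. \<mu> (I N1) \<le> \<mu> (I n)"
    using ex_has_least_nat[of "\<lambda>_. True" 0 "\<lambda>n. \<mu> (I n)"] by auto
  have eqI: "I (N1 + k) = I N1" for k
    using \<mu>[OF sI sI, of "N1 + k" N1] I_anti[of N1 k] N1[of "N1 + k"] by force
  have bnd: "\<mu> (K n) < Suc (\<mu> (carrier M))" for n
  proof (cases "K n = carrier M")
    case False
    then have "K n \<subset> carrier M" by (auto simp: K_def)
    then show ?thesis using \<mu>[OF sK sC, of n] by simp
  qed simp
  \<comment> \<open>Dually, a kernel of largest measure; the measure of the whole module bounds all
    kernels.\<close>
  obtain N2 where N2: "\<And>n. \<mu> (K n) \<le> \<mu> (K N2)"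
    using ex_has_greatest_nat[of "\<lambda>_. True" 0 "\<lambda>n. \<mu> (K n)"] bnd by blast
  have eqK: "K (k + N2) = K N2" for k
    using \<mu>[OF sK sK, of N2 "k + N2"] K_mono[of N2 k] N2[of "k + N2"] by force
  define N where "N = N1 + N2"
  have IN: "I (N + k) = I N" for k using eqI[of "N2 + k"] eqI[of N2] by (simp add: N_def add.assoc)
  have KN: "K (k + N) = K N" for k using eqK[of "k + N1"] eqK[of N1] by (simp add: N_def add.assoc)
  have si: "stable_image M f = I N"
  proof
    show "stable_image M f \<subseteq> I N" by (auto simp: stable_image_def I_def)
    show "I N \<subseteq> stable_image M f"
    proof
      fix x assume x: "x \<in> I N"
      have "x \<in> I n" for n using x IN[of n] I_anti[of n N] by (auto simp: add.commute)
      moreover have "x \<in> carrier M" using x F(1) by (auto simp: I_def)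
      ultimately show "x \<in> stable_image M f" by (auto simp: stable_image_def I_def)
    qed
  qed
  have sk: "stable_kernel M f = K N"
  proof
    show "K N \<subseteq> stable_kernel M f" by (auto simp: stable_kernel_def K_def)
    show "stable_kernel M f \<subseteq> K N"
    proof
      fix x assume "x \<in> stable_kernel M f"
      then obtain n where "x \<in> K n" by (auto simp: stable_kernel_def K_def)
      then show "x \<in> K N" using K_mono[of n N] KN[of n] by (auto simp: add.commute)
    qed
  qed
  show "stable_image M f \<inter> stable_kernel M f = {\<zero>\<^bsub>M\<^esub>}"
  proof
    show "stable_image M f \<inter> stable_kernel M f \<subseteq> {\<zero>\<^bsub>M\<^esub>}"
    proof
      fix x assume x: "x \<in> stable_image M f \<inter> stable_kernel M f"
      then obtain y where y: "y \<in> carrier M" "x = (f ^^ N) y" by (auto simp: si I_def)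
      then have "y \<in> K (N + N)" using x by (auto simp: sk K_def funpow_add)
      then show "x \<in> {\<zero>\<^bsub>M\<^esub>}" using KN[of N] y by (auto simp: K_def)
    qed
    show "{\<zero>\<^bsub>M\<^esub>} \<subseteq> stable_image M f \<inter> stable_kernel M f" 
      using submod_stable[OF l f] by (auto simp: submod_def)
  qed
  show "\<exists>y\<in>stable_image M f. x \<oplus>\<^bsub>M\<^esub> \<ominus>\<^bsub>M\<^esub> y \<in> stable_kernel M f" if x: "x \<in> carrier M"
  proof -
    \<comment> \<open>Since images are stable, the N-th power of f at x equals the 2N-th power at
      some y. Hence x minus the N-th power at y is killed by the N-th power.\<close>
    have "(f ^^ N) x \<in> I (N + N)" using x IN[of N] by (auto simp: I_def)
    then obtain y where y: "y \<in> carrier M" "(f ^^ N) x = (f ^^ N) ((f ^^ N) y)" by (auto simp: I_def funpow_add)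
    have "(f ^^ N) (x \<oplus>\<^bsub>M\<^esub> \<ominus>\<^bsub>M\<^esub> (f ^^ N) y) = \<zero>\<^bsub>M\<^esub>"
      using F(1,2,5) x y l by simp
    then show ?thesis unfolding si sk using y x F(1) l by (auto simp: I_def K_def)
  qed
qed

text \<open>The projection is chosen pointwise from the decomposition. Its linearity comes from
  uniqueness, as the two stable parts are submodules that meet in zero.\<close>

lemma fitting_projection:
  assumes M: "fg M" and f: "f \<in> lhom A M M"
  shows "\<exists>q\<in>lhom A M M. \<forall>x\<in>carrier M. q x \<in> stable_image M f \<and> x \<oplus>\<^bsub>M\<^esub> \<ominus>\<^bsub>M\<^esub> q x \<in> stable_kernel M f"
    and "\<lbrakk>x \<in> carrier M; y \<in> stable_image M f; x \<oplus>\<^bsub>M\<^esub> \<ominus>\<^bsub>M\<^esub> y \<in> stable_kernel M f;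
       z \<in> stable_image M f; x \<oplus>\<^bsub>M\<^esub> \<ominus>\<^bsub>M\<^esub> z \<in> stable_kernel M f\<rbrakk> \<Longrightarrow> y = z"
proof -
  have l: "lm M" by (rule fg_lm[OF M])
  note S = submod_stable[OF l f] and Fit = fitting[OF M f]
  have Ic: "x \<in> stable_image M f \<Longrightarrow> x \<in> carrier M" and Kc: "x \<in> stable_kernel M f \<Longrightarrow> x \<in> carrier M" for x
    by (auto simp: stable_image_def stable_kernel_def)
  have Iadd: "x \<in> stable_image M f \<Longrightarrow> y \<in> stable_image M f \<Longrightarrow> x \<oplus>\<^bsub>M\<^esub> y \<in> stable_image M f"
    and Kadd: "x \<in> stable_kernel M f \<Longrightarrow> y \<in> stable_kernel M f \<Longrightarrow> x \<oplus>\<^bsub>M\<^esub> y \<in> stable_kernel M f"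
    and Ism: "a \<in> carrier A \<Longrightarrow> x \<in> stable_image M f \<Longrightarrow> a \<odot>\<^bsub>M\<^esub> x \<in> stable_image M f"
    and Ksm: "a \<in> carrier A \<Longrightarrow> x \<in> stable_kernel M f \<Longrightarrow> a \<odot>\<^bsub>M\<^esub> x \<in> stable_kernel M f" for a x y
    using S by (auto simp: submod_def)
  have uniq: "y = z" if x: "x \<in> carrier M" and y: "y \<in> stable_image M f" "x \<oplus>\<^bsub>M\<^esub> \<ominus>\<^bsub>M\<^esub> y \<in> stable_kernel M f"
    and z: "z \<in> stable_image M f" "x \<oplus>\<^bsub>M\<^esub> \<ominus>\<^bsub>M\<^esub> z \<in> stable_kernel M f" for x y z
  proof -
    have yz: "y \<in> carrier M" "z \<in> carrier M" using y z Ic by auto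
    have "y \<oplus>\<^bsub>M\<^esub> \<ominus>\<^bsub>M\<^esub> z \<in> stable_image M f" using Iadd y z submod_neg(2)[OF l S(1)] by auto
    moreover have "(x \<oplus>\<^bsub>M\<^esub> \<ominus>\<^bsub>M\<^esub> z) \<oplus>\<^bsub>M\<^esub> \<ominus>\<^bsub>M\<^esub> (x \<oplus>\<^bsub>M\<^esub> \<ominus>\<^bsub>M\<^esub> y) \<in> stable_kernel M f"
      using Kadd y z submod_neg(2)[OF l S(2)] by auto
    moreover have "(x \<oplus>\<^bsub>M\<^esub> \<ominus>\<^bsub>M\<^esub> z) \<oplus>\<^bsub>M\<^esub> \<ominus>\<^bsub>M\<^esub> (x \<oplus>\<^bsub>M\<^esub> \<ominus>\<^bsub>M\<^esub> y) = y \<oplus>\<^bsub>M\<^esub> \<ominus>\<^bsub>M\<^esub> z"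
      using x yz l by (simp add: lm_ac)
    ultimately have "y \<oplus>\<^bsub>M\<^esub> \<ominus>\<^bsub>M\<^esub> z = \<zero>\<^bsub>M\<^esub>" using Fit(1) by auto
    then show "y = z" using lm_eq_neg_iff[OF l, of y "\<ominus>\<^bsub>M\<^esub> z"] yz l by simp
  qed
  then show "\<lbrakk>x \<in> carrier M; y \<in> stable_image M f; x \<oplus>\<^bsub>M\<^esub> \<ominus>\<^bsub>M\<^esub> y \<in> stable_kernel M f;
       z \<in> stable_image M f; x \<oplus>\<^bsub>M\<^esub> \<ominus>\<^bsub>M\<^esub> z \<in> stable_kernel M f\<rbrakk> \<Longrightarrow> y = z" by blast
  obtain q0 where q0: "\<And>x. x \<in> carrier M \<Longrightarrow> q0 x \<in> stable_image M f \<and> x \<oplus>\<^bsub>M\<^esub> \<ominus>\<^bsub>M\<^esub> q0 x \<in> stable_kernel M f"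
    using Fit(2) by metis
  have "(\<lambda>x\<in>carrier M. q0 x) \<in> lhom A M M"
  proof (rule lh_restrict[OF l])
    fix x assume x: "x \<in> carrier M"
    show "q0 x \<in> carrier M" using q0[OF x] Ic by auto
    show "q0 (a \<odot>\<^bsub>M\<^esub> x) = a \<odot>\<^bsub>M\<^esub> q0 x" if a: "a \<in> carrier A" for a
    proof (rule uniq)
      have "a \<odot>\<^bsub>M\<^esub> (x \<oplus>\<^bsub>M\<^esub> \<ominus>\<^bsub>M\<^esub> q0 x) \<in> stable_kernel M f" using Ksm a q0[OF x] by auto
      then show "a \<odot>\<^bsub>M\<^esub> x \<oplus>\<^bsub>M\<^esub> \<ominus>\<^bsub>M\<^esub> (a \<odot>\<^bsub>M\<^esub> q0 x) \<in> stable_kernel M f"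
        using a x Ic q0[OF x] l by simp
    qed (use q0[of "a \<odot>\<^bsub>M\<^esub> x"] q0[OF x] a x l Ism in auto)
    fix y assume y: "y \<in> carrier M"
    show "q0 (x \<oplus>\<^bsub>M\<^esub> y) = q0 x \<oplus>\<^bsub>M\<^esub> q0 y"
    proof (rule uniq)
      have "(x \<oplus>\<^bsub>M\<^esub> \<ominus>\<^bsub>M\<^esub> q0 x) \<oplus>\<^bsub>M\<^esub> (y \<oplus>\<^bsub>M\<^esub> \<ominus>\<^bsub>M\<^esub> q0 y) \<in> stable_kernel M f"
        using Kadd q0[OF x] q0[OF y] by auto
      then show "x \<oplus>\<^bsub>M\<^esub> y \<oplus>\<^bsub>M\<^esub> \<ominus>\<^bsub>M\<^esub> (q0 x \<oplus>\<^bsub>M\<^esub> q0 y) \<in> stable_kernel M f"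
        using x y Ic q0[OF x] q0[OF y] l by (simp add: lm_ac)
    qed (use q0[of "x \<oplus>\<^bsub>M\<^esub> y"] q0[OF x] q0[OF y] x y l Iadd in auto)
  qed
  then show "\<exists>q\<in>lhom A M M. \<forall>x\<in>carrier M. q x \<in> stable_image M f \<and> x \<oplus>\<^bsub>M\<^esub> \<ominus>\<^bsub>M\<^esub> q x \<in> stable_kernel M f"
    using q0 by (intro bexI[of _ "\<lambda>x\<in>carrier M. q0 x"]) auto
qed

text \<open>A map that intertwines f and f' also intertwines their powers. Applied to the
  differentials of a complex, this makes the Fitting projections commute with them.\<close>

lemma stable_natural:
  assumes M: "lm M" and M': "lm M'" and f: "f \<in> lhom A M M" and f': "f' \<in> lhom A M' M'" and d: "d \<in> lhom A M M'"
    and comm: "\<And>x. x \<in> carrier M \<Longrightarrow> d (f x) = f' (d x)"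
  shows "x \<in> stable_image M f \<Longrightarrow> d x \<in> stable_image M' f'" "x \<in> stable_kernel M f \<Longrightarrow> d x \<in> stable_kernel M' f'"
proof -
  have *: "d ((f ^^ n) x) = (f' ^^ n) (d x)" if "x \<in> carrier M" for x n
    using that by (induction n) (auto simp: comm funpow_lh(1)[OF M f])
  show "d x \<in> stable_image M' f'" if x: "x \<in> stable_image M f"
    unfolding stable_image_def
  proof (intro CollectI conjI allI)
    show "d x \<in> carrier M'" using x lh_closed[OF d] by (auto simp: stable_image_def)
    fix n obtain y where "y \<in> carrier M" "x = (f ^^ n) y" using x by (auto simp: stable_image_def)
    then show "\<exists>y\<in>carrier M'. d x = (f' ^^ n) y" using * lh_closed[OF d] by auto
  qed
  show "d x \<in> stable_kernel M' f'" if x: "x \<in> stable_kernel M f"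
  proof -
    obtain n where n: "x \<in> carrier M" "(f ^^ n) x = \<zero>\<^bsub>M\<^esub>" using x by (auto simp: stable_kernel_def)
    then have "(f' ^^ n) (d x) = \<zero>\<^bsub>M'\<^esub>" using *[OF n(1), of n] lh_zero[OF d M M'] by simp
    then show ?thesis using n(1) lh_closed[OF d] by (auto simp: stable_kernel_def)
  qed
qed

section \<open>Complete resolutions and their endomorphisms\<close>

lemma Aproj_retract:
  assumes r: "retract X S" and S: "S \<in> Aproj A" and X: "fg X"
  shows "X \<in> Aproj A"
proof -
  have "lifts X N N' p" if "fg N" "fg N'" "p \<in> lhom A N N'" "p ` carrier N = carrier N'" for N N' p
  proof (rule lifts_retract[OF r X])
    show "fg S" using S by (simp add: Aproj_def)
    show "lifts S N N' p"
      unfolding lifts_def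
    proof
      fix \<phi> assume "\<phi> \<in> lhom A S N'"
      then have "\<exists>g\<in>lhom A S N. compose (carrier S) p g = \<phi>" using S that unfolding Aproj_def by blast
      then obtain g where "g \<in> lhom A S N" "compose (carrier S) p g = \<phi>" by blast
      then show "\<exists>\<psi>\<in>lhom A S N. \<forall>x\<in>carrier S. p (\<psi> x) = \<phi> x" by (auto simp: compose_eq)
    qed
  qed
  moreover have "\<exists>g\<in>lhom A X N. compose (carrier X) p g = \<phi>"
    if L: "lifts X N N' p" and \<phi>: "\<phi> \<in> lhom A X N'" and p: "p \<in> lhom A N N'" for N N' p \<phi>
  proof -
    obtain g where g: "g \<in> lhom A X N" "\<And>x. x \<in> carrier X \<Longrightarrow> p (g x) = \<phi> x" using liftsE[OF L \<phi>] by blast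
    have "compose (carrier X) p g = \<phi>"
      by (rule lh_eqI[OF lh_comp[OF fg_lm[OF X] g(1) p] \<phi>]) (use g(2) in \<open>simp add: compose_eq\<close>)
    then show ?thesis using g(1) by blast
  qed
  ultimately have "\<exists>g\<in>lhom A X N. compose (carrier X) p g = \<phi>"
    if "fg N" "fg N'" "p \<in> lhom A N N'" "\<phi> \<in> lhom A X N'" "p ` carrier N = carrier N'" for N N' p \<phi>
    using that by blast
  then show ?thesis unfolding Aproj_def using X by (intro CollectI conjI ballI impI)
qed

lemma Aproj_lifts:
  assumes S: "S \<in> Aproj A" and "fg N" "fg N'" "p \<in> lhom A N N'" "p ` carrier N = carrier N'" and \<phi>: "\<phi> \<in> lhom A S N'"
  obtains g where "g \<in> lhom A S N" "\<And>x. x \<in> carrier S \<Longrightarrow> p (g x) = \<phi> x"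
proof -
  have "\<exists>g\<in>lhom A S N. compose (carrier S) p g = \<phi>" using assms unfolding Aproj_def by blast
  then obtain g where "g \<in> lhom A S N" "compose (carrier S) p g = \<phi>" by blast
  then show ?thesis using that[of g] by (metis compose_eq)
qed

lemma hom_to_exactE:
  assumes he: "hom_to_exact A C Q" and f: "f \<in> lhom A (cob C i) Q"
    and z: "\<And>x. x \<in> carrier (cob C (i - 1)) \<Longrightarrow> f (dif C (i - 1) x) = \<zero>\<^bsub>Q\<^esub>"
  obtains g where "g \<in> lhom A (cob C (i + 1)) Q" "\<And>x. x \<in> carrier (cob C i) \<Longrightarrow> g (dif C i x) = f x"
proof -
  have "f \<in> {f \<in> lhom A (cob C i) Q. \<forall>x\<in>carrier (cob C (i - 1)). f (dif C (i - 1) x) = \<zero>\<^bsub>Q\<^esub>}"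
    using f z by simp
  then have "f \<in> (\<lambda>g. compose (carrier (cob C i)) g (dif C i)) ` lhom A (cob C (i + 1)) Q"
    unfolding spec[OF he[unfolded hom_to_exact_def], of i] .
  then obtain g where g: "g \<in> lhom A (cob C (i + 1)) Q" "f = compose (carrier (cob C i)) g (dif C i)" by (rule imageE)
  show ?thesis by (rule that[OF g(1)]) (simp add: g(2) compose_eq)
qed

text \<open>To the right, maps are extended along differentials by exactness of Hom(P, Q) for Q a
  term of P; to the left, they are lifted by projectivity against the surjection onto the
  cycles.\<close>

lemma extend_to_chain_map:
  assumes ex: "exact_complex A P" and pr: "\<And>i. cob P i \<in> Aproj A"
    and he: "\<And>Q. Q \<in> Aproj A \<Longrightarrow> hom_to_exact A P Q" and e: "e \<in> lhom A (cyc P 0) (cyc P 0)"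
  shows "\<exists>f. (\<forall>i. f i \<in> lhom A (cob P i) (cob P i)) \<and>
    (\<forall>i. \<forall>x\<in>carrier (cob P i). dif P i (f i x) = f (i + 1) (dif P i x)) \<and>
    (\<forall>z\<in>carrier (cyc P 0). f 0 z = e z)"
proof -
  have cx: "is_complex A P" using ex by (simp add: exact_complex_def)
  note [simp] = cx_lm[OF cx]
  have im: "carrier (cyc P i) = dif P (i - 1) ` carrier (cob P (i - 1))" for i
    using ex by (simp add: exact_complex_def cyc_def)
  have imE: "\<exists>x\<in>carrier (cob P (i - 1)). z = dif P (i - 1) x" if "z \<in> carrier (cyc P i)" for z i
    using that unfolding im by blast
  \<comment> \<open>Preservation of cycles is the invariant that allows the next step in either
    direction; \<open>L\<close> says that neighbouring components commute with the
    differential.\<close>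
  define R where "R i f \<longleftrightarrow> f \<in> lhom A (cob P i) (cob P i) \<and> (\<forall>z\<in>carrier (cyc P i). f z \<in> carrier (cyc P i))"
    for i and f :: "'a umap"
  define L where "L i f g \<longleftrightarrow> (\<forall>x\<in>carrier (cob P i). dif P i (f x) = g (dif P i x))" for i and f g :: "'a umap"
  \<comment> \<open>d f kills the image of the previous differential because that image consists of
    cycles and f preserves cycles. Hence d f factors through d.\<close>
  have right: "\<exists>g. R (i + 1) g \<and> L i f g" if "R i f" for i f
  proof -
    have f: "f \<in> lhom A (cob P i) (cob P i)" using that by (simp add: R_def)
    have c: "compose (carrier (cob P i)) (dif P i) f \<in> lhom A (cob P i) (cob P (i + 1))"
      by (rule lh_comp[OF _ f cx_lh[OF cx]]) simp
    have "compose (carrier (cob P i)) (dif P i) f (dif P (i - 1) x) = \<zero>\<^bsub>cob P (i + 1)\<^esub>"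
      if x: "x \<in> carrier (cob P (i - 1))" for x
    proof -
      have "dif P (i - 1) x \<in> carrier (cyc P i)" using x cx by simp
      then have "f (dif P (i - 1) x) \<in> carrier (cyc P i)" using \<open>R i f\<close> by (auto simp: R_def)
      then show ?thesis using x cx by (simp add: compose_eq)
    qed
    from hom_to_exactE[OF he[OF pr] c this] obtain g where
      g: "g \<in> lhom A (cob P (i + 1)) (cob P (i + 1))"
      "\<And>x. x \<in> carrier (cob P i) \<Longrightarrow> g (dif P i x) = compose (carrier (cob P i)) (dif P i) f x" by blast
    then have L: "L i f g" by (simp add: L_def compose_eq)
    have "g z \<in> carrier (cyc P (i + 1))" if z: "z \<in> carrier (cyc P (i + 1))" for z
    proof -
      obtain x where x: "x \<in> carrier (cob P i)" "z = dif P i x" using imE[OF z] by auto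
      then have "g z = dif P i (f x)" using L by (simp add: L_def)
      then show ?thesis using lh_closed[OF f x(1)] cx_dd[OF cx lh_closed[OF f x(1)]] cx by (simp add: add.assoc)
    qed
    then show ?thesis using g L by (auto simp: R_def)
  qed
  \<comment> \<open>g d takes values in the cycles, and these are the image of the differential by
    exactness, so projectivity supplies the lift.\<close>
  have left: "\<exists>f. R (i - 1) f \<and> L (i - 1) f g" if "R i g" for i g
  proof -
    have g: "g \<in> lhom A (cob P i) (cob P i)" using that by (simp add: R_def)
    have dl: "dif P (i - 1) \<in> lhom A (cob P (i - 1)) (cyc P i)" by (rule dif_lh_cyc[OF cx])
    have "compose (carrier (cob P (i - 1))) g (dif P (i - 1)) \<in> lhom A (cob P (i - 1)) (cob P i)"
      by (rule lh_comp[OF _ cx_lh'[OF cx] g]) simp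
    then have c: "compose (carrier (cob P (i - 1))) g (dif P (i - 1)) \<in> lhom A (cob P (i - 1)) (cyc P i)"
      unfolding lh_cyc_iff using that cx by (auto simp: R_def compose_eq)
    from Aproj_lifts[OF pr cx_fg[OF cx] fg_cyc[OF cx] dl im[of i, symmetric] c]
    obtain f where f: "f \<in> lhom A (cob P (i - 1)) (cob P (i - 1))"
      "\<And>x. x \<in> carrier (cob P (i - 1)) \<Longrightarrow> dif P (i - 1) (f x) = g (dif P (i - 1) x)"
      by (auto simp: compose_eq)
    have "f z \<in> carrier (cyc P (i - 1))" if "z \<in> carrier (cyc P (i - 1))" for z
      using that f(2)[of z] lh_closed[OF f(1), of z] lh_zero[OF g] by simp
    then show ?thesis using f by (auto simp: R_def L_def)
  qed
  \<comment> \<open>The start: e d on degree -1 kills the image of degree -2, so it factors through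
    d as g d for some g on degree 0. By exactness g and e agree on all cycles.\<close>
  have "\<exists>f0. R 0 f0 \<and> (\<forall>z\<in>carrier (cyc P 0). f0 z = e z)"
  proof -
    have e': "e \<in> lhom A (cyc P 0) (cob P 0)" using e by (simp add: lh_cyc_iff)
    have dl: "dif P (- 1) \<in> lhom A (cob P (- 1)) (cyc P 0)" using dif_lh_cyc[OF cx, of 0] by simp
    have c: "compose (carrier (cob P (- 1))) e (dif P (- 1)) \<in> lhom A (cob P (- 1)) (cob P 0)"
      by (rule lh_comp[OF _ dl e']) simp
    have "compose (carrier (cob P (- 1))) e (dif P (- 1)) (dif P (- 1 - 1) x) = \<zero>\<^bsub>cob P 0\<^esub>"
      if "x \<in> carrier (cob P (- 1 - 1))" for x
      using that cx_dd'[OF cx that] cx_closed'[OF cx that] lh_zero[OF e'] fg_lm[OF fg_cyc[OF cx, of 0]] 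
      by (simp add: compose_eq)
    from hom_to_exactE[OF he[OF pr] c this] obtain g where
      g: "g \<in> lhom A (cob P 0) (cob P 0)" "\<And>x. x \<in> carrier (cob P (- 1)) \<Longrightarrow> g (dif P (- 1) x) = e (dif P (- 1) x)"
      by (auto simp: compose_eq)
    have eq: "g z = e z" if "z \<in> carrier (cyc P 0)" for z
      using imE[OF that] g(2) by auto
    then show ?thesis using g(1) lh_closed[OF e] by (auto simp: R_def)
  qed
  then obtain f0 where f0: "R 0 f0" "\<forall>z\<in>carrier (cyc P 0). f0 z = e z" by blast
  \<comment> \<open>Two dependent choices, one for each direction. The conjunct on n = 0 fixes the
    same start \<open>f0\<close> for both, so that they fit together in degree 0.\<close>
  have "\<exists>F. \<forall>n. (R (int n) (F n) \<and> (n = 0 \<longrightarrow> F n = f0)) \<and> L (int n) (F n) (F (Suc n))"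
  proof (rule dependent_nat_choice)
    fix f n assume "R (int n) f \<and> (n = 0 \<longrightarrow> f = f0)"
    then obtain g where "R (int n + 1) g \<and> L (int n) f g" using right by blast
    then show "\<exists>y. (R (int (Suc n)) y \<and> (Suc n = 0 \<longrightarrow> y = f0)) \<and> L (int n) f y" by (auto simp: add.commute)
  qed (use f0 in auto)
  then obtain F where F: "\<And>n. R (int n) (F n)" "F 0 = f0" "\<And>n. L (int n) (F n) (F (Suc n))" by blast
  have "\<exists>F. \<forall>n. (R (- int n) (F n) \<and> (n = 0 \<longrightarrow> F n = f0)) \<and> L (- int n - 1) (F (Suc n)) (F n)"
  proof (rule dependent_nat_choice)
    fix f n assume "R (- int n) f \<and> (n = 0 \<longrightarrow> f = f0)"
    then obtain g where "R (- int n - 1) g \<and> L (- int n - 1) g f" using left by blast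
    then show "\<exists>y. (R (- int (Suc n)) y \<and> (Suc n = 0 \<longrightarrow> y = f0)) \<and> L (- int n - 1) y f"
      using diff_conv_add_uminus[of "- int n" 1] by (intro exI[of _ g]) (simp add: minus_diff_commute)
  qed (use f0 in auto)
  then obtain H where H: "\<And>n. R (- int n) (H n)" "H 0 = f0" "\<And>n. L (- int n - 1) (H (Suc n)) (H n)" by blast
  define f where "f i = (if i \<ge> 0 then F (nat i) else H (nat (- i)))" for i
  have Rf: "R i (f i)" for i
    using F(1)[of "nat i"] H(1)[of "nat (- i)"] by (auto simp: f_def)
  have Lf: "L i (f i) (f (i + 1))" for i
  proof (cases "i \<ge> 0")
    case True
    then show ?thesis using F(3)[of "nat i"] by (auto simp: f_def nat_add_distrib)
  next
    case False
    define n where "n = nat (- i - 1)"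
    have i: "i = - int n - 1" using False by (simp add: n_def)
    have "f i = H (Suc n)" using False by (simp add: f_def i nat_add_distrib)
    \<comment> \<open>For n = 0 the degree i + 1 is 0, where f is defined by \<open>F\<close>; both
      sequences have the value \<open>f0\<close> there.\<close>
    moreover have "f (i + 1) = H n" using F(2) H(2) by (cases n) (simp_all add: f_def i nat_add_distrib)
    ultimately show ?thesis using H(3)[of n] i by simp
  qed
  have "f 0 = f0" using F(2) by (simp add: f_def)
  then show ?thesis using Rf Lf f0(2) by (intro exI[of _ f]) (auto simp: R_def L_def)
qed

definition image_cx :: "'a cochain \<Rightarrow> (int \<Rightarrow> 'a umap) \<Rightarrow> 'a cochain" where
  "image_cx P q = \<lparr>cob = (\<lambda>i. (cob P i)\<lparr>carrier := q i ` carrier (cob P i)\<rparr>),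
     dif = (\<lambda>i. restrict (dif P i) (q i ` carrier (cob P i)))\<rparr>"

text \<open>The image of an idempotent chain map is a summand of the complex. A preimage or an
  extension found in P is carried to the image by applying or precomposing q.\<close>

lemma complete_resolution_image:
  assumes ex: "exact_complex A P" and pr: "\<And>i. cob P i \<in> Aproj A"
    and he: "\<And>Q. Q \<in> Aproj A \<Longrightarrow> hom_to_exact A P Q"
    and q: "\<And>i. q i \<in> lhom A (cob P i) (cob P i)"
    and qq: "\<And>i x. x \<in> carrier (cob P i) \<Longrightarrow> q i (q i x) = q i x"
    and qd: "\<And>i x. x \<in> carrier (cob P i) \<Longrightarrow> dif P i (q i x) = q (i + 1) (dif P i x)"
  shows "exact_complex A (image_cx P q)" "\<And>i. cob (image_cx P q) i \<in> Aproj A"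
    "\<And>Q. Q \<in> Aproj A \<Longrightarrow> hom_to_exact A (image_cx P q) Q"
proof -
  let ?I = "image_cx P q"
  have cx: "is_complex A P" using ex by (simp add: exact_complex_def)
  note [simp] = cx_lm[OF cx] cx_closed[OF cx] cx_closed'[OF cx]
  note qc [simp] = lh_closed[OF q]
  have im: "carrier (cyc P i) = dif P (i - 1) ` carrier (cob P (i - 1))" for i
    using ex by (simp add: exact_complex_def cyc_def)
  have imE: "\<exists>x\<in>carrier (cob P (i - 1)). z = dif P (i - 1) x" if "z \<in> carrier (cyc P i)" for z i
    using that unfolding im by blast
  have qd': "dif P (i - 1) (q (i - 1) x) = q i (dif P (i - 1) x)" if "x \<in> carrier (cob P (i - 1))" for i x
    using qd[OF that] by simp
  have co [simp]: "carrier (cob ?I i) = q i ` carrier (cob P i)" "add (cob ?I i) = add (cob P i)"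
    "zero (cob ?I i) = zero (cob P i)" "smult (cob ?I i) = smult (cob P i)" for i by (auto simp: image_cx_def)
  have di: "dif ?I i x = dif P i x" if "x \<in> q i ` carrier (cob P i)" for i x
    using that by (auto simp: image_cx_def)
  have sub: "submod A (cob P i) (q i ` carrier (cob P i))" for i by (rule submod_range[OF _ _ q]) auto
  have fgI: "fg (cob ?I i)" for i
    using fg_submod[OF cx_fg[OF cx] sub] by (simp add: image_cx_def)
  \<comment> \<open>The image of an idempotent is its set of fixed points; in this form membership
    is a rewrite rule.\<close>
  have memI: "x \<in> q i ` carrier (cob P i) \<longleftrightarrow> x \<in> carrier (cob P i) \<and> q i x = x" for i x
    using qq[of _ i] by (auto simp: image_iff) metis
  have cxI: "is_complex A ?I"
    unfolding is_complex_def
  proof (intro allI conjI ballI)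
    fix i
    show "fg (cob ?I i)" by (rule fgI)
    show "dif ?I i \<in> lhom A (cob ?I i) (cob ?I (i + 1))"
    proof (rule lhI)
      fix x assume "x \<notin> carrier (cob ?I i)"
      then show "dif ?I i x = undefined" unfolding co by (simp add: image_cx_def)
    next
      fix x assume x: "x \<in> carrier (cob ?I i)"
      then show "dif ?I i x \<in> carrier (cob ?I (i + 1))" using qd by (auto simp: di)
      show "dif ?I i (a \<odot>\<^bsub>cob ?I i\<^esub> x) = a \<odot>\<^bsub>cob ?I (i + 1)\<^esub> dif ?I i x" if "a \<in> carrier A" for a
        using x that lm_sm[OF fg_lm[OF fgI] that x] lh_sm[OF cx_lh[OF cx]] by (simp add: di memI)
      fix y assume y: "y \<in> carrier (cob ?I i)"
      then show "dif ?I i (x \<oplus>\<^bsub>cob ?I i\<^esub> y) = dif ?I i x \<oplus>\<^bsub>cob ?I (i + 1)\<^esub> dif ?I i y"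
        using x y lm_add[OF fg_lm[OF fgI] x y] lh_add[OF cx_lh[OF cx]] by (simp add: di memI)
    qed
    fix x assume x: "x \<in> carrier (cob ?I i)"
    then have "dif ?I i x \<in> q (i + 1) ` carrier (cob P (i + 1))" using qd by (auto simp: di)
    then show "dif ?I (i + 1) (dif ?I i x) = \<zero>\<^bsub>cob ?I (i + 2)\<^esub>" using x cx_dd[OF cx] by (auto simp: di memI)
  qed
  have exI: "\<exists>y\<in>carrier (cob ?I (i - 1)). x = dif ?I (i - 1) y"
    if "x \<in> carrier (cob ?I i)" "dif ?I i x = \<zero>\<^bsub>cob ?I (i + 1)\<^esub>" for i x
  proof -
    have x: "x \<in> carrier (cob P i)" "q i x = x" "dif P i x = \<zero>\<^bsub>cob P (i + 1)\<^esub>" using that by (auto simp: memI di)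
    then obtain y where y: "y \<in> carrier (cob P (i - 1))" "x = dif P (i - 1) y" using imE[of x i] by auto
    then have "x = dif P (i - 1) (q (i - 1) y)" using x qd' by simp
    then show ?thesis using y by (intro bexI[of _ "q (i - 1) y"]) (auto simp: di)
  qed
  show "exact_complex A ?I"
    unfolding exact_complex_def
  proof (intro conjI cxI allI equalityI subsetI)
    fix i x assume "x \<in> dif ?I (i - 1) ` carrier (cob ?I (i - 1))"
    then obtain y where y: "y \<in> carrier (cob ?I (i - 1))" "x = dif ?I (i - 1) y" by blast
    show "x \<in> {x \<in> carrier (cob ?I i). dif ?I i x = \<zero>\<^bsub>cob ?I (i + 1)\<^esub>}"
      unfolding y(2) using cx_dd'[OF cxI y(1)] cx_closed'[OF cxI y(1)] by blast
  next
    fix i x assume "x \<in> {x \<in> carrier (cob ?I i). dif ?I i x = \<zero>\<^bsub>cob ?I (i + 1)\<^esub>}"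
    then show "x \<in> dif ?I (i - 1) ` carrier (cob ?I (i - 1))" using exI[of x i] by blast
  qed
  have incl: "(\<lambda>x\<in>carrier (cob ?I i). x) \<in> lhom A (cob ?I i) (cob P i)" for i
    by (rule lh_restrict[OF fg_lm[OF fgI]]) auto
  have qI: "q i \<in> lhom A (cob P i) (cob ?I i)" for i
    using q[of i] by (auto simp: lhom_def PiE_iff)
  show "cob ?I i \<in> Aproj A" for i
  proof (rule Aproj_retract[OF _ pr fgI])
    show "retract (cob ?I i) (cob P i)"
      unfolding retract_def by (rule bexI[OF _ incl[of i]], rule bexI[OF _ qI[of i]]) (auto simp: memI qq)
  qed
  show "hom_to_exact A ?I Q" if Q: "Q \<in> Aproj A" for Q
    unfolding hom_to_exact_def
  proof (intro allI equalityI subsetI)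
    have lQ: "lm Q" using Q fg_lm by (auto simp: Aproj_def)
    fix i f assume f: "f \<in> {f \<in> lhom A (cob ?I i) Q. \<forall>x\<in>carrier (cob ?I (i - 1)). f (dif ?I (i - 1) x) = \<zero>\<^bsub>Q\<^esub>}"
    then have f1: "f \<in> lhom A (cob ?I i) Q" and f2: "\<And>x. x \<in> q (i - 1) ` carrier (cob P (i - 1)) \<Longrightarrow> f (dif P (i - 1) x) = \<zero>\<^bsub>Q\<^esub>"
      by (auto simp: di)
    \<comment> \<open>A map on the image complex becomes one on P by precomposition with q; the
      extension found there is restricted back along the inclusion.\<close>
    have c: "compose (carrier (cob P i)) f (q i) \<in> lhom A (cob P i) Q" by (rule lh_comp[OF _ qI f1]) simp
    have "compose (carrier (cob P i)) f (q i) (dif P (i - 1) x) = \<zero>\<^bsub>Q\<^esub>" if "x \<in> carrier (cob P (i - 1))" for x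
      using that f2[of "q (i - 1) x"] qd'[OF that] by (simp add: compose_eq)
    from hom_to_exactE[OF he[OF Q] c this] obtain g where
      g: "g \<in> lhom A (cob P (i + 1)) Q" "\<And>x. x \<in> carrier (cob P i) \<Longrightarrow> g (dif P i x) = f (q i x)" by (auto simp: compose_eq)
    let ?g = "compose (carrier (cob ?I (i + 1))) g (\<lambda>x\<in>carrier (cob ?I (i + 1)). x)"
    have gl: "?g \<in> lhom A (cob ?I (i + 1)) Q" by (rule lh_comp[OF fg_lm[OF fgI] incl g(1)])
    have "f = compose (carrier (cob ?I i)) ?g (dif ?I i)"
    proof (rule lh_eqI[OF f1 lh_comp[OF fg_lm[OF fgI] cx_lh[OF cxI] gl]])
      fix x assume x: "x \<in> carrier (cob ?I i)"
      have "dif ?I i x \<in> carrier (cob ?I (i + 1))" by (rule cx_closed[OF cxI x])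
      then have "compose (carrier (cob ?I i)) ?g (dif ?I i) x = g (dif P i x)" using x by (simp add: compose_def di)
      then show "f x = compose (carrier (cob ?I i)) ?g (dif ?I i) x" using g(2)[of x] x by (simp add: memI)
    qed
    then show "f \<in> (\<lambda>g. compose (carrier (cob ?I i)) g (dif ?I i)) ` lhom A (cob ?I (i + 1)) Q" using gl by blast
  next
    have lQ: "lm Q" using Q fg_lm by (auto simp: Aproj_def)
    fix i f assume "f \<in> (\<lambda>g. compose (carrier (cob ?I i)) g (dif ?I i)) ` lhom A (cob ?I (i + 1)) Q"
    then obtain g where g: "g \<in> lhom A (cob ?I (i + 1)) Q" "f = compose (carrier (cob ?I i)) g (dif ?I i)" by blast
    have "f \<in> lhom A (cob ?I i) Q" unfolding g(2) by (rule lh_comp[OF fg_lm[OF fgI] cx_lh[OF cxI] g(1)])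
    moreover have "f (dif ?I (i - 1) x) = \<zero>\<^bsub>Q\<^esub>" if x: "x \<in> carrier (cob ?I (i - 1))" for x
      unfolding g(2) compose_eq[OF cx_closed'[OF cxI x]] cx_dd'[OF cxI x]
      by (rule lh_zero[OF g(1) fg_lm[OF fgI] lQ])
    ultimately show "f \<in> {f \<in> lhom A (cob ?I i) Q. \<forall>x\<in>carrier (cob ?I (i - 1)). f (dif ?I (i - 1) x) = \<zero>\<^bsub>Q\<^esub>}" by blast
  qed
qed

text \<open>X is the image of an idempotent e on the cycles of a complete resolution P of G. The
  Fitting projections of a chain map extending e form an idempotent chain map that restricts to e,
  so its image is a complete resolution whose cycles in degree 0 are a copy of X.\<close>

lemma AGproj_retract:
  assumes r: "retract X G" and G: "G \<in> AGproj A" and X: "fg X"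
  shows "X \<in> AGproj A"
proof -
  obtain P where P: "exact_complex A P" "\<And>i. cob P i \<in> Aproj A" "\<And>Q. Q \<in> Aproj A \<Longrightarrow> hom_to_exact A P Q"
    and iso: "lmod_iso A G (cyc P 0)" and fG: "fg G"
    using G unfolding AGproj_def cyc_def by auto
  have cx: "is_complex A P" using P(1) by (simp add: exact_complex_def)
  have lX: "lm X" and lG: "lm G" and lZ: "lm (cyc P 0)" using X fG fg_cyc[OF cx] fg_lm by auto
  obtain i0 p0 where ip0: "i0 \<in> lhom A X G" "p0 \<in> lhom A G X" "\<And>x. x \<in> carrier X \<Longrightarrow> p0 (i0 x) = x"
    using r by (auto simp: retract_def)
  obtain a b where ab: "a \<in> lhom A G (cyc P 0)" "b \<in> lhom A (cyc P 0) G" "\<And>x. x \<in> carrier G \<Longrightarrow> b (a x) = x"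
    using iso lhom_inv[OF lG lZ] unfolding lmod_iso_def by metis
  define j where "j = compose (carrier X) a i0"
  define p where "p = compose (carrier (cyc P 0)) p0 b"
  have j: "j \<in> lhom A X (cyc P 0)" unfolding j_def by (rule lh_comp[OF lX ip0(1) ab(1)])
  have p: "p \<in> lhom A (cyc P 0) X" unfolding p_def by (rule lh_comp[OF lZ ab(2) ip0(2)])
  have pj: "p (j x) = x" if "x \<in> carrier X" for x
    using that ip0(3) ab(3) lh_closed[OF ip0(1)] lh_closed[OF ab(1)] by (simp add: j_def p_def compose_def)
  define e where "e = compose (carrier (cyc P 0)) j p"
  have e: "e \<in> lhom A (cyc P 0) (cyc P 0)" unfolding e_def by (rule lh_comp[OF lZ p j])
  have e_eq: "e z = j (p z)" if "z \<in> carrier (cyc P 0)" for z using that by (simp add: e_def compose_eq)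
  have ee: "e (e z) = e z" if "z \<in> carrier (cyc P 0)" for z
    using that e_eq[OF that] e_eq[OF lh_closed[OF e that]] pj lh_closed[OF p that] by simp
  obtain f where f: "\<And>i. f i \<in> lhom A (cob P i) (cob P i)"
    "\<And>i x. x \<in> carrier (cob P i) \<Longrightarrow> dif P i (f i x) = f (i + 1) (dif P i x)"
    "\<And>z. z \<in> carrier (cyc P 0) \<Longrightarrow> f 0 z = e z"
    using extend_to_chain_map[OF P e] by blast
  note l [simp] = cx_lm[OF cx]
  have "\<exists>q. q \<in> lhom A (cob P i) (cob P i) \<and> (\<forall>x\<in>carrier (cob P i).
      q x \<in> stable_image (cob P i) (f i) \<and> x \<oplus>\<^bsub>cob P i\<^esub> \<ominus>\<^bsub>cob P i\<^esub> q x \<in> stable_kernel (cob P i) (f i))" for i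
    using fitting_projection(1)[OF cx_fg[OF cx] f(1)] by blast
  then obtain q where q: "\<And>i. q i \<in> lhom A (cob P i) (cob P i)"
    "\<And>i x. x \<in> carrier (cob P i) \<Longrightarrow> q i x \<in> stable_image (cob P i) (f i)"
    "\<And>i x. x \<in> carrier (cob P i) \<Longrightarrow> x \<oplus>\<^bsub>cob P i\<^esub> \<ominus>\<^bsub>cob P i\<^esub> q i x \<in> stable_kernel (cob P i) (f i)"
    by metis
  note uniq = fitting_projection(2)[OF cx_fg[OF cx] f(1)]
  note qc = lh_closed[OF q(1)]
  have k0: "\<zero>\<^bsub>cob P i\<^esub> \<in> stable_kernel (cob P i) (f i)" "\<zero>\<^bsub>cob P i\<^esub> \<in> stable_image (cob P i) (f i)" for i
    using submod_stable[OF l f(1)] by (auto simp: submod_def)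
  have qq: "q i (q i x) = q i x" if x: "x \<in> carrier (cob P i)" for i x
  proof (rule uniq[OF qc[OF x] q(2)[OF qc[OF x]] q(3)[OF qc[OF x]] q(2)[OF x]])
    show "q i x \<oplus>\<^bsub>cob P i\<^esub> \<ominus>\<^bsub>cob P i\<^esub> q i x \<in> stable_kernel (cob P i) (f i)" using k0 qc[OF x] by simp
  qed
  \<comment> \<open>Both sides split the same element into a stable image part and a stable kernel
    part, so uniqueness of the splitting identifies them.\<close>
  have qd: "dif P i (q i x) = q (i + 1) (dif P i x)" if x: "x \<in> carrier (cob P i)" for i x
  proof (rule sym, rule uniq[OF cx_closed[OF cx x] q(2)[OF cx_closed[OF cx x]] q(3)[OF cx_closed[OF cx x]]])
    note nat = stable_natural[of "cob P i" "cob P (i + 1)" "f i" "f (i + 1)" "dif P i", OF l l f(1) f(1) cx_lh[OF cx] f(2)]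
    show "dif P i (q i x) \<in> stable_image (cob P (i + 1)) (f (i + 1))" by (rule nat(1)[OF _ q(2)[OF x]])
    have "dif P i (x \<oplus>\<^bsub>cob P i\<^esub> \<ominus>\<^bsub>cob P i\<^esub> q i x) \<in> stable_kernel (cob P (i + 1)) (f (i + 1))"
      by (rule nat(2)[OF _ q(3)[OF x]])
    then show "dif P i x \<oplus>\<^bsub>cob P (i + 1)\<^esub> \<ominus>\<^bsub>cob P (i + 1)\<^esub> dif P i (q i x) \<in> stable_kernel (cob P (i + 1)) (f (i + 1))"
      using x qc[OF x] cx by simp
  qed
  \<comment> \<open>On cycles the splitting is already known: e z is fixed by \<open>f 0\<close>,
    hence in the stable image, and z - e z is killed by \<open>f 0\<close>.\<close>
  have qe: "q 0 z = e z" if z: "z \<in> carrier (cyc P 0)" for z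
  proof (rule uniq)
    have zc: "z \<in> carrier (cob P 0)" using z by simp
    have ez: "e z \<in> carrier (cob P 0)" "e z \<in> carrier (cyc P 0)" using lh_closed[OF e z] by auto
    show "z \<in> carrier (cob P 0)" "q 0 z \<in> stable_image (cob P 0) (f 0)"
      "z \<oplus>\<^bsub>cob P 0\<^esub> \<ominus>\<^bsub>cob P 0\<^esub> q 0 z \<in> stable_kernel (cob P 0) (f 0)"
      using zc q(2,3) by auto
    have "(f 0 ^^ n) (e z) = e z" for n
      by (induction n) (use f(3)[OF ez(2)] ee[OF z] in auto)
    then show "e z \<in> stable_image (cob P 0) (f 0)" using ez by (auto simp: stable_image_def) metis
    have "f 0 (z \<oplus>\<^bsub>cob P 0\<^esub> \<ominus>\<^bsub>cob P 0\<^esub> e z) = \<zero>\<^bsub>cob P 0\<^esub>"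
      using zc ez f(3)[OF z] f(3)[OF ez(2)] ee[OF z] lh_add[OF f(1)] lh_neg[OF f(1)] by simp
    then show "z \<oplus>\<^bsub>cob P 0\<^esub> \<ominus>\<^bsub>cob P 0\<^esub> e z \<in> stable_kernel (cob P 0) (f 0)"
      using zc ez by (auto simp: stable_kernel_def intro!: exI[of _ 1])
  qed
  note I = complete_resolution_image[OF P q(1) qq qd]
  let ?I = "image_cx P q"
  \<comment> \<open>The cycles of the image complex are the fixed points of e, and j maps X
    bijectively onto them with inverse p.\<close>
  have cI: "carrier (cyc ?I 0) = {z \<in> carrier (cyc P 0). e z = z}"
  proof (intro equalityI subsetI)
    fix z assume "z \<in> carrier (cyc ?I 0)"
    then obtain x where x: "x \<in> carrier (cob P 0)" "z = q 0 x" "dif P 0 z = \<zero>\<^bsub>cob P 1\<^esub>"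
      by (auto simp: image_cx_def)
    then have "z \<in> carrier (cyc P 0)" using qc[OF x(1)] by simp
    moreover have "q 0 z = z" using x qq by simp
    ultimately show "z \<in> {z \<in> carrier (cyc P 0). e z = z}" using qe by auto
  next
    fix z assume z: "z \<in> {z \<in> carrier (cyc P 0). e z = z}"
    then have "q 0 z = z" using qe by auto
    then show "z \<in> carrier (cyc ?I 0)" using z by (auto simp: image_cx_def image_iff) metis+
  qed
  have "j \<in> lhom A X (cyc ?I 0)"
  proof (rule lhI)
    fix x assume x: "x \<in> carrier X"
    show "j x \<in> carrier (cyc ?I 0)" unfolding cI using lh_closed[OF j x] e_eq[OF lh_closed[OF j x]] pj[OF x] by auto
  qed (use lh_add[OF j] lh_sm[OF j] lh_ext[OF j] in \<open>auto simp: image_cx_def\<close>)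
  moreover have "bij_betw j (carrier X) (carrier (cyc ?I 0))"
  proof (rule bij_betwI[where g = p])
    show "j \<in> carrier X \<rightarrow> carrier (cyc ?I 0)" using lh_closed[OF calculation] by auto
    show "p \<in> carrier (cyc ?I 0) \<rightarrow> carrier X" unfolding cI using lh_closed[OF p] by auto
    show "p (j x) = x" if "x \<in> carrier X" for x using pj that .
    show "j (p z) = z" if "z \<in> carrier (cyc ?I 0)" for z using that e_eq[of z] unfolding cI by auto
  qed
  ultimately have "lmod_iso A X (cyc ?I 0)" unfolding lmod_iso_def by blast
  then show ?thesis unfolding AGproj_def using X I unfolding cyc_def by (auto intro!: exI[of _ ?I])
qed

lemma AGproj_fg: "X \<in> AGproj A \<Longrightarrow> fg X"
  by (simp add: AGproj_def)

text \<open>Every Gorenstein projective module is a finite direct sum of indecomposable ones, which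
  are direct summands of \<open>G\<close>.\<close>

lemma AGproj_lifts:
  assumes rep: "Gproj_representatives A m Gs" and ds: "direct_sum (Amod A) {..<m} Gs G \<iota>"
    and P: "fg P" and H: "fg H" and p: "p \<in> lhom A P H" and L: "lifts G P H p"
    and G': "G' \<in> AGproj A"
  shows "lifts G' P H p"
proof -
  have fG': "fg G'" and lG': "lm G'" using G' AGproj_fg fg_lm by auto
  obtain \<mu> :: "_ \<Rightarrow> nat" where \<mu>: "\<And>U V. submod A G' U \<Longrightarrow> submod A G' V \<Longrightarrow> U \<subset> V \<Longrightarrow> \<mu> U < \<mu> V"
    using ex_measure[OF lG'] fG' by (auto simp: fg_iff)
  \<comment> \<open>The claim is generalised to X embedded in G' by k, so that all measures are
    taken in the one module G' while X is split further and further.\<close>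
  have "lifts X P H p" if "X \<in> AGproj A" "k \<in> lhom A X G'" "inj_on k (carrier X)" for X k
    using that
  proof (induction "\<mu> (k ` carrier X)" arbitrary: X k rule: less_induct)
    case less
    have X: "fg X" "lm X" using less.prems AGproj_fg fg_lm by auto
    consider "zero_module X" | "\<not> zero_module X" "indecomposable A X"
      | Y Z where "direct_sum2 (Amod A) Y Z X" "\<not> zero_module Y" "\<not> zero_module Z"
      using X unfolding indecomposable_def by blast
    then show ?case
    proof cases
      case 1
      show ?thesis
        unfolding lifts_def
      proof
        fix \<phi> assume "\<phi> \<in> lhom A X H"
        then have "\<phi> = (\<lambda>x\<in>carrier X. \<zero>\<^bsub>H\<^esub>)" by (rule zero_lh[OF 1 X(2) fg_lm[OF H]])
        then show "\<exists>\<psi>\<in>lhom A X P. \<forall>x\<in>carrier X. p (\<psi> x) = \<phi> x"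
          using lh_0[OF X(2) fg_lm[OF P]] lh_zero[OF p fg_lm[OF P] fg_lm[OF H]]
          by (intro bexI[of _ "\<lambda>x\<in>carrier X. \<zero>\<^bsub>P\<^esub>"]) auto
      qed
    next
      case 2
      then obtain j where j: "j < m" "lmod_iso A X (Gs j)"
        using rep less.prems(1) unfolding Gproj_representatives_def by blast
      have fj: "fg (Gs j)" using direct_sum_mem(2)[OF ds] j by simp
      have "lifts (Gs j) P H p"
        by (rule lifts_retract[OF direct_sum_retract[OF ds] fj direct_sum_mem(1)[OF ds] L]) (use j in simp)
      then show ?thesis by (rule lifts_retract[OF iso_retract[OF X(1) fj j(2)] X(1) fj])
    next
      case (3 Y Z)
      then obtain \<kappa> where ds2: "direct_sum (Amod A) {0, 1} (\<lambda>j. if j = 0 then Y else Z) X \<kappa>"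
        by (auto simp: direct_sum2_def)
      let ?W = "\<lambda>j::nat. if j = 0 then Y else Z"
      note D = direct_sum_mem[OF ds2]
      obtain \<pi> where \<pi>: "\<And>j. j \<in> {0, 1} \<Longrightarrow> \<pi> j \<in> lhom A X (?W j)"
        "\<And>j k x. j \<in> {0, 1} \<Longrightarrow> k \<in> {0, 1} \<Longrightarrow> x \<in> carrier (?W k) \<Longrightarrow> \<pi> j (\<kappa> k x) = (if j = k then x else \<zero>\<^bsub>?W j\<^esub>)"
        using direct_sum_projections[OF ds2] by blast
      have nz: "\<not> zero_module (?W j)" for j using 3 by simp
      have "lifts (?W j) P H p" if j: "j \<in> {0, 1}" for j
      proof -
        have fW: "fg (?W j)" using D(2)[OF j] .
        have W: "?W j \<in> AGproj A"
          by (rule AGproj_retract[OF direct_sum_retract[OF ds2 j] less.prems(1) fW])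
        have kl: "compose (carrier (?W j)) k (\<kappa> j) \<in> lhom A (?W j) G'"
          by (rule lh_comp[OF fg_lm[OF fW] D(3)[OF j] less.prems(2)])
        have inj: "inj_on (\<kappa> j) (carrier (?W j))"
          by (rule inj_on_inverseI[of _ "\<pi> j"]) (use \<pi>(2)[OF j j] in auto)
        have kc: "\<kappa> j x \<in> carrier X" if "x \<in> carrier (?W j)" for x using lh_closed[OF D(3)[OF j] that] .
        have injc: "inj_on (compose (carrier (?W j)) k (\<kappa> j)) (carrier (?W j))"
          using inj less.prems(3) kc by (auto simp: inj_on_def compose_eq)
        \<comment> \<open>The complementary summand contains a nonzero y. Its image under k is
          missed by the summand j, so the image in G' shrinks strictly and the induction hypothesis
          applies.\<close>
        define j' where "j' = 1 - j"
        have j': "j' \<in> {0, 1}" "j' \<noteq> j" using j by (auto simp: j'_def)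
        have lj': "lm (?W j')" using D(2)[OF j'(1)] fg_lm by auto
        obtain y where y: "y \<in> carrier (?W j')" "y \<noteq> \<zero>\<^bsub>?W j'\<^esub>"
          using nz[of j'] lm_zero[OF lj'] by (auto simp: zero_module_def)
        have ky: "\<kappa> j' y \<in> carrier X" using lh_closed[OF D(3)[OF j'(1)] y(1)] .
        have "\<kappa> j' y \<noteq> \<kappa> j x" if "x \<in> carrier (?W j)" for x
          using \<pi>(2)[OF j'(1) j that] \<pi>(2)[OF j'(1) j'(1) y(1)] j' y(2) by auto
        then have "k (\<kappa> j' y) \<noteq> k (\<kappa> j x)" if "x \<in> carrier (?W j)" for x
          using inj_onD[OF less.prems(3) _ ky kc[OF that]] that by blast
        then have "k (\<kappa> j' y) \<notin> compose (carrier (?W j)) k (\<kappa> j) ` carrier (?W j)"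
          unfolding image_iff by (metis compose_eq)
        then have sub: "compose (carrier (?W j)) k (\<kappa> j) ` carrier (?W j) \<subset> k ` carrier X"
          using ky kc by (auto simp: compose_eq)
        have "\<mu> (compose (carrier (?W j)) k (\<kappa> j) ` carrier (?W j)) < \<mu> (k ` carrier X)"
          by (rule \<mu>[OF submod_range[OF fg_lm[OF fW] lG' kl] submod_range[OF X(2) lG' less.prems(2)] sub])
        from less.hyps[OF this W kl injc] show ?thesis .
      qed
      then show ?thesis by (rule lifts_direct_sum[OF ds2 P H p])
    qed
  qed
  from this[OF G' lh_id[OF lG']] show ?thesis by (auto simp: inj_on_def)
qed

end

section \<open>Verdier quotients by calculus of fractions\<close>

definition weq :: "('o, 'm, 'z) tri_cat_scheme \<Rightarrow> 'o set \<Rightarrow> 'o \<Rightarrow> 'o \<Rightarrow> 'm \<Rightarrow> bool" where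
  "weq T N X Y s \<longleftrightarrow> X \<in> Ob T \<and> Y \<in> Ob T \<and> s \<in> cone_in T N X Y"

text \<open>What a calculus of right fractions compatible with the shift requires of the class
  \<open>weq\<close> of denominators. Stating it as axioms separates the formal part from
  homological algebra; for the homotopy category they are verified with quasi-isomorphisms and
  homotopy fibres.\<close>

locale fractions = precat T for T :: "('o, 'm, 'z) tri_cat_scheme" +
  fixes N :: "'o set"
  assumes weq_id: "X \<in> Ob T \<Longrightarrow> weq T N X X (idt T X)"
    and weq_cmp: "weq T N X Y s \<Longrightarrow> weq T N Y Z t \<Longrightarrow> weq T N X Z (cmp T X Y Z t s)"
    and weq_left: "weq T N Y Z t \<Longrightarrow> arr T X Y s \<Longrightarrow> weq T N X Z (cmp T X Y Z t s) \<Longrightarrow> weq T N X Y s"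
    and ore: "arr T X Y f \<Longrightarrow> weq T N V Y t \<Longrightarrow>
      \<exists>P u v. weq T N P X u \<and> arr T P V v \<and> cmp T P X Y f u = cmp T P V Y t v"
    and cancel: "weq T N Y Y' t \<Longrightarrow> arr T X Y f \<Longrightarrow> arr T X Y g \<Longrightarrow> cmp T X Y Y' t f = cmp T X Y Y' t g \<Longrightarrow>
      \<exists>P u. weq T N P X u \<and> cmp T P X Y f u = cmp T P X Y g u"
    and shift_Ob: "X \<in> Ob T \<Longrightarrow> shO T 1 X \<in> Ob T"
    and shift_arr: "arr T X Y f \<Longrightarrow> arr T (shO T 1 X) (shO T 1 Y) (shM T 1 f)"
    and shift_id: "X \<in> Ob T \<Longrightarrow> shM T 1 (idt T X) = idt T (shO T 1 X)"
    and shift_cmp: "arr T X Y f \<Longrightarrow> arr T Y Z g \<Longrightarrow> shM T 1 (cmp T X Y Z g f) =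
      cmp T (shO T 1 X) (shO T 1 Y) (shO T 1 Z) (shM T 1 g) (shM T 1 f)"
    and shift_weq: "weq T N X Y s \<Longrightarrow> weq T N (shO T 1 X) (shO T 1 Y) (shM T 1 s)"
begin

section \<open>Equivalence of roofs and independence of choices\<close>

abbreviation W where "W \<equiv> weq T N"
abbreviation ar where "ar \<equiv> arr T"
abbreviation cm where "cm \<equiv> cmp T"

lemma W_arr: "W X Y s \<Longrightarrow> ar X Y s"
  by (auto simp: weq_def arr_def cone_in_def)

lemma cm_lift:
  assumes "ar X Y f" "ar Y Z g" "ar X Y' f'" "ar Y' Z g'" "cm X Y Z g f = cm X Y' Z g' f'" "ar V X w"
  shows "cm V Y Z g (cm V X Y f w) = cm V Y' Z g' (cm V X Y' f' w)"
  using assms assoc[of V X w Y f Z g] assoc[of V X w Y' f' Z g'] by simp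

text \<open>\<open>roof_rel\<close> rewritten with \<open>arr\<close> and \<open>weq\<close>, the
  predicates in which the axioms of the locale are phrased.\<close>

definition req :: "'o \<Rightarrow> 'o \<Rightarrow> ('o, 'm) roof \<Rightarrow> ('o, 'm) roof \<Rightarrow> bool" where
  "req X Y = (\<lambda>(Z, s, f) (Z', s', f'). W Z X s \<and> ar Z Y f \<and> W Z' X s' \<and> ar Z' Y f' \<and>
     (\<exists>Q a b. ar Q Z a \<and> ar Q Z' b \<and> cm Q Z X s a = cm Q Z' X s' b \<and> W Q X (cm Q Z X s a) \<and>
       cm Q Z Y f a = cm Q Z' Y f' b))"

abbreviation rc :: "'o \<Rightarrow> 'o \<Rightarrow> ('o, 'm) roof \<Rightarrow> ('o, 'm) roof set" where
  "rc X Y r \<equiv> roof_rel T N X Y `` {r}"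

lemma roofs_iff: "X \<in> Ob T \<Longrightarrow> Y \<in> Ob T \<Longrightarrow> (Z, s, f) \<in> roofs T N X Y \<longleftrightarrow> W Z X s \<and> ar Z Y f"
  by (auto simp: roofs_def weq_def arr_def)

lemma roof_rel_iff:
  assumes XY: "X \<in> Ob T" "Y \<in> Ob T"
  shows "(r, r') \<in> roof_rel T N X Y \<longleftrightarrow> req X Y r r'"
proof -
  obtain Z s f Z' s' f' where r: "r = (Z, s, f)" "r' = (Z', s', f')" by (metis prod_cases3)
  have "((Z, s, f), (Z', s', f')) \<in> roof_rel T N X Y \<longleftrightarrow> req X Y (Z, s, f) (Z', s', f')"
    unfolding roof_rel_def req_def mem_Collect_eq prod.case roofs_iff[OF XY]
    using XY by (auto simp: weq_def arr_def)
  then show ?thesis by (simp add: r)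
qed

lemma reqI:
  assumes "W Z X s" "ar Z Y f" "W Z' X s'" "ar Z' Y f'" "ar Q Z a" "ar Q Z' b"
    "cm Q Z X s a = cm Q Z' X s' b" "W Q X (cm Q Z X s a)" "cm Q Z Y f a = cm Q Z' Y f' b"
  shows "req X Y (Z, s, f) (Z', s', f')"
  using assms unfolding req_def by blast

text \<open>The definition only says that the composite denominator lies in W. By
  \<open>weq_left\<close> the legs of the common refinement lie in W as well, so they can enter
  further Ore squares.\<close>

lemma reqE:
  assumes "req X Y (Z, s, f) (Z', s', f')"
  obtains Q a b where "W Z X s" "ar Z Y f" "W Z' X s'" "ar Z' Y f'" "W Q Z a" "W Q Z' b"
    "cm Q Z X s a = cm Q Z' X s' b" "W Q X (cm Q Z X s a)" "cm Q Z Y f a = cm Q Z' Y f' b"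
proof -
  from assms obtain Q a b where *: "W Z X s" "ar Z Y f" "W Z' X s'" "ar Z' Y f'" "ar Q Z a" "ar Q Z' b"
    "cm Q Z X s a = cm Q Z' X s' b" "W Q X (cm Q Z X s a)" "cm Q Z Y f a = cm Q Z' Y f' b"
    by (auto simp: req_def)
  moreover have "W Q Z a" by (rule weq_left[OF *(1,5,8)])
  moreover have "W Q Z' b" by (rule weq_left[OF *(3,6)]) (use *(7,8) in simp)
  ultimately show ?thesis using that by blast
qed

lemma req_refine:
  assumes s: "W Z X s" and f: "ar Z Y f" and x: "W Q Z x"
  shows "req X Y (Z, s, f) (Q, cm Q Z X s x, cm Q Z Y f x)"
proof (rule reqI[OF s f _ _ W_arr[OF x]])
  have Q: "Q \<in> Ob T" using x by (simp add: weq_def)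
  show "W Q X (cm Q Z X s x)" "W Q X (cm Q Z X s x)" by (rule weq_cmp[OF x s])+
  show "ar Q Y (cm Q Z Y f x)" by (rule arr_cmp[OF W_arr[OF x] f])
  show "ar Q Q (idt T Q)" by (rule arr_id[OF Q])
  show "cm Q Z X s x = cm Q Q X (cm Q Z X s x) (idt T Q)" "cm Q Z Y f x = cm Q Q Y (cm Q Z Y f x) (idt T Q)"
    using id_right[OF arr_cmp[OF W_arr[OF x] W_arr[OF s]]] id_right[OF arr_cmp[OF W_arr[OF x] f]] by simp_all
qed

lemma req_refl: "W Z X s \<Longrightarrow> ar Z Y f \<Longrightarrow> req X Y (Z, s, f) (Z, s, f)"
  using req_refine[of Z X s Y f Z "idt T Z"] weq_id[of Z] id_right[of Z X s] id_right[of Z Y f] W_arr[of Z X s]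
  by (simp add: weq_def)

lemma req_sym: "req X Y r r' \<Longrightarrow> req X Y r' r"
  by (cases r, cases r') (auto simp: req_def, metis)

text \<open>Completing two roofs over a common refinement is independent of all choices.\<close>

lemma req_compose:
  assumes r: "req X Y (Z, s, f) (Z', s', f')" and q: "req Y U (V, t, g) (V', t', g')"
    and u: "W P Z u" "ar P V v" "cm P Z Y f u = cm P V Y t v"
    and u': "W P' Z' u'" "ar P' V' v'" "cm P' Z' Y f' u' = cm P' V' Y t' v'"
  shows "req X U (P, cm P Z X s u, cm P V U g v) (P', cm P' Z' X s' u', cm P' V' U g' v')"
proof -
  from r obtain Q a b where r: "W Z X s" "ar Z Y f" "W Z' X s'" "ar Z' Y f'" "W Q Z a" "W Q Z' b"
    "cm Q Z X s a = cm Q Z' X s' b" "W Q X (cm Q Z X s a)" "cm Q Z Y f a = cm Q Z' Y f' b" by (rule reqE)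
  from q obtain R c e where q: "W V Y t" "ar V U g" "W V' Y t'" "ar V' U g'" "W R V c" "W R V' e"
    "cm R V Y t c = cm R V' Y t' e" "W R Y (cm R V Y t c)" "cm R V U g c = cm R V' U g' e" by (rule reqE)
  note A = W_arr[OF r(1)] r(2) W_arr[OF r(3)] r(4) W_arr[OF r(5)] W_arr[OF r(6)]
    W_arr[OF q(1)] q(2) W_arr[OF q(3)] q(4) W_arr[OF q(5)] W_arr[OF q(6)] W_arr[OF u(1)] u(2) W_arr[OF u'(1)] u'(2)
  \<comment> \<open>P1 maps to P and to Q over Z, and P2 also maps to P' over Z'. On P2 both
    composites thus start from the common refinement Q of the first pair of roofs.\<close>
  obtain P1 x1 y1 where 1: "W P1 Q x1" "ar P1 P y1" "cm P1 Q Z a x1 = cm P1 P Z u y1"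
    using ore[OF A(5) u(1)] by blast
  note A1 = W_arr[OF 1(1)] 1(2)
  obtain P2 x2 y2 where 2: "W P2 P1 x2" "ar P2 P' y2" "cm P2 P1 Z' (cm P1 Q Z' b x1) x2 = cm P2 P' Z' u' y2"
    using ore[OF arr_cmp[OF A1(1) A(6)] u'(1)] by blast
  note A2 = W_arr[OF 2(1)] 2(2)
  define p where "p = cm P2 P1 P y1 x2"
  have p: "ar P2 P p" unfolding p_def by (rule arr_cmp[OF A2(1) A1(2)])
  define w where "w = cm P2 P1 Q x1 x2"
  have w: "W P2 Q w" unfolding w_def by (rule weq_cmp[OF 2(1) 1(1)])
  note w' = W_arr[OF w]
  have up: "cm P2 P Z u p = cm P2 Q Z a w"
    unfolding p_def w_def by (rule cm_lift[OF A1(2) A(13) A1(1) A(5) 1(3)[symmetric] A2(1)])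
  have bw: "cm P2 P' Z' u' y2 = cm P2 Q Z' b w"
    using 2(3) assoc[OF A2(1) A1(1) A(6)] by (simp add: w_def)
  have tv: "cm P2 V Y t (cm P2 P V v p) = cm P2 V' Y t' (cm P2 P' V' v' y2)"
  proof -
    have "cm P2 V Y t (cm P2 P V v p) = cm P2 Z Y f (cm P2 P Z u p)"
      by (rule cm_lift[OF u(2) A(7) A(13) r(2) u(3)[symmetric] p])
    also have "\<dots> = cm P2 Z' Y f' (cm P2 Q Z' b w)"
      unfolding up by (rule cm_lift[OF A(5) r(2) A(6) r(4) r(9) w'])
    also have "\<dots> = cm P2 V' Y t' (cm P2 P' V' v' y2)"
      unfolding bw[symmetric] by (rule cm_lift[OF A(15) r(4) u'(2) A(9) u'(3) A2(2)])
    finally show ?thesis .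
  qed
  have vp: "ar P2 V (cm P2 P V v p)" by (rule arr_cmp[OF p u(2)])
  have vp': "ar P2 V' (cm P2 P' V' v' y2)" by (rule arr_cmp[OF A2(2) u'(2)])
  \<comment> \<open>The leg to V is factored through the refinement R of the second pair. The leg to
    V' then agrees with the one through R only after t', and cancelling the denominator t' costs the
    further refinement P4.\<close>
  obtain P3 x3 k where 3: "W P3 P2 x3" "ar P3 R k" "cm P3 P2 V (cm P2 P V v p) x3 = cm P3 R V c k"
    using ore[OF vp q(5)] by blast
  note A3 = W_arr[OF 3(1)]
  have "cm P3 V' Y t' (cm P3 R V' e k) = cm P3 V Y t (cm P3 R V c k)"
    by (rule cm_lift[OF A(12) A(9) A(11) A(7) q(7)[symmetric] 3(2)])
  also have "\<dots> = cm P3 V' Y t' (cm P3 P2 V' (cm P2 P' V' v' y2) x3)"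
    unfolding 3(3)[symmetric] by (rule cm_lift[OF vp A(7) vp' A(9) tv A3])
  finally obtain P4 y where 4: "W P4 P3 y" "cm P4 P3 V' (cm P3 R V' e k) y = cm P4 P3 V' (cm P3 P2 V' (cm P2 P' V' v' y2) x3) y"
    using cancel[OF q(3) arr_cmp[OF 3(2) A(12)] arr_cmp[OF A3 vp']] by blast
  note A4 = W_arr[OF 4(1)]
  define z where "z = cm P4 P3 P2 x3 y"
  have z: "W P4 P2 z" unfolding z_def by (rule weq_cmp[OF 4(1) 3(1)])
  note z' = W_arr[OF z]
  have \<alpha>: "ar P4 P (cm P4 P2 P p z)" by (rule arr_cmp[OF z' p])
  have \<beta>: "ar P4 P' (cm P4 P2 P' y2 z)" by (rule arr_cmp[OF z' A2(2)])
  have wz: "W P4 Q (cm P4 P2 Q w z)" by (rule weq_cmp[OF z w])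
  have usz: "cm P4 P Z u (cm P4 P2 P p z) = cm P4 Q Z a (cm P4 P2 Q w z)"
    by (rule cm_lift[OF p A(13) w' A(5) up z'])
  have usz': "cm P4 P' Z' u' (cm P4 P2 P' y2 z) = cm P4 Q Z' b (cm P4 P2 Q w z)"
    by (rule cm_lift[OF A2(2) A(15) w' A(6) bw z'])
  have s1: "cm P4 P X (cm P Z X s u) (cm P4 P2 P p z) = cm P4 Q X (cm Q Z X s a) (cm P4 P2 Q w z)"
    unfolding assoc[OF \<alpha> A(13) A(1)] assoc[OF W_arr[OF wz] A(5) A(1)] usz ..
  have s2: "cm P4 P' X (cm P' Z' X s' u') (cm P4 P2 P' y2 z) = cm P4 Q X (cm Q Z' X s' b) (cm P4 P2 Q w z)"
    unfolding assoc[OF \<beta> A(15) A(3)] assoc[OF W_arr[OF wz] A(6) A(3)] usz' ..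
  have g1: "cm P4 P U (cm P V U g v) (cm P4 P2 P p z) = cm P4 R U (cm R V U g c) (cm P4 P3 R k y)"
  proof -
    have ky: "ar P4 R (cm P4 P3 R k y)" by (rule arr_cmp[OF A4 3(2)])
    have "cm P4 P V v (cm P4 P2 P p z) = cm P4 P3 V (cm P3 P2 V (cm P2 P V v p) x3) y"
      unfolding assoc[OF A4 A3 vp] z_def[symmetric] by (rule assoc[OF z' p u(2), symmetric])
    also have "\<dots> = cm P4 R V c (cm P4 P3 R k y)" unfolding 3(3) by (rule assoc[OF A4 3(2) A(11)])
    finally show ?thesis unfolding assoc[OF \<alpha> u(2) q(2)] assoc[OF ky A(11) q(2)] by simp
  qed
  have g2: "cm P4 P' U (cm P' V' U g' v') (cm P4 P2 P' y2 z) = cm P4 R U (cm R V' U g' e) (cm P4 P3 R k y)"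
  proof -
    have ky: "ar P4 R (cm P4 P3 R k y)" by (rule arr_cmp[OF A4 3(2)])
    have "cm P4 P' V' v' (cm P4 P2 P' y2 z) = cm P4 P3 V' (cm P3 P2 V' (cm P2 P' V' v' y2) x3) y"
      unfolding assoc[OF A4 A3 vp'] z_def[symmetric] by (rule assoc[OF z' A2(2) u'(2), symmetric])
    also have "\<dots> = cm P4 R V' e (cm P4 P3 R k y)" unfolding 4(2)[symmetric] by (rule assoc[OF A4 3(2) A(12)])
    finally show ?thesis unfolding assoc[OF \<beta> u'(2) q(4)] assoc[OF ky A(12) q(4)] by simp
  qed
  show ?thesis
  proof (rule reqI[OF weq_cmp[OF u(1) r(1)] arr_cmp[OF u(2) q(2)] weq_cmp[OF u'(1) r(3)] arr_cmp[OF u'(2) q(4)] \<alpha> \<beta>])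
    show "W P4 X (cm P4 P X (cm P Z X s u) (cm P4 P2 P p z))" unfolding s1 by (rule weq_cmp[OF wz r(8)])
  qed (simp_all add: s1 s2 g1 g2 r(7) q(9))
qed

text \<open>The refinements Q and R of the two pairs both map to the middle roof; an Ore square for
  these two legs is a refinement of the outer roofs.\<close>

lemma req_trans:
  assumes 1: "req X Y r r'" and 2: "req X Y r' r''"
  shows "req X Y r r''"
proof (cases r, cases r', cases r'')
  fix Z s f Z' s' f' Z'' s'' f''
  assume e: "r = (Z, s, f)" "r' = (Z', s', f')" "r'' = (Z'', s'', f'')"
  from 1 obtain Q a b where r: "W Z X s" "ar Z Y f" "W Z' X s'" "ar Z' Y f'" "W Q Z a" "W Q Z' b"
    "cm Q Z X s a = cm Q Z' X s' b" "W Q X (cm Q Z X s a)" "cm Q Z Y f a = cm Q Z' Y f' b" unfolding e by (rule reqE)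
  from 2 obtain R c d where q: "W Z' X s'" "ar Z' Y f'" "W Z'' X s''" "ar Z'' Y f''" "W R Z' c" "W R Z'' d"
    "cm R Z' X s' c = cm R Z'' X s'' d" "W R X (cm R Z' X s' c)" "cm R Z' Y f' c = cm R Z'' Y f'' d" unfolding e by (rule reqE)
  obtain P x y where o: "W P Q x" "ar P R y" "cm P Q Z' b x = cm P R Z' c y"
    using ore[OF W_arr[OF r(6)] q(5)] by blast
  have x: "ar P Q x" by (rule W_arr[OF o(1)])
  have s: "cm P Z X s (cm P Q Z a x) = cm P Z'' X s'' (cm P R Z'' d y)"
    using cm_lift[OF W_arr[OF r(5)] W_arr[OF r(1)] W_arr[OF r(6)] W_arr[OF r(3)] r(7) x]
      cm_lift[OF W_arr[OF q(5)] W_arr[OF q(1)] W_arr[OF q(6)] W_arr[OF q(3)] q(7) o(2)] o(3) by simp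
  have f: "cm P Z Y f (cm P Q Z a x) = cm P Z'' Y f'' (cm P R Z'' d y)"
    using cm_lift[OF W_arr[OF r(5)] r(2) W_arr[OF r(6)] r(4) r(9) x]
      cm_lift[OF W_arr[OF q(5)] q(2) W_arr[OF q(6)] q(4) q(9) o(2)] o(3) by simp
  show ?thesis unfolding e
  proof (rule reqI[OF r(1,2) q(3,4) arr_cmp[OF x W_arr[OF r(5)]] arr_cmp[OF o(2) W_arr[OF q(6)]] s _ f])
    show "W P X (cm P Z X s (cm P Q Z a x))" by (rule weq_cmp[OF weq_cmp[OF o(1) r(5)] r(1)])
  qed
qed

lemma roof_Ob: "W Z X s \<Longrightarrow> ar Z Y f \<Longrightarrow> X \<in> Ob T \<and> Y \<in> Ob T"
  by (auto simp: weq_def arr_def)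

lemma rc_eq: "req X Y r r' \<Longrightarrow> rc X Y r = rc X Y r'"
proof -
  assume *: "req X Y r r'"
  have "X \<in> Ob T \<and> Y \<in> Ob T" using * roof_Ob by (cases r) (auto simp: req_def split: prod.splits)
  then have "x \<in> rc X Y r \<longleftrightarrow> req X Y r x" "x \<in> rc X Y r' \<longleftrightarrow> req X Y r' x" for x
    by (simp_all add: roof_rel_iff)
  moreover have "req X Y r x \<longleftrightarrow> req X Y r' x" for x
    using req_trans[OF *] req_trans[OF req_sym[OF *]] by blast
  ultimately show ?thesis by blast
qed

lemma rc_mem: "X \<in> Ob T \<Longrightarrow> Y \<in> Ob T \<Longrightarrow> r' \<in> rc X Y r \<longleftrightarrow> req X Y r r'"
  by (simp add: roof_rel_iff)

lemma rc_eqD: "rc X Y (Z, s, f) = rc X Y r' \<Longrightarrow> W Z X s \<Longrightarrow> ar Z Y f \<Longrightarrow> req X Y (Z, s, f) r'"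
  using roof_Ob[of Z X s Y f] rc_mem[of X Y] req_refl[of Z X s Y f] req_sym by metis

section \<open>The quotient category\<close>

abbreviation D :: "('o, ('o, 'm) roof set) shift_cat" where "D \<equiv> verdier_shift_cat T N"

lemma D_simps [simp]: "Ob D = Ob T" "idt D X = roof_image T N X X (idt T X)" "cmp D = roof_comp T N"
  "shO D = shO T" "Hm D X Y = roofs T N X Y // roof_rel T N X Y"
  by (simp_all add: verdier_shift_cat_def)

lemma arr_D: "arr D X Y \<phi> \<longleftrightarrow> (\<exists>Z s f. W Z X s \<and> ar Z Y f \<and> \<phi> = rc X Y (Z, s, f))"
proof
  assume "arr D X Y \<phi>"
  then have XY: "X \<in> Ob T" "Y \<in> Ob T" and "\<phi> \<in> roofs T N X Y // roof_rel T N X Y" by (auto simp: arr_def)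
  then obtain r where "r \<in> roofs T N X Y" "\<phi> = rc X Y r" by (auto elim: quotientE)
  then show "\<exists>Z s f. W Z X s \<and> ar Z Y f \<and> \<phi> = rc X Y (Z, s, f)" by (cases r) (auto simp: roofs_iff[OF XY])
next
  assume "\<exists>Z s f. W Z X s \<and> ar Z Y f \<and> \<phi> = rc X Y (Z, s, f)"
  then obtain Z s f where *: "W Z X s" "ar Z Y f" "\<phi> = rc X Y (Z, s, f)" by blast
  then have XY: "X \<in> Ob T" "Y \<in> Ob T" using roof_Ob by auto
  then show "arr D X Y \<phi>" using * by (auto simp: arr_def roofs_iff intro!: quotientI)
qed

lemma arr_rc: "W Z X s \<Longrightarrow> ar Z Y f \<Longrightarrow> arr D X Y (rc X Y (Z, s, f))"
  by (auto simp: arr_D)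

text \<open>Stated for parts of classes that contain the given representative. The shift of a class
  is formed elementwise and is a priori only such a part, which matters in
  \<open>Tri_image\<close>.\<close>

lemma comp_subset:
  assumes r: "W Z X s" "ar Z Y f" and q: "W V Y t" "ar V U g"
    and u: "W P Z u" "ar P V v" "cm P Z Y f u = cm P V Y t v"
    and \<phi>: "\<phi> \<subseteq> rc X Y (Z, s, f)" "(Z, s, f) \<in> \<phi>" and \<psi>: "\<psi> \<subseteq> rc Y U (V, t, g)" "(V, t, g) \<in> \<psi>"
  shows "roof_comp T N X Y U \<psi> \<phi> = rc X U (P, cm P Z X s u, cm P V U g v)"
proof (intro equalityI subsetI)
  have ob: "X \<in> Ob T" "Y \<in> Ob T" "U \<in> Ob T" "P \<in> Ob T" using roof_Ob[OF r] roof_Ob[OF q] roof_Ob[OF u(1,2)] u(1) by (auto simp: weq_def)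
  {
    fix x assume "x \<in> rc X U (P, cm P Z X s u, cm P V U g v)"
    then show "x \<in> roof_comp T N X Y U \<psi> \<phi>"
      unfolding roof_comp_def using \<phi>(2) \<psi>(2) u ob by (auto simp: weq_def arr_def) blast
  next
    fix x assume "x \<in> roof_comp T N X Y U \<psi> \<phi>"
    then obtain Z' s' f' V' t' g' P' u' v' where x: "(Z', s', f') \<in> \<phi>" "(V', t', g') \<in> \<psi>"
      "P' \<in> Ob T" "u' \<in> cone_in T N P' Z'" "v' \<in> Hm T P' V'" "cm P' Z' Y f' u' = cm P' V' Y t' v'"
      "((P', cm P' Z' X s' u', cm P' V' U g' v'), x) \<in> roof_rel T N X U"
      unfolding roof_comp_def by blast
    have 1: "req X Y (Z, s, f) (Z', s', f')" using \<phi>(1) x(1) rc_mem[OF ob(1,2)] by blast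
    have 2: "req Y U (V, t, g) (V', t', g')" using \<psi>(1) x(2) rc_mem[OF ob(2,3)] by blast
    have "Z' \<in> Ob T" "V' \<in> Ob T" using 1 2 by (auto simp: req_def arr_def)
    then have "W P' Z' u'" "ar P' V' v'" using x by (auto simp: weq_def arr_def)
    from req_compose[OF 1 2 u this x(6)] x(7)
    have "req X U (P, cm P Z X s u, cm P V U g v) x" using roof_rel_iff[OF ob(1,3)] req_trans by blast
    then show "x \<in> rc X U (P, cm P Z X s u, cm P V U g v)" using rc_mem[OF ob(1,3)] by blast
  }
qed

lemma comp_rc:
  assumes r: "W Z X s" "ar Z Y f" and q: "W V Y t" "ar V U g"
    and u: "W P Z u" "ar P V v" "cm P Z Y f u = cm P V Y t v"
  shows "roof_comp T N X Y U (rc Y U (V, t, g)) (rc X Y (Z, s, f)) = rc X U (P, cm P Z X s u, cm P V U g v)"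
  by (rule comp_subset[OF assms])
    (use roof_Ob[OF r] roof_Ob[OF q] req_refl[OF r] req_refl[OF q] in \<open>auto simp: roof_rel_iff\<close>)

lemma comp_ex:
  assumes q: "W V Y t" "ar V U g" and r: "W Z X s" "ar Z Y f"
  obtains P u v where "W P Z u" "ar P V v" "cm P Z Y f u = cm P V Y t v"
    "roof_comp T N X Y U (rc Y U (V, t, g)) (rc X Y (Z, s, f)) = rc X U (P, cm P Z X s u, cm P V U g v)"
  using ore[OF r(2) q(1)] comp_rc[OF r q] by metis

lemma roof_image_rc: "roof_image T N X Y f = rc X Y (X, idt T X, f)"
  by (simp add: roof_image_def)

lemma comp_image_right:
  assumes f: "ar X Y f" and q: "W V Y t" "ar V U g" and u: "W P X u" "ar P V v" "cm P X Y f u = cm P V Y t v"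
  shows "roof_comp T N X Y U (rc Y U (V, t, g)) (roof_image T N X Y f) = rc X U (P, u, cm P V U g v)"
  using comp_rc[OF weq_id f q u] id_left[OF W_arr[OF u(1)]] f by (simp add: roof_image_rc arr_def)

lemma comp_image_left:
  assumes r: "W Z X s" "ar Z Y f" and g: "ar Y U g"
  shows "roof_comp T N X Y U (roof_image T N Y U g) (rc X Y (Z, s, f)) = rc X U (Z, s, cm Z Y U g f)"
proof -
  have ob: "Y \<in> Ob T" "Z \<in> Ob T" using r by (auto simp: arr_def)
  have "cm Z Z Y f (idt T Z) = cm Z Y Y (idt T Y) f" using id_left[OF r(2)] id_right[OF r(2)] by simp
  from comp_rc[OF r weq_id[OF ob(1)] g weq_id[OF ob(2)] r(2) this] show ?thesis
    using id_right[OF W_arr[OF r(1)]] by (simp add: roof_image_rc)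
qed

lemma arr_image: "ar X Y f \<Longrightarrow> arr D X Y (roof_image T N X Y f)"
  unfolding roof_image_rc by (rule arr_rc) (auto simp: arr_def weq_id)

lemma image_cmp:
  assumes f: "ar X Y f" and g: "ar Y U g"
  shows "cmp D X Y U (roof_image T N Y U g) (roof_image T N X Y f) = roof_image T N X U (cm X Y U g f)"
  using comp_image_left[OF weq_id f g] f by (simp add: roof_image_rc arr_def)

lemma precat_D: "precat D"
proof
  fix X assume "X \<in> Ob D"
  then show "arr D X X (idt D X)" using arr_image[OF arr_id] by simp
next
  fix X Y U \<phi> \<psi> assume "arr D X Y \<phi>" "arr D Y U \<psi>"
  then obtain Z s f V t g where *: "W Z X s" "ar Z Y f" "\<phi> = rc X Y (Z, s, f)" "W V Y t" "ar V U g" "\<psi> = rc Y U (V, t, g)"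
    by (auto simp: arr_D)
  from comp_ex[OF *(4,5) *(1,2)] obtain P u v where "W P Z u" "ar P V v"
    "roof_comp T N X Y U (rc Y U (V, t, g)) (rc X Y (Z, s, f)) = rc X U (P, cm P Z X s u, cm P V U g v)" by metis
  then show "arr D X U (cmp D X Y U \<psi> \<phi>)" using arr_rc[OF weq_cmp arr_cmp] * by simp
next
  fix X Y \<phi> assume "arr D X Y \<phi>"
  then obtain Z s f where *: "W Z X s" "ar Z Y f" "\<phi> = rc X Y (Z, s, f)" by (auto simp: arr_D)
  have ob: "X \<in> Ob T" "Y \<in> Ob T" using roof_Ob[OF *(1,2)] by auto
  show "cmp D X Y Y (idt D Y) \<phi> = \<phi>"
    using comp_image_left[OF *(1,2) arr_id[OF ob(2)]] id_left[OF *(2)] * by simp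
  have "cm Z X X (idt T X) s = cm Z Z X s (idt T Z)"
    using id_left[OF W_arr[OF *(1)]] id_right[OF W_arr[OF *(1)]] by simp
  from comp_image_right[OF arr_id[OF ob(1)] *(1,2,1) _ this] 
  show "cmp D X X Y \<phi> (idt D X) = \<phi>"
    using arr_id[of Z] * id_right[OF *(2)] by (auto simp: arr_def)
next
  fix X Y U S \<phi> \<psi> \<chi> assume "arr D X Y \<phi>" "arr D Y U \<psi>" "arr D U S \<chi>"
  then obtain Z s f V t g R r h where *: "W Z X s" "ar Z Y f" "\<phi> = rc X Y (Z, s, f)" "W V Y t" "ar V U g" "\<psi> = rc Y U (V, t, g)"
    "W R U r" "ar R S h" "\<chi> = rc U S (R, r, h)"
    by (auto simp: arr_D)
  from comp_ex[OF *(4,5) *(1,2)] obtain P u v where 1: "W P Z u" "ar P V v" "cm P Z Y f u = cm P V Y t v"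
    "roof_comp T N X Y U (rc Y U (V, t, g)) (rc X Y (Z, s, f)) = rc X U (P, cm P Z X s u, cm P V U g v)" by metis
  from comp_ex[OF *(7,8) *(4,5)] obtain Q p q where 2: "W Q V p" "ar Q R q" "cm Q V U g p = cm Q R U r q"
    "roof_comp T N Y U S (rc U S (R, r, h)) (rc Y U (V, t, g)) = rc Y S (Q, cm Q V Y t p, cm Q R S h q)" by metis
  \<comment> \<open>O' completes the square formed over V by the two completions; both ways of
    bracketing are evaluated on it.\<close>
  obtain O' x y where 3: "W O' P x" "ar O' Q y" "cm O' P V v x = cm O' Q V p y"
    using ore[OF 1(2) 2(1)] by blast
  note a = W_arr[OF 1(1)] W_arr[OF 2(1)] W_arr[OF 3(1)] W_arr[OF *(4)] W_arr[OF *(7)] W_arr[OF *(1)]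
  have e1: "cm O' P U (cm P V U g v) x = cm O' R U r (cm O' Q R q y)"
    unfolding assoc[OF a(3) 1(2) *(5)] 3(3) by (rule cm_lift[OF a(2) *(5) 2(2) a(5) 2(3) 3(2)])
  have e2: "cm O' Z Y f (cm O' P Z u x) = cm O' Q Y (cm Q V Y t p) y"
    unfolding assoc[OF 3(2) a(2) a(4)] 3(3)[symmetric]
    by (rule cm_lift[OF a(1) *(2) 1(2) a(4) 1(3) a(3)])
  have "roof_comp T N X U S (rc U S (R, r, h)) (rc X U (P, cm P Z X s u, cm P V U g v)) =
      rc X S (O', cm O' P X (cm P Z X s u) x, cm O' R S h (cm O' Q R q y))"
    by (rule comp_rc[OF weq_cmp[OF 1(1) *(1)] arr_cmp[OF 1(2) *(5)] *(7,8) 3(1) arr_cmp[OF 3(2) 2(2)] e1])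
  moreover have "roof_comp T N X Y S (rc Y S (Q, cm Q V Y t p, cm Q R S h q)) (rc X Y (Z, s, f)) =
      rc X S (O', cm O' Z X s (cm O' P Z u x), cm O' Q S (cm Q R S h q) y)"
    by (rule comp_rc[OF *(1,2) weq_cmp[OF 2(1) *(4)] arr_cmp[OF 2(2) *(8)] weq_cmp[OF 3(1) 1(1)] 3(2) e2])
  ultimately show "cmp D X Y S (cmp D Y U S \<chi> \<psi>) \<phi> = cmp D X U S \<chi> (cmp D X Y U \<psi> \<phi>)"
    using 1(4) 2(4) * assoc[OF a(3) a(1) a(6)] assoc[OF 3(2) 2(2) *(8)] by simp
qed

sublocale D: precat D by (rule precat_D)

text \<open>The inverse is the roof with s as denominator and the identity as numerator.\<close>

lemma image_iso:
  assumes s: "W X Y s"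
  shows "is_iso D X Y (roof_image T N X Y s)"
proof (rule D.is_isoI)
  have ob: "X \<in> Ob T" "Y \<in> Ob T" using s by (auto simp: weq_def)
  note i = arr_id[OF ob(1)] weq_id[OF ob(1)]
  show "arr D X Y (roof_image T N X Y s)" by (rule arr_image[OF W_arr[OF s]])
  show "arr D Y X (rc Y X (X, s, idt T X))" by (rule arr_rc[OF s i(1)])
  have "roof_comp T N X Y X (rc Y X (X, s, idt T X)) (roof_image T N X Y s) = rc X X (X, idt T X, cm X X X (idt T X) (idt T X))"
    by (rule comp_image_right[OF W_arr[OF s] s i(1) i(2) i(1)]) simp
  then show "cmp D X Y X (rc Y X (X, s, idt T X)) (roof_image T N X Y s) = idt D X"
    using id_left[OF i(1)] by (simp add: roof_image_rc)
  have "roof_comp T N Y X Y (roof_image T N X Y s) (rc Y X (X, s, idt T X)) = rc Y Y (X, s, cm X X Y s (idt T X))"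
    by (rule comp_image_left[OF s i(1) W_arr[OF s]])
  moreover have "rc Y Y (Y, idt T Y, idt T Y) = rc Y Y (X, cm X Y Y (idt T Y) s, cm X Y Y (idt T Y) s)"
    by (rule rc_eq[OF req_refine[OF weq_id[OF ob(2)] arr_id[OF ob(2)] s]])
  ultimately show "cmp D Y X Y (roof_image T N X Y s) (rc Y X (X, s, idt T X)) = idt D Y"
    using id_left[OF W_arr[OF s]] id_right[OF W_arr[OF s]] by (simp add: roof_image_rc)
qed

lemma image_iso':
  assumes "is_iso T X Y f" "X \<in> Ob T" "Y \<in> Ob T"
  shows "is_iso D X Y (roof_image T N X Y f)"
proof -
  obtain g where g: "ar X Y f" "ar Y X g" "cm X Y X g f = idt T X" "cm Y X Y f g = idt T Y"
    using is_isoE[OF assms] .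
  show ?thesis
    by (rule D.is_isoI[OF arr_image[OF g(1)] arr_image[OF g(2)]]) (use image_cmp[OF g(1,2)] image_cmp[OF g(2,1)] g in simp_all)
qed

text \<open>The hypothesis says that denominators over the summands can be summed to a denominator
  over S. A family of roofs on the summands then glues to one roof: its numerators are glued on the
  sum of their sources.\<close>

lemma direct_sum_localizes:
  assumes ds: "direct_sum T J X S \<iota>"
    and stable: "\<And>Z s. (\<And>j. j \<in> J \<Longrightarrow> W (Z j) (X j) (s j)) \<Longrightarrow> \<exists>S' \<kappa> r. direct_sum T J Z S' \<kappa> \<and> W S' S r \<and>
      (\<forall>j\<in>J. cm (Z j) S' S r (\<kappa> j) = cm (Z j) (X j) S (\<iota> j) (s j))"
  shows "direct_sum D J X S (\<lambda>j. roof_image T N (X j) S (\<iota> j))"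
proof (rule D.direct_sumI)
  note E = direct_sumD[OF ds]
  show "S \<in> Ob D" using E(1) by simp
  show "arr D (X j) S (roof_image T N (X j) S (\<iota> j))" if "j \<in> J" for j by (rule arr_image[OF E(2)[OF that]])
  {
    fix U \<phi> assume U: "U \<in> Ob D" and "\<And>j. j \<in> J \<Longrightarrow> arr D (X j) U (\<phi> j)"
    then have "\<forall>j\<in>J. \<exists>Z s f. W Z (X j) s \<and> ar Z U f \<and> \<phi> j = rc (X j) U (Z, s, f)" by (simp add: arr_D)
    then obtain Z s f where z: "\<And>j. j \<in> J \<Longrightarrow> W (Z j) (X j) (s j)" "\<And>j. j \<in> J \<Longrightarrow> ar (Z j) U (f j)"
      "\<And>j. j \<in> J \<Longrightarrow> \<phi> j = rc (X j) U (Z j, s j, f j)" by metis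
    from stable[OF z(1)] obtain S' \<kappa> r where S': "direct_sum T J Z S' \<kappa>" "W S' S r"
      "\<And>j. j \<in> J \<Longrightarrow> cm (Z j) S' S r (\<kappa> j) = cm (Z j) (X j) S (\<iota> j) (s j)" by blast
    note F = direct_sumD[OF S'(1)]
    obtain g where g: "ar S' U g" "\<And>j. j \<in> J \<Longrightarrow> cm (Z j) S' U g (\<kappa> j) = f j"
      using F(3)[of U f] U z(2) by auto
    have "roof_comp T N (X j) S U (rc S U (S', r, g)) (roof_image T N (X j) S (\<iota> j)) = \<phi> j" if j: "j \<in> J" for j
      using comp_image_right[OF E(2)[OF j] S'(2) g(1) z(1)[OF j] F(2)[OF j] S'(3)[OF j, symmetric]] g(2)[OF j] z(3)[OF j] by simp
    then show "\<exists>h. arr D S U h \<and> (\<forall>j\<in>J. cmp D (X j) S U h (roof_image T N (X j) S (\<iota> j)) = \<phi> j)"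
      using arr_rc[OF S'(2) g(1)] by (intro exI[of _ "rc S U (S', r, g)"]) simp
  next
    fix U \<phi> \<phi>' assume "arr D S U \<phi>" "arr D S U \<phi>'"
      and eq: "\<And>j. j \<in> J \<Longrightarrow> cmp D (X j) S U \<phi> (roof_image T N (X j) S (\<iota> j)) = cmp D (X j) S U \<phi>' (roof_image T N (X j) S (\<iota> j))"
    then obtain V0 t0 g0 V1 t1 g1 where v: "W V0 S t0" "ar V0 U g0" "\<phi> = rc S U (V0, t0, g0)"
      "W V1 S t1" "ar V1 U g1" "\<phi>' = rc S U (V1, t1, g1)" by (auto simp: arr_D)
    \<comment> \<open>For uniqueness, both roofs are brought to a common denominator t.\<close>
    obtain V x y where V: "W V V0 x" "ar V V1 y" "cm V V0 S t0 x = cm V V1 S t1 y" using ore[OF W_arr[OF v(1)] v(4)] by blast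
    define t where "t = cm V V0 S t0 x"
    define g where "g = cm V V0 U g0 x"
    define g' where "g' = cm V V1 U g1 y"
    have t: "W V S t" unfolding t_def by (rule weq_cmp[OF V(1) v(1)])
    have y: "W V V1 y" by (rule weq_left[OF v(4) V(2)]) (use t V(3) t_def in simp)
    have g: "ar V U g" "ar V U g'" unfolding g_def g'_def using arr_cmp[OF W_arr[OF V(1)] v(2)] arr_cmp[OF V(2) v(5)] by auto
    have \<phi>: "\<phi> = rc S U (V, t, g)" "\<phi>' = rc S U (V, t, g')"
      using rc_eq[OF req_refine[OF v(1,2) V(1)]] rc_eq[OF req_refine[OF v(4,5) y]] v(3,6) V(3)
      by (simp_all add: t_def g_def g'_def)
    \<comment> \<open>Equality on the j-th summand gives two legs a and b that agree only after s;
      cancelling s makes them equal on R, and the numerators g and g' then agree there.\<close>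
    have "\<exists>Z s u. W Z (X j) s \<and> ar Z V u \<and> cm Z (X j) S (\<iota> j) s = cm Z V S t u \<and> cm Z V U g u = cm Z V U g' u" if j: "j \<in> J" for j
    proof -
      obtain Z s u where z: "W Z (X j) s" "ar Z V u" "cm Z (X j) S (\<iota> j) s = cm Z V S t u" using ore[OF E(2)[OF j] t] by blast
      have "rc (X j) U (Z, s, cm Z V U g u) = rc (X j) U (Z, s, cm Z V U g' u)"
        using eq[OF j] comp_image_right[OF E(2)[OF j] t g(1) z] comp_image_right[OF E(2)[OF j] t g(2) z] \<phi> by simp
      from rc_eqD[OF this z(1) arr_cmp[OF z(2) g(1)]] obtain Q a b where q: "W Q Z a" "W Q Z b"
        "cm Q Z (X j) s a = cm Q Z (X j) s b" "cm Q Z U (cm Z V U g u) a = cm Q Z U (cm Z V U g' u) b"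
        by (rule reqE)
      obtain R c where c: "W R Q c" "cm R Q Z a c = cm R Q Z b c"
        using cancel[OF z(1) W_arr[OF q(1)] W_arr[OF q(2)] q(3)] by blast
      let ?z = "cm R Q Z a c"
      have zz: "W R Z ?z" by (rule weq_cmp[OF c(1) q(1)])
      note zz' = W_arr[OF zz]
      have "cm R Z U (cm Z V U g u) ?z = cm R Z U (cm Z V U g' u) ?z"
        using cm_lift[OF W_arr[OF q(1)] arr_cmp[OF z(2) g(1)] W_arr[OF q(2)] arr_cmp[OF z(2) g(2)] q(4) W_arr[OF c(1)]] c(2) by simp
      then have "cm R V U g (cm R Z V u ?z) = cm R V U g' (cm R Z V u ?z)"
        using assoc[OF zz' z(2) g(1)] assoc[OF zz' z(2) g(2)] by simp
      moreover have "cm R (X j) S (\<iota> j) (cm R Z (X j) s ?z) = cm R V S t (cm R Z V u ?z)"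
        by (rule cm_lift[OF W_arr[OF z(1)] E(2)[OF j] z(2) W_arr[OF t] z(3) zz'])
      ultimately show ?thesis using weq_cmp[OF zz z(1)] arr_cmp[OF zz' z(2)] by blast
    qed
    then obtain Z s u where z: "\<And>j. j \<in> J \<Longrightarrow> W (Z j) (X j) (s j)" "\<And>j. j \<in> J \<Longrightarrow> ar (Z j) V (u j)"
      "\<And>j. j \<in> J \<Longrightarrow> cm (Z j) (X j) S (\<iota> j) (s j) = cm (Z j) V S t (u j)"
      "\<And>j. j \<in> J \<Longrightarrow> cm (Z j) V U g (u j) = cm (Z j) V U g' (u j)" by metis
    from stable[OF z(1)] obtain S' \<kappa> r where S': "direct_sum T J Z S' \<kappa>" "W S' S r"
      "\<And>j. j \<in> J \<Longrightarrow> cm (Z j) S' S r (\<kappa> j) = cm (Z j) (X j) S (\<iota> j) (s j)" by blast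
    note F = direct_sumD[OF S'(1)]
    have "V \<in> Ob T" using t by (simp add: weq_def)
    from F(3)[OF this, of u] z(2) obtain k where k: "ar S' V k" "\<And>j. j \<in> J \<Longrightarrow> cm (Z j) S' V k (\<kappa> j) = u j" by blast
    \<comment> \<open>The glued k satisfies t k = r, a denominator, and equalises g and g'; so (k,
      k) is a refinement witnessing that the two roofs are equivalent.\<close>
    have tk: "cm S' V S t k = r"
    proof (rule F(4)[OF arr_cmp[OF k(1) W_arr[OF t]] W_arr[OF S'(2)]])
      fix j assume j: "j \<in> J"
      show "cm (Z j) S' S (cm S' V S t k) (\<kappa> j) = cm (Z j) S' S r (\<kappa> j)"
        using assoc[OF F(2)[OF j] k(1) W_arr[OF t]] k(2)[OF j] S'(3)[OF j] z(3)[OF j] by simp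
    qed
    have gk: "cm S' V U g k = cm S' V U g' k"
    proof (rule F(4)[OF arr_cmp[OF k(1) g(1)] arr_cmp[OF k(1) g(2)]])
      fix j assume j: "j \<in> J"
      show "cm (Z j) S' U (cm S' V U g k) (\<kappa> j) = cm (Z j) S' U (cm S' V U g' k) (\<kappa> j)"
        using assoc[OF F(2)[OF j] k(1) g(1)] assoc[OF F(2)[OF j] k(1) g(2)] k(2)[OF j] z(4)[OF j] by simp
    qed
    have "req S U (V, t, g) (V, t, g')"
      by (rule reqI[OF t g(1) t g(2) k(1) k(1) refl _ gk]) (use tk S'(2) in simp)
    then show "\<phi> = \<phi>'" unfolding \<phi> by (rule rc_eq)
  }
qed

text \<open>An initial object is the sum of the empty family, for which the identity is the required
  denominator.\<close>

lemma initial_localizes: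
  assumes "initial T Z" shows "initial D Z"
proof -
  have ds: "direct_sum T {} (\<lambda>_. Z) Z (\<lambda>_. undefined)" and Z: "Z \<in> Ob T"
    using direct_sum_empty[OF assms, of "\<lambda>_. Z"] assms by (auto simp: initial_def)
  have "direct_sum D {} (\<lambda>_. Z) Z (\<lambda>j. roof_image T N Z Z undefined)"
  proof (rule direct_sum_localizes[OF ds])
    fix Z' s show "\<exists>S' \<kappa> r. direct_sum T {} Z' S' \<kappa> \<and> W S' Z r \<and> (\<forall>j\<in>{}. cm (Z' j) S' Z r (\<kappa> j) = cm (Z' j) Z Z undefined (s j))"
      using direct_sum_empty[OF assms, of Z'] weq_id[OF Z] by auto
  qed
  then show ?thesis by (auto simp: initial_def direct_sum_def)
qed

text \<open>The triangle is related to its image by three identities. Only the last square needs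
  work: the shifted identity is formed elementwise from a class of roofs, and is compared with the
  identity of X[1] through \<open>comp_subset\<close>.\<close>

lemma Tri_image:
  assumes t: "(X, Y, Z, u, v, w) \<in> Tri T" and u: "ar X Y u" and v: "ar Y Z v" and w: "ar Z (shO T 1 X) w"
  shows "(X, Y, Z, roof_image T N X Y u, roof_image T N Y Z v, roof_image T N Z (shO T 1 X) w) \<in> Tri (verdier_quotient T N)"
proof -
  have ob: "X \<in> Ob T" "Y \<in> Ob T" "Z \<in> Ob T" "shO T 1 X \<in> Ob T" using u v w by (auto simp: arr_def)
  let ?X = "shO T 1 X"
  let ?\<alpha> = "shM D 1 (idt D X)"
  have sh: "?\<alpha> = (\<lambda>(Z, s, f). (shO T 1 Z, shM T 1 s, shM T 1 f)) ` rc X X (X, idt T X, idt T X)"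
    by (simp add: verdier_shift_cat_def roof_image_rc)
  have sub: "?\<alpha> \<subseteq> rc ?X ?X (?X, idt T ?X, idt T ?X)"
  proof
    fix r assume "r \<in> ?\<alpha>"
    then obtain V s f where r: "r = (shO T 1 V, shM T 1 s, shM T 1 f)" "req X X (X, idt T X, idt T X) (V, s, f)"
      unfolding sh using rc_mem[OF ob(1,1)] by force
    from r(2) obtain Q a b where q: "W X X (idt T X)" "ar X X (idt T X)" "W V X s" "ar V X f" "W Q X a" "W Q V b"
      "cm Q X X (idt T X) a = cm Q V X s b" "W Q X (cm Q X X (idt T X) a)" "cm Q X X (idt T X) a = cm Q V X f b"
      by (rule reqE)
    note qa = W_arr[OF q(5)] W_arr[OF q(6)] W_arr[OF q(3)]
    have "req ?X ?X (?X, shM T 1 (idt T X), shM T 1 (idt T X)) r" unfolding r(1)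
      by (rule reqI[OF shift_weq[OF q(1)] shift_arr[OF q(2)] shift_weq[OF q(3)] shift_arr[OF q(4)] shift_arr[OF qa(1)] shift_arr[OF qa(2)]])
        (use shift_cmp[OF qa(1) q(2)] shift_cmp[OF qa(2,3)] shift_cmp[OF qa(2) q(4)] shift_weq[OF q(8)] q(7,9) in simp_all)
    then show "r \<in> rc ?X ?X (?X, idt T ?X, idt T ?X)" using rc_mem[OF ob(4,4)] shift_id[OF ob(1)] by simp
  qed
  have mem: "(?X, idt T ?X, idt T ?X) \<in> ?\<alpha>"
    unfolding sh using req_refl[OF weq_id[OF ob(1)] arr_id[OF ob(1)]] rc_mem[OF ob(1,1)] shift_id[OF ob(1)]
    by (intro image_eqI[of _ _ "(X, idt T X, idt T X)"]) auto
  have w0: "roof_comp T N Z ?X ?X ?\<alpha> (roof_image T N Z ?X w) = roof_image T N Z ?X w"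
  proof -
    have e: "cm Z Z ?X w (idt T Z) = cm Z ?X ?X (idt T ?X) w" using id_left[OF w] id_right[OF w] by simp
    have m: "(Z, idt T Z, w) \<in> rc Z ?X (Z, idt T Z, w)"
      using req_refl[OF weq_id[OF ob(3)] w] rc_mem[OF ob(3,4)] by simp
    show ?thesis
      using comp_subset[OF weq_id[OF ob(3)] w weq_id[OF ob(4)] arr_id[OF ob(4)] weq_id[OF ob(3)] w e order_refl m sub mem]
        id_left[OF w] id_left[OF arr_id[OF ob(3)]] by (simp add: roof_image_rc)
  qed
  note A = arr_image[OF u] arr_image[OF v] arr_image[OF w]
  have "triangle_iso D (X, Y, Z, roof_image T N X Y u, roof_image T N Y Z v, roof_image T N Z ?X w)
      (X, Y, Z, roof_image T N X Y u, roof_image T N Y Z v, roof_image T N Z ?X w)"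
    unfolding triangle_iso_def prod.case
    using ob D.arrD(3)[OF A(1)] D.arrD(3)[OF A(2)] D.arrD(3)[OF A(3)]
      D.is_iso_idt[of X] D.is_iso_idt[of Y] D.is_iso_idt[of Z]
      D.id_left[OF A(1)] D.id_right[OF A(1)] D.id_left[OF A(2)] D.id_right[OF A(2)] D.id_right[OF A(3)] w0
    by (intro conjI exI[of _ "idt D X"] exI[of _ "idt D Y"] exI[of _ "idt D Z"]) (simp_all del: D_simps(2))
  then show ?thesis using t
    unfolding verdier_quotient_def shift_cat.extend_def tri_cat.fields_def by (simp, blast)
qed

lemma VQ_simps [simp]: "Ob (verdier_quotient T N) = Ob T" "shO (verdier_quotient T N) = shO T"
  by (simp_all add: verdier_quotient_def shift_cat.extend_def tri_cat.fields_def verdier_shift_cat_def)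

lemma direct_sum_VQ: "direct_sum (verdier_quotient T N) = direct_sum D"
  by (intro ext) (simp add: direct_sum_def verdier_quotient_def shift_cat.extend_def tri_cat.fields_def)

lemma add_closure_VQ: "add_closure (verdier_quotient T N) = add_closure D"
  by (intro ext) (simp add: add_closure_def direct_sum2_def direct_sum_VQ)

end

section \<open>The bounded homotopy category\<close>

context fda
begin

section \<open>Chain maps, homotopies and their composition\<close>

abbreviation cx :: "'a cochain \<Rightarrow> bool" where "cx C \<equiv> is_complex A C"
abbreviation bcx :: "'a cochain \<Rightarrow> bool" where "bcx C \<equiv> C \<in> bounded_complexes A"

text \<open>Arithmetic simplification may move the numeral to the front of a degree. These equations
  restore the form in which the rules for complexes are stated.\<close>

lemma int_plus_normal: "1 + i = i + (1::int)" "2 + i = i + (2::int)"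
  by simp_all

lemma bcx_cx: "bcx C \<Longrightarrow> cx C"
  by (simp add: bounded_complexes_def)

lemma cx2 [simp]:
  assumes C: "cx C"
  shows "x \<in> carrier (cob C (i + 1)) \<Longrightarrow> dif C (i + 1) x \<in> carrier (cob C (i + 2))"
    "x \<in> carrier (cob C (i + 1)) \<Longrightarrow> y \<in> carrier (cob C (i + 1)) \<Longrightarrow>
      dif C (i + 1) (x \<oplus>\<^bsub>cob C (i + 1)\<^esub> y) = dif C (i + 1) x \<oplus>\<^bsub>cob C (i + 2)\<^esub> dif C (i + 1) y"
    "x \<in> carrier (cob C (i + 1)) \<Longrightarrow> dif C (i + 1) (\<ominus>\<^bsub>cob C (i + 1)\<^esub> x) = \<ominus>\<^bsub>cob C (i + 2)\<^esub> dif C (i + 1) x"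
    "dif C (i + 1) \<zero>\<^bsub>cob C (i + 1)\<^esub> = \<zero>\<^bsub>cob C (i + 2)\<^esub>"
    "x \<in> carrier (cob C i) \<Longrightarrow> dif C (i + 1) (dif C i x) = \<zero>\<^bsub>cob C (i + 2)\<^esub>"
  using cx_closed[OF C, of x "i + 1"] cx_add[OF C, of x "i + 1" y] cx_neg[OF C, of x "i + 1"] cx_zero[OF C, of "i + 1"]
    cx_dd[OF C, of x i] by (simp_all add: add.assoc)

lemma cm_lh:
  assumes "f \<in> chain_maps A X Y"
  shows "f i \<in> lhom A (cob X i) (cob Y i)"
  using assms by (simp add: chain_maps_def)

lemma cm_rules:
  assumes X: "cx X" and Y: "cx Y" and f: "f \<in> chain_maps A X Y"
  shows "x \<in> carrier (cob X i) \<Longrightarrow> f i x \<in> carrier (cob Y i)"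
    "x \<in> carrier (cob X i) \<Longrightarrow> y \<in> carrier (cob X i) \<Longrightarrow> f i (x \<oplus>\<^bsub>cob X i\<^esub> y) = f i x \<oplus>\<^bsub>cob Y i\<^esub> f i y"
    "x \<in> carrier (cob X i) \<Longrightarrow> f i (\<ominus>\<^bsub>cob X i\<^esub> x) = \<ominus>\<^bsub>cob Y i\<^esub> f i x"
    "f i \<zero>\<^bsub>cob X i\<^esub> = \<zero>\<^bsub>cob Y i\<^esub>"
    "x \<in> carrier (cob X i) \<Longrightarrow> f (i + 1) (dif X i x) = dif Y i (f i x)"
    "x \<in> carrier (cob X (i - 1)) \<Longrightarrow> f i (dif X (i - 1) x) = dif Y (i - 1) (f (i - 1) x)"
    "x \<in> carrier (cob X (i + 1)) \<Longrightarrow> f (i + 2) (dif X (i + 1) x) = dif Y (i + 1) (f (i + 1) x)"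
    "x \<in> carrier (cob X i) \<Longrightarrow> a \<in> carrier A \<Longrightarrow> f i (a \<odot>\<^bsub>cob X i\<^esub> x) = a \<odot>\<^bsub>cob Y i\<^esub> f i x"
proof -
  note l = cm_lh[OF f]
  show "x \<in> carrier (cob X i) \<Longrightarrow> f i x \<in> carrier (cob Y i)" by (rule lh_closed[OF l])
  show "x \<in> carrier (cob X i) \<Longrightarrow> y \<in> carrier (cob X i) \<Longrightarrow> f i (x \<oplus>\<^bsub>cob X i\<^esub> y) = f i x \<oplus>\<^bsub>cob Y i\<^esub> f i y"
    by (rule lh_add[OF l])
  show "x \<in> carrier (cob X i) \<Longrightarrow> f i (\<ominus>\<^bsub>cob X i\<^esub> x) = \<ominus>\<^bsub>cob Y i\<^esub> f i x" by (rule lh_neg[OF l]) (use X Y in auto)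
  show "f i \<zero>\<^bsub>cob X i\<^esub> = \<zero>\<^bsub>cob Y i\<^esub>" by (rule lh_zero[OF l]) (use X Y in auto)
  show c: "x \<in> carrier (cob X i) \<Longrightarrow> f (i + 1) (dif X i x) = dif Y i (f i x)" for x i using f by (simp add: chain_maps_def)
  show "x \<in> carrier (cob X (i - 1)) \<Longrightarrow> f i (dif X (i - 1) x) = dif Y (i - 1) (f (i - 1) x)" using c[of x "i - 1"] by simp
  show "x \<in> carrier (cob X (i + 1)) \<Longrightarrow> f (i + 2) (dif X (i + 1) x) = dif Y (i + 1) (f (i + 1) x)"
    using c[of x "i + 1"] by (simp add: add.assoc)
  show "x \<in> carrier (cob X i) \<Longrightarrow> a \<in> carrier A \<Longrightarrow> f i (a \<odot>\<^bsub>cob X i\<^esub> x) = a \<odot>\<^bsub>cob Y i\<^esub> f i x"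
    by (rule lh_sm[OF l])
qed

lemma cmI:
  "(\<And>i. f i \<in> lhom A (cob X i) (cob Y i)) \<Longrightarrow> (\<And>i x. x \<in> carrier (cob X i) \<Longrightarrow> dif Y i (f i x) = f (i + 1) (dif X i x)) \<Longrightarrow>
    f \<in> chain_maps A X Y"
  by (simp add: chain_maps_def)

lemma hrI:
  assumes "f \<in> chain_maps A X Y" "g \<in> chain_maps A X Y" "\<And>i. h i \<in> lhom A (cob X i) (cob Y (i - 1))"
    "\<And>i x. x \<in> carrier (cob X i) \<Longrightarrow> f i x = g i x \<oplus>\<^bsub>cob Y i\<^esub> (dif Y (i - 1) (h i x) \<oplus>\<^bsub>cob Y i\<^esub> h (i + 1) (dif X i x))"
  shows "(f, g) \<in> homotopy_rel A X Y"
  using assms by (auto simp: homotopy_rel_def)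

lemma hrE:
  assumes "(f, g) \<in> homotopy_rel A X Y"
  obtains h where "f \<in> chain_maps A X Y" "g \<in> chain_maps A X Y" "\<And>i. h i \<in> lhom A (cob X i) (cob Y (i - 1))"
    "\<And>i x. x \<in> carrier (cob X i) \<Longrightarrow> f i x = g i x \<oplus>\<^bsub>cob Y i\<^esub> (dif Y (i - 1) (h i x) \<oplus>\<^bsub>cob Y i\<^esub> h (i + 1) (dif X i x))"
  using assms by (auto simp: homotopy_rel_def)

lemma hm_rules:
  assumes X: "cx X" and Y: "cx Y" and h: "\<And>i. h i \<in> lhom A (cob X i) (cob Y (i - 1))"
  shows "x \<in> carrier (cob X i) \<Longrightarrow> h i x \<in> carrier (cob Y (i - 1))"
    "x \<in> carrier (cob X (i + 1)) \<Longrightarrow> h (i + 1) x \<in> carrier (cob Y i)"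
    "x \<in> carrier (cob X (i + 2)) \<Longrightarrow> h (i + 2) x \<in> carrier (cob Y (i + 1))"
    "h i \<zero>\<^bsub>cob X i\<^esub> = \<zero>\<^bsub>cob Y (i - 1)\<^esub>"
    "h (i + 1) \<zero>\<^bsub>cob X (i + 1)\<^esub> = \<zero>\<^bsub>cob Y i\<^esub>"
    "x \<in> carrier (cob X (i - 1)) \<Longrightarrow> h (i - 1) x \<in> carrier (cob Y (i - 2))"
  using lh_closed[OF h] lh_closed[OF h, of x "i + 1"] lh_closed[OF h, of x "i + 2"] lh_closed[OF h, of x "i - 1"]
    lh_zero[OF h, of i] lh_zero[OF h, of "i + 1"] X Y
  by (simp_all add: int_plus_normal(1)[of i])

lemma hr_refl:
  assumes X: "cx X" and Y: "cx Y" and f: "f \<in> chain_maps A X Y"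
  shows "(f, f) \<in> homotopy_rel A X Y"
  by (rule hrI[where h = "\<lambda>i. \<lambda>x\<in>carrier (cob X i). \<zero>\<^bsub>cob Y (i - 1)\<^esub>"])
    (use X Y f cm_rules[OF X Y f] in \<open>simp_all add: lh_0\<close>)

lemma hr_sym:
  assumes X: "cx X" and Y: "cx Y" and fg: "(f, g) \<in> homotopy_rel A X Y"
  shows "(g, f) \<in> homotopy_rel A X Y"
proof -
  from hrE[OF fg] obtain h where f: "f \<in> chain_maps A X Y" and g: "g \<in> chain_maps A X Y" and
    h: "\<And>i. h i \<in> lhom A (cob X i) (cob Y (i - 1))" and
    e: "\<And>i x. x \<in> carrier (cob X i) \<Longrightarrow> f i x = g i x \<oplus>\<^bsub>cob Y i\<^esub> (dif Y (i - 1) (h i x) \<oplus>\<^bsub>cob Y i\<^esub> h (i + 1) (dif X i x))" by metis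
  note [simp] = cm_rules(1)[OF X Y f] cm_rules(1)[OF X Y g] hm_rules[OF X Y h]
  show ?thesis
  proof (rule hrI[OF g f, where h = "\<lambda>i. \<lambda>x\<in>carrier (cob X i). \<ominus>\<^bsub>cob Y (i - 1)\<^esub> h i x"])
    show "(\<lambda>x\<in>carrier (cob X i). \<ominus>\<^bsub>cob Y (i - 1)\<^esub> h i x) \<in> lhom A (cob X i) (cob Y (i - 1))" for i
      by (rule lh_uminus[OF _ _ h]) (use X Y in auto)
  qed (use X Y in \<open>simp add: e lm_ac\<close>)
qed

lemma hr_trans:
  assumes X: "cx X" and Y: "cx Y" and fg: "(f, g) \<in> homotopy_rel A X Y" and gk: "(g, k) \<in> homotopy_rel A X Y"
  shows "(f, k) \<in> homotopy_rel A X Y"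
proof -
  from hrE[OF fg] obtain h where f: "f \<in> chain_maps A X Y" and g: "g \<in> chain_maps A X Y" and
    h: "\<And>i. h i \<in> lhom A (cob X i) (cob Y (i - 1))" and
    e: "\<And>i x. x \<in> carrier (cob X i) \<Longrightarrow> f i x = g i x \<oplus>\<^bsub>cob Y i\<^esub> (dif Y (i - 1) (h i x) \<oplus>\<^bsub>cob Y i\<^esub> h (i + 1) (dif X i x))" by metis
  from hrE[OF gk] obtain h' where k: "k \<in> chain_maps A X Y" and
    h': "\<And>i. h' i \<in> lhom A (cob X i) (cob Y (i - 1))" and
    e': "\<And>i x. x \<in> carrier (cob X i) \<Longrightarrow> g i x = k i x \<oplus>\<^bsub>cob Y i\<^esub> (dif Y (i - 1) (h' i x) \<oplus>\<^bsub>cob Y i\<^esub> h' (i + 1) (dif X i x))" by metis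
  note [simp] = cm_rules(1)[OF X Y f] cm_rules(1)[OF X Y g] cm_rules(1)[OF X Y k] hm_rules[OF X Y h] hm_rules[OF X Y h']
  show ?thesis
  proof (rule hrI[OF f k, where h = "\<lambda>i. \<lambda>x\<in>carrier (cob X i). h i x \<oplus>\<^bsub>cob Y (i - 1)\<^esub> h' i x"])
    show "(\<lambda>x\<in>carrier (cob X i). h i x \<oplus>\<^bsub>cob Y (i - 1)\<^esub> h' i x) \<in> lhom A (cob X i) (cob Y (i - 1))" for i
      by (rule lh_plus[OF _ _ h h']) (use X Y in auto)
  qed (use X Y in \<open>simp add: e e' lm_ac\<close>)
qed

lemma hr_equiv: "cx X \<Longrightarrow> cx Y \<Longrightarrow> equiv (chain_maps A X Y) (homotopy_rel A X Y)"
proof (rule equivI)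
  show "homotopy_rel A X Y \<subseteq> chain_maps A X Y \<times> chain_maps A X Y"
    by (auto simp: homotopy_rel_def)
  assume c: "cx X" "cx Y"
  show "refl_on (chain_maps A X Y) (homotopy_rel A X Y)" by (rule refl_onI) (rule hr_refl[OF c])
  show "sym (homotopy_rel A X Y)" by (rule symI) (rule hr_sym[OF c])
  show "trans (homotopy_rel A X Y)" by (rule transI) (rule hr_trans[OF c])
qed

definition cc :: "'a cochain \<Rightarrow> (int \<Rightarrow> 'a umap) \<Rightarrow> (int \<Rightarrow> 'a umap) \<Rightarrow> int \<Rightarrow> 'a umap" where
  "cc X g f = (\<lambda>i. compose (carrier (cob X i)) (g i) (f i))"

lemma cc_apply [simp]: "x \<in> carrier (cob X i) \<Longrightarrow> cc X g f i x = g i (f i x)"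
  by (simp add: cc_def compose_eq)

lemma hr_ccE:
  assumes "(cc X g f, cc X g' f') \<in> homotopy_rel A X Z"
  obtains h where "\<And>i. h i \<in> lhom A (cob X i) (cob Z (i - 1))"
    "\<And>i x. x \<in> carrier (cob X i) \<Longrightarrow>
      g i (f i x) = g' i (f' i x) \<oplus>\<^bsub>cob Z i\<^esub> (dif Z (i - 1) (h i x) \<oplus>\<^bsub>cob Z i\<^esub> h (i + 1) (dif X i x))"
proof -
  from hrE[OF assms] obtain h where h: "\<And>i. h i \<in> lhom A (cob X i) (cob Z (i - 1))" and
    e: "\<And>i x. x \<in> carrier (cob X i) \<Longrightarrow> cc X g f i x =
      cc X g' f' i x \<oplus>\<^bsub>cob Z i\<^esub> (dif Z (i - 1) (h i x) \<oplus>\<^bsub>cob Z i\<^esub> h (i + 1) (dif X i x))" by metis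
  show ?thesis by (rule that[OF h]) (use e in simp)
qed

lemma cc_cm:
  assumes X: "cx X" and Y: "cx Y" and Z: "cx Z" and f: "f \<in> chain_maps A X Y" and g: "g \<in> chain_maps A Y Z"
  shows "cc X g f \<in> chain_maps A X Z"
proof (rule cmI)
  show "cc X g f i \<in> lhom A (cob X i) (cob Z i)" for i
    unfolding cc_def by (rule lh_comp[OF _ cm_lh[OF f] cm_lh[OF g]]) (use X in simp)
  fix i x assume x: "x \<in> carrier (cob X i)"
  then show "dif Z i (cc X g f i x) = cc X g f (i + 1) (dif X i x)"
    using X cm_rules[OF X Y f] cm_rules[OF Y Z g] by simp
qed

lemma hr_cc_right:
  assumes X: "cx X" and Y: "cx Y" and Z: "cx Z" and ff: "(f, f') \<in> homotopy_rel A X Y" and g: "g \<in> chain_maps A Y Z"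
  shows "(cc X g f, cc X g f') \<in> homotopy_rel A X Z"
proof -
  from hrE[OF ff] obtain h where f: "f \<in> chain_maps A X Y" and f': "f' \<in> chain_maps A X Y" and
    h: "\<And>i. h i \<in> lhom A (cob X i) (cob Y (i - 1))" and
    e: "\<And>i x. x \<in> carrier (cob X i) \<Longrightarrow> f i x = f' i x \<oplus>\<^bsub>cob Y i\<^esub> (dif Y (i - 1) (h i x) \<oplus>\<^bsub>cob Y i\<^esub> h (i + 1) (dif X i x))" by metis
  note [simp] = cm_rules(1)[OF X Y f] cm_rules(1)[OF X Y f'] cm_rules[OF Y Z g] hm_rules[OF X Y h]
  show ?thesis
  proof (rule hrI[OF cc_cm[OF X Y Z f g] cc_cm[OF X Y Z f' g], where h = "\<lambda>i. compose (carrier (cob X i)) (g (i - 1)) (h i)"])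
    show "compose (carrier (cob X i)) (g (i - 1)) (h i) \<in> lhom A (cob X i) (cob Z (i - 1))" for i
      by (rule lh_comp[OF _ h cm_lh[OF g]]) (use X in auto)
  qed (use X Y Z in \<open>simp add: e compose_eq\<close>)
qed

lemma hr_cc_left:
  assumes X: "cx X" and Y: "cx Y" and Z: "cx Z" and f: "f \<in> chain_maps A X Y" and gg: "(g, g') \<in> homotopy_rel A Y Z"
  shows "(cc X g f, cc X g' f) \<in> homotopy_rel A X Z"
proof -
  from hrE[OF gg] obtain h where g: "g \<in> chain_maps A Y Z" and g': "g' \<in> chain_maps A Y Z" and
    h: "\<And>i. h i \<in> lhom A (cob Y i) (cob Z (i - 1))" and
    e: "\<And>i x. x \<in> carrier (cob Y i) \<Longrightarrow> g i x = g' i x \<oplus>\<^bsub>cob Z i\<^esub> (dif Z (i - 1) (h i x) \<oplus>\<^bsub>cob Z i\<^esub> h (i + 1) (dif Y i x))" by metis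
  note [simp] = cm_rules[OF X Y f] cm_rules(1)[OF Y Z g] cm_rules(1)[OF Y Z g'] hm_rules[OF Y Z h]
  show ?thesis
  proof (rule hrI[OF cc_cm[OF X Y Z f g] cc_cm[OF X Y Z f g'], where h = "\<lambda>i. compose (carrier (cob X i)) (h i) (f i)"])
    show "compose (carrier (cob X i)) (h i) (f i) \<in> lhom A (cob X i) (cob Z (i - 1))" for i
      by (rule lh_comp[OF _ cm_lh[OF f] h]) (use X in auto)
  qed (use X Y Z in \<open>simp add: e compose_eq\<close>)
qed

lemma hr_cc:
  assumes "cx X" "cx Y" "cx Z" "(f, f') \<in> homotopy_rel A X Y" "(g, g') \<in> homotopy_rel A Y Z"
  shows "(cc X g f, cc X g' f') \<in> homotopy_rel A X Z"
  using hr_trans[OF assms(1,3) hr_cc_right[OF assms(1-4)] hr_cc_left[OF assms(1-3) _ assms(5)]] assms(4,5)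
  by (auto simp: homotopy_rel_def)

lemma hclass_eq_iff:
  assumes "cx X" "cx Y" "f \<in> chain_maps A X Y" "g \<in> chain_maps A X Y"
  shows "hclass A X Y f = hclass A X Y g \<longleftrightarrow> (f, g) \<in> homotopy_rel A X Y"
  unfolding hclass_def using eq_equiv_class_iff[OF hr_equiv[OF assms(1,2)] assms(3,4)] .

lemma hclass_eqI: "cx X \<Longrightarrow> cx Y \<Longrightarrow> (f, g) \<in> homotopy_rel A X Y \<Longrightarrow> hclass A X Y f = hclass A X Y g"
  unfolding hclass_def by (rule equiv_class_eq[OF hr_equiv])

lemma hclass_mem: "g \<in> hclass A X Y f \<longleftrightarrow> (f, g) \<in> homotopy_rel A X Y"
  by (simp add: hclass_def)

definition icm :: "'a cochain \<Rightarrow> int \<Rightarrow> 'a umap" where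
  "icm X = (\<lambda>i. \<lambda>x\<in>carrier (cob X i). x)"

lemma icm_cm: "cx X \<Longrightarrow> icm X \<in> chain_maps A X X"
  by (rule cmI) (auto simp: icm_def lh_id)

section \<open>The homotopy category as a category\<close>

lemma Kb_simps [simp]:
  "Ob (Kb A) = bounded_complexes A" "Hm (Kb A) X Y = chain_maps A X Y // homotopy_rel A X Y"
  "idt (Kb A) X = hclass A X X (icm X)" "shO (Kb A) = shift_cx"
  "shM (Kb A) n \<phi> = (\<lambda>f i. f (i + n)) ` \<phi>"
  "cmp (Kb A) X Y Z \<psi> \<phi> = (\<Union>f\<in>\<phi>. \<Union>g\<in>\<psi>. hclass A X Z (cc X g f))"
  by (simp_all add: Kb_def Kb_shift_cat_def shift_cat.extend_def tri_cat.fields_def icm_def cc_def)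

lemma Ks_simps:
  "Ob (Kb_shift_cat A) = Ob (Kb A)" "Hm (Kb_shift_cat A) = Hm (Kb A)" "idt (Kb_shift_cat A) = idt (Kb A)"
  "shO (Kb_shift_cat A) = shO (Kb A)" "shM (Kb_shift_cat A) = shM (Kb A)" "cmp (Kb_shift_cat A) = cmp (Kb A)"
  by (simp_all add: Kb_def Kb_shift_cat_def shift_cat.extend_def tri_cat.fields_def)

lemma is_iso_Ks: "is_iso (Kb_shift_cat A) = is_iso (Kb A)"
  by (intro ext) (simp add: is_iso_def Ks_simps del: Kb_simps)

lemma arr_Kb: "arr (Kb A) X Y \<phi> \<longleftrightarrow> bcx X \<and> bcx Y \<and> (\<exists>f\<in>chain_maps A X Y. \<phi> = hclass A X Y f)"
  by (auto simp: arr_def hclass_def quotient_def)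

lemma cmp_subset:
  assumes X: "cx X" and Y: "cx Y" and Z: "cx Z" and f: "f \<in> chain_maps A X Y" and g: "g \<in> chain_maps A Y Z"
    and \<phi>: "\<phi> \<subseteq> hclass A X Y f" "f \<in> \<phi>" and \<psi>: "\<psi> \<subseteq> hclass A Y Z g" "g \<in> \<psi>"
  shows "cmp (Kb A) X Y Z \<psi> \<phi> = hclass A X Z (cc X g f)"
proof -
  have "hclass A X Z (cc X g' f') = hclass A X Z (cc X g f)" if "f' \<in> \<phi>" "g' \<in> \<psi>" for f' g'
  proof -
    have "(f, f') \<in> homotopy_rel A X Y" "(g, g') \<in> homotopy_rel A Y Z" using that \<phi> \<psi> hclass_mem by blast+
    from hclass_eqI[OF X Z hr_cc[OF X Y Z this]] show ?thesis by simp
  qed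
  note e = this
  show ?thesis
  proof (intro equalityI subsetI)
    fix k assume "k \<in> cmp (Kb A) X Y Z \<psi> \<phi>"
    then obtain f' g' where "f' \<in> \<phi>" "g' \<in> \<psi>" "k \<in> hclass A X Z (cc X g' f')" unfolding Kb_simps UN_iff by blast
    then show "k \<in> hclass A X Z (cc X g f)" using e by blast
  next
    fix k assume "k \<in> hclass A X Z (cc X g f)"
    then show "k \<in> cmp (Kb A) X Y Z \<psi> \<phi>" unfolding Kb_simps UN_iff using \<phi>(2) \<psi>(2) by blast
  qed
qed

lemma cmp_hclass:
  assumes X: "cx X" and Y: "cx Y" and Z: "cx Z" and f: "f \<in> chain_maps A X Y" and g: "g \<in> chain_maps A Y Z"
  shows "cmp (Kb A) X Y Z (hclass A Y Z g) (hclass A X Y f) = hclass A X Z (cc X g f)"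
  by (rule cmp_subset[OF assms order_refl _ order_refl]) (use hr_refl[OF X Y f] hr_refl[OF Y Z g] hclass_mem in auto)

lemma cc_icm: "f \<in> chain_maps A X Y \<Longrightarrow> cc X f (icm X) = f" "f \<in> chain_maps A X Y \<Longrightarrow> cc X (icm Y) f = f"
proof -
  assume f: "f \<in> chain_maps A X Y"
  note l = cm_lh[OF f]
  show "cc X f (icm X) = f" "cc X (icm Y) f = f"
    using lh_ext[OF l] lh_closed[OF l] by (auto simp: cc_def icm_def compose_def intro!: ext)
qed

lemma precat_Kb: "precat (Kb A)"
proof
  fix X assume "X \<in> Ob (Kb A)"
  then show "arr (Kb A) X X (idt (Kb A) X)" using icm_cm bcx_cx by (auto simp: arr_Kb)
next
  fix X Y \<phi> Z \<psi> assume "arr (Kb A) X Y \<phi>" "arr (Kb A) Y Z \<psi>"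
  then obtain f g where *: "bcx X" "bcx Y" "bcx Z" "f \<in> chain_maps A X Y" "g \<in> chain_maps A Y Z"
    "\<phi> = hclass A X Y f" "\<psi> = hclass A Y Z g" by (auto simp: arr_Kb)
  note c = *(1-3)[THEN bcx_cx]
  show "arr (Kb A) X Z (cmp (Kb A) X Y Z \<psi> \<phi>)"
    unfolding *(6,7) cmp_hclass[OF c *(4,5)] using cc_cm[OF c *(4,5)] * by (auto simp: arr_Kb)
next
  fix X Y \<phi> assume "arr (Kb A) X Y \<phi>"
  then obtain f where *: "bcx X" "bcx Y" "f \<in> chain_maps A X Y" "\<phi> = hclass A X Y f" by (auto simp: arr_Kb)
  note c = *(1,2)[THEN bcx_cx]
  show "cmp (Kb A) X Y Y (idt (Kb A) Y) \<phi> = \<phi>"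
    unfolding *(4) Kb_simps(3) cmp_hclass[OF c c(2) *(3) icm_cm[OF c(2)]] cc_icm[OF *(3)] ..
  show "cmp (Kb A) X X Y \<phi> (idt (Kb A) X) = \<phi>"
    unfolding *(4) Kb_simps(3) cmp_hclass[OF c(1) c icm_cm[OF c(1)] *(3)] cc_icm[OF *(3)] ..
next
  fix W X Y Z \<epsilon> \<phi> \<psi> assume "arr (Kb A) W X \<epsilon>" "arr (Kb A) X Y \<phi>" "arr (Kb A) Y Z \<psi>"
  then obtain e f g where *: "bcx W" "bcx X" "bcx Y" "bcx Z" "e \<in> chain_maps A W X" "f \<in> chain_maps A X Y" "g \<in> chain_maps A Y Z"
    "\<epsilon> = hclass A W X e" "\<phi> = hclass A X Y f" "\<psi> = hclass A Y Z g" by (auto simp: arr_Kb)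
  note c = *(1-4)[THEN bcx_cx]
  have "cc W (cc X g f) e = cc W g (cc W f e)"
    using lh_closed[OF cm_lh[OF *(5)]] by (auto simp: cc_def compose_def intro!: ext)
  then show "cmp (Kb A) W X Z (cmp (Kb A) X Y Z \<psi> \<phi>) \<epsilon> = cmp (Kb A) W Y Z \<psi> (cmp (Kb A) W X Y \<phi> \<epsilon>)"
    unfolding *(8-10) cmp_hclass[OF c(2-4) *(6,7)] cmp_hclass[OF c(1-3) *(5,6)]
      cmp_hclass[OF c(1,2,4) *(5) cc_cm[OF c(2-4) *(6,7)]] cmp_hclass[OF c(1,3,4) cc_cm[OF c(1-3) *(5,6)] *(7)] by simp
qed

sublocale Kbc: precat "Kb A" by (rule precat_Kb)

subsection \<open>Shifts\<close>

lemma shift_cob [simp]: "cob (shift_cx n X) i = cob X (i + n)"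
  by (simp add: shift_cx_def)

lemma shift_dif: "x \<in> carrier (cob X (i + n)) \<Longrightarrow>
    dif (shift_cx n X) i x = (if even n then dif X (i + n) x else \<ominus>\<^bsub>cob X (i + n + 1)\<^esub> dif X (i + n) x)"
  by (simp add: shift_cx_def)

lemma cx_shift:
  assumes X: "cx X" shows "cx (shift_cx n X)"
  unfolding is_complex_def
proof (intro allI conjI ballI)
  fix i
  have [simp]: "i + 1 + n = i + n + 1" "i + 2 + n = i + n + 2" by auto
  show "fg (cob (shift_cx n X) i)" using X by simp
  show "dif (shift_cx n X) i \<in> lhom A (cob (shift_cx n X) i) (cob (shift_cx n X) (i + 1))"
    using X lh_uminus[OF _ _ cx_lh[OF X, of "i + n"]] by (auto simp: shift_cx_def)
  fix x assume "x \<in> carrier (cob (shift_cx n X) i)"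
  then have x: "x \<in> carrier (cob X (i + n))" by simp
  define j where "j = i + n"
  have j: "i + 1 + n = j + 1" "i + 2 + n = j + 2" by (auto simp: j_def)
  show "dif (shift_cx n X) (i + 1) (dif (shift_cx n X) i x) = \<zero>\<^bsub>cob (shift_cx n X) (i + 2)\<^esub>"
    using X x unfolding shift_cx_def cochain.simps j j_def[symmetric] by (auto simp: int_plus_normal(2)[of j])
qed

lemma bcx_shift: "bcx X \<Longrightarrow> bcx (shift_cx n X)"
proof -
  assume X: "bcx X"
  then obtain k :: nat where k: "\<And>i. \<bar>i\<bar> > int k \<Longrightarrow> zero_module (cob X i)" by (auto simp: bounded_complexes_def)
  have "zero_module (cob (shift_cx n X) i)" if "\<bar>i\<bar> > int (k + nat \<bar>n\<bar>)" for i
    using that by (auto intro!: k)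
  then show ?thesis using cx_shift[OF bcx_cx[OF X], of n] unfolding bounded_complexes_def by blast
qed

lemma shift_dif1 [simp]: "x \<in> carrier (cob X (i + 1)) \<Longrightarrow> dif (shift_cx 1 X) i x = \<ominus>\<^bsub>cob X (i + 2)\<^esub> dif X (i + 1) x"
  using shift_dif[of x X i 1] by (simp add: add.assoc)

lemma shift_difm [simp]: "x \<in> carrier (cob X (i - 1)) \<Longrightarrow> dif (shift_cx (- 1) X) i x = \<ominus>\<^bsub>cob X i\<^esub> dif X (i - 1) x"
  using shift_dif[of x X i "- 1"] by simp

lemma cm_shift_iff:
  assumes X: "cx X" and Y: "cx Y"
  shows "(\<lambda>i. f (i + 1)) \<in> chain_maps A (shift_cx 1 X) (shift_cx 1 Y) \<longleftrightarrow> f \<in> chain_maps A X Y"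
proof
  assume f: "f \<in> chain_maps A X Y"
  note [simp] = cm_rules[OF X Y f]
  show "(\<lambda>i. f (i + 1)) \<in> chain_maps A (shift_cx 1 X) (shift_cx 1 Y)"
  proof (rule cmI)
    show "f (i + 1) \<in> lhom A (cob (shift_cx 1 X) i) (cob (shift_cx 1 Y) i)" for i using cm_lh[OF f] by simp
    fix i x assume "x \<in> carrier (cob (shift_cx 1 X) i)"
    then show "dif (shift_cx 1 Y) i (f (i + 1) x) = f (i + 1 + 1) (dif (shift_cx 1 X) i x)"
      using X Y cm_rules(3,7)[OF X Y f] by (simp add: add.assoc)
  qed
next
  assume f: "(\<lambda>i. f (i + 1)) \<in> chain_maps A (shift_cx 1 X) (shift_cx 1 Y)"
  have l: "f i \<in> lhom A (cob X i) (cob Y i)" for i using cm_lh[OF f, of "i - 1"] by simp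
  show "f \<in> chain_maps A X Y"
  proof (rule cmI[OF l])
    fix i x assume x: "x \<in> carrier (cob X i)"
    have "dif (shift_cx 1 Y) (i - 1) (f i x) = f (i + 1) (dif (shift_cx 1 X) (i - 1) x)"
      using f x unfolding chain_maps_def by (auto dest!: spec[of _ "i - 1"] simp: int_plus_normal(1)[of i])
    then have "\<ominus>\<^bsub>cob Y (i + 1)\<^esub> dif Y i (f i x) = \<ominus>\<^bsub>cob Y (i + 1)\<^esub> f (i + 1) (dif X i x)"
      using x X Y lh_closed[OF l x] lh_neg[OF l, of "i + 1" "dif X i x"] shift_dif[of x X "i - 1" 1]
        shift_dif[of "f i x" Y "i - 1" 1] by simp
    then show "dif Y i (f i x) = f (i + 1) (dif X i x)"
      using x X Y lh_closed[OF l] lm_negneg[OF cx_lm[OF Y, of "i + 1"]] by (metis cx_closed)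
  qed
qed

text \<open>The shift negates the differential, so the homotopy is negated too. The equivalence, not
  just one implication, is what makes the shift of a class a full class in
  \<open>shM_hclass\<close>.\<close>

lemma hr_shift_iff:
  assumes X: "cx X" and Y: "cx Y"
  shows "((\<lambda>i. f (i + 1)), (\<lambda>i. g (i + 1))) \<in> homotopy_rel A (shift_cx 1 X) (shift_cx 1 Y) \<longleftrightarrow> (f, g) \<in> homotopy_rel A X Y"
proof
  note s = cm_shift_iff[OF X Y]
  {
    assume "(f, g) \<in> homotopy_rel A X Y"
    from hrE[OF this] obtain h where f: "f \<in> chain_maps A X Y" and g: "g \<in> chain_maps A X Y" and
      h: "\<And>i. h i \<in> lhom A (cob X i) (cob Y (i - 1))" and
      e: "\<And>i x. x \<in> carrier (cob X i) \<Longrightarrow> f i x = g i x \<oplus>\<^bsub>cob Y i\<^esub> (dif Y (i - 1) (h i x) \<oplus>\<^bsub>cob Y i\<^esub> h (i + 1) (dif X i x))" by metis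
    note [simp] = hm_rules[OF X Y h]
    have h1: "h (i + 1) \<in> lhom A (cob X (i + 1)) (cob Y i)" for i using h[of "i + 1"] by simp
    show "((\<lambda>i. f (i + 1)), (\<lambda>i. g (i + 1))) \<in> homotopy_rel A (shift_cx 1 X) (shift_cx 1 Y)"
    proof (rule hrI[where h = "\<lambda>i. \<lambda>x\<in>carrier (cob X (i + 1)). \<ominus>\<^bsub>cob Y i\<^esub> h (i + 1) x"])
      show "(\<lambda>x\<in>carrier (cob X (i + 1)). \<ominus>\<^bsub>cob Y i\<^esub> h (i + 1) x) \<in> lhom A (cob (shift_cx 1 X) i) (cob (shift_cx 1 Y) (i - 1))" for i
        using lh_uminus[OF _ _ h1] X Y by simp
      fix i x assume x: "x \<in> carrier (cob (shift_cx 1 X) i)"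
      have "h (i + 2) \<in> lhom A (cob X (i + 2)) (cob Y (i + 1))" using h1[of "i + 1"] by (simp add: add.assoc)
      from lh_neg[OF this, of "dif X (i + 1) x"] 
      show "f (i + 1) x = g (i + 1) x \<oplus>\<^bsub>cob (shift_cx 1 Y) i\<^esub>
          (dif (shift_cx 1 Y) (i - 1) ((\<lambda>x\<in>carrier (cob X (i + 1)). \<ominus>\<^bsub>cob Y i\<^esub> h (i + 1) x) x) \<oplus>\<^bsub>cob (shift_cx 1 Y) i\<^esub>
          (\<lambda>x\<in>carrier (cob X (i + 1 + 1)). \<ominus>\<^bsub>cob Y (i + 1)\<^esub> h (i + 1 + 1) x) (dif (shift_cx 1 X) i x))"
        using x X Y e[of x "i + 1"] shift_dif[of "\<ominus>\<^bsub>cob Y i\<^esub> h (i + 1) x" Y "i - 1" 1] by (simp add: add.assoc)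
    qed (use f g s in auto)
  next
    assume "((\<lambda>i. f (i + 1)), (\<lambda>i. g (i + 1))) \<in> homotopy_rel A (shift_cx 1 X) (shift_cx 1 Y)"
    from hrE[OF this] obtain h where f: "(\<lambda>i. f (i + 1)) \<in> chain_maps A (shift_cx 1 X) (shift_cx 1 Y)"
      and g: "(\<lambda>i. g (i + 1)) \<in> chain_maps A (shift_cx 1 X) (shift_cx 1 Y)" and
      h: "\<And>i. h i \<in> lhom A (cob X (i + 1)) (cob Y i)" and
      e: "\<And>i x. x \<in> carrier (cob X (i + 1)) \<Longrightarrow> f (i + 1) x = g (i + 1) x \<oplus>\<^bsub>cob Y (i + 1)\<^esub>
        (dif (shift_cx 1 Y) (i - 1) (h i x) \<oplus>\<^bsub>cob Y (i + 1)\<^esub> h (i + 1) (dif (shift_cx 1 X) i x))"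
      by (metis (no_types, lifting) diff_add_cancel shift_cob)
    have hc: "x \<in> carrier (cob X (i + 1)) \<Longrightarrow> h i x \<in> carrier (cob Y i)" for i x by (rule lh_closed[OF h])
    have h': "h (i - 1) \<in> lhom A (cob X i) (cob Y (i - 1))" for i using h[of "i - 1"] by simp
    have hc': "x \<in> carrier (cob X i) \<Longrightarrow> h (i - 1) x \<in> carrier (cob Y (i - 1))" for i x by (rule lh_closed[OF h'])
    show "(f, g) \<in> homotopy_rel A X Y"
    proof (rule hrI[where h = "\<lambda>i. \<lambda>x\<in>carrier (cob X i). \<ominus>\<^bsub>cob Y (i - 1)\<^esub> h (i - 1) x"])
      show "(\<lambda>x\<in>carrier (cob X i). \<ominus>\<^bsub>cob Y (i - 1)\<^esub> h (i - 1) x) \<in> lhom A (cob X i) (cob Y (i - 1))" for i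
        by (rule lh_uminus[OF _ _ h']) (use X Y in auto)
      fix i x assume x: "x \<in> carrier (cob X i)"
      have 1: "dif (shift_cx 1 Y) (i - 1 - 1) (h (i - 1) x) = \<ominus>\<^bsub>cob Y i\<^esub> dif Y (i - 1) (h (i - 1) x)"
        using shift_dif[of "h (i - 1) x" Y "i - 1 - 1" 1] hc'[OF x] by simp
      have 2: "h i (dif (shift_cx 1 X) (i - 1) x) = \<ominus>\<^bsub>cob Y i\<^esub> h i (dif X i x)"
        using shift_dif[of x X "i - 1" 1] x lh_neg[OF h, of i "dif X i x"] X Y by simp
      show "f i x = g i x \<oplus>\<^bsub>cob Y i\<^esub> (dif Y (i - 1) ((\<lambda>x\<in>carrier (cob X i). \<ominus>\<^bsub>cob Y (i - 1)\<^esub> h (i - 1) x) x) \<oplus>\<^bsub>cob Y i\<^esub>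
          (\<lambda>x\<in>carrier (cob X (i + 1)). \<ominus>\<^bsub>cob Y (i + 1 - 1)\<^esub> h (i + 1 - 1) x) (dif X i x))"
        using e[of x "i - 1"] x X Y hc' 1 2 by simp
    qed (use f g s in auto)
  }
qed

lemma shM_hclass:
  assumes X: "cx X" and Y: "cx Y"
  shows "shM (Kb A) 1 (hclass A X Y f) = hclass A (shift_cx 1 X) (shift_cx 1 Y) (\<lambda>i. f (i + 1))"
proof (intro equalityI subsetI)
  fix k assume "k \<in> shM (Kb A) 1 (hclass A X Y f)"
  then obtain k' where "k' \<in> hclass A X Y f" "k = (\<lambda>i. k' (i + 1))" unfolding Kb_simps by blast
  then show "k \<in> hclass A (shift_cx 1 X) (shift_cx 1 Y) (\<lambda>i. f (i + 1))"
    using hr_shift_iff[OF X Y, of f k'] by (simp add: hclass_mem)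
next
  fix k assume k: "k \<in> hclass A (shift_cx 1 X) (shift_cx 1 Y) (\<lambda>i. f (i + 1))"
  have "(\<lambda>i. k (i - 1)) \<in> hclass A X Y f" using k hr_shift_iff[OF X Y, of f "\<lambda>i. k (i - 1)"] by (simp add: hclass_mem)
  then show "k \<in> shM (Kb A) 1 (hclass A X Y f)"
    unfolding Kb_simps by (intro image_eqI[of _ _ "\<lambda>i. k (i - 1)"]) simp_all
qed

subsection \<open>Cones\<close>

lemma cone_cob [simp]: "cob (cone X Y f) i = dsum (cob X (i + 1)) (cob Y i)"
  by (simp add: cone_def)

lemma cone_dif [simp]: "x \<in> carrier (cob X (i + 1)) \<Longrightarrow> y \<in> carrier (cob Y i) \<Longrightarrow>
    dif (cone X Y f) i (seq_pair x y) = seq_pair (\<ominus>\<^bsub>cob X (i + 2)\<^esub> dif X (i + 1) x) (f (i + 1) x \<oplus>\<^bsub>cob Y (i + 1)\<^esub> dif Y i y)"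
  by (simp add: cone_def)

lemma lh_into_dsum:
  assumes "lm G" "lm M" "lm N" "x \<in> lhom A G M" "y \<in> lhom A G N"
  shows "(\<lambda>g\<in>carrier G. seq_pair (x g) (y g)) \<in> lhom A G (dsum M N)"
  by (rule lh_restrict) (use assms lh_closed[OF assms(4)] lh_closed[OF assms(5)] lh_add[OF assms(4)] lh_add[OF assms(5)]
      lh_sm[OF assms(4)] lh_sm[OF assms(5)] in auto)

lemma lh_into_dsumE:
  assumes G: "lm G" and M: "lm M" and N: "lm N" and w: "w \<in> lhom A G (dsum M N)"
  obtains x y where "x \<in> lhom A G M" "y \<in> lhom A G N" "\<And>g. g \<in> carrier G \<Longrightarrow> w g = seq_pair (x g) (y g)"
proof -
  have c: "seq_fst (w g) \<in> carrier M" "seq_snd (w g) \<in> carrier N" if "g \<in> carrier G" for g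
    using lh_closed[OF w that] by (auto simp: dsum_carrier_iff)
  have "(\<lambda>g\<in>carrier G. seq_fst (w g)) \<in> lhom A G M" "(\<lambda>g\<in>carrier G. seq_snd (w g)) \<in> lhom A G N"
    using c lh_add[OF w] lh_sm[OF w] by (auto intro!: lh_restrict[OF G] simp: dsum_ops)
  then show ?thesis by (rule that) simp
qed

lemma cx_cone:
  assumes X: "cx X" and Y: "cx Y" and f: "f \<in> chain_maps A X Y"
  shows "cx (cone X Y f)"
  unfolding is_complex_def
proof (intro allI conjI ballI)
  note [simp] = cm_rules[OF X Y f]
  fix i
  have c: "cob (cone X Y f) (i + 1) = dsum (cob X (i + 2)) (cob Y (i + 1))" by (simp add: add.assoc)
  have l: "lm (cob X (i + 2))" "lm (cob X (i + 1))" "lm (cob Y i)" "lm (cob Y (i + 1))" using X Y by auto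
  show "fg (cob (cone X Y f) i)" using X Y by (simp add: fg_dsum)
  have e: "dif (cone X Y f) i w = seq_pair (\<ominus>\<^bsub>cob X (i + 2)\<^esub> dif X (i + 1) (seq_fst w))
      (f (i + 1) (seq_fst w) \<oplus>\<^bsub>cob Y (i + 1)\<^esub> dif Y i (seq_snd w))" if "w \<in> carrier (dsum (cob X (i + 1)) (cob Y i))" for w
    using that by (simp add: cone_def)
  show "dif (cone X Y f) i \<in> lhom A (cob (cone X Y f) i) (cob (cone X Y f) (i + 1))"
    unfolding c cone_cob[of X Y f i]
  proof (rule lhI)
    fix w assume "w \<notin> carrier (dsum (cob X (i + 1)) (cob Y i))"
    then show "dif (cone X Y f) i w = undefined" by (simp add: cone_def)
  next
    fix w assume w: "w \<in> carrier (dsum (cob X (i + 1)) (cob Y i))"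
    then have w': "seq_fst w \<in> carrier (cob X (i + 1))" "seq_snd w \<in> carrier (cob Y i)" by (auto simp: dsum_carrier_iff)
    show "dif (cone X Y f) i w \<in> carrier (dsum (cob X (i + 2)) (cob Y (i + 1)))" using w w' X Y l by (simp add: e)
    {
      fix a assume a: "a \<in> carrier A"
      have "a \<odot>\<^bsub>dsum (cob X (i + 1)) (cob Y i)\<^esub> w \<in> carrier (dsum (cob X (i + 1)) (cob Y i))"
        by (rule lm_sm[OF lm_dsum[OF l(2,3)] a w])
      moreover have "dif X (i + 1) (a \<odot>\<^bsub>cob X (i + 1)\<^esub> seq_fst w) = a \<odot>\<^bsub>cob X (i + 2)\<^esub> dif X (i + 1) (seq_fst w)"
        "dif Y i (a \<odot>\<^bsub>cob Y i\<^esub> seq_snd w) = a \<odot>\<^bsub>cob Y (i + 1)\<^esub> dif Y i (seq_snd w)"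
        using lh_sm[OF cx_lh[OF X] a w'(1)] lh_sm[OF cx_lh[OF Y] a w'(2)] by (simp_all add: add.assoc)
      ultimately show "dif (cone X Y f) i (a \<odot>\<^bsub>dsum (cob X (i + 1)) (cob Y i)\<^esub> w) = a \<odot>\<^bsub>dsum (cob X (i + 2)) (cob Y (i + 1))\<^esub> dif (cone X Y f) i w"
        using a w w' X Y l by (simp add: e dsum_ops)
    next
      fix v assume v: "v \<in> carrier (dsum (cob X (i + 1)) (cob Y i))"
      then have v': "seq_fst v \<in> carrier (cob X (i + 1))" "seq_snd v \<in> carrier (cob Y i)" by (auto simp: dsum_carrier_iff)
      have "w \<oplus>\<^bsub>dsum (cob X (i + 1)) (cob Y i)\<^esub> v \<in> carrier (dsum (cob X (i + 1)) (cob Y i))"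
        by (rule lm_add[OF lm_dsum[OF l(2,3)] w v])
      then show "dif (cone X Y f) i (w \<oplus>\<^bsub>dsum (cob X (i + 1)) (cob Y i)\<^esub> v) =
          dif (cone X Y f) i w \<oplus>\<^bsub>dsum (cob X (i + 2)) (cob Y (i + 1))\<^esub> dif (cone X Y f) i v"
        using v w v' w' X Y l by (simp add: e dsum_ops lm_four int_plus_normal(2)[of i])
    }
  qed
  fix w assume "w \<in> carrier (cob (cone X Y f) i)"
  then obtain x y where w: "w = seq_pair x y" "x \<in> carrier (cob X (i + 1))" "y \<in> carrier (cob Y i)"
    by (metis cone_cob dsum_carrier_iff seq_pair_simps(3))
  have [simp]: "dif (cone X Y f) (i + 1) (seq_pair x' y') = seq_pair (\<ominus>\<^bsub>cob X (i + 3)\<^esub> dif X (i + 2) x') (f (i + 2) x' \<oplus>\<^bsub>cob Y (i + 2)\<^esub> dif Y (i + 1) y')"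
    if "x' \<in> carrier (cob X (i + 2))" "y' \<in> carrier (cob Y (i + 1))" for x' y'
    using cone_dif[of x' X "i + 1" y' Y f] that by (simp add: add.assoc)
  have dd: "dif X (i + 2) (dif X (i + 1) x) = \<zero>\<^bsub>cob X (i + 3)\<^esub>" and dn: "dif X (i + 2) (\<ominus>\<^bsub>cob X (i + 2)\<^esub> dif X (i + 1) x) = \<ominus>\<^bsub>cob X (i + 3)\<^esub> dif X (i + 2) (dif X (i + 1) x)"
    using cx_dd[OF X w(2)] cx_neg[OF X, of "dif X (i + 1) x" "i + 2"] w X by (simp_all add: add.assoc)
  show "dif (cone X Y f) (i + 1) (dif (cone X Y f) i w) = \<zero>\<^bsub>cob (cone X Y f) (i + 2)\<^esub>"
    using w X Y l dd dn by (simp add: add.assoc lm_ac)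
qed

lemma zero_dsum: "zero_module M \<Longrightarrow> zero_module N \<Longrightarrow> zero_module (dsum M N)"
  by (auto simp: zero_module_def dsum_def) (metis seq_pair_simps(3))

lemma bcx_cone:
  assumes X: "bcx X" and Y: "bcx Y" and f: "f \<in> chain_maps A X Y"
  shows "bcx (cone X Y f)"
proof -
  obtain n m :: nat where n: "\<And>i. \<bar>i\<bar> > int n \<Longrightarrow> zero_module (cob X i)" and m: "\<And>i. \<bar>i\<bar> > int m \<Longrightarrow> zero_module (cob Y i)"
    using X Y by (auto simp: bounded_complexes_def)
  have "zero_module (cob (cone X Y f) i)" if "\<bar>i\<bar> > int (n + m + 1)" for i
    using that by (auto intro!: zero_dsum n m)
  then show ?thesis using cx_cone[OF bcx_cx[OF X] bcx_cx[OF Y] f] unfolding bounded_complexes_def by blast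
qed

lemma cone_inj_cm:
  assumes X: "cx X" and Y: "cx Y" and f: "f \<in> chain_maps A X Y"
  shows "cone_inj X Y \<in> chain_maps A Y (cone X Y f)"
proof (rule cmI)
  fix i
  show "cone_inj X Y i \<in> lhom A (cob Y i) (cob (cone X Y f) i)"
    using lh_inr[of "cob X (i + 1)" "cob Y i"] X Y by (simp add: cone_inj_def inr_def)
  fix y assume "y \<in> carrier (cob Y i)"
  then show "dif (cone X Y f) i (cone_inj X Y i y) = cone_inj X Y (i + 1) (dif Y i y)"
    using X Y cm_rules(4)[OF X Y f] by (simp add: cone_inj_def add.assoc)
qed

lemma cone_proj_cm:
  assumes X: "cx X" and Y: "cx Y" and f: "f \<in> chain_maps A X Y"
  shows "cone_proj X Y \<in> chain_maps A (cone X Y f) (shift_cx 1 X)"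
proof (rule cmI)
  fix i
  have l: "lm (cob X (i + 1))" "lm (cob Y i)" using X Y by auto
  show "cone_proj X Y i \<in> lhom A (cob (cone X Y f) i) (cob (shift_cx 1 X) i)"
    unfolding cone_proj_def cone_cob shift_cob
    by (rule lh_restrict[OF lm_dsum[OF l]]) (auto simp: dsum_carrier_iff dsum_ops)
  fix w assume w: "w \<in> carrier (cob (cone X Y f) i)"
  then obtain x y where w': "w = seq_pair x y" "x \<in> carrier (cob X (i + 1))" "y \<in> carrier (cob Y i)"
    by (metis cone_cob dsum_carrier_iff seq_pair_simps(3))
  have "dif (cone X Y f) i w \<in> carrier (cob (cone X Y f) (i + 1))" by (rule cx_closed[OF cx_cone[OF X Y f] w])
  then show "dif (shift_cx 1 X) i (cone_proj X Y i w) = cone_proj X Y (i + 1) (dif (cone X Y f) i w)"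
    using w' X Y by (simp add: cone_proj_def)
qed

text \<open>Triangles are the closure of standard ones under isomorphism; the standard triangle
  itself enters through identities, because the shift of an identity is an identity.\<close>

lemma Tri_cone:
  assumes X: "bcx X" and Y: "bcx Y" and f: "f \<in> chain_maps A X Y"
  shows "(X, Y, cone X Y f, hclass A X Y f, hclass A Y (cone X Y f) (cone_inj X Y),
     hclass A (cone X Y f) (shift_cx 1 X) (cone_proj X Y)) \<in> Tri (Kb A)"
proof -
  note c = bcx_cx[OF X] bcx_cx[OF Y]
  let ?C = "cone X Y f"
  have C: "bcx ?C" by (rule bcx_cone[OF X Y f])
  have a: "arr (Kb A) X Y (hclass A X Y f)" "arr (Kb A) Y ?C (hclass A Y ?C (cone_inj X Y))"
    "arr (Kb A) ?C (shift_cx 1 X) (hclass A ?C (shift_cx 1 X) (cone_proj X Y))"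
    using X Y C f cone_inj_cm[OF c f] cone_proj_cm[OF c f] bcx_shift[OF X] by (auto simp: arr_Kb)
  have s: "shM (Kb A) 1 (idt (Kb A) X) = idt (Kb A) (shift_cx 1 X)"
    unfolding Kb_simps(3) shM_hclass[OF c(1,1)] by (simp add: icm_def)
  have ob: "X \<in> Ob (Kb A)" "Y \<in> Ob (Kb A)" "?C \<in> Ob (Kb A)" using X Y C by simp_all
  have "triangle_iso (Kb_shift_cat A) (X, Y, ?C, hclass A X Y f, hclass A Y ?C (cone_inj X Y), hclass A ?C (shift_cx 1 X) (cone_proj X Y))
     (X, Y, ?C, hclass A X Y f, hclass A Y ?C (cone_inj X Y), hclass A ?C (shift_cx 1 X) (cone_proj X Y))"
    unfolding triangle_iso_def prod.case Ks_simps is_iso_Ks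
  proof (intro conjI, rule_tac[7] exI[of _ "idt (Kb A) X"], rule_tac[7] exI[of _ "idt (Kb A) Y"], rule_tac[7] exI[of _ "idt (Kb A) ?C"],
      intro conjI Kbc.is_iso_idt ob)
    show "hclass A X Y f \<in> Hm (Kb A) X Y" "hclass A Y ?C (cone_inj X Y) \<in> Hm (Kb A) Y ?C"
      "hclass A ?C (shift_cx 1 X) (cone_proj X Y) \<in> Hm (Kb A) ?C (shO (Kb A) 1 X)"
      using Kbc.arrD(3)[OF a(1)] Kbc.arrD(3)[OF a(2)] Kbc.arrD(3)[OF a(3)] by simp_all
  qed (simp_all only: simp_thms ob Kbc.is_iso_idt[OF ob(1)] Kbc.is_iso_idt[OF ob(2)] Kbc.is_iso_idt[OF ob(3)] s Kb_simps(4) Kbc.id_left[OF a(1)] Kbc.id_right[OF a(1)] Kbc.id_left[OF a(2)] Kbc.id_right[OF a(2)]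
      Kbc.id_left[OF a(3)] Kbc.id_right[OF a(3)])
  then show ?thesis using X Y f unfolding Kb_def shift_cat.extend_def tri_cat.fields_def by auto
qed

text \<open>Of the isomorphism of triangles, the first square and the component at the cone are
  retained. They carry a statement about cones from the standard triangle to the given one.\<close>

lemma TriE:
  assumes "(X, Y, Z, u, v, w) \<in> Tri (Kb A)"
  obtains X' Y' f \<alpha> \<beta> \<gamma> where "bcx X" "bcx Y" "bcx Z" "bcx X'" "bcx Y'" "f \<in> chain_maps A X' Y'" "u \<in> Hm (Kb A) X Y"
    "is_iso (Kb A) X X' \<alpha>" "is_iso (Kb A) Y Y' \<beta>" "is_iso (Kb A) Z (cone X' Y' f) \<gamma>"
    "cmp (Kb A) X Y Y' \<beta> u = cmp (Kb A) X X' Y' (hclass A X' Y' f) \<alpha>"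
proof -
  from assms obtain X' Y' f where XY: "bcx X'" "bcx Y'" "f \<in> chain_maps A X' Y'" and
    t: "triangle_iso (Kb_shift_cat A) (X, Y, Z, u, v, w)
          (X', Y', cone X' Y' f, hclass A X' Y' f, hclass A Y' (cone X' Y' f) (cone_inj X' Y'),
           hclass A (cone X' Y' f) (shift_cx 1 X') (cone_proj X' Y'))"
    unfolding Kb_def shift_cat.extend_def tri_cat.fields_def by auto
  from t that XY show ?thesis
    unfolding triangle_iso_def prod.case Ks_simps is_iso_Ks Kb_simps(1) by blast
qed

end

section \<open>The bounded Gorenstein derived category\<close>

context fda
begin

text \<open>For a module \<open>G\<close>, the elements of \<open>lhom A G (cyc X i)\<close> are the cocycles of the complex
  \<open>Hom(G, X)\<close>; \<open>cohomologous G X i\<close> says that two of them differ by a coboundary.\<close>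

definition cohomologous :: "'a umod \<Rightarrow> 'a cochain \<Rightarrow> int \<Rightarrow> 'a umap \<Rightarrow> 'a umap \<Rightarrow> bool" where
  "cohomologous G X i x y \<longleftrightarrow> (\<exists>w\<in>lhom A G (cob X (i - 1)). \<forall>g\<in>carrier G. x g = y g \<oplus>\<^bsub>cob X i\<^esub> dif X (i - 1) (w g))"

abbreviation push :: "'a umod \<Rightarrow> (int \<Rightarrow> 'a umap) \<Rightarrow> int \<Rightarrow> 'a umap \<Rightarrow> 'a umap" where
  "push G f i x \<equiv> compose (carrier G) (f i) x"

abbreviation zmap :: "'a umod \<Rightarrow> 'a cochain \<Rightarrow> int \<Rightarrow> 'a umap" where
  "zmap G X i \<equiv> (\<lambda>g\<in>carrier G. \<zero>\<^bsub>cob X i\<^esub>)"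

lemma cocycleD:
  assumes "x \<in> lhom A G (cyc X i)"
  shows "x \<in> lhom A G (cob X i)" "g \<in> carrier G \<Longrightarrow> x g \<in> carrier (cob X i)" "g \<in> carrier G \<Longrightarrow> dif X i (x g) = \<zero>\<^bsub>cob X (i + 1)\<^esub>"
  using assms lh_closed[of x G "cob X i" g] by (auto simp: lh_cyc_iff)

lemma cohomologousE:
  assumes "cohomologous G X i x y"
  obtains w where "w \<in> lhom A G (cob X (i - 1))" "\<And>g. g \<in> carrier G \<Longrightarrow> w g \<in> carrier (cob X (i - 1))"
    "\<And>g. g \<in> carrier G \<Longrightarrow> x g = y g \<oplus>\<^bsub>cob X i\<^esub> dif X (i - 1) (w g)"
proof -
  obtain w where w: "w \<in> lhom A G (cob X (i - 1))" "\<And>g. g \<in> carrier G \<Longrightarrow> x g = y g \<oplus>\<^bsub>cob X i\<^esub> dif X (i - 1) (w g)"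
    using assms unfolding cohomologous_def by blast
  show ?thesis by (rule that[OF w(1) lh_closed[OF w(1)] w(2)])
qed

lemma cohomologousI:
  "w \<in> lhom A G (cob X (i - 1)) \<Longrightarrow> (\<And>g. g \<in> carrier G \<Longrightarrow> x g = y g \<oplus>\<^bsub>cob X i\<^esub> dif X (i - 1) (w g)) \<Longrightarrow> cohomologous G X i x y"
  unfolding cohomologous_def by blast

section \<open>Quasi-isomorphisms after applying Hom(G, -)\<close>

context
  fixes G :: "'a umod" assumes G: "lm G"
begin

lemma coh_refl: "cx X \<Longrightarrow> x \<in> lhom A G (cyc X i) \<Longrightarrow> cohomologous G X i x x"
  by (rule cohomologousI[where w = "zmap G X (i - 1)"]) (use G in \<open>simp_all add: lh_0 cocycleD\<close>)

lemma coh_sym: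
  assumes X: "cx X" and x: "x \<in> lhom A G (cyc X i)" and y: "y \<in> lhom A G (cyc X i)" and xy: "cohomologous G X i x y"
  shows "cohomologous G X i y x"
proof -
  obtain w where w: "w \<in> lhom A G (cob X (i - 1))" "\<And>g. g \<in> carrier G \<Longrightarrow> w g \<in> carrier (cob X (i - 1))"
    "\<And>g. g \<in> carrier G \<Longrightarrow> x g = y g \<oplus>\<^bsub>cob X i\<^esub> dif X (i - 1) (w g)" by (rule cohomologousE[OF xy]) blast
  show ?thesis
    by (rule cohomologousI[OF lh_uminus[OF G _ w(1)]]) (use X w cocycleD(2)[OF y] in \<open>simp_all add: lm_ac\<close>)
qed

lemma coh_trans:
  assumes X: "cx X" and x: "x \<in> lhom A G (cyc X i)" and y: "y \<in> lhom A G (cyc X i)" and z: "z \<in> lhom A G (cyc X i)"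
    and xy: "cohomologous G X i x y" and yz: "cohomologous G X i y z"
  shows "cohomologous G X i x z"
proof -
  obtain w where w: "w \<in> lhom A G (cob X (i - 1))" "\<And>g. g \<in> carrier G \<Longrightarrow> w g \<in> carrier (cob X (i - 1))"
    "\<And>g. g \<in> carrier G \<Longrightarrow> x g = y g \<oplus>\<^bsub>cob X i\<^esub> dif X (i - 1) (w g)" by (rule cohomologousE[OF xy]) blast
  obtain v where v: "v \<in> lhom A G (cob X (i - 1))" "\<And>g. g \<in> carrier G \<Longrightarrow> v g \<in> carrier (cob X (i - 1))"
    "\<And>g. g \<in> carrier G \<Longrightarrow> y g = z g \<oplus>\<^bsub>cob X i\<^esub> dif X (i - 1) (v g)" by (rule cohomologousE[OF yz]) blast
  show ?thesis
    by (rule cohomologousI[OF lh_plus[OF G _ w(1) v(1)]]) (use X w v cocycleD(2)[OF z] in \<open>simp_all add: lm_ac\<close>)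
qed

lemma push_cocycle:
  assumes X: "cx X" and Y: "cx Y" and f: "f \<in> chain_maps A X Y" and x: "x \<in> lhom A G (cyc X i)"
  shows "push G f i x \<in> lhom A G (cyc Y i)"
  unfolding lh_cyc_iff
proof
  show "push G f i x \<in> lhom A G (cob Y i)" by (rule lh_comp[OF G cocycleD(1)[OF x] cm_lh[OF f]])
  show "\<forall>g\<in>carrier G. dif Y i (push G f i x g) = \<zero>\<^bsub>cob Y (i + 1)\<^esub>"
    using cm_rules(5)[OF X Y f, symmetric] cm_rules(4)[OF X Y f] cocycleD(2,3)[OF x] by (simp add: compose_eq)
qed

lemma push_coh:
  assumes X: "cx X" and Y: "cx Y" and f: "f \<in> chain_maps A X Y" and y: "y \<in> lhom A G (cyc X i)"
    and xy: "cohomologous G X i x y"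
  shows "cohomologous G Y i (push G f i x) (push G f i y)"
proof -
  obtain w where w: "w \<in> lhom A G (cob X (i - 1))" "\<And>g. g \<in> carrier G \<Longrightarrow> w g \<in> carrier (cob X (i - 1))"
    "\<And>g. g \<in> carrier G \<Longrightarrow> x g = y g \<oplus>\<^bsub>cob X i\<^esub> dif X (i - 1) (w g)" by (rule cohomologousE[OF xy]) blast
  show ?thesis
    by (rule cohomologousI[OF lh_comp[OF G w(1) cm_lh[OF f]]])
      (use X cm_rules(2,6)[OF X Y f] w(2,3) cocycleD(2)[OF y] in \<open>simp add: compose_eq\<close>)
qed

text \<open>On a cocycle x the term h d vanishes, so h x is the element whose differential is the
  difference.\<close>

lemma push_homotopic:
  assumes X: "cx X" and Y: "cx Y" and ff: "(f, f') \<in> homotopy_rel A X Y" and x: "x \<in> lhom A G (cyc X i)"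
  shows "cohomologous G Y i (push G f i x) (push G f' i x)"
proof -
  from hrE[OF ff] obtain h where f': "f' \<in> chain_maps A X Y" and h: "\<And>i. h i \<in> lhom A (cob X i) (cob Y (i - 1))" and
    e: "\<And>i x. x \<in> carrier (cob X i) \<Longrightarrow> f i x = f' i x \<oplus>\<^bsub>cob Y i\<^esub> (dif Y (i - 1) (h i x) \<oplus>\<^bsub>cob Y i\<^esub> h (i + 1) (dif X i x))" by metis
  show ?thesis
    by (rule cohomologousI[OF lh_comp[OF G cocycleD(1)[OF x] h]])
      (use X Y hm_rules(1,5)[OF X Y h] cocycleD(2,3)[OF x] in \<open>simp add: compose_eq e\<close>)
qed

text \<open>Bijectivity on the cohomology of Hom(G, -), expressed on cocycles modulo
  \<open>cohomologous\<close>; the cohomology groups themselves are never formed.\<close>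

definition qis :: "'a cochain \<Rightarrow> 'a cochain \<Rightarrow> (int \<Rightarrow> 'a umap) \<Rightarrow> bool" where
  "qis X Y f \<longleftrightarrow> (\<forall>i. (\<forall>y\<in>lhom A G (cyc Y i). \<exists>x\<in>lhom A G (cyc X i). cohomologous G Y i (push G f i x) y) \<and>
     (\<forall>x\<in>lhom A G (cyc X i). \<forall>x'\<in>lhom A G (cyc X i). cohomologous G Y i (push G f i x) (push G f i x') \<longrightarrow> cohomologous G X i x x'))"

lemma qisE1:
  assumes "qis X Y f" "y \<in> lhom A G (cyc Y i)"
  obtains x where "x \<in> lhom A G (cyc X i)" "cohomologous G Y i (push G f i x) y"
  using assms unfolding qis_def by blast

lemma qisE2:
  "qis X Y f \<Longrightarrow> x \<in> lhom A G (cyc X i) \<Longrightarrow> x' \<in> lhom A G (cyc X i) \<Longrightarrow>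
    cohomologous G Y i (push G f i x) (push G f i x') \<Longrightarrow> cohomologous G X i x x'"
  unfolding qis_def by blast

lemma push_cc:
  assumes "x \<in> lhom A G (cyc X i)" shows "push G (cc X g f) i x = push G g i (push G f i x)"
  using cocycleD(2)[OF assms] by (auto simp: compose_def intro!: ext)

lemma qis_homotopic:
  assumes X: "cx X" and Y: "cx Y" and ff: "(f, f') \<in> homotopy_rel A X Y" and f: "qis X Y f"
  shows "qis X Y f'"
  unfolding qis_def
proof (intro allI conjI ballI impI)
  have fc: "f \<in> chain_maps A X Y" "f' \<in> chain_maps A X Y" using ff by (auto elim: hrE)
  note p = push_cocycle[OF X Y fc(1)] push_cocycle[OF X Y fc(2)]
  note h = push_homotopic[OF X Y ff] push_homotopic[OF X Y hr_sym[OF X Y ff]]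
  fix i
  {
    fix y assume y: "y \<in> lhom A G (cyc Y i)"
    obtain x where x: "x \<in> lhom A G (cyc X i)" "cohomologous G Y i (push G f i x) y" using qisE1[OF f y] .
    have "cohomologous G Y i (push G f' i x) y"
      by (rule coh_trans[OF Y p(2)[OF x(1)] p(1)[OF x(1)] y h(2)[OF x(1)] x(2)])
    then show "\<exists>x\<in>lhom A G (cyc X i). cohomologous G Y i (push G f' i x) y" using x(1) by blast
  next
    fix x x' assume x: "x \<in> lhom A G (cyc X i)" "x' \<in> lhom A G (cyc X i)" and e: "cohomologous G Y i (push G f' i x) (push G f' i x')"
    have "cohomologous G Y i (push G f i x) (push G f i x')"
      by (rule coh_trans[OF Y p(1)[OF x(1)] p(2)[OF x(1)] p(1)[OF x(2)] h(1)[OF x(1)]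
            coh_trans[OF Y p(2)[OF x(1)] p(2)[OF x(2)] p(1)[OF x(2)] e h(2)[OF x(2)]]])
    then show "cohomologous G X i x x'" by (rule qisE2[OF f x])
  }
qed

lemma qis_cc:
  assumes X: "cx X" and Y: "cx Y" and Z: "cx Z" and f: "f \<in> chain_maps A X Y" and g: "g \<in> chain_maps A Y Z"
    and qf: "qis X Y f" and qg: "qis Y Z g"
  shows "qis X Z (cc X g f)"
  unfolding qis_def
proof (intro allI conjI ballI impI)
  note pf = push_cocycle[OF X Y f] and pg = push_cocycle[OF Y Z g]
  fix i
  {
    fix z assume z: "z \<in> lhom A G (cyc Z i)"
    obtain y where y: "y \<in> lhom A G (cyc Y i)" "cohomologous G Z i (push G g i y) z" using qisE1[OF qg z] .
    obtain x where x: "x \<in> lhom A G (cyc X i)" "cohomologous G Y i (push G f i x) y" using qisE1[OF qf y(1)] .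
    have "cohomologous G Z i (push G g i (push G f i x)) z"
      by (rule coh_trans[OF Z pg[OF pf[OF x(1)]] pg[OF y(1)] z push_coh[OF Y Z g y(1) x(2)] y(2)])
    then show "\<exists>x\<in>lhom A G (cyc X i). cohomologous G Z i (push G (cc X g f) i x) z" by (intro bexI[OF _ x(1)]) (simp add: push_cc[OF x(1)])
  next
    fix x x' assume x: "x \<in> lhom A G (cyc X i)" "x' \<in> lhom A G (cyc X i)" and
      e: "cohomologous G Z i (push G (cc X g f) i x) (push G (cc X g f) i x')"
    then show "cohomologous G X i x x'"
      using qisE2[OF qf x qisE2[OF qg pf[OF x(1)] pf[OF x(2)]]] by (simp add: push_cc)
  }
qed

lemma qis_left:
  assumes X: "cx X" and Y: "cx Y" and Z: "cx Z" and f: "f \<in> chain_maps A X Y" and g: "g \<in> chain_maps A Y Z"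
    and qgf: "qis X Z (cc X g f)" and qg: "qis Y Z g"
  shows "qis X Y f"
  unfolding qis_def
proof (intro allI conjI ballI impI)
  note pf = push_cocycle[OF X Y f] and pg = push_cocycle[OF Y Z g]
  fix i
  {
    fix y assume y: "y \<in> lhom A G (cyc Y i)"
    obtain x where x: "x \<in> lhom A G (cyc X i)" "cohomologous G Z i (push G (cc X g f) i x) (push G g i y)"
      using qisE1[OF qgf pg[OF y]] .
    have "cohomologous G Y i (push G f i x) y"
      by (rule qisE2[OF qg pf[OF x(1)] y]) (use x in \<open>simp add: push_cc\<close>)
    then show "\<exists>x\<in>lhom A G (cyc X i). cohomologous G Y i (push G f i x) y" using x(1) by blast
  next
    fix x x' assume x: "x \<in> lhom A G (cyc X i)" "x' \<in> lhom A G (cyc X i)" and e: "cohomologous G Y i (push G f i x) (push G f i x')"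
    have "cohomologous G Z i (push G (cc X g f) i x) (push G (cc X g f) i x')"
      using push_coh[OF Y Z g pf[OF x(2)] e] x by (simp add: push_cc)
    then show "cohomologous G X i x x'" by (rule qisE2[OF qgf x])
  }
qed

lemma qis_inverse:
  assumes X: "cx X" and Y: "cx Y" and f: "f \<in> chain_maps A X Y" and g: "g \<in> chain_maps A Y X"
    and gf: "(cc X g f, icm X) \<in> homotopy_rel A X X" and fg: "(cc Y f g, icm Y) \<in> homotopy_rel A Y Y"
  shows "qis X Y f"
  unfolding qis_def
proof (intro allI conjI ballI impI)
  have i: "push G (icm Z) i z = z" if "z \<in> lhom A G (cyc Z i)" for Z z i
    using cocycleD(2)[OF that] lh_ext[OF that] by (auto simp: compose_def icm_def intro!: ext)
  fix i
  {
    fix y assume y: "y \<in> lhom A G (cyc Y i)"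
    have "cohomologous G Y i (push G f i (push G g i y)) y"
      using push_homotopic[OF Y Y fg y] by (simp add: push_cc[OF y] i[OF y])
    then show "\<exists>x\<in>lhom A G (cyc X i). cohomologous G Y i (push G f i x) y"
      using push_cocycle[OF Y X g y] by blast
  next
    fix x x' assume x: "x \<in> lhom A G (cyc X i)" "x' \<in> lhom A G (cyc X i)" and e: "cohomologous G Y i (push G f i x) (push G f i x')"
    note pf = push_cocycle[OF X Y f] and pg = push_cocycle[OF Y X g]
    have h: "cohomologous G X i (push G g i (push G f i z)) z" if "z \<in> lhom A G (cyc X i)" for z
      using push_homotopic[OF X X gf that] by (simp add: push_cc[OF that] i[OF that])
    note c = pg[OF pf[OF x(1)]] pg[OF pf[OF x(2)]]
    show "cohomologous G X i x x'"
      by (rule coh_trans[OF X x(1) c(1) x(2) coh_sym[OF X c(1) x(1) h[OF x(1)]]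
            coh_trans[OF X c(1,2) x(2) push_coh[OF Y X g pf[OF x(2)] e] h[OF x(2)]]])
  }
qed

lemma exact_iff_coboundaries:
  assumes C: "cx C"
  shows "hom_from_exact A G C \<longleftrightarrow> (\<forall>i. \<forall>x\<in>lhom A G (cyc C i). \<exists>w\<in>lhom A G (cob C (i - 1)). \<forall>g\<in>carrier G. dif C (i - 1) (w g) = x g)"
  by (simp add: hom_from_exact_iff[OF C G] lifts_def)

lemma exactE:
  assumes "hom_from_exact A G C" "cx C" "x \<in> lhom A G (cyc C i)"
  obtains w where "w \<in> lhom A G (cob C (i - 1))" "\<And>g. g \<in> carrier G \<Longrightarrow> w g \<in> carrier (cob C (i - 1))"
    "\<And>g. g \<in> carrier G \<Longrightarrow> dif C (i - 1) (w g) = x g"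
proof -
  obtain w where w: "w \<in> lhom A G (cob C (i - 1))" "\<forall>g\<in>carrier G. dif C (i - 1) (w g) = x g"
    using assms(1,3) unfolding exact_iff_coboundaries[OF assms(2)] by blast
  show ?thesis using that[OF w(1)] w(2) lh_closed[OF w(1)] by blast
qed

text \<open>The part of the long exact cohomology sequence of the cone that matters here, chased by
  hand: surjectivity and injectivity in all degrees correspond to bounding every cocycle (x, y) of
  the cone.\<close>

lemma qis_iff_cone:
  assumes X: "cx X" and Y: "cx Y" and f: "f \<in> chain_maps A X Y"
  shows "qis X Y f \<longleftrightarrow> hom_from_exact A G (cone X Y f)"
proof
  note [simp] = cm_rules[OF X Y f]
  have C: "cx (cone X Y f)" by (rule cx_cone[OF X Y f])
  {
    assume q: "qis X Y f"
    show "hom_from_exact A G (cone X Y f)"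
      unfolding exact_iff_coboundaries[OF C]
    proof (intro allI ballI)
      fix i w assume w: "w \<in> lhom A G (cyc (cone X Y f) i)"
      then have "w \<in> lhom A G (dsum (cob X (i + 1)) (cob Y i))" by (auto simp: lh_cyc_iff)
      from lh_into_dsumE[OF G _ _ this] X Y obtain x y where x: "x \<in> lhom A G (cob X (i + 1))" and y: "y \<in> lhom A G (cob Y i)"
        and xy: "\<And>g. g \<in> carrier G \<Longrightarrow> w g = seq_pair (x g) (y g)" by (metis cx_lm)
      note xc [simp] = lh_closed[OF x] and yc [simp] = lh_closed[OF y]
      have "\<ominus>\<^bsub>cob X (i + 2)\<^esub> dif X (i + 1) (x g) = \<zero>\<^bsub>cob X (i + 2)\<^esub>" and
        fy: "f (i + 1) (x g) \<oplus>\<^bsub>cob Y (i + 1)\<^esub> dif Y i (y g) = \<zero>\<^bsub>cob Y (i + 1)\<^esub>" if g: "g \<in> carrier G" for g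
        using cocycleD(3)[OF w g] g xy by (simp_all add: add.assoc)
      then have dx: "dif X (i + 1) (x g) = \<zero>\<^bsub>cob X (i + 2)\<^esub>" if "g \<in> carrier G" for g
        using that X lm_negneg[OF cx_lm[OF X], of "dif X (i + 1) (x g)" "i + 2"] by force
      have xz: "x \<in> lhom A G (cyc X (i + 1))" using x dx by (simp add: lh_cyc_iff add.assoc)
      have z: "zmap G X (i + 1) \<in> lhom A G (cyc X (i + 1))" using X lh_0[OF G cx_lm[OF X], of "i + 1"] by (simp add: lh_cyc_iff)
      \<comment> \<open>The second component of the cocycle condition reads f x = -d y, hence the
        witness -y.\<close>
      have "cohomologous G Y (i + 1) (push G f (i + 1) x) (push G f (i + 1) (zmap G X (i + 1)))"
      proof (rule cohomologousI[where w = "\<lambda>g\<in>carrier G. \<ominus>\<^bsub>cob Y i\<^esub> y g"])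
        show "(\<lambda>g\<in>carrier G. \<ominus>\<^bsub>cob Y i\<^esub> y g) \<in> lhom A G (cob Y (i + 1 - 1))" using lh_uminus[OF G _ y] Y by simp
        fix g assume g: "g \<in> carrier G"
        then show "push G f (i + 1) x g = push G f (i + 1) (zmap G X (i + 1)) g \<oplus>\<^bsub>cob Y (i + 1)\<^esub>
            dif Y (i + 1 - 1) ((\<lambda>g\<in>carrier G. \<ominus>\<^bsub>cob Y i\<^esub> y g) g)"
          using X Y fy[OF g] lm_eq_neg_iff[OF cx_lm[OF Y], of "f (i + 1) (x g)" "i + 1" "dif Y i (y g)"] by (simp add: compose_eq)
      qed
      from qisE2[OF q xz z this] obtain a where a: "a \<in> lhom A G (cob X i)" and ac [simp]: "\<And>g. g \<in> carrier G \<Longrightarrow> a g \<in> carrier (cob X i)"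
        and xa: "\<And>g. g \<in> carrier G \<Longrightarrow> x g = dif X i (a g)" by (rule cohomologousE) (use X in simp)
      \<comment> \<open>With x = d a, the element y + f a is a cocycle of Y. It is cohomologous to f
        x2 for a cocycle x2, say with f x2 = y1 + d v, and then (x2 - a, -v) bounds (x, y).\<close>
      define y1 where "y1 = (\<lambda>g\<in>carrier G. f i (a g) \<oplus>\<^bsub>cob Y i\<^esub> y g)"
      have fa: "compose (carrier G) (f i) a \<in> lhom A G (cob Y i)" by (rule lh_comp[OF G a cm_lh[OF f]])
      have "(\<lambda>g\<in>carrier G. compose (carrier G) (f i) a g \<oplus>\<^bsub>cob Y i\<^esub> y g) \<in> lhom A G (cob Y i)"
        by (rule lh_plus[OF G _ fa y]) (use Y in simp)
      then have "y1 \<in> lhom A G (cob Y i)" by (simp add: y1_def compose_eq cong: restrict_cong)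
      moreover have "dif Y i (y1 g) = \<zero>\<^bsub>cob Y (i + 1)\<^esub>" if "g \<in> carrier G" for g
        using that X Y fy[OF that] xa[OF that] by (simp add: y1_def)
      ultimately have y1: "y1 \<in> lhom A G (cyc Y i)" by (simp add: lh_cyc_iff)
      from qisE1[OF q y1] obtain x2 where x2: "x2 \<in> lhom A G (cyc X i)" "cohomologous G Y i (push G f i x2) y1" by blast
      from cohomologousE[OF x2(2)] obtain v where v: "v \<in> lhom A G (cob Y (i - 1))" and vc [simp]: "\<And>g. g \<in> carrier G \<Longrightarrow> v g \<in> carrier (cob Y (i - 1))"
        and fx2: "\<And>g. g \<in> carrier G \<Longrightarrow> push G f i x2 g = y1 g \<oplus>\<^bsub>cob Y i\<^esub> dif Y (i - 1) (v g)" by blast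
      note x2c [simp] = cocycleD(2,3)[OF x2(1)]
      let ?p = "\<lambda>g\<in>carrier G. x2 g \<oplus>\<^bsub>cob X i\<^esub> (\<lambda>g\<in>carrier G. \<ominus>\<^bsub>cob X i\<^esub> a g) g"
      have p: "?p \<in> lhom A G (cob X i)" by (rule lh_plus[OF G _ cocycleD(1)[OF x2(1)] lh_uminus[OF G _ a]]) (use X in auto)
      have vn: "(\<lambda>g\<in>carrier G. \<ominus>\<^bsub>cob Y (i - 1)\<^esub> v g) \<in> lhom A G (cob Y (i - 1))" by (rule lh_uminus[OF G _ v]) (use Y in auto)
      let ?u = "\<lambda>g\<in>carrier G. seq_pair (?p g) ((\<lambda>g\<in>carrier G. \<ominus>\<^bsub>cob Y (i - 1)\<^esub> v g) g)"
      have "?u \<in> lhom A G (cob (cone X Y f) (i - 1))" using lh_into_dsum[OF G _ _ p vn] X Y by simp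
      moreover have "dif (cone X Y f) (i - 1) (?u g) = w g" if g: "g \<in> carrier G" for g
      proof -
        have "f i (x2 g) = (f i (a g) \<oplus>\<^bsub>cob Y i\<^esub> y g) \<oplus>\<^bsub>cob Y i\<^esub> dif Y (i - 1) (v g)"
          using fx2[OF g] g by (simp add: compose_eq y1_def)
        then show ?thesis using g X Y by (simp add: xy xa lm_ac int_plus_normal(1)[of i])
      qed
      ultimately show "\<exists>u\<in>lhom A G (cob (cone X Y f) (i - 1)). \<forall>g\<in>carrier G. dif (cone X Y f) (i - 1) (u g) = w g" by blast
    qed
  next
    assume e: "hom_from_exact A G (cone X Y f)"
    \<comment> \<open>Surjectivity: a preimage (a, b) of the cocycle (0, y) satisfies d a = 0 and f
      a + d b = y.\<close>
    have A: "\<exists>x\<in>lhom A G (cyc X i). cohomologous G Y i (push G f i x) y" if y: "y \<in> lhom A G (cyc Y i)" for i y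
    proof -
      note yc [simp] = cocycleD(2,3)[OF y]
      let ?u = "\<lambda>g\<in>carrier G. seq_pair (zmap G X (i + 1) g) (y g)"
      have "?u \<in> lhom A G (cob (cone X Y f) i)"
        using lh_into_dsum[OF G _ _ lh_0[OF G cx_lm[OF X]] cocycleD(1)[OF y], of "i + 1"] X Y by simp
      then have "?u \<in> lhom A G (cyc (cone X Y f) i)" using X Y by (simp add: lh_cyc_iff add.assoc)
      then obtain w where w: "w \<in> lhom A G (cob (cone X Y f) (i - 1))"
        "\<And>g. g \<in> carrier G \<Longrightarrow> dif (cone X Y f) (i - 1) (w g) = seq_pair \<zero>\<^bsub>cob X (i + 1)\<^esub> (y g)" by (rule exactE[OF e C]) auto
      from w(1) have "w \<in> lhom A G (dsum (cob X i) (cob Y (i - 1)))" by simp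
      from lh_into_dsumE[OF G _ _ this] X Y obtain a b where a: "a \<in> lhom A G (cob X i)" and b: "b \<in> lhom A G (cob Y (i - 1))"
        and ab: "\<And>g. g \<in> carrier G \<Longrightarrow> w g = seq_pair (a g) (b g)" by (metis cx_lm)
      note [simp] = lh_closed[OF a] lh_closed[OF b]
      have "\<ominus>\<^bsub>cob X (i + 1)\<^esub> dif X i (a g) = \<zero>\<^bsub>cob X (i + 1)\<^esub>" and
        fy: "f i (a g) \<oplus>\<^bsub>cob Y i\<^esub> dif Y (i - 1) (b g) = y g" if g: "g \<in> carrier G" for g
        using w(2)[OF g] g ab by (simp_all add: int_plus_normal(1)[of i])
      then have dx: "dif X i (a g) = \<zero>\<^bsub>cob X (i + 1)\<^esub>" if "g \<in> carrier G" for g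
        using that X lm_negneg[OF cx_lm[OF X], of "dif X i (a g)" "i + 1"] by force
      have "a \<in> lhom A G (cyc X i)" using a dx by (simp add: lh_cyc_iff)
      moreover have "cohomologous G Y i (push G f i a) y"
        by (rule cohomologousI[OF lh_uminus[OF G _ b]]) (use X Y in \<open>simp_all add: compose_eq fy[symmetric] lm_ac\<close>)
      ultimately show ?thesis by blast
    qed
    \<comment> \<open>Injectivity: if f x = f x' + d w, then (x - x', -w) is a cocycle of the cone.
      The degree i + 1 is that of X in the cone of degree i; it is shifted back at the end.\<close>
    have B: "cohomologous G X (i + 1) x x'" if x: "x \<in> lhom A G (cyc X (i + 1))" and x': "x' \<in> lhom A G (cyc X (i + 1))"
      and xx: "cohomologous G Y (i + 1) (push G f (i + 1) x) (push G f (i + 1) x')" for i x x'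
    proof -
      note [simp] = cocycleD(2,3)[OF x] cocycleD(2,3)[OF x']
      from cohomologousE[OF xx] obtain w where w: "w \<in> lhom A G (cob Y i)" and [simp]: "\<And>g. g \<in> carrier G \<Longrightarrow> w g \<in> carrier (cob Y i)"
        and fx: "\<And>g. g \<in> carrier G \<Longrightarrow> f (i + 1) (x g) = f (i + 1) (x' g) \<oplus>\<^bsub>cob Y (i + 1)\<^esub> dif Y i (w g)" by (auto simp: compose_eq)
      let ?p = "\<lambda>g\<in>carrier G. x g \<oplus>\<^bsub>cob X (i + 1)\<^esub> (\<lambda>g\<in>carrier G. \<ominus>\<^bsub>cob X (i + 1)\<^esub> x' g) g"
      have p: "?p \<in> lhom A G (cob X (i + 1))"
        by (rule lh_plus[OF G _ cocycleD(1)[OF x] lh_uminus[OF G _ cocycleD(1)[OF x']]]) (use X in auto)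
      have wn: "(\<lambda>g\<in>carrier G. \<ominus>\<^bsub>cob Y i\<^esub> w g) \<in> lhom A G (cob Y i)" by (rule lh_uminus[OF G _ w]) (use Y in auto)
      let ?u = "\<lambda>g\<in>carrier G. seq_pair (?p g) ((\<lambda>g\<in>carrier G. \<ominus>\<^bsub>cob Y i\<^esub> w g) g)"
      have d2: "dif X (i + 1) (x g) = \<zero>\<^bsub>cob X (i + 2)\<^esub>" "dif X (i + 1) (x' g) = \<zero>\<^bsub>cob X (i + 2)\<^esub>" if "g \<in> carrier G" for g
        using cocycleD(3)[OF x that] cocycleD(3)[OF x' that] by (simp_all add: add.assoc)
      have "?u \<in> lhom A G (cob (cone X Y f) i)" using lh_into_dsum[OF G _ _ p wn] X Y by simp
      then have "?u \<in> lhom A G (cyc (cone X Y f) i)" using X Y d2 by (simp add: lh_cyc_iff add.assoc fx lm_ac)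
      then obtain v where v: "v \<in> lhom A G (cob (cone X Y f) (i - 1))"
        "\<And>g. g \<in> carrier G \<Longrightarrow> dif (cone X Y f) (i - 1) (v g) = seq_pair (x g \<oplus>\<^bsub>cob X (i + 1)\<^esub> \<ominus>\<^bsub>cob X (i + 1)\<^esub> x' g) (\<ominus>\<^bsub>cob Y i\<^esub> w g)" by (rule exactE[OF e C]) auto
      from v(1) have "v \<in> lhom A G (dsum (cob X i) (cob Y (i - 1)))" by simp
      from lh_into_dsumE[OF G _ _ this] X Y obtain a b where a: "a \<in> lhom A G (cob X i)" and b: "b \<in> lhom A G (cob Y (i - 1))"
        and ab: "\<And>g. g \<in> carrier G \<Longrightarrow> v g = seq_pair (a g) (b g)" by (metis cx_lm)
      note [simp] = lh_closed[OF a] lh_closed[OF b]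
      have xa: "\<ominus>\<^bsub>cob X (i + 1)\<^esub> dif X i (a g) = x g \<oplus>\<^bsub>cob X (i + 1)\<^esub> \<ominus>\<^bsub>cob X (i + 1)\<^esub> x' g" if g: "g \<in> carrier G" for g
        using v(2)[OF g] g ab by (simp add: int_plus_normal(1)[of i])
      show ?thesis
      proof (rule cohomologousI[where w = "\<lambda>g\<in>carrier G. \<ominus>\<^bsub>cob X i\<^esub> a g"])
        show "(\<lambda>g\<in>carrier G. \<ominus>\<^bsub>cob X i\<^esub> a g) \<in> lhom A G (cob X (i + 1 - 1))" using lh_uminus[OF G _ a] X by simp
      qed (use X xa in \<open>simp add: lm_ac\<close>)
    qed
    show "qis X Y f" unfolding qis_def using A B[of _ "i - 1" for i] by (metis diff_add_cancel)
  }
qed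

end


lemma exact_iff_cohomologous:
  assumes G: "lm G" and C: "cx C"
  shows "hom_from_exact A G C \<longleftrightarrow> (\<forall>i. \<forall>x\<in>lhom A G (cyc C i). cohomologous G C i x (zmap G C i))"
proof -
  have "(\<exists>w\<in>lhom A G (cob C (i - 1)). \<forall>g\<in>carrier G. dif C (i - 1) (w g) = x g) \<longleftrightarrow> cohomologous G C i x (zmap G C i)" for i x
    unfolding cohomologous_def
  proof (rule bex_cong[OF refl])
    fix w assume w: "w \<in> lhom A G (cob C (i - 1))"
    have "dif C (i - 1) (w g) \<in> carrier (cob C i)" if "g \<in> carrier G" for g
      using lh_closed[OF w that] C by simp
    then show "(\<forall>g\<in>carrier G. dif C (i - 1) (w g) = x g) = (\<forall>g\<in>carrier G. x g = zmap G C i g \<oplus>\<^bsub>cob C i\<^esub> dif C (i - 1) (w g))"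
      using C by auto
  qed
  then show ?thesis unfolding exact_iff_coboundaries[OF G C] by simp
qed

text \<open>Every cocycle of Y is cohomologous to the image of one from X, and the latter is a
  coboundary.\<close>

lemma qis_exact:
  assumes G: "lm G" and X: "cx X" and Y: "cx Y" and f: "f \<in> chain_maps A X Y" and q: "qis G X Y f" and e: "hom_from_exact A G X"
  shows "hom_from_exact A G Y"
  unfolding exact_iff_cohomologous[OF G Y]
proof (intro allI ballI)
  fix i y assume y: "y \<in> lhom A G (cyc Y i)"
  obtain x where x: "x \<in> lhom A G (cyc X i)" "cohomologous G Y i (push G f i x) y" using qisE1[OF G q y] .
  have z: "zmap G Z i \<in> lhom A G (cyc Z i)" if "cx Z" for Z i
    using lh_0[OF G cx_lm[OF that], of i] that by (simp add: lh_cyc_iff)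
  have pz: "push G f i (zmap G X i) = zmap G Y i"
    using cm_rules(4)[OF X Y f, of i] by (auto simp: compose_def intro!: ext)
  have "cohomologous G X i x (zmap G X i)" using e x(1) unfolding exact_iff_cohomologous[OF G X] by blast
  from push_coh[OF G X Y f z[OF X] this] have 1: "cohomologous G Y i (push G f i x) (zmap G Y i)" by (simp only: pz)
  note p = push_cocycle[OF G X Y f x(1)]
  show "cohomologous G Y i y (zmap G Y i)"
    by (rule coh_trans[OF G Y y p z[OF Y] coh_sym[OF G Y p y x(2)] 1])
qed

section \<open>The denominators of the Verdier quotient\<close>

definition gqis :: "'a cochain \<Rightarrow> 'a cochain \<Rightarrow> (int \<Rightarrow> 'a umap) \<Rightarrow> bool" where
  "gqis X Y f \<longleftrightarrow> (\<forall>G\<in>AGproj A. qis G X Y f)"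

lemma AGproj_lm: "G \<in> AGproj A \<Longrightarrow> lm G"
  using AGproj_fg fg_lm by blast

lemma Gproj_acyclic_iff: "C \<in> Gproj_acyclic A \<longleftrightarrow> bcx C \<and> (\<forall>G\<in>AGproj A. hom_from_exact A G C)"
  by (simp add: Gproj_acyclic_def)

lemma gqis_iff_cone:
  assumes X: "bcx X" and Y: "bcx Y" and f: "f \<in> chain_maps A X Y"
  shows "gqis X Y f \<longleftrightarrow> cone X Y f \<in> Gproj_acyclic A"
  unfolding gqis_def Gproj_acyclic_iff
  using bcx_cone[OF assms] qis_iff_cone[OF AGproj_lm bcx_cx[OF X] bcx_cx[OF Y] f] by blast

lemma iso_KbE:
  assumes "is_iso (Kb A) X Y \<alpha>" "bcx X" "bcx Y"
  obtains a b where "a \<in> chain_maps A X Y" "b \<in> chain_maps A Y X" "\<alpha> = hclass A X Y a"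
    "(cc X b a, icm X) \<in> homotopy_rel A X X" "(cc Y a b, icm Y) \<in> homotopy_rel A Y Y"
proof -
  have ob: "X \<in> Ob (Kb A)" "Y \<in> Ob (Kb A)" using assms by simp_all
  obtain \<beta> where ab: "arr (Kb A) X Y \<alpha>" "arr (Kb A) Y X \<beta>" "cmp (Kb A) X Y X \<beta> \<alpha> = idt (Kb A) X" "cmp (Kb A) Y X Y \<alpha> \<beta> = idt (Kb A) Y"
    using Kbc.is_isoE[OF assms(1) ob] .
  obtain a b where a: "a \<in> chain_maps A X Y" "\<alpha> = hclass A X Y a" and b: "b \<in> chain_maps A Y X" "\<beta> = hclass A Y X b"
    using ab(1,2) by (auto simp: arr_Kb)
  note c = bcx_cx[OF assms(2)] bcx_cx[OF assms(3)]
  have "hclass A X X (cc X b a) = hclass A X X (icm X)" "hclass A Y Y (cc Y a b) = hclass A Y Y (icm Y)"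
    using ab(3,4) unfolding a(2) b(2) cmp_hclass[OF c c(1) a(1) b(1)] cmp_hclass[OF c(2,1,2) b(1) a(1)] Kb_simps(3) by auto
  then show ?thesis
    using that[OF a(1) b(1) a(2)] hclass_eq_iff[OF c(1,1) cc_cm[OF c c(1) a(1) b(1)] icm_cm[OF c(1)]]
      hclass_eq_iff[OF c(2,2) cc_cm[OF c(2,1,2) b(1) a(1)] icm_cm[OF c(2)]] by blast
qed

text \<open>\<open>cone_in\<close> allows any triangle on f, while the cone construction gives one.
  Bijectivity on cohomology is invariant under homotopy equivalence, which makes the two agree and
  also shows independence of the representative f.\<close>

lemma cone_in_iff:
  assumes X: "bcx X" and Y: "bcx Y" and f: "f \<in> chain_maps A X Y"
  shows "hclass A X Y f \<in> cone_in (Kb A) (Gproj_acyclic A) X Y \<longleftrightarrow> gqis X Y f"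
proof
  assume "gqis X Y f"
  then have "cone X Y f \<in> Gproj_acyclic A" using gqis_iff_cone[OF assms] by simp
  moreover have "hclass A X Y f \<in> Hm (Kb A) X Y" using f by (auto simp: hclass_def intro!: quotientI)
  ultimately show "hclass A X Y f \<in> cone_in (Kb A) (Gproj_acyclic A) X Y"
    using Tri_cone[OF assms] unfolding cone_in_def by blast
next
  assume "hclass A X Y f \<in> cone_in (Kb A) (Gproj_acyclic A) X Y"
  then obtain Z v w where Z: "Z \<in> Gproj_acyclic A" "(X, Y, Z, hclass A X Y f, v, w) \<in> Tri (Kb A)" by (auto simp: cone_in_def)
  from TriE[OF Z(2)] obtain X' Y' f' \<alpha> \<beta> \<gamma> where t: "bcx X'" "bcx Y'" "f' \<in> chain_maps A X' Y'" "bcx Z"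
    "is_iso (Kb A) X X' \<alpha>" "is_iso (Kb A) Y Y' \<beta>" "is_iso (Kb A) Z (cone X' Y' f') \<gamma>"
    "cmp (Kb A) X Y Y' \<beta> (hclass A X Y f) = cmp (Kb A) X X' Y' (hclass A X' Y' f') \<alpha>" by metis
  have bC: "bcx (cone X' Y' f')" by (rule bcx_cone[OF t(1-3)])
  note c = bcx_cx[OF X] bcx_cx[OF Y] bcx_cx[OF t(1)] bcx_cx[OF t(2)] bcx_cx[OF t(4)] bcx_cx[OF bC]
  from iso_KbE[OF t(5) X t(1)] obtain a a' where a: "a \<in> chain_maps A X X'" "a' \<in> chain_maps A X' X" "\<alpha> = hclass A X X' a"
    "(cc X a' a, icm X) \<in> homotopy_rel A X X" "(cc X' a a', icm X') \<in> homotopy_rel A X' X'" .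
  from iso_KbE[OF t(6) Y t(2)] obtain b b' where b: "b \<in> chain_maps A Y Y'" "b' \<in> chain_maps A Y' Y" "\<beta> = hclass A Y Y' b"
    "(cc Y b' b, icm Y) \<in> homotopy_rel A Y Y" "(cc Y' b b', icm Y') \<in> homotopy_rel A Y' Y'" .
  from iso_KbE[OF t(7) t(4) bC] obtain d d' where d: "d \<in> chain_maps A Z (cone X' Y' f')" "d' \<in> chain_maps A (cone X' Y' f') Z" "\<gamma> = hclass A Z (cone X' Y' f') d"
    "(cc Z d' d, icm Z) \<in> homotopy_rel A Z Z" "(cc (cone X' Y' f') d d', icm (cone X' Y' f')) \<in> homotopy_rel A (cone X' Y' f') (cone X' Y' f')" .
  have "hclass A X Y' (cc X b f) = hclass A X Y' (cc X f' a)"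
    using t(8) unfolding a(3) b(3) cmp_hclass[OF c(1,2,4) f b(1)] cmp_hclass[OF c(1,3,4) a(1) t(3)] .
  then have h: "(cc X f' a, cc X b f) \<in> homotopy_rel A X Y'"
    using hclass_eq_iff[OF c(1,4) cc_cm[OF c(1,3,4) a(1) t(3)] cc_cm[OF c(1,2,4) f b(1)]] by auto
  show "gqis X Y f"
    unfolding gqis_def
  proof
    fix G assume GA: "G \<in> AGproj A"
    have G: "lm G" by (rule AGproj_lm[OF GA])
    \<comment> \<open>Exactness moves from Z to the standard cone of f', so f' is bijective on
      cohomology. Since b f is homotopic to f' a, and a and b are equivalences, the same holds for
      f.\<close>
    have "hom_from_exact A G Z" using Z(1) GA by (simp add: Gproj_acyclic_iff)
    then have "hom_from_exact A G (cone X' Y' f')"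
      by (rule qis_exact[OF G c(5,6) d(1) qis_inverse[OF G c(5,6) d(1,2,4,5)]])
    then have f': "qis G X' Y' f'" using qis_iff_cone[OF G c(3,4) t(3)] by simp
    have "qis G X Y' (cc X f' a)"
      by (rule qis_cc[OF G c(1,3,4) a(1) t(3) qis_inverse[OF G c(1,3) a(1,2,4,5)] f'])
    then have "qis G X Y' (cc X b f)" by (rule qis_homotopic[OF G c(1,4) h])
    then show "qis G X Y f" by (rule qis_left[OF G c(1,2,4) f b(1) _ qis_inverse[OF G c(2,4) b(1,2,4,5)]])
  qed
qed

abbreviation Nac :: "'a cochain set" where "Nac \<equiv> Gproj_acyclic A"

lemma weq_iff: "weq (Kb A) Nac X Y s \<longleftrightarrow> bcx X \<and> bcx Y \<and> (\<exists>f\<in>chain_maps A X Y. s = hclass A X Y f \<and> gqis X Y f)"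
proof
  assume *: "weq (Kb A) Nac X Y s"
  then have b: "bcx X" "bcx Y" and s: "s \<in> cone_in (Kb A) Nac X Y" by (auto simp: weq_def)
  then obtain f where "f \<in> chain_maps A X Y" "s = hclass A X Y f" by (auto simp: cone_in_def quotient_def hclass_def)
  then show "bcx X \<and> bcx Y \<and> (\<exists>f\<in>chain_maps A X Y. s = hclass A X Y f \<and> gqis X Y f)"
    using b s cone_in_iff[OF b] by blast
next
  assume "bcx X \<and> bcx Y \<and> (\<exists>f\<in>chain_maps A X Y. s = hclass A X Y f \<and> gqis X Y f)"
  then show "weq (Kb A) Nac X Y s" using cone_in_iff[of X Y] by (auto simp: weq_def)
qed

subsection \<open>Homotopy fibres\<close>

lemma lh_fst: "lm M \<Longrightarrow> lm N \<Longrightarrow> (\<lambda>w\<in>carrier (dsum M N). seq_fst w) \<in> lhom A (dsum M N) M"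
  and lh_snd: "lm M \<Longrightarrow> lm N \<Longrightarrow> (\<lambda>w\<in>carrier (dsum M N). seq_snd w) \<in> lhom A (dsum M N) N"
  by (rule lh_restrict[OF lm_dsum]; simp add: dsum_carrier_iff dsum_ops)+

text \<open>The object that makes l null-homotopic after projection to X: in degree i it is the sum
  of X in degree i and C in degree i - 1, and \<open>fhom\<close> is the null-homotopy.\<close>

definition fibre :: "'a cochain \<Rightarrow> 'a cochain \<Rightarrow> (int \<Rightarrow> 'a umap) \<Rightarrow> 'a cochain" where
  "fibre X C l = shift_cx (- 1) (cone X C l)"

lemma fibre_cob [simp]: "cob (fibre X C l) i = dsum (cob X i) (cob C (i - 1))"
  by (simp add: fibre_def)

context
  fixes X C :: "'a cochain" and l :: "int \<Rightarrow> 'a umap"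
  assumes X: "cx X" and C: "cx C" and l: "l \<in> chain_maps A X C"
begin

lemma fibre_dif [simp]:
  assumes "x \<in> carrier (cob X i)" "c \<in> carrier (cob C (i - 1))"
  shows "dif (fibre X C l) i (seq_pair x c) = seq_pair (dif X i x) (\<ominus>\<^bsub>cob C i\<^esub> l i x \<oplus>\<^bsub>cob C i\<^esub> \<ominus>\<^bsub>cob C i\<^esub> dif C (i - 1) c)"
  using assms X C cm_rules(1)[OF X C l] by (simp add: fibre_def int_plus_normal(1)[of i])

lemma fibre_dif' [simp]:
  assumes "x \<in> carrier (cob X (i - 1))" "c \<in> carrier (cob C (i - 2))"
  shows "dif (fibre X C l) (i - 1) (seq_pair x c) =
    seq_pair (dif X (i - 1) x) (\<ominus>\<^bsub>cob C (i - 1)\<^esub> l (i - 1) x \<oplus>\<^bsub>cob C (i - 1)\<^esub> \<ominus>\<^bsub>cob C (i - 1)\<^esub> dif C (i - 2) c)"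
  using fibre_dif[of x "i - 1" c] assms by simp

lemma cx_fibre: "cx (fibre X C l)"
  unfolding fibre_def by (rule cx_shift[OF cx_cone[OF X C l]])

definition fproj :: "int \<Rightarrow> 'a umap" where
  "fproj i = (\<lambda>w\<in>carrier (cob (fibre X C l) i). seq_fst w)"

text \<open>The map from (x, c) to -c; as a composite of two linear maps its linearity is an
  instance of \<open>lh_comp\<close>.\<close>

definition fhom :: "int \<Rightarrow> 'a umap" where
  "fhom i = compose (carrier (cob (fibre X C l) i)) (\<lambda>c\<in>carrier (cob C (i - 1)). \<ominus>\<^bsub>cob C (i - 1)\<^esub> c) (\<lambda>w\<in>carrier (cob (fibre X C l) i). seq_snd w)"

lemma fhom_lh: "fhom i \<in> lhom A (cob (fibre X C l) i) (cob C (i - 1))"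
  unfolding fhom_def
proof (rule lh_comp)
  show "(\<lambda>w\<in>carrier (cob (fibre X C l) i). seq_snd w) \<in> lhom A (cob (fibre X C l) i) (cob C (i - 1))"
    using lh_snd[OF cx_lm[OF X] cx_lm[OF C], of i "i - 1"] by simp
  show "(\<lambda>c\<in>carrier (cob C (i - 1)). \<ominus>\<^bsub>cob C (i - 1)\<^esub> c) \<in> lhom A (cob C (i - 1)) (cob C (i - 1))"
    by (rule lh_restrict) (use C in auto)
qed (use X C in \<open>simp add: lm_dsum\<close>)

lemma fibreE: "w \<in> carrier (cob (fibre X C l) i) \<Longrightarrow> \<exists>x\<in>carrier (cob X i). \<exists>c\<in>carrier (cob C (i - 1)). w = seq_pair x c"
  by (metis fibre_cob dsum_carrier_iff seq_pair_simps(3))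

lemma fproj_cm: "fproj \<in> chain_maps A (fibre X C l) X"
proof (rule cmI)
  fix i
  show "fproj i \<in> lhom A (cob (fibre X C l) i) (cob X i)"
    using lh_fst[OF cx_lm[OF X] cx_lm[OF C], of i "i - 1"] by (simp add: fproj_def)
  fix w assume w: "w \<in> carrier (cob (fibre X C l) i)"
  obtain x c where xc: "x \<in> carrier (cob X i)" "c \<in> carrier (cob C (i - 1))" "w = seq_pair x c" using fibreE[OF w] by blast
  have "dif (fibre X C l) i w \<in> carrier (cob (fibre X C l) (i + 1))" by (rule cx_closed[OF cx_fibre w])
  then show "dif X i (fproj i w) = fproj (i + 1) (dif (fibre X C l) i w)"
    using xc X C by (simp add: fproj_def)
qed

lemma fproj_null:
  assumes w: "w \<in> carrier (cob (fibre X C l) i)"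
  shows "l i (fproj i w) = dif C (i - 1) (fhom i w) \<oplus>\<^bsub>cob C i\<^esub> fhom (i + 1) (dif (fibre X C l) i w)"
proof -
  note [simp] = cm_rules[OF X C l]
  obtain x c where xc: "x \<in> carrier (cob X i)" "c \<in> carrier (cob C (i - 1))" "w = seq_pair x c" using fibreE[OF w] by blast
  have d: "dif (fibre X C l) i w \<in> carrier (cob (fibre X C l) (i + 1))" by (rule cx_closed[OF cx_fibre w])
  have "fhom i w = \<ominus>\<^bsub>cob C (i - 1)\<^esub> c" using xc by (simp add: fhom_def compose_def)
  moreover have "fhom (i + 1) (dif (fibre X C l) i w) = l i x \<oplus>\<^bsub>cob C i\<^esub> dif C (i - 1) c"
    using d xc X C by (simp add: fhom_def compose_def)
  moreover have "fproj i w = x" using xc by (simp add: fproj_def)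
  ultimately show ?thesis using xc X C by (simp add: lm_ac)
qed

text \<open>This is the source of denominators. Surjectivity: l x = d v by exactness of C, and (x,
  -v) is a cocycle over x. Injectivity: if x = x' + d a, then l a + c - c' is a cocycle of C; with d
  v equal to it, (a, -v) accounts for the difference.\<close>

lemma fproj_qis:
  assumes G: "lm G" and e: "hom_from_exact A G C"
  shows "qis G (fibre X C l) X fproj"
  unfolding qis_def[OF G]
proof (intro allI conjI ballI impI)
  note [simp] = cm_rules[OF X C l] and F = cx_fibre
  let ?F = "fibre X C l"
  fix i
  {
    fix x assume x: "x \<in> lhom A G (cyc X i)"
    note [simp] = cocycleD(2,3)[OF x]
    obtain v where v: "v \<in> lhom A G (cob C (i - 1))" and [simp]: "\<And>g. g \<in> carrier G \<Longrightarrow> v g \<in> carrier (cob C (i - 1))"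
      and dv: "\<And>g. g \<in> carrier G \<Longrightarrow> dif C (i - 1) (v g) = l i (x g)"
      by (rule exactE[OF G e C push_cocycle[OF G X C l x]]) (auto simp: compose_eq)
    let ?p = "\<lambda>g\<in>carrier G. seq_pair (x g) ((\<lambda>g\<in>carrier G. \<ominus>\<^bsub>cob C (i - 1)\<^esub> v g) g)"
    have "?p \<in> lhom A G (cob ?F i)"
      using lh_into_dsum[OF G _ _ cocycleD(1)[OF x] lh_uminus[OF G _ v]] X C by simp
    then have p: "?p \<in> lhom A G (cyc ?F i)" using X C dv by (simp add: lh_cyc_iff)
    have "push G fproj i ?p = x"
      using lh_ext[OF x] by (auto simp: compose_def fproj_def X C intro!: ext)
    then show "\<exists>p\<in>lhom A G (cyc ?F i). cohomologous G X i (push G fproj i p) x"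
      using p coh_refl[OF G X x] by (intro bexI[OF _ p]) simp
  next
    fix p p' assume p: "p \<in> lhom A G (cyc ?F i)" and p': "p' \<in> lhom A G (cyc ?F i)"
      and pp: "cohomologous G X i (push G fproj i p) (push G fproj i p')"
    have "p \<in> lhom A G (dsum (cob X i) (cob C (i - 1)))" using cocycleD(1)[OF p] by simp
    from lh_into_dsumE[OF G cx_lm[OF X] cx_lm[OF C] this] obtain x c where x: "x \<in> lhom A G (cob X i)" and c: "c \<in> lhom A G (cob C (i - 1))"
      and pe: "\<And>g. g \<in> carrier G \<Longrightarrow> p g = seq_pair (x g) (c g)" by metis
    have "p' \<in> lhom A G (dsum (cob X i) (cob C (i - 1)))" using cocycleD(1)[OF p'] by simp
    from lh_into_dsumE[OF G cx_lm[OF X] cx_lm[OF C] this] obtain x' c' where x': "x' \<in> lhom A G (cob X i)" and c': "c' \<in> lhom A G (cob C (i - 1))"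
      and pe': "\<And>g. g \<in> carrier G \<Longrightarrow> p' g = seq_pair (x' g) (c' g)" by metis
    note [simp] = lh_closed[OF x] lh_closed[OF c] lh_closed[OF x'] lh_closed[OF c']
    obtain a where a: "a \<in> lhom A G (cob X (i - 1))" and [simp]: "\<And>g. g \<in> carrier G \<Longrightarrow> a g \<in> carrier (cob X (i - 1))"
      and xa: "\<And>g. g \<in> carrier G \<Longrightarrow> x g = x' g \<oplus>\<^bsub>cob X i\<^esub> dif X (i - 1) (a g)"
      by (rule cohomologousE[OF pp]) (auto simp: compose_eq fproj_def pe pe')
    have lx: "\<ominus>\<^bsub>cob C i\<^esub> l i (x g) \<oplus>\<^bsub>cob C i\<^esub> \<ominus>\<^bsub>cob C i\<^esub> dif C (i - 1) (c g) = \<zero>\<^bsub>cob C i\<^esub>" if "g \<in> carrier G" for g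
      using cocycleD(3)[OF p that] that pe by simp
    have lx': "\<ominus>\<^bsub>cob C i\<^esub> l i (x' g) \<oplus>\<^bsub>cob C i\<^esub> \<ominus>\<^bsub>cob C i\<^esub> dif C (i - 1) (c' g) = \<zero>\<^bsub>cob C i\<^esub>" if "g \<in> carrier G" for g
      using cocycleD(3)[OF p' that] that pe' by simp
    have dc: "dif C (i - 1) (c g) = \<ominus>\<^bsub>cob C i\<^esub> l i (x g)" "dif C (i - 1) (c' g) = \<ominus>\<^bsub>cob C i\<^esub> l i (x' g)" if g: "g \<in> carrier G" for g
      using lx[OF g] lx'[OF g] g C lm_eq_neg_iff[OF cx_lm[OF C], of "\<ominus>\<^bsub>cob C i\<^esub> l i (x g)" i "\<ominus>\<^bsub>cob C i\<^esub> dif C (i - 1) (c g)"]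
        lm_eq_neg_iff[OF cx_lm[OF C], of "\<ominus>\<^bsub>cob C i\<^esub> l i (x' g)" i "\<ominus>\<^bsub>cob C i\<^esub> dif C (i - 1) (c' g)"] by simp_all
    let ?d = "\<lambda>g\<in>carrier G. c g \<oplus>\<^bsub>cob C (i - 1)\<^esub> (\<lambda>g\<in>carrier G. \<ominus>\<^bsub>cob C (i - 1)\<^esub> c' g) g"
    have d: "?d \<in> lhom A G (cob C (i - 1))" by (rule lh_plus[OF G _ c lh_uminus[OF G _ c']]) (use C in auto)
    let ?z = "\<lambda>g\<in>carrier G. compose (carrier G) (l (i - 1)) a g \<oplus>\<^bsub>cob C (i - 1)\<^esub> ?d g"
    have "?z \<in> lhom A G (cob C (i - 1))" by (rule lh_plus[OF G _ lh_comp[OF G a cm_lh[OF l]] d]) (use C in auto)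
    then have z: "?z \<in> lhom A G (cyc C (i - 1))"
      using C X by (simp add: lh_cyc_iff compose_eq dc xa lm_ac)
    obtain v where v: "v \<in> lhom A G (cob C (i - 2))" and [simp]: "\<And>g. g \<in> carrier G \<Longrightarrow> v g \<in> carrier (cob C (i - 2))"
      and dv: "\<And>g. g \<in> carrier G \<Longrightarrow> dif C (i - 2) (v g) = l (i - 1) (a g) \<oplus>\<^bsub>cob C (i - 1)\<^esub> (c g \<oplus>\<^bsub>cob C (i - 1)\<^esub> \<ominus>\<^bsub>cob C (i - 1)\<^esub> c' g)"
      by (rule exactE[OF G e C z]) (auto simp: compose_eq)
    let ?w = "\<lambda>g\<in>carrier G. seq_pair (a g) ((\<lambda>g\<in>carrier G. \<ominus>\<^bsub>cob C (i - 2)\<^esub> v g) g)"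
    have [simp]: "dif C (i - 2) (\<ominus>\<^bsub>cob C (i - 2)\<^esub> v g) = \<ominus>\<^bsub>cob C (i - 1)\<^esub> dif C (i - 2) (v g)" if "g \<in> carrier G" for g
      using cx_neg[OF C, of "v g" "i - 2"] that by simp
    show "cohomologous G ?F i p p'"
    proof (rule cohomologousI[where w = ?w])
      show "?w \<in> lhom A G (cob ?F (i - 1))" using lh_into_dsum[OF G _ _ a lh_uminus[OF G _ v]] X C by simp
      fix g assume "g \<in> carrier G"
      then show "p g = p' g \<oplus>\<^bsub>cob ?F i\<^esub> dif ?F (i - 1) (?w g)"
        using X C by (simp add: pe pe' xa dv lm_ac)
    qed
  }
qed

end

lemma bcx_fibre: "bcx X \<Longrightarrow> bcx C \<Longrightarrow> l \<in> chain_maps A X C \<Longrightarrow> bcx (fibre X C l)"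
  unfolding fibre_def by (intro bcx_shift bcx_cone)

lemma exact_shift:
  assumes G: "lm G" and C: "cx C" and e: "hom_from_exact A G C"
  shows "hom_from_exact A G (shift_cx (- 1) C)"
  unfolding exact_iff_coboundaries[OF G cx_shift[OF C]]
proof (intro allI ballI)
  fix i x assume x: "x \<in> lhom A G (cyc (shift_cx (- 1) C) i)"
  have xl: "x \<in> lhom A G (cob C (i - 1))" using cocycleD(1)[OF x] by simp
  note [simp] = lh_closed[OF xl]
  have "\<ominus>\<^bsub>cob C i\<^esub> dif C (i - 1) (x g) = \<zero>\<^bsub>cob C i\<^esub>" if "g \<in> carrier G" for g
    using cocycleD(3)[OF x that] that by simp
  then have "dif C (i - 1) (x g) = \<zero>\<^bsub>cob C i\<^esub>" if "g \<in> carrier G" for g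
    using that C lm_negneg[OF cx_lm[OF C], of "dif C (i - 1) (x g)" i] by force
  then have "x \<in> lhom A G (cyc C (i - 1))" using xl by (simp add: lh_cyc_iff)
  then obtain w where w: "w \<in> lhom A G (cob C (i - 2))" and [simp]: "\<And>g. g \<in> carrier G \<Longrightarrow> w g \<in> carrier (cob C (i - 2))"
    and dw: "\<And>g. g \<in> carrier G \<Longrightarrow> dif C (i - 2) (w g) = x g" by (rule exactE[OF G e C]) auto
  let ?w = "\<lambda>g\<in>carrier G. \<ominus>\<^bsub>cob C (i - 2)\<^esub> w g"
  have "?w \<in> lhom A G (cob (shift_cx (- 1) C) (i - 1))" using lh_uminus[OF G _ w] C by simp
  moreover have "dif (shift_cx (- 1) C) (i - 1) (?w g) = x g" if "g \<in> carrier G" for g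
    using cx_neg[OF C, of "w g" "i - 2"] that C dw by simp
  ultimately show "\<exists>w\<in>lhom A G (cob (shift_cx (- 1) C) (i - 1)). \<forall>g\<in>carrier G. dif (shift_cx (- 1) C) (i - 1) (w g) = x g" by blast
qed

text \<open>P is the fibre of X -> Y -> cone t. The cone is acyclic, so P -> X is a denominator. The
  null-homotopy of P -> cone t has two components: the one in V is the chain map v, and the one in Y
  is a homotopy from f u to t v.\<close>

lemma Kb_ore:
  assumes f: "arr (Kb A) X Y \<phi>" and t: "weq (Kb A) Nac V Y \<tau>"
  shows "\<exists>P u v. weq (Kb A) Nac P X u \<and> arr (Kb A) P V v \<and> cmp (Kb A) P X Y \<phi> u = cmp (Kb A) P V Y \<tau> v"
proof -
  obtain f where f: "bcx X" "bcx Y" "f \<in> chain_maps A X Y" "\<phi> = hclass A X Y f" using f by (auto simp: arr_Kb)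
  obtain t where t: "bcx V" "t \<in> chain_maps A V Y" "\<tau> = hclass A V Y t" "gqis V Y t" using t by (auto simp: weq_iff)
  let ?C = "cone V Y t"
  have bC: "bcx ?C" by (rule bcx_cone[OF t(1) f(2) t(2)])
  have C: "?C \<in> Nac" using gqis_iff_cone[OF t(1) f(2) t(2)] t(4) by simp
  note c = bcx_cx[OF f(1)] bcx_cx[OF f(2)] bcx_cx[OF t(1)] bcx_cx[OF bC]
  let ?l = "cc X (cone_inj V Y) f"
  have l: "?l \<in> chain_maps A X ?C" by (rule cc_cm[OF c(1,2,4) f(3) cone_inj_cm[OF c(3,2) t(2)]])
  let ?P = "fibre X ?C ?l"
  define u where "u = fproj X ?C ?l"
  have bP: "bcx ?P" by (rule bcx_fibre[OF f(1) bC l])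
  note P = bcx_cx[OF bP]
  have u: "u \<in> chain_maps A ?P X" unfolding u_def by (rule fproj_cm[OF c(1,4) l])
  have qu: "gqis ?P X u" unfolding gqis_def u_def
    using fproj_qis[OF c(1,4) l AGproj_lm] C by (simp add: Gproj_acyclic_iff)
  define k where "k = fhom X ?C ?l"
  have kl: "k i \<in> lhom A (cob ?P i) (cob ?C (i - 1))" for i unfolding k_def by (rule fhom_lh[OF c(1,4) l])
  have lu: "?l i (u i w) = dif ?C (i - 1) (k i w) \<oplus>\<^bsub>cob ?C i\<^esub> k (i + 1) (dif ?P i w)" if "w \<in> carrier (cob ?P i)" for i w
    unfolding u_def k_def by (rule fproj_null[OF c(1,4) l that])
  have lP: "lm (cob ?P i)" and lV: "lm (cob V i)" and lY: "lm (cob Y i)" for i using cx_lm[OF P] c by auto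
  have "\<exists>a b. a \<in> lhom A (cob ?P i) (cob V i) \<and> b \<in> lhom A (cob ?P i) (cob Y (i - 1)) \<and>
      (\<forall>w\<in>carrier (cob ?P i). k i w = seq_pair (a w) (b w))" for i
  proof -
    have "k i \<in> lhom A (cob ?P i) (dsum (cob V i) (cob Y (i - 1)))" using kl[of i] by simp
    from lh_into_dsumE[OF lP lV lY this] show ?thesis by metis
  qed
  then obtain a b where a: "\<And>i. a i \<in> lhom A (cob ?P i) (cob V i)" and b: "\<And>i. b i \<in> lhom A (cob ?P i) (cob Y (i - 1))"
    and kab: "\<And>i w. w \<in> carrier (cob ?P i) \<Longrightarrow> k i w = seq_pair (a i w) (b i w)" by metis
  note [simp] = cm_rules(1)[OF P c(1) u] lh_closed[OF a] hm_rules(1,2)[OF P c(2) b] cm_rules(1)[OF c(1,2) f(3)] cm_rules(1)[OF c(3,2) t(2)]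
  have ci: "cone_inj V Y i y = seq_pair \<zero>\<^bsub>cob V (i + 1)\<^esub> y" if "y \<in> carrier (cob Y i)" for i y
    using that by (simp add: cone_inj_def)
  \<comment> \<open>Comparison of the two components of the null-homotopy identity: the first gives
    that a commutes with differentials, the second the homotopy.\<close>
  have e: "seq_pair \<zero>\<^bsub>cob V (i + 1)\<^esub> (f i (u i w)) =
      seq_pair (\<ominus>\<^bsub>cob V (i + 1)\<^esub> dif V i (a i w) \<oplus>\<^bsub>cob V (i + 1)\<^esub> a (i + 1) (dif ?P i w))
       ((t i (a i w) \<oplus>\<^bsub>cob Y i\<^esub> dif Y (i - 1) (b i w)) \<oplus>\<^bsub>cob Y i\<^esub> b (i + 1) (dif ?P i w))"
    if w: "w \<in> carrier (cob ?P i)" for i w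
    using lu[OF w] w kab[OF w] kab[OF cx_closed[OF P w]] by (simp add: ci int_plus_normal(1)[of i] del: fibre_cob)
  have v: "a \<in> chain_maps A ?P V"
  proof (rule cmI[OF a])
    fix i w assume w: "w \<in> carrier (cob ?P i)"
    have aw: "a i w \<in> carrier (cob V i)" "a (i + 1) (dif ?P i w) \<in> carrier (cob V (i + 1))"
      using lh_closed[OF a w] lh_closed[OF a cx_closed[OF P w]] by auto
    have "\<ominus>\<^bsub>cob V (i + 1)\<^esub> dif V i (a i w) \<oplus>\<^bsub>cob V (i + 1)\<^esub> a (i + 1) (dif ?P i w) = \<zero>\<^bsub>cob V (i + 1)\<^esub>"
      using e[OF w] by simp
    then show "dif V i (a i w) = a (i + 1) (dif ?P i w)"
      using lm_eq_neg_iff[OF lV, of "a (i + 1) (dif ?P i w)" "i + 1" "\<ominus>\<^bsub>cob V (i + 1)\<^esub> dif V i (a i w)"] aw c lm_comm[OF lV] by simp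
  qed
  have "(cc ?P f u, cc ?P t a) \<in> homotopy_rel A ?P Y"
  proof (rule hrI[OF cc_cm[OF P c(1,2) u f(3)] cc_cm[OF P c(3,2) v t(2)] b])
    fix i w assume w: "w \<in> carrier (cob ?P i)"
    have m: "a i w \<in> carrier (cob V i)" "b i w \<in> carrier (cob Y (i - 1))" "b (i + 1) (dif ?P i w) \<in> carrier (cob Y i)"
      using lh_closed[OF a w] lh_closed[OF b w] lh_closed[OF b cx_closed[OF P w]] by auto
    show "cc ?P f u i w = cc ?P t a i w \<oplus>\<^bsub>cob Y i\<^esub> (dif Y (i - 1) (b i w) \<oplus>\<^bsub>cob Y i\<^esub> b (i + 1) (dif ?P i w))"
      unfolding cc_apply[OF w] using e[OF w] m c by (simp add: lm_assoc)
  qed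
  from hclass_eqI[OF P c(2) this] have "cmp (Kb A) ?P X Y \<phi> (hclass A ?P X u) = cmp (Kb A) ?P V Y \<tau> (hclass A ?P V a)"
    unfolding f(4) t(3) cmp_hclass[OF P c(1,2) u f(3)] cmp_hclass[OF P c(3,2) v t(2)] .
  moreover have "weq (Kb A) Nac ?P X (hclass A ?P X u)" using bP f(1) u qu by (auto simp: weq_iff)
  moreover have "arr (Kb A) ?P V (hclass A ?P V a)" using bP t(1) v by (auto simp: arr_Kb)
  ultimately show ?thesis by blast
qed

text \<open>A null-homotopy h of t f - t g turns (f - g, -h) into a chain map to the fibre of t,
  which is acyclic. On the fibre P of this map it becomes null-homotopic, and the component of the
  homotopy in Y shows that f u and g u are homotopic.\<close>

lemma Kb_cancel:
  assumes t: "weq (Kb A) Nac Y Y' \<tau>" and f: "arr (Kb A) X Y \<phi>" and g: "arr (Kb A) X Y \<psi>"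
    and eq: "cmp (Kb A) X Y Y' \<tau> \<phi> = cmp (Kb A) X Y Y' \<tau> \<psi>"
  shows "\<exists>P u. weq (Kb A) Nac P X u \<and> cmp (Kb A) P X Y \<phi> u = cmp (Kb A) P X Y \<psi> u"
proof -
  obtain f where f: "bcx X" "bcx Y" "f \<in> chain_maps A X Y" "\<phi> = hclass A X Y f" using f by (auto simp: arr_Kb)
  obtain g where g: "g \<in> chain_maps A X Y" "\<psi> = hclass A X Y g" using g by (auto simp: arr_Kb)
  obtain t where t: "bcx Y'" "t \<in> chain_maps A Y Y'" "\<tau> = hclass A Y Y' t" "gqis Y Y' t" using t by (auto simp: weq_iff)
  note c = bcx_cx[OF f(1)] bcx_cx[OF f(2)] bcx_cx[OF t(1)]
  have "hclass A X Y' (cc X t f) = hclass A X Y' (cc X t g)"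
    using eq unfolding f(4) g(2) t(3) cmp_hclass[OF c f(3) t(2)] cmp_hclass[OF c g(1) t(2)] .
  then have "(cc X t f, cc X t g) \<in> homotopy_rel A X Y'"
    using hclass_eq_iff[OF c(1,3) cc_cm[OF c f(3) t(2)] cc_cm[OF c g(1) t(2)]] by simp
  from hr_ccE[OF this] obtain h where h: "\<And>i. h i \<in> lhom A (cob X i) (cob Y' (i - 1))" and
    th: "\<And>i x. x \<in> carrier (cob X i) \<Longrightarrow> t i (f i x) = t i (g i x) \<oplus>\<^bsub>cob Y' i\<^esub> (dif Y' (i - 1) (h i x) \<oplus>\<^bsub>cob Y' i\<^esub> h (i + 1) (dif X i x))"
    by metis
  let ?C = "fibre Y Y' t"
  note C = cx_fibre[OF c(2,3) t(2)]
  have bC: "bcx ?C" by (rule bcx_fibre[OF f(2) t(1,2)])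
  have NC: "?C \<in> Nac"
    using bC exact_shift[OF AGproj_lm cx_cone[OF c(2,3) t(2)]] gqis_iff_cone[OF f(2) t(1,2)] t(4)
    by (simp add: Gproj_acyclic_iff fibre_def)
  let ?d = "\<lambda>i. \<lambda>x\<in>carrier (cob X i). f i x \<oplus>\<^bsub>cob Y i\<^esub> (\<lambda>x\<in>carrier (cob X i). \<ominus>\<^bsub>cob Y i\<^esub> g i x) x"
  let ?h = "\<lambda>i. \<lambda>x\<in>carrier (cob X i). \<ominus>\<^bsub>cob Y' (i - 1)\<^esub> h i x"
  define l where "l i = (\<lambda>x\<in>carrier (cob X i). seq_pair (?d i x) (?h i x))" for i
  note fr [simp] = cm_rules[OF c(1,2) f(3)] cm_rules[OF c(1,2) g(1)] cm_rules[OF c(2,3) t(2)] hm_rules[OF c(1,3) h]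
  have dl: "?d i \<in> lhom A (cob X i) (cob Y i)" for i
    by (rule lh_plus[OF _ _ cm_lh[OF f(3)] lh_uminus[OF _ _ cm_lh[OF g(1)]]]) (use c in auto)
  have hl: "?h i \<in> lhom A (cob X i) (cob Y' (i - 1))" for i by (rule lh_uminus[OF _ _ h]) (use c in auto)
  \<comment> \<open>The homotopy identity for h is exactly the condition that (f - g, -h) commutes
    with the differential of the fibre.\<close>
  have l: "l \<in> chain_maps A X ?C"
  proof (rule cmI)
    fix i
    show "l i \<in> lhom A (cob X i) (cob ?C i)" unfolding l_def fibre_cob by (rule lh_into_dsum[OF _ _ _ dl hl]) (use c in auto)
    fix x assume x: "x \<in> carrier (cob X i)"
    have [simp]: "h i (dif X (i - 1) y) \<in> carrier (cob Y' (i - 1))" if "y \<in> carrier (cob X (i - 1))" for y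
      using that c by simp
    show "dif ?C i (l i x) = l (i + 1) (dif X i x)"
      using x c th[OF x] fibre_dif[OF c(2,3) t(2), of "?d i x" i "?h i x"] lh_closed[OF dl x] lh_closed[OF hl x]
      by (simp add: l_def lm_ac)
  qed
  let ?P = "fibre X ?C l"
  define u where "u = fproj X ?C l"
  have bP: "bcx ?P" by (rule bcx_fibre[OF f(1) bC l])
  note P = bcx_cx[OF bP]
  have u: "u \<in> chain_maps A ?P X" unfolding u_def by (rule fproj_cm[OF c(1) C l])
  have qu: "gqis ?P X u" unfolding gqis_def u_def
    using fproj_qis[OF c(1) C l AGproj_lm] NC by (simp add: Gproj_acyclic_iff)
  define k where "k = fhom X ?C l"
  have kl: "k i \<in> lhom A (cob ?P i) (cob ?C (i - 1))" for i unfolding k_def by (rule fhom_lh[OF c(1) C l])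
  have lu: "l i (u i w) = dif ?C (i - 1) (k i w) \<oplus>\<^bsub>cob ?C i\<^esub> k (i + 1) (dif ?P i w)" if "w \<in> carrier (cob ?P i)" for i w
    unfolding u_def k_def by (rule fproj_null[OF c(1) C l that])
  have lP: "lm (cob ?P i)" and lY: "lm (cob Y i)" and lY': "lm (cob Y' i)" for i using cx_lm[OF P] c by auto
  have "\<exists>a b. a \<in> lhom A (cob ?P i) (cob Y (i - 1)) \<and> b \<in> lhom A (cob ?P i) (cob Y' (i - 2)) \<and>
      (\<forall>w\<in>carrier (cob ?P i). k i w = seq_pair (a w) (b w))" for i
  proof -
    have "k i \<in> lhom A (cob ?P i) (dsum (cob Y (i - 1)) (cob Y' (i - 2)))" using kl[of i] by simp
    from lh_into_dsumE[OF lP lY lY' this] show ?thesis by metis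
  qed
  then obtain a b where a: "\<And>i. a i \<in> lhom A (cob ?P i) (cob Y (i - 1))" and b: "\<And>i. b i \<in> lhom A (cob ?P i) (cob Y' (i - 2))"
    and kab: "\<And>i w. w \<in> carrier (cob ?P i) \<Longrightarrow> k i w = seq_pair (a i w) (b i w)" by metis
  have "(cc ?P f u, cc ?P g u) \<in> homotopy_rel A ?P Y"
  proof (rule hrI[OF cc_cm[OF P c(1,2) u f(3)] cc_cm[OF P c(1,2) u g(1)] a])
    fix i w assume w: "w \<in> carrier (cob ?P i)"
    have m: "u i w \<in> carrier (cob X i)" "a i w \<in> carrier (cob Y (i - 1))" "b i w \<in> carrier (cob Y' (i - 2))" "a (i + 1) (dif ?P i w) \<in> carrier (cob Y i)"
      using cm_rules(1)[OF P c(1) u w] lh_closed[OF a w] lh_closed[OF b w] lh_closed[OF a cx_closed[OF P w]] by auto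
    have "f i (u i w) \<oplus>\<^bsub>cob Y i\<^esub> \<ominus>\<^bsub>cob Y i\<^esub> g i (u i w) = dif Y (i - 1) (a i w) \<oplus>\<^bsub>cob Y i\<^esub> a (i + 1) (dif ?P i w)"
      using lu[OF w] m kab[OF w] kab[OF cx_closed[OF P w]] fibre_dif'[OF c(2,3) t(2) m(2,3)] by (simp add: l_def)
    then have "f i (u i w) = (dif Y (i - 1) (a i w) \<oplus>\<^bsub>cob Y i\<^esub> a (i + 1) (dif ?P i w)) \<oplus>\<^bsub>cob Y i\<^esub> g i (u i w)"
      using lm_move(1)[OF lY] m c by simp
    then show "cc ?P f u i w = cc ?P g u i w \<oplus>\<^bsub>cob Y i\<^esub> (dif Y (i - 1) (a i w) \<oplus>\<^bsub>cob Y i\<^esub> a (i + 1) (dif ?P i w))"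
      unfolding cc_apply[OF w] using m c by (simp add: lm_ac)
  qed
  from hclass_eqI[OF P c(2) this] have "cmp (Kb A) ?P X Y \<phi> (hclass A ?P X u) = cmp (Kb A) ?P X Y \<psi> (hclass A ?P X u)"
    unfolding f(4) g(2) cmp_hclass[OF P c(1,2) u f(3)] cmp_hclass[OF P c(1,2) u g(1)] .
  moreover have "weq (Kb A) Nac ?P X (hclass A ?P X u)" using bP f(1) u qu by (auto simp: weq_iff)
  ultimately show ?thesis by blast
qed

text \<open>The shift changes the differential by a sign, which affects neither cocycles nor, after
  negating the witness, coboundaries.\<close>

lemma shift_cocycles:
  assumes X: "cx X" and G: "lm G"
  shows "lhom A G (cyc (shift_cx 1 X) i) = lhom A G (cyc X (i + 1))"
proof -
  have "\<ominus>\<^bsub>cob X (i + 2)\<^esub> dif X (i + 1) x = \<zero>\<^bsub>cob X (i + 2)\<^esub> \<longleftrightarrow> dif X (i + 1) x = \<zero>\<^bsub>cob X (i + 2)\<^esub>" if "x \<in> carrier (cob X (i + 1))" for x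
    using that X cx2(1)[OF X that] lm_neg0[OF cx_lm[OF X], of "i + 2"] by (metis cx_lm lm_negneg)
  then have "(dif (shift_cx 1 X) i x = \<zero>\<^bsub>cob (shift_cx 1 X) (i + 1)\<^esub>) = (dif X (i + 1) x = \<zero>\<^bsub>cob X (i + 1 + 1)\<^esub>)"
    if "x \<in> carrier (cob X (i + 1))" for x using that by (simp add: add.assoc)
  then show ?thesis unfolding set_eq_iff lh_cyc_iff shift_cob by (metis (no_types, lifting) lh_closed shift_cob)
qed

lemma shift_cohomologous:
  assumes X: "cx X" and G: "lm G"
  shows "cohomologous G (shift_cx 1 X) i x y \<longleftrightarrow> cohomologous G X (i + 1) x y"
proof -
  have d: "dif (shift_cx 1 X) (i - 1) z = \<ominus>\<^bsub>cob X (i + 1)\<^esub> dif X i z" if "z \<in> carrier (cob X i)" for z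
    using shift_dif[of z X "i - 1" 1] that by simp
  have *: "(\<lambda>g\<in>carrier G. \<ominus>\<^bsub>cob X i\<^esub> w g) \<in> lhom A G (cob X i)" if "w \<in> lhom A G (cob X i)" for w
    using lh_uminus[OF G cx_lm[OF X] that] .
  show ?thesis
  proof
    assume "cohomologous G (shift_cx 1 X) i x y"
    then obtain w where w: "w \<in> lhom A G (cob X i)" "\<And>g. g \<in> carrier G \<Longrightarrow> x g = y g \<oplus>\<^bsub>cob X (i + 1)\<^esub> dif (shift_cx 1 X) (i - 1) (w g)"
      by (auto simp: cohomologous_def)
    show "cohomologous G X (i + 1) x y"
      by (rule cohomologousI[where w = "\<lambda>g\<in>carrier G. \<ominus>\<^bsub>cob X i\<^esub> w g"]) (use *[OF w(1)] w(2) d lh_closed[OF w(1)] X in \<open>simp_all add: int_plus_normal(1)[of i]\<close>)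
  next
    assume "cohomologous G X (i + 1) x y"
    then obtain w where w: "w \<in> lhom A G (cob X i)" "\<And>g. g \<in> carrier G \<Longrightarrow> x g = y g \<oplus>\<^bsub>cob X (i + 1)\<^esub> dif X i (w g)"
      by (auto simp: cohomologous_def)
    show "cohomologous G (shift_cx 1 X) i x y"
      by (rule cohomologousI[where w = "\<lambda>g\<in>carrier G. \<ominus>\<^bsub>cob X i\<^esub> w g"]) (use *[OF w(1)] w(2) d lh_closed[OF w(1)] X in \<open>simp_all add: int_plus_normal(1)[of i]\<close>)
  qed
qed

lemma qis_shift:
  assumes X: "cx X" and Y: "cx Y" and G: "lm G" and q: "qis G X Y f"
  shows "qis G (shift_cx 1 X) (shift_cx 1 Y) (\<lambda>i. f (i + 1))"
  using q unfolding qis_def[OF G] shift_cocycles[OF X G] shift_cocycles[OF Y G] shift_cohomologous[OF X G] shift_cohomologous[OF Y G] by blast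

lemma fractions_Kb: "fractions (Kb A) Nac"
proof (intro fractions.intro fractions_axioms.intro precat_Kb)
  fix X assume "X \<in> Ob (Kb A)"
  then have X: "bcx X" by simp
  note c = bcx_cx[OF X]
  have "gqis X X (icm X)"
    unfolding gqis_def using qis_inverse[OF AGproj_lm c c icm_cm[OF c] icm_cm[OF c]] cc_icm(1)[OF icm_cm[OF c]] hr_refl[OF c c icm_cm[OF c]] by simp
  then show "weq (Kb A) Nac X X (idt (Kb A) X)" using X icm_cm[OF c] by (auto simp: weq_iff)
  show "shO (Kb A) 1 X \<in> Ob (Kb A)" using bcx_shift[OF X] by simp
  show "shM (Kb A) 1 (idt (Kb A) X) = idt (Kb A) (shO (Kb A) 1 X)"
    unfolding Kb_simps(3,4) shM_hclass[OF c c] by (simp add: icm_def)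
next
  fix X Y s Z t assume "weq (Kb A) Nac X Y s" "weq (Kb A) Nac Y Z t"
  then obtain f g where *: "bcx X" "bcx Y" "bcx Z" "f \<in> chain_maps A X Y" "g \<in> chain_maps A Y Z" "s = hclass A X Y f" "t = hclass A Y Z g"
    "gqis X Y f" "gqis Y Z g" by (auto simp: weq_iff)
  note c = *(1-3)[THEN bcx_cx]
  have "gqis X Z (cc X g f)" using *(8,9) qis_cc[OF AGproj_lm c *(4,5)] by (simp add: gqis_def)
  then show "weq (Kb A) Nac X Z (cmp (Kb A) X Y Z t s)"
    unfolding *(6,7) cmp_hclass[OF c *(4,5)] using * cc_cm[OF c *(4,5)] by (auto simp: weq_iff)
next
  fix X Y s Z t assume 1: "weq (Kb A) Nac Y Z t" and 2: "arr (Kb A) X Y s" and 3: "weq (Kb A) Nac X Z (cmp (Kb A) X Y Z t s)"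
  obtain f where f: "bcx X" "bcx Y" "f \<in> chain_maps A X Y" "s = hclass A X Y f" using 2 by (auto simp: arr_Kb)
  obtain g where g: "bcx Z" "g \<in> chain_maps A Y Z" "t = hclass A Y Z g" "gqis Y Z g" using 1 by (auto simp: weq_iff)
  note c = f(1,2)[THEN bcx_cx] g(1)[THEN bcx_cx]
  note gf = cc_cm[OF c f(3) g(2)]
  obtain k where k: "k \<in> chain_maps A X Z" "hclass A X Z (cc X g f) = hclass A X Z k" "gqis X Z k"
    using 3 unfolding f(4) g(3) cmp_hclass[OF c f(3) g(2)] weq_iff by auto
  have "(k, cc X g f) \<in> homotopy_rel A X Z" using hclass_eq_iff[OF c(1,3) k(1) gf] k(2) by simp
  then have "gqis X Z (cc X g f)" using k(3) qis_homotopic[OF AGproj_lm c(1,3)] by (auto simp: gqis_def)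
  then have "gqis X Y f" using g(4) qis_left[OF AGproj_lm c f(3) g(2)] by (auto simp: gqis_def)
  then show "weq (Kb A) Nac X Y s" using f by (auto simp: weq_iff)
next
  fix X Y f assume "arr (Kb A) X Y f"
  then obtain a where a: "bcx X" "bcx Y" "a \<in> chain_maps A X Y" "f = hclass A X Y a" by (auto simp: arr_Kb)
  note c = a(1,2)[THEN bcx_cx]
  show "arr (Kb A) (shO (Kb A) 1 X) (shO (Kb A) 1 Y) (shM (Kb A) 1 f)"
    unfolding a(4) shM_hclass[OF c] Kb_simps(4) using a cm_shift_iff[OF c] bcx_shift by (auto simp: arr_Kb)
next
  fix X Y f Z g assume "arr (Kb A) X Y f" "arr (Kb A) Y Z g"
  then obtain a b where a: "bcx X" "bcx Y" "bcx Z" "a \<in> chain_maps A X Y" "b \<in> chain_maps A Y Z" "f = hclass A X Y a" "g = hclass A Y Z b"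
    by (auto simp: arr_Kb)
  note c = a(1-3)[THEN bcx_cx]
  note s = c[THEN cx_shift]
  have "cc (shift_cx 1 X) (\<lambda>i. b (i + 1)) (\<lambda>i. a (i + 1)) = (\<lambda>i. cc X b a (i + 1))" by (simp add: cc_def)
  then show "shM (Kb A) 1 (cmp (Kb A) X Y Z g f) =
      cmp (Kb A) (shO (Kb A) 1 X) (shO (Kb A) 1 Y) (shO (Kb A) 1 Z) (shM (Kb A) 1 g) (shM (Kb A) 1 f)"
    unfolding a(6,7) cmp_hclass[OF c a(4,5)] shM_hclass[OF c(1,2)] shM_hclass[OF c(2,3)] shM_hclass[OF c(1,3)] Kb_simps(4)
    using cmp_hclass[OF s] cm_shift_iff[OF c(1,2)] cm_shift_iff[OF c(2,3)] a(4,5) by simp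
next
  fix X Y s assume "weq (Kb A) Nac X Y s"
  then obtain a where a: "bcx X" "bcx Y" "a \<in> chain_maps A X Y" "s = hclass A X Y a" "gqis X Y a" by (auto simp: weq_iff)
  note c = a(1,2)[THEN bcx_cx]
  have "gqis (shift_cx 1 X) (shift_cx 1 Y) (\<lambda>i. a (i + 1))" using a(5) qis_shift[OF c AGproj_lm] by (simp add: gqis_def)
  then show "weq (Kb A) Nac (shO (Kb A) 1 X) (shO (Kb A) 1 Y) (shM (Kb A) 1 s)"
    unfolding a(4) shM_hclass[OF c] Kb_simps(4) using a cm_shift_iff[OF c] bcx_shift by (auto simp: weq_iff)
qed (fact Kb_ore Kb_cancel)+

sublocale Kf: fractions "Kb A" "Gproj_acyclic A"
  by (rule fractions_Kb)

end

subsection \<open>Finite direct sums in the derived category\<close>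

context fda
begin

abbreviation DK where "DK \<equiv> verdier_shift_cat (Kb A) Nac"

definition stalk_family :: "(int \<Rightarrow> 'a umod) \<Rightarrow> 'a cochain" where
  "stalk_family H = \<lparr>cob = H, dif = (\<lambda>i. \<lambda>x\<in>carrier (H i). \<zero>\<^bsub>H (i + 1)\<^esub>)\<rparr>"

text \<open>A predicate beside \<open>stalk_family\<close>, because shifts and sums of such
  complexes are not syntactically stalk families.\<close>

definition zero_dif :: "'a cochain \<Rightarrow> bool" where
  "zero_dif X \<longleftrightarrow> (\<forall>i. \<forall>x\<in>carrier (cob X i). dif X i x = \<zero>\<^bsub>cob X (i + 1)\<^esub>)"

lemma stalk_family_simps [simp]: "cob (stalk_family H) i = H i" "x \<in> carrier (H i) \<Longrightarrow> dif (stalk_family H) i x = \<zero>\<^bsub>H (i + 1)\<^esub>"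
  by (simp_all add: stalk_family_def)

lemma zero_dif_stalk: "zero_dif (stalk_family H)"
  by (simp add: zero_dif_def)

lemma cx_stalk:
  assumes H: "\<And>i. fg (H i)" shows "cx (stalk_family H)"
  unfolding is_complex_def
proof (intro allI conjI ballI)
  fix i
  show "dif (stalk_family H) i \<in> lhom A (cob (stalk_family H) i) (cob (stalk_family H) (i + 1))"
    using lh_0[OF fg_lm[OF H[of i]] fg_lm[OF H[of "i + 1"]]] by (simp add: stalk_family_def)
  fix x assume "x \<in> carrier (cob (stalk_family H) i)"
  then show "dif (stalk_family H) (i + 1) (dif (stalk_family H) i x) = \<zero>\<^bsub>cob (stalk_family H) (i + 2)\<^esub>"
    using fg_lm[OF H] by (simp add: add.assoc)
qed (use H in simp)

lemma bcx_stalk: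
  assumes "\<And>i. fg (H i)" "\<And>i. \<bar>i\<bar> > int r \<Longrightarrow> zero_module (H i)"
  shows "bcx (stalk_family H)"
  unfolding bounded_complexes_def using cx_stalk[of H] assms by auto

text \<open>With zero differentials, isomorphisms chosen separately in each degree already form a
  chain map.\<close>

lemma zero_dif_iso:
  assumes X: "bcx X" "zero_dif X" and Y: "bcx Y" "zero_dif Y" and iso: "\<And>i. \<exists>\<theta>. is_iso (Amod A) (cob X i) (cob Y i) \<theta>"
  shows "\<exists>\<phi>. is_iso DK X Y \<phi>"
proof -
  note c = bcx_cx[OF X(1)] bcx_cx[OF Y(1)]
  have "\<exists>f g. f \<in> lhom A (cob X i) (cob Y i) \<and> g \<in> lhom A (cob Y i) (cob X i) \<and>
      (\<forall>x\<in>carrier (cob X i). g (f x) = x) \<and> (\<forall>y\<in>carrier (cob Y i). f (g y) = y)" for i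
  proof -
    obtain \<theta> where "is_iso (Amod A) (cob X i) (cob Y i) \<theta>" using iso by blast
    from is_iso_AmodE[OF this] show ?thesis by metis
  qed
  then obtain f g where f: "\<And>i. f i \<in> lhom A (cob X i) (cob Y i)" and g: "\<And>i. g i \<in> lhom A (cob Y i) (cob X i)"
    and gf: "\<And>i x. x \<in> carrier (cob X i) \<Longrightarrow> g i (f i x) = x" and fg: "\<And>i y. y \<in> carrier (cob Y i) \<Longrightarrow> f i (g i y) = y" by metis
  have fc: "f \<in> chain_maps A X Y"
    by (rule cmI[OF f]) (use X(2) Y(2) lh_closed[OF f] lh_zero[OF f] c in \<open>simp add: zero_dif_def\<close>)
  have gc: "g \<in> chain_maps A Y X"
    by (rule cmI[OF g]) (use X(2) Y(2) lh_closed[OF g] lh_zero[OF g] c in \<open>simp add: zero_dif_def\<close>)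
  have "cc X g f = icm X" "cc Y f g = icm Y"
    using gf fg by (auto simp: cc_def icm_def compose_def intro!: ext)
  then have "is_iso (Kb A) X Y (hclass A X Y f)"
    using cmp_hclass[OF c c(1) fc gc] cmp_hclass[OF c(2,1,2) gc fc] X(1) Y(1) fc gc
    by (intro Kbc.is_isoI[of _ _ _ "hclass A Y X g"]) (auto simp: arr_Kb simp del: Kb_simps(6))
  from Kf.image_iso'[OF this] show ?thesis using X(1) Y(1) by auto
qed

definition zcx :: "'a cochain" where "zcx = stalk_family (\<lambda>_. zero_mod)"

lemma zcx_props: "bcx zcx" "zero_dif zcx" "cob zcx i = zero_mod"
  unfolding zcx_def using bcx_stalk[of "\<lambda>_. zero_mod" 0] fg_zero_mod zero_zero_mod zero_dif_stalk by auto

lemma initial_zcx: "initial (Kb A) zcx"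
  unfolding initial_def
proof (intro conjI ballI)
  show "zcx \<in> Ob (Kb A)" using zcx_props by simp
  fix T assume "T \<in> Ob (Kb A)"
  then have T: "cx T" using bcx_cx by simp
  note Z = bcx_cx[OF zcx_props(1)]
  let ?z = "\<lambda>i. \<lambda>x\<in>carrier (zero_mod :: 'a umod). \<zero>\<^bsub>cob T i\<^esub>"
  have eq: "f = ?z" if "f \<in> chain_maps A zcx T" for f
  proof
    fix i show "f i = ?z i"
      by (rule zero_lh[OF zero_zero_mod fg_lm[OF fg_zero_mod] cx_lm[OF T]]) (use cm_lh[OF that, of i] in \<open>simp add: zcx_props\<close>)
  qed
  have z: "?z \<in> chain_maps A zcx T"
  proof (rule cmI)
    fix i show "?z i \<in> lhom A (cob zcx i) (cob T i)"
      using lh_0[OF fg_lm[OF fg_zero_mod] cx_lm[OF T]] by (simp add: zcx_props)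
    fix x assume x: "x \<in> carrier (cob zcx i)"
    then have "dif zcx i x \<in> carrier (cob zcx (i + 1))" by (rule cx_closed[OF Z])
    then show "dif T i (?z i x) = ?z (i + 1) (dif zcx i x)" using x T by (simp add: zcx_props)
  qed
  show "\<exists>!h. h \<in> Hm (Kb A) zcx T"
  proof (rule ex1I[of _ "hclass A zcx T ?z"])
    show "hclass A zcx T ?z \<in> Hm (Kb A) zcx T" using z by (auto simp: hclass_def intro!: quotientI)
    fix h assume "h \<in> Hm (Kb A) zcx T"
    then obtain f where "f \<in> chain_maps A zcx T" "h = hclass A zcx T f" by (auto simp: quotient_def hclass_def)
    then show "h = hclass A zcx T ?z" using eq by simp
  qed
qed

lemma initial_DK: "initial DK zcx"
  by (rule Kf.initial_localizes[OF initial_zcx])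

definition dsumc :: "'a cochain \<Rightarrow> 'a cochain \<Rightarrow> 'a cochain" where
  "dsumc X Y = \<lparr>cob = (\<lambda>i. dsum (cob X i) (cob Y i)),
     dif = (\<lambda>i. \<lambda>w\<in>carrier (dsum (cob X i) (cob Y i)). seq_pair (dif X i (seq_fst w)) (dif Y i (seq_snd w)))\<rparr>"

lemma dsumc_cob [simp]: "cob (dsumc X Y) i = dsum (cob X i) (cob Y i)"
  by (simp add: dsumc_def)

lemma dsumc_dif [simp]: "x \<in> carrier (cob X i) \<Longrightarrow> y \<in> carrier (cob Y i) \<Longrightarrow> dif (dsumc X Y) i (seq_pair x y) = seq_pair (dif X i x) (dif Y i y)"
  by (simp add: dsumc_def)

lemma dsumE:
  assumes "w \<in> carrier (dsum M N)"
  obtains x y where "w = seq_pair x y" "x \<in> carrier M" "y \<in> carrier N"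
  using assms that[of "seq_fst w" "seq_snd w"] by (simp add: dsum_carrier_iff)

lemma lh_pair_map:
  assumes M: "lm M" "lm N" "lm M'" "lm N'" and f: "f \<in> lhom A M M'" and g: "g \<in> lhom A N N'"
  shows "(\<lambda>w\<in>carrier (dsum M N). seq_pair (f (seq_fst w)) (g (seq_snd w))) \<in> lhom A (dsum M N) (dsum M' N')"
  by (rule lh_restrict[OF lm_dsum[OF M(1,2)]])
    (simp_all add: dsum_carrier_iff dsum_ops lh_closed[OF f] lh_closed[OF g] lh_add[OF f] lh_add[OF g] lh_sm[OF f] lh_sm[OF g])

lemma cx_dsumc:
  assumes X: "cx X" and Y: "cx Y" shows "cx (dsumc X Y)"
  unfolding is_complex_def
proof (intro allI conjI ballI)
  fix i
  show "fg (cob (dsumc X Y) i)" using X Y by (simp add: fg_dsum)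
  show "dif (dsumc X Y) i \<in> lhom A (cob (dsumc X Y) i) (cob (dsumc X Y) (i + 1))"
    using lh_pair_map[OF _ _ _ _ cx_lh[OF X] cx_lh[OF Y]] X Y by (simp add: dsumc_def)
  fix w assume "w \<in> carrier (cob (dsumc X Y) i)"
  then show "dif (dsumc X Y) (i + 1) (dif (dsumc X Y) i w) = \<zero>\<^bsub>cob (dsumc X Y) (i + 2)\<^esub>"
    using X Y by (auto elim!: dsumE)
qed

lemma bcx_dsumc:
  assumes X: "bcx X" and Y: "bcx Y" shows "bcx (dsumc X Y)"
proof -
  obtain n m :: nat where n: "\<And>i. \<bar>i\<bar> > int n \<Longrightarrow> zero_module (cob X i)" and m: "\<And>i. \<bar>i\<bar> > int m \<Longrightarrow> zero_module (cob Y i)"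
    using X Y by (auto simp: bounded_complexes_def)
  have "zero_module (cob (dsumc X Y) i)" if "\<bar>i\<bar> > int (n + m)" for i
    using that by (auto intro!: zero_dsum n m)
  then show ?thesis using cx_dsumc[OF bcx_cx[OF X] bcx_cx[OF Y]] unfolding bounded_complexes_def by blast
qed

lemma zero_dif_dsumc: "zero_dif X \<Longrightarrow> zero_dif Y \<Longrightarrow> zero_dif (dsumc X Y)"
  unfolding zero_dif_def by (auto elim!: dsumE)

definition inlc :: "'a cochain \<Rightarrow> 'a cochain \<Rightarrow> int \<Rightarrow> 'a umap" where "inlc X Y i = inl (cob X i) (cob Y i)"
definition inrc :: "'a cochain \<Rightarrow> 'a cochain \<Rightarrow> int \<Rightarrow> 'a umap" where "inrc X Y i = inr (cob X i) (cob Y i)"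

lemma inc_apply [simp]: "x \<in> carrier (cob X i) \<Longrightarrow> inlc X Y i x = seq_pair x \<zero>\<^bsub>cob Y i\<^esub>"
  "y \<in> carrier (cob Y i) \<Longrightarrow> inrc X Y i y = seq_pair \<zero>\<^bsub>cob X i\<^esub> y"
  by (simp_all add: inlc_def inl_def inrc_def inr_def)

lemma inc_cm:
  assumes X: "cx X" and Y: "cx Y"
  shows "inlc X Y \<in> chain_maps A X (dsumc X Y)" "inrc X Y \<in> chain_maps A Y (dsumc X Y)"
  by (rule cmI; use X Y lh_inl lh_inr in \<open>simp add: inlc_def inrc_def\<close>;
      use X Y in \<open>simp add: inl_def inr_def\<close>)+

text \<open>Chain maps on the summands glue degreewise. Uniqueness is up to homotopy: homotopies h
  and k on the summands are glued to one on the sum.\<close>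

lemma direct_sum_Kb:
  assumes X: "bcx X" and Y: "bcx Y"
  shows "direct_sum (Kb A) {0, 1} (\<lambda>j. if j = 0 then X else Y) (dsumc X Y)
    (\<lambda>j. if j = 0 then hclass A X (dsumc X Y) (inlc X Y) else hclass A Y (dsumc X Y) (inrc X Y))" (is "direct_sum _ _ ?X ?S ?\<iota>")
proof (rule Kbc.direct_sumI)
  note c = bcx_cx[OF X] bcx_cx[OF Y]
  have S: "bcx ?S" by (rule bcx_dsumc[OF X Y])
  note cS = bcx_cx[OF S]
  note i = inc_cm[OF c]
  show "?S \<in> Ob (Kb A)" using S by simp
  show "arr (Kb A) (?X j) ?S (?\<iota> j)" if "j \<in> {0, 1}" for j using X Y S i by (auto simp: arr_Kb)
  {
    fix T \<phi> assume T: "T \<in> Ob (Kb A)" and f: "\<And>j. j \<in> {0::nat, 1} \<Longrightarrow> arr (Kb A) (?X j) T (\<phi> j)"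
    have bT: "bcx T" and cT: "cx T" using T bcx_cx by auto
    obtain f g where f: "f \<in> chain_maps A X T" "\<phi> 0 = hclass A X T f" and g: "g \<in> chain_maps A Y T" "\<phi> 1 = hclass A Y T g"
      using f[of 0] f[of 1] by (auto simp: arr_Kb)
    define h where "h = (\<lambda>i. \<lambda>w\<in>carrier (dsum (cob X i) (cob Y i)). f i (seq_fst w) \<oplus>\<^bsub>cob T i\<^esub> g i (seq_snd w))"
    note [simp] = cm_rules[OF c(1) cT f(1)] cm_rules[OF c(2) cT g(1)]
    have h: "h \<in> chain_maps A ?S T"
    proof (rule cmI)
      fix i show "h i \<in> lhom A (cob ?S i) (cob T i)"
        using lh_copair[OF _ _ _ cm_lh[OF f(1)] cm_lh[OF g(1)], of i] c cT by (simp add: h_def)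
      fix w assume "w \<in> carrier (cob ?S i)"
      then show "dif T i (h i w) = h (i + 1) (dif ?S i w)" using c cT by (auto elim!: dsumE simp: h_def)
    qed
    have 1: "cc X h (inlc X Y) = f"
    proof (rule ext, rule ext)
      fix i x show "cc X h (inlc X Y) i x = f i x"
        using lh_ext[OF cm_lh[OF f(1)], of x i] c cT by (cases "x \<in> carrier (cob X i)") (auto simp: h_def cc_def compose_def)
    qed
    have 2: "cc Y h (inrc X Y) = g"
    proof (rule ext, rule ext)
      fix i x show "cc Y h (inrc X Y) i x = g i x"
        using lh_ext[OF cm_lh[OF g(1)], of x i] c cT by (cases "x \<in> carrier (cob Y i)") (auto simp: h_def cc_def compose_def)
    qed
    have "cmp (Kb A) X ?S T (hclass A ?S T h) (hclass A X ?S (inlc X Y)) = \<phi> 0"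
      "cmp (Kb A) Y ?S T (hclass A ?S T h) (hclass A Y ?S (inrc X Y)) = \<phi> 1"
      unfolding cmp_hclass[OF c(1) cS cT i(1) h] cmp_hclass[OF c(2) cS cT i(2) h] f(2) g(2) 1 2 by (rule refl)+
    moreover have "arr (Kb A) ?S T (hclass A ?S T h)" using S bT h by (auto simp: arr_Kb)
    ultimately show "\<exists>h. arr (Kb A) ?S T h \<and> (\<forall>j\<in>{0, 1}. cmp (Kb A) (?X j) ?S T h (?\<iota> j) = \<phi> j)"
      by (intro exI[of _ "hclass A ?S T h"]) (simp del: Kb_simps)
  next
    fix T \<phi> \<phi>' assume f: "arr (Kb A) ?S T \<phi>" "arr (Kb A) ?S T \<phi>'"
      and e: "\<And>j. j \<in> {0::nat, 1} \<Longrightarrow> cmp (Kb A) (?X j) ?S T \<phi> (?\<iota> j) = cmp (Kb A) (?X j) ?S T \<phi>' (?\<iota> j)"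
    obtain f f' where f: "f \<in> chain_maps A ?S T" "\<phi> = hclass A ?S T f" and f': "f' \<in> chain_maps A ?S T" "\<phi>' = hclass A ?S T f'" and T: "bcx T"
      using f by (auto simp: arr_Kb)
    note cT = bcx_cx[OF T]
    have "hclass A X T (cc X f (inlc X Y)) = hclass A X T (cc X f' (inlc X Y))"
      using e[of 0] unfolding f(2) f'(2) by (simp add: cmp_hclass[OF c(1) cS cT i(1)] f(1) f'(1) del: Kb_simps)
    then have "(cc X f (inlc X Y), cc X f' (inlc X Y)) \<in> homotopy_rel A X T"
      using hclass_eq_iff[OF c(1) cT cc_cm[OF c(1) cS cT i(1) f(1)] cc_cm[OF c(1) cS cT i(1) f'(1)]] by simp
    from hr_ccE[OF this] obtain h where h: "\<And>i. h i \<in> lhom A (cob X i) (cob T (i - 1))" and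
      he0: "\<And>i x. x \<in> carrier (cob X i) \<Longrightarrow> f i (inlc X Y i x) = f' i (inlc X Y i x) \<oplus>\<^bsub>cob T i\<^esub> (dif T (i - 1) (h i x) \<oplus>\<^bsub>cob T i\<^esub> h (i + 1) (dif X i x))"
      by metis
    have he: "f i (seq_pair x \<zero>\<^bsub>cob Y i\<^esub>) = f' i (seq_pair x \<zero>\<^bsub>cob Y i\<^esub>) \<oplus>\<^bsub>cob T i\<^esub> (dif T (i - 1) (h i x) \<oplus>\<^bsub>cob T i\<^esub> h (i + 1) (dif X i x))"
      if "x \<in> carrier (cob X i)" for i x using he0[OF that] that by simp
    have "hclass A Y T (cc Y f (inrc X Y)) = hclass A Y T (cc Y f' (inrc X Y))"
      using e[of 1] unfolding f(2) f'(2) by (simp add: cmp_hclass[OF c(2) cS cT i(2)] f(1) f'(1) del: Kb_simps)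
    then have "(cc Y f (inrc X Y), cc Y f' (inrc X Y)) \<in> homotopy_rel A Y T"
      using hclass_eq_iff[OF c(2) cT cc_cm[OF c(2) cS cT i(2) f(1)] cc_cm[OF c(2) cS cT i(2) f'(1)]] by simp
    from hr_ccE[OF this] obtain k where k: "\<And>i. k i \<in> lhom A (cob Y i) (cob T (i - 1))" and
      ke0: "\<And>i y. y \<in> carrier (cob Y i) \<Longrightarrow> f i (inrc X Y i y) = f' i (inrc X Y i y) \<oplus>\<^bsub>cob T i\<^esub> (dif T (i - 1) (k i y) \<oplus>\<^bsub>cob T i\<^esub> k (i + 1) (dif Y i y))"
      by metis
    have ke: "f i (seq_pair \<zero>\<^bsub>cob X i\<^esub> y) = f' i (seq_pair \<zero>\<^bsub>cob X i\<^esub> y) \<oplus>\<^bsub>cob T i\<^esub> (dif T (i - 1) (k i y) \<oplus>\<^bsub>cob T i\<^esub> k (i + 1) (dif Y i y))"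
      if "y \<in> carrier (cob Y i)" for i y using ke0[OF that] that by simp
    have "(f, f') \<in> homotopy_rel A ?S T"
    proof (rule hrI[OF f(1) f'(1), where h = "\<lambda>i. \<lambda>w\<in>carrier (dsum (cob X i) (cob Y i)). h i (seq_fst w) \<oplus>\<^bsub>cob T (i - 1)\<^esub> k i (seq_snd w)"])
      fix i show "(\<lambda>w\<in>carrier (dsum (cob X i) (cob Y i)). h i (seq_fst w) \<oplus>\<^bsub>cob T (i - 1)\<^esub> k i (seq_snd w)) \<in> lhom A (cob ?S i) (cob T (i - 1))"
        using lh_copair[OF _ _ _ h k, of i] c cT by simp
      fix w assume w: "w \<in> carrier (cob ?S i)"
      then obtain x y where xy: "w = seq_pair x y" "x \<in> carrier (cob X i)" "y \<in> carrier (cob Y i)" by (auto elim: dsumE)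
      have sp: "F i w = F i (seq_pair x \<zero>\<^bsub>cob Y i\<^esub>) \<oplus>\<^bsub>cob T i\<^esub> F i (seq_pair \<zero>\<^bsub>cob X i\<^esub> y)" if "F \<in> chain_maps A ?S T" for F
        using cm_rules(2)[OF cS cT that, of "seq_pair x \<zero>\<^bsub>cob Y i\<^esub>" i "seq_pair \<zero>\<^bsub>cob X i\<^esub> y"] xy c by simp
      have m: "f' i (seq_pair x \<zero>\<^bsub>cob Y i\<^esub>) \<in> carrier (cob T i)" "f' i (seq_pair \<zero>\<^bsub>cob X i\<^esub> y) \<in> carrier (cob T i)"
        using cm_rules(1)[OF cS cT f'(1)] xy c by simp_all
      show "f i w = f' i w \<oplus>\<^bsub>cob T i\<^esub> (dif T (i - 1) ((\<lambda>w\<in>carrier (dsum (cob X i) (cob Y i)). h i (seq_fst w) \<oplus>\<^bsub>cob T (i - 1)\<^esub> k i (seq_snd w)) w) \<oplus>\<^bsub>cob T i\<^esub>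
          (\<lambda>w\<in>carrier (dsum (cob X (i + 1)) (cob Y (i + 1))). h (i + 1) (seq_fst w) \<oplus>\<^bsub>cob T (i + 1 - 1)\<^esub> k (i + 1) (seq_snd w)) (dif ?S i w))"
        unfolding sp[OF f(1)] sp[OF f'(1)] he[OF xy(2)] ke[OF xy(3)]
        using xy m c cT hm_rules(1,2)[OF c(1) cT h] hm_rules(1,2)[OF c(2) cT k] by (simp add: lm_ac)
    qed
    then show "\<phi> = \<phi>'" unfolding f(2) f'(2) by (rule hclass_eqI[OF cS cT])
  }
qed

definition pair_map :: "'a cochain \<Rightarrow> 'a cochain \<Rightarrow> (int \<Rightarrow> 'a umap) \<Rightarrow> (int \<Rightarrow> 'a umap) \<Rightarrow> int \<Rightarrow> 'a umap" where
  "pair_map Z Z' s t = (\<lambda>i. \<lambda>w\<in>carrier (dsum (cob Z i) (cob Z' i)). seq_pair (s i (seq_fst w)) (t i (seq_snd w)))"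

text \<open>Cocycles of a sum are pairs of cocycles (\<open>split\<close>), and cohomologous pairs
  are pairs of cohomologous elements (\<open>coh\<close>), so bijectivity can be read off in the
  components.\<close>

lemma qis_pair:
  assumes c: "cx Z" "cx Z'" "cx X" "cx Y" and s: "s \<in> chain_maps A Z X" and t: "t \<in> chain_maps A Z' Y"
  shows "pair_map Z Z' s t \<in> chain_maps A (dsumc Z Z') (dsumc X Y)"
    "lm G \<Longrightarrow> qis G Z X s \<Longrightarrow> qis G Z' Y t \<Longrightarrow> qis G (dsumc Z Z') (dsumc X Y) (pair_map Z Z' s t)"
proof -
  note [simp] = cm_rules[OF c(1,3) s] cm_rules[OF c(2,4) t]
  let ?r = "pair_map Z Z' s t"
  show "?r \<in> chain_maps A (dsumc Z Z') (dsumc X Y)"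
  proof (rule cmI)
    fix i show "?r i \<in> lhom A (cob (dsumc Z Z') i) (cob (dsumc X Y) i)"
      using lh_pair_map[OF _ _ _ _ cm_lh[OF s] cm_lh[OF t]] c by (simp add: pair_map_def)
    fix w assume "w \<in> carrier (cob (dsumc Z Z') i)"
    then show "dif (dsumc X Y) i (?r i w) = ?r (i + 1) (dif (dsumc Z Z') i w)" using c by (auto elim!: dsumE simp: pair_map_def)
  qed
  assume G: "lm G" and qs: "qis G Z X s" and qt: "qis G Z' Y t"
  have split: "\<exists>x\<in>lhom A G (cyc X i). \<exists>y\<in>lhom A G (cyc Y i). \<forall>g\<in>carrier G. w g = seq_pair (x g) (y g)"
    if XY: "cx X" "cx Y" and w: "w \<in> lhom A G (cyc (dsumc X Y) i)" for X Y w i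
  proof -
    have "w \<in> lhom A G (dsum (cob X i) (cob Y i))" using cocycleD(1)[OF w] by simp
    from lh_into_dsumE[OF G cx_lm[OF XY(1)] cx_lm[OF XY(2)] this] obtain x y where x: "x \<in> lhom A G (cob X i)" and y: "y \<in> lhom A G (cob Y i)"
      and wg: "\<And>g. g \<in> carrier G \<Longrightarrow> w g = seq_pair (x g) (y g)" by metis
    have "dif X i (x g) = \<zero>\<^bsub>cob X (i + 1)\<^esub>" "dif Y i (y g) = \<zero>\<^bsub>cob Y (i + 1)\<^esub>" if "g \<in> carrier G" for g
      using cocycleD(3)[OF w that] wg[OF that] lh_closed[OF x that] lh_closed[OF y that] by simp_all
    then show ?thesis using x y wg by (intro bexI[of _ x] bexI[of _ y]) (auto simp: lh_cyc_iff)
  qed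
  have coh: "cohomologous G (dsumc X Y) i w w' \<longleftrightarrow> cohomologous G X i x x' \<and> cohomologous G Y i y y'"
    if XY: "cx X" "cx Y" and w: "\<And>g. g \<in> carrier G \<Longrightarrow> w g = seq_pair (x g) (y g)" "\<And>g. g \<in> carrier G \<Longrightarrow> w' g = seq_pair (x' g) (y' g)"
    for X Y w w' x x' y y' i
  proof
    assume "cohomologous G (dsumc X Y) i w w'"
    then obtain v where v: "v \<in> lhom A G (dsum (cob X (i - 1)) (cob Y (i - 1)))"
      "\<And>g. g \<in> carrier G \<Longrightarrow> w g = w' g \<oplus>\<^bsub>dsum (cob X i) (cob Y i)\<^esub> dif (dsumc X Y) (i - 1) (v g)" by (auto simp: cohomologous_def)
    from lh_into_dsumE[OF G cx_lm[OF XY(1)] cx_lm[OF XY(2)] v(1)] obtain a b where a: "a \<in> lhom A G (cob X (i - 1))" and b: "b \<in> lhom A G (cob Y (i - 1))"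
      and vg: "\<And>g. g \<in> carrier G \<Longrightarrow> v g = seq_pair (a g) (b g)" by metis
    have "x g = x' g \<oplus>\<^bsub>cob X i\<^esub> dif X (i - 1) (a g)" "y g = y' g \<oplus>\<^bsub>cob Y i\<^esub> dif Y (i - 1) (b g)" if "g \<in> carrier G" for g
      using v(2)[OF that] w(1)[OF that] w(2)[OF that] vg[OF that] lh_closed[OF a that] lh_closed[OF b that] by simp_all
    then show "cohomologous G X i x x' \<and> cohomologous G Y i y y'" using a b by (auto simp: cohomologous_def)
  next
    assume "cohomologous G X i x x' \<and> cohomologous G Y i y y'"
    then obtain a b where a: "a \<in> lhom A G (cob X (i - 1))" "\<And>g. g \<in> carrier G \<Longrightarrow> x g = x' g \<oplus>\<^bsub>cob X i\<^esub> dif X (i - 1) (a g)"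
      and b: "b \<in> lhom A G (cob Y (i - 1))" "\<And>g. g \<in> carrier G \<Longrightarrow> y g = y' g \<oplus>\<^bsub>cob Y i\<^esub> dif Y (i - 1) (b g)"
      by (auto simp: cohomologous_def)
    show "cohomologous G (dsumc X Y) i w w'"
      by (rule cohomologousI[where w = "\<lambda>g\<in>carrier G. seq_pair (a g) (b g)"])
        (use lh_into_dsum[OF G cx_lm[OF XY(1)] cx_lm[OF XY(2)] a(1) b(1)] w a b lh_closed[OF a(1)] lh_closed[OF b(1)] in simp_all)
  qed
  show "qis G (dsumc Z Z') (dsumc X Y) ?r"
    unfolding qis_def[OF G]
  proof (intro allI conjI ballI impI)
    fix i
    have rp: "push G ?r i w g = seq_pair (push G s i x g) (push G t i y g)"
      if "\<And>g. g \<in> carrier G \<Longrightarrow> w g = seq_pair (x g) (y g)" "x \<in> lhom A G (cyc Z i)" "y \<in> lhom A G (cyc Z' i)" "g \<in> carrier G" for w x y g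
      using that cocycleD(2)[OF that(2)] cocycleD(2)[OF that(3)] by (simp add: compose_eq pair_map_def)
    {
      fix w assume w: "w \<in> lhom A G (cyc (dsumc X Y) i)"
      obtain x y where x: "x \<in> lhom A G (cyc X i)" and y: "y \<in> lhom A G (cyc Y i)" and wg: "\<And>g. g \<in> carrier G \<Longrightarrow> w g = seq_pair (x g) (y g)"
        using split[OF c(3,4) w] by blast
      obtain a where a: "a \<in> lhom A G (cyc Z i)" "cohomologous G X i (push G s i a) x" using qisE1[OF G qs x] .
      obtain b where b: "b \<in> lhom A G (cyc Z' i)" "cohomologous G Y i (push G t i b) y" using qisE1[OF G qt y] .
      let ?v = "\<lambda>g\<in>carrier G. seq_pair (a g) (b g)"
      have "?v \<in> lhom A G (cob (dsumc Z Z') i)"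
        using lh_into_dsum[OF G cx_lm[OF c(1)] cx_lm[OF c(2)] cocycleD(1)[OF a(1)] cocycleD(1)[OF b(1)]] by simp
      then have v: "?v \<in> lhom A G (cyc (dsumc Z Z') i)" using cocycleD(2,3)[OF a(1)] cocycleD(2,3)[OF b(1)] by (simp add: lh_cyc_iff)
      have "cohomologous G (dsumc X Y) i (push G ?r i ?v) w"
        by (rule iffD2[OF coh[OF c(3,4) rp[OF _ a(1) b(1)] wg] conjI[OF a(2) b(2)]]) simp_all
      then show "\<exists>v\<in>lhom A G (cyc (dsumc Z Z') i). cohomologous G (dsumc X Y) i (push G ?r i v) w" using v by blast
    next
      fix w w' assume w: "w \<in> lhom A G (cyc (dsumc Z Z') i)" and w': "w' \<in> lhom A G (cyc (dsumc Z Z') i)"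
        and e: "cohomologous G (dsumc X Y) i (push G ?r i w) (push G ?r i w')"
      obtain x y where x: "x \<in> lhom A G (cyc Z i)" and y: "y \<in> lhom A G (cyc Z' i)" and wg: "\<And>g. g \<in> carrier G \<Longrightarrow> w g = seq_pair (x g) (y g)"
        using split[OF c(1,2) w] by blast
      obtain x' y' where x': "x' \<in> lhom A G (cyc Z i)" and y': "y' \<in> lhom A G (cyc Z' i)" and wg': "\<And>g. g \<in> carrier G \<Longrightarrow> w' g = seq_pair (x' g) (y' g)"
        using split[OF c(1,2) w'] by blast
      have "cohomologous G X i (push G s i x) (push G s i x') \<and> cohomologous G Y i (push G t i y) (push G t i y')"
        by (rule iffD1[OF coh[OF c(3,4) rp[OF wg x y] rp[OF wg' x' y']] e])
      then have "cohomologous G Z i x x' \<and> cohomologous G Z' i y y'" using qisE2[OF G qs x x'] qisE2[OF G qt y y'] by blast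
      from iffD2[OF coh[OF c(1,2) wg wg'] this] show "cohomologous G (dsumc Z Z') i w w'" .
    }
  qed
qed

text \<open>Binary sums survive localisation because \<open>pair_map\<close> of two denominators is
  a denominator, as \<open>direct_sum_localizes\<close> requires.\<close>

lemma direct_sum_DK:
  assumes X: "bcx X" and Y: "bcx Y"
  shows "\<exists>\<kappa>. direct_sum DK {0, 1} (\<lambda>j. if j = 0 then X else Y) (dsumc X Y) \<kappa>"
proof -
  let ?X = "\<lambda>j::nat. if j = 0 then X else Y"
  let ?\<iota> = "\<lambda>X Y j. if j = (0::nat) then hclass A X (dsumc X Y) (inlc X Y) else hclass A Y (dsumc X Y) (inrc X Y)"
  note c = bcx_cx[OF X] bcx_cx[OF Y]
  have "direct_sum DK {0, 1} ?X (dsumc X Y) (\<lambda>j. roof_image (Kb A) Nac (?X j) (dsumc X Y) (?\<iota> X Y j))"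
  proof (rule Kf.direct_sum_localizes[OF direct_sum_Kb[OF X Y]])
    fix Z \<sigma> assume W: "\<And>j. j \<in> {0, 1} \<Longrightarrow> weq (Kb A) Nac (Z j) (?X j) (\<sigma> j)"
    obtain s where s: "bcx (Z 0)" "s \<in> chain_maps A (Z 0) X" "\<sigma> 0 = hclass A (Z 0) X s" "gqis (Z 0) X s"
      using W[of 0] by (auto simp: weq_iff)
    obtain t where t: "bcx (Z 1)" "t \<in> chain_maps A (Z 1) Y" "\<sigma> 1 = hclass A (Z 1) Y t" "gqis (Z 1) Y t"
      using W[of 1] by (auto simp: weq_iff)
    note z = bcx_cx[OF s(1)] bcx_cx[OF t(1)]
    let ?S = "dsumc (Z 0) (Z 1)"
    have bS: "bcx ?S" by (rule bcx_dsumc[OF s(1) t(1)])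
    have bXY: "bcx (dsumc X Y)" by (rule bcx_dsumc[OF X Y])
    note cS = bcx_cx[OF bS] bcx_cx[OF bXY]
    define r where "r = pair_map (Z 0) (Z 1) s t"
    have q: "qis G ?S (dsumc X Y) r" if "G \<in> AGproj A" for G
      unfolding r_def using qis_pair(2)[OF z c s(2) t(2) AGproj_lm[OF that]] s(4) t(4) that by (simp add: gqis_def)
    have r: "r \<in> chain_maps A ?S (dsumc X Y)" unfolding r_def by (rule qis_pair(1)[OF z c s(2) t(2)])
    have ds: "direct_sum (Kb A) {0, 1} Z ?S (?\<iota> (Z 0) (Z 1))"
      by (rule Kbc.direct_sum_cong[OF direct_sum_Kb[OF s(1) t(1)]]) auto
    have W: "weq (Kb A) Nac ?S (dsumc X Y) (hclass A ?S (dsumc X Y) r)"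
      using bS bXY r q by (auto simp: weq_iff gqis_def)
    note iz = inc_cm[OF z] and ic = inc_cm[OF c]
    have "cc (Z 0) r (inlc (Z 0) (Z 1)) = cc (Z 0) (inlc X Y) s" "cc (Z 1) r (inrc (Z 0) (Z 1)) = cc (Z 1) (inrc X Y) t"
      using z c cm_rules(1,4)[OF z(1) c(1) s(2)] cm_rules(1,4)[OF z(2) c(2) t(2)]
      by (auto simp: cc_def compose_def r_def pair_map_def intro!: ext)
    then have "cmp (Kb A) (Z 0) ?S (dsumc X Y) (hclass A ?S (dsumc X Y) r) (?\<iota> (Z 0) (Z 1) 0) = cmp (Kb A) (Z 0) X (dsumc X Y) (?\<iota> X Y 0) (\<sigma> 0)"
      "cmp (Kb A) (Z 1) ?S (dsumc X Y) (hclass A ?S (dsumc X Y) r) (?\<iota> (Z 0) (Z 1) 1) = cmp (Kb A) (Z 1) Y (dsumc X Y) (?\<iota> X Y 1) (\<sigma> 1)"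
      unfolding s(3) t(3) using cmp_hclass[OF z(1) cS iz(1) r] cmp_hclass[OF z(2) cS iz(2) r]
        cmp_hclass[OF z(1) c(1) cS(2) s(2) ic(1)] cmp_hclass[OF z(2) c(2) cS(2) t(2) ic(2)] by (simp_all del: Kb_simps)
    then show "\<exists>S' \<kappa> r. direct_sum (Kb A) {0, 1} Z S' \<kappa> \<and> weq (Kb A) Nac S' (dsumc X Y) r \<and>
        (\<forall>j\<in>{0, 1}. cmp (Kb A) (Z j) S' (dsumc X Y) r (\<kappa> j) = cmp (Kb A) (Z j) (?X j) (dsumc X Y) (?\<iota> X Y j) (\<sigma> j))"
      using ds W by (intro exI[of _ ?S] exI[of _ "?\<iota> (Z 0) (Z 1)"] exI[of _ "hclass A ?S (dsumc X Y) r"]) (simp del: Kb_simps)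
  qed
  then show ?thesis by blast
qed

primrec bigsum :: "(nat \<Rightarrow> 'a cochain) \<Rightarrow> nat \<Rightarrow> 'a cochain" where
  "bigsum X 0 = zcx"
| "bigsum X (Suc n) = dsumc (bigsum X n) (X n)"

text \<open>One object with two universal properties: a direct sum in the derived category, and in
  every degree a direct sum of modules. The second identifies it, the first places it in the
  additive closure.\<close>

lemma bigsum_props:
  assumes "\<And>k. k < n \<Longrightarrow> bcx (X k)"
  shows "bcx (bigsum X n)" "\<exists>\<iota>. direct_sum DK {..<n} X (bigsum X n) \<iota>"
    "\<exists>\<iota>. direct_sum (Amod A) {..<n} (\<lambda>k. cob (X k) i) (cob (bigsum X n) i) \<iota>"
    "(\<And>k. k < n \<Longrightarrow> zero_dif (X k)) \<Longrightarrow> zero_dif (bigsum X n)"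
proof -
  have b: "bcx (bigsum X n)" if "\<And>k. k < n \<Longrightarrow> bcx (X k)" for n
    using that by (induction n) (auto intro: bcx_dsumc simp: zcx_props)
  show "bcx (bigsum X n)" using b assms by blast
  show "\<exists>\<iota>. direct_sum DK {..<n} X (bigsum X n) \<iota>"
    using assms
  proof (induction n)
    case 0
    show ?case using Kf.D.direct_sum_empty[OF initial_DK] by auto
  next
    case (Suc n)
    obtain \<iota> where i: "direct_sum DK {..<n} X (bigsum X n) \<iota>" using Suc by auto
    obtain \<kappa> where "direct_sum DK {0, 1} (\<lambda>j. if j = 0 then bigsum X n else X n) (dsumc (bigsum X n) (X n)) \<kappa>"
      using direct_sum_DK[OF b[of n] Suc.prems[of n]] Suc.prems by auto
    from Kf.D.direct_sum_Suc[OF i this] show ?case by auto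
  qed
  show "\<exists>\<iota>. direct_sum (Amod A) {..<n} (\<lambda>k. cob (X k) i) (cob (bigsum X n) i) \<iota>"
    using assms
  proof (induction n)
    case 0
    show ?case using Am.direct_sum_empty[OF initial_zero[OF fg_zero_mod zero_zero_mod]] by (auto simp: zcx_props)
  next
    case (Suc n)
    obtain \<iota> where i: "direct_sum (Amod A) {..<n} (\<lambda>k. cob (X k) i) (cob (bigsum X n) i) \<iota>" using Suc by auto
    have "fg (cob (bigsum X n) i)" "fg (cob (X n) i)" using b[of n] Suc.prems bcx_cx cx_fg by auto
    from Am.direct_sum_Suc[OF i direct_sum_dsum[OF this]] show ?case by auto
  qed
  show "(\<And>k. k < n \<Longrightarrow> zero_dif (X k)) \<Longrightarrow> zero_dif (bigsum X n)"
    by (induction n) (auto simp: zcx_props intro!: zero_dif_dsumc)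
qed

lemma add_closure_iso:
  assumes X: "X \<in> add_closure DK \<X>" and iso: "is_iso DK X' X \<alpha>" and X': "bcx X'"
  shows "X' \<in> add_closure DK \<X>"
proof -
  obtain n :: nat and Y S \<iota> Z where n: "\<forall>j<n. Y j \<in> \<X>" "direct_sum DK {..<n} Y S \<iota>" "Z \<in> Ob DK" "direct_sum2 DK X Z S"
    using X by (auto simp: add_closure_def)
  obtain \<kappa> where k: "direct_sum DK {0, 1} (\<lambda>j. if j = 0 then X else Z) S \<kappa>" using n(4) by (auto simp: direct_sum2_def)
  let ?\<alpha> = "\<lambda>j::nat. if j = 0 then \<alpha> else idt DK Z"
  have "direct_sum DK {0, 1} (\<lambda>j. if j = 0 then X' else Z) S
      (\<lambda>j. cmp DK (if j = 0 then X' else Z) (if j = 0 then X else Z) S (\<kappa> j) (?\<alpha> j))"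
    by (rule Kf.D.direct_sum_iso_source[OF k]) (use X' n(3) iso Kf.D.is_iso_idt[OF n(3)] in \<open>auto simp del: Kf.D_simps(2)\<close>)
  then have "direct_sum2 DK X' Z S" unfolding direct_sum2_def by blast
  then show ?thesis using n X' unfolding add_closure_def by auto
qed

definition stalk :: "'a umod \<Rightarrow> 'a cochain" where
  "stalk M = stalk_family (\<lambda>i. if i = 0 then M else zero_mod)"

lemma stalk_shift:
  assumes M: "fg M"
  shows "bcx (stalk M)" "bcx (shift_cx n (stalk M))" "zero_dif (shift_cx n (stalk M))"
    "cob (shift_cx n (stalk M)) i = (if i = - n then M else zero_mod)"
proof -
  show b: "bcx (stalk M)" unfolding stalk_def by (rule bcx_stalk[where r = 0]) (use M fg_zero_mod zero_zero_mod in auto)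
  then show "bcx (shift_cx n (stalk M))" by (rule bcx_shift)
  show "cob (shift_cx n (stalk M)) i = (if i = - n then M else zero_mod)" by (auto simp: stalk_def)
  have z: "dif (stalk M) j x = \<zero>\<^bsub>cob (stalk M) (j + 1)\<^esub>" if "x \<in> carrier (cob (stalk M) j)" for j x
    using that zero_dif_stalk[of "\<lambda>i. if i = 0 then M else zero_mod"] unfolding stalk_def zero_dif_def by blast
  show "zero_dif (shift_cx n (stalk M))"
    unfolding zero_dif_def
  proof (intro allI ballI)
    fix i x assume x: "x \<in> carrier (cob (shift_cx n (stalk M)) i)"
    have "i + 1 + n = i + n + 1" by simp
    then show "dif (shift_cx n (stalk M)) i x = \<zero>\<^bsub>cob (shift_cx n (stalk M)) (i + 1)\<^esub>"
      unfolding shift_cob using x z[of x "i + n"] bcx_cx[OF b] by (simp only: shift_cob shift_dif) simp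
  qed
qed

text \<open>The copies of M in all degrees are numbered by one index k, where e k is the pair of
  degree and position. In degree i the members with another degree contribute
  \<open>zero_mod\<close>, so the sum is still that of the n i copies.\<close>

lemma regroup_direct_sum:
  assumes M: "fg M" and bij: "bij_betw e {..<N} {(i, j). \<bar>i\<bar> \<le> int r \<and> j < n i}"
    and n: "\<And>i. \<bar>i\<bar> > int r \<Longrightarrow> n i = (0::nat)" and ds: "direct_sum (Amod A) {..<n i} (\<lambda>_. M) S \<iota>"
  shows "\<exists>\<iota>'. direct_sum (Amod A) {..<N} (\<lambda>k. if i = fst (e k) then M else zero_mod) S \<iota>'"
proof -
  note D = direct_sum_mem[OF ds]
  have lM: "lm M" and lS: "lm S" using M D(1) fg_lm by auto
  define \<iota>' where "\<iota>' k = (if i = fst (e k) then \<iota> (snd (e k)) else (\<lambda>x\<in>carrier zero_mod. \<zero>\<^bsub>S\<^esub>))" for k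
  let ?X = "\<lambda>k. if i = fst (e k) then M else zero_mod"
  have mem: "snd (e k) < n i" if "k < N" "i = fst (e k)" for k
    using bij_betwE[OF bij] that by (auto simp: case_prod_beta)
  have ex: "\<exists>k<N. e k = (i, j)" if "j < n i" for j
  proof -
    have "\<bar>i\<bar> \<le> int r" using n[of i] that by (cases "\<bar>i\<bar> > int r") auto
    then have "(i, j) \<in> e ` {..<N}" using bij that by (auto simp: bij_betw_def)
    then show ?thesis by auto
  qed
  have il: "\<iota>' k \<in> lhom A (?X k) S" if "k < N" for k
    using D(3) mem[OF that] lh_0[OF fg_lm[OF fg_zero_mod] lS] by (auto simp: \<iota>'_def)
  have "direct_sum (Amod A) {..<N} ?X S \<iota>'"
  proof (rule Am.direct_sumI)
    show "S \<in> Ob (Amod A)" by (rule D(1))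
    show "arr (Amod A) (?X k) S (\<iota>' k)" if "k \<in> {..<N}" for k
      using il[of k] that D(1) M fg_zero_mod by (simp add: arr_Amod)
    {
      fix T f assume T: "T \<in> Ob (Amod A)" and "\<And>k. k \<in> {..<N} \<Longrightarrow> arr (Amod A) (?X k) T (f k)"
      then have f: "f k \<in> lhom A (?X k) T" if "k < N" for k using that by (simp add: arr_Amod)
      \<comment> \<open>Inverts e on the pairs in degree i, so that data indexed by k can be
        restricted to the copies of M in this degree.\<close>
      obtain \<tau> where \<tau>: "\<And>j. j < n i \<Longrightarrow> \<tau> j < N \<and> e (\<tau> j) = (i, j)" using ex by metis
      have "f (\<tau> j) \<in> lhom A M T" if "j \<in> {..<n i}" for j using f[of "\<tau> j"] \<tau>[of j] that by auto
      then obtain h where h: "h \<in> lhom A S T"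
        "\<And>j x. j \<in> {..<n i} \<Longrightarrow> x \<in> carrier M \<Longrightarrow> h (\<iota> j x) = f (\<tau> j) x"
        by (rule direct_sum_liftE[OF ds T, of "\<lambda>j. f (\<tau> j)"]) auto
      have "compose (carrier (?X k)) h (\<iota>' k) = f k" if k: "k < N" for k
      proof (rule lh_eqI[OF lh_comp[OF _ il[OF k] h(1)] f[OF k]])
        show "lm (?X k)" using lM fg_lm[OF fg_zero_mod] by simp
        fix x assume x: "x \<in> carrier (?X k)"
        show "compose (carrier (?X k)) h (\<iota>' k) x = f k x"
        proof (cases "i = fst (e k)")
          case True
          have "\<tau> (snd (e k)) = k"
            using bij \<tau>[OF mem[OF k True]] True k by (auto simp: bij_betw_def inj_on_def)
          then show ?thesis using True x h(2)[of "snd (e k)" x] mem[OF k True] by (simp add: compose_def \<iota>'_def)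
        next
          case False
          have "f k = (\<lambda>x\<in>carrier zero_mod. \<zero>\<^bsub>T\<^esub>)"
            by (rule zero_lh[OF zero_zero_mod fg_lm[OF fg_zero_mod] fg_lm[OF T]]) (use f[OF k] False in simp)
          then show ?thesis using False x lh_zero[OF h(1) lS fg_lm[OF T]] by (simp add: compose_def \<iota>'_def)
        qed
      qed
      then show "\<exists>h. arr (Amod A) S T h \<and> (\<forall>k\<in>{..<N}. cmp (Amod A) (?X k) S T h (\<iota>' k) = f k)"
        using h(1) T D(1) by (intro exI[of _ h]) (auto simp: arr_Amod)
    next
      fix T h h' assume h: "arr (Amod A) S T h" "arr (Amod A) S T h'"
        and e: "\<And>k. k \<in> {..<N} \<Longrightarrow> cmp (Amod A) (?X k) S T h (\<iota>' k) = cmp (Amod A) (?X k) S T h' (\<iota>' k)"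
      show "h = h'"
      proof (rule direct_sum_eqI[OF ds])
        show "fg T" "h \<in> lhom A S T" "h' \<in> lhom A S T" using h by (auto simp: arr_Amod)
        fix j x assume "j \<in> {..<n i}" "x \<in> carrier M"
        moreover obtain k where "k < N" "e k = (i, j)" using ex[of j] calculation by auto
        ultimately show "h (\<iota> j x) = h' (\<iota> j x)" using fun_cong[OF e[of k], of x] by (simp add: \<iota>'_def compose_def)
      qed
    }
  qed
  then show ?thesis by blast
qed

text \<open>Membership of each term in add M gives a complement Q i separately in each degree. These
  complements form a second complex with zero differential, and the sum of both is isomorphic to a
  single finite sum of shifts of M.\<close>

lemma zero_dif_add_closure:
  assumes M: "fg M" and P: "bcx P" "zero_dif P" "\<And>i. cob P i \<in> addM A M"
  shows "P \<in> add_closure DK {shift_cx i (stalk M) | i. True}"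
proof -
  note cP = bcx_cx[OF P(1)]
  obtain r :: nat where r: "\<And>i. \<bar>i\<bar> > int r \<Longrightarrow> zero_module (cob P i)" using P(1) by (auto simp: bounded_complexes_def)
  \<comment> \<open>Outside the support of P the number of copies and the complement are chosen to
    be zero; this makes the family finite and the complex of complements bounded.\<close>
  have "\<exists>n S \<iota> Q. direct_sum (Amod A) {..<n::nat} (\<lambda>_. M) S \<iota> \<and> fg Q \<and> direct_sum2 (Amod A) (cob P i) Q S \<and>
      (\<bar>i\<bar> > int r \<longrightarrow> n = 0 \<and> zero_module Q)" for i
  proof (cases "\<bar>i\<bar> > int r")
    case True
    have "fg (cob P i)" using cP by simp
    note 1 = initial_zero[OF this r[OF True]] and 2 = initial_zero[OF fg_zero_mod zero_zero_mod]
    show ?thesis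
      using Am.direct_sum_empty[OF 1, of "\<lambda>_. M"] Am.direct_sum2_zero[OF \<open>fg (cob P i)\<close> 2] fg_zero_mod zero_zero_mod by blast
  next
    case False
    obtain n S \<iota> Q where "direct_sum (Amod A) {..<n::nat} (\<lambda>_. M) S \<iota>" "fg Q" "direct_sum2 (Amod A) (cob P i) Q S"
      using addME[OF P(3)] .
    then show ?thesis using False by blast
  qed
  then obtain n S \<iota> Q where n: "\<And>i. direct_sum (Amod A) {..<n i::nat} (\<lambda>_. M) (S i) (\<iota> i)" "\<And>i. fg (Q i)"
    "\<And>i. direct_sum2 (Amod A) (cob P i) (Q i) (S i)" "\<And>i. \<bar>i\<bar> > int r \<Longrightarrow> n i = 0" "\<And>i. \<bar>i\<bar> > int r \<Longrightarrow> zero_module (Q i)" by metis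
  let ?F = "{(i, j). \<bar>i\<bar> \<le> int r \<and> j < n i}"
  have "?F = (SIGMA i:{- int r..int r}. {..<n i})" by auto
  then have "finite ?F" by simp
  then obtain e where e: "bij_betw e {..<card ?F} ?F" using ex_bij_betw_nat_finite[of ?F] by (auto simp: atLeast0LessThan)
  define N where "N = card ?F"
  \<comment> \<open>The shift by -i places the stalk in degree i.\<close>
  define X where "X k = shift_cx (- fst (e k)) (stalk M)" for k
  have cX: "cob (X k) i = (if i = fst (e k) then M else zero_mod)" for k i
    unfolding X_def stalk_shift(4)[OF M] by simp
  have bX: "bcx (X k)" "zero_dif (X k)" for k unfolding X_def using stalk_shift[OF M] by auto
  note B = bigsum_props[of N X, OF bX(1)]
  let ?B = "bigsum X N"
  define Q' where "Q' = stalk_family Q"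
  have bQ: "bcx Q'" "zero_dif Q'" unfolding Q'_def using bcx_stalk[of Q r] n(2,5) zero_dif_stalk by auto
  \<comment> \<open>In each degree both sides are direct sums of the same n i copies of M;
    uniqueness of sums of modules gives the isomorphism.\<close>
  have "\<exists>\<theta>. is_iso (Amod A) (cob (dsumc P Q') i) (cob ?B i) \<theta>" for i
  proof -
    obtain \<iota>' where 1: "direct_sum (Amod A) {..<N} (\<lambda>k. cob (X k) i) (S i) \<iota>'"
      unfolding cX using regroup_direct_sum[OF M e[folded N_def] n(4) n(1)[of i]] by auto
    obtain \<iota>'' where 2: "direct_sum (Amod A) {..<N} (\<lambda>k. cob (X k) i) (cob ?B i) \<iota>''" using B(3) by blast
    obtain \<theta> where \<theta>: "is_iso (Amod A) (S i) (cob ?B i) \<theta>" using Am.direct_sum_unique[OF 1 2] by blast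
    obtain \<kappa> where 3: "direct_sum (Amod A) {0, 1} (\<lambda>j. if j = 0 then cob P i else Q i) (S i) \<kappa>"
      using n(3)[of i] by (auto simp: direct_sum2_def)
    have "fg (cob ?B i)" using bcx_cx[OF B(1)] by simp
    from Am.direct_sum_unique[OF direct_sum_dsum Am.direct_sum_iso[OF 3 \<theta> this]] show ?thesis
      using cP n(2) by (simp add: Q'_def)
  qed
  from zero_dif_iso[OF bcx_dsumc[OF P(1) bQ(1)] zero_dif_dsumc[OF P(2) bQ(2)] B(1) B(4) this] bX(2)
  obtain \<phi> where \<phi>: "is_iso DK (dsumc P Q') ?B \<phi>" by blast
  obtain \<kappa> where "direct_sum DK {0, 1} (\<lambda>j. if j = 0 then P else Q') (dsumc P Q') \<kappa>" using direct_sum_DK[OF P(1) bQ(1)] by blast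
  from Kf.D.direct_sum_iso[OF this \<phi>] have "direct_sum2 DK P Q' ?B" using B(1) unfolding direct_sum2_def by auto
  moreover obtain \<iota> where "direct_sum DK {..<N} X ?B \<iota>" using B(2) by blast
  moreover have "\<forall>k<N. X k \<in> {shift_cx i (stalk M) | i. True}" by (auto simp: X_def)
  ultimately show ?thesis unfolding add_closure_def using P(1) bQ(1) by auto
qed

end

section \<open>Building complexes from a module\<close>

context fda
begin

section \<open>Relative syzygies and the length of resolutions\<close>

abbreviation kern :: "'a umod \<Rightarrow> 'a umap \<Rightarrow> 'a umod \<Rightarrow> 'a umod" where
  "kern P p H \<equiv> P\<lparr>carrier := {x \<in> carrier P. p x = \<zero>\<^bsub>H\<^esub>}\<rparr>"

text \<open>\<open>resolved M n H\<close>: there is an exact sequence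
  \<open>0 \<rightarrow> Hom(M, M\<^sub>n) \<rightarrow> \<dots> \<rightarrow> Hom(M, M\<^sub>1) \<rightarrow> Hom(M, H) \<rightarrow> 0\<close> with all \<open>M\<^sub>i\<close> in \<open>add M\<close>.\<close>

primrec resolved :: "'a umod \<Rightarrow> nat \<Rightarrow> 'a umod \<Rightarrow> bool" where
  "resolved M 0 H = zero_module H"
| "resolved M (Suc n) H = (\<exists>P p. P \<in> addM A M \<and> p \<in> lhom A P H \<and> lifts M P H p \<and> resolved M n (kern P p H))"

lemma fg_kern: "fg P \<Longrightarrow> fg H \<Longrightarrow> p \<in> lhom A P H \<Longrightarrow> fg (kern P p H)"
  by (rule fg_submod[OF _ submod_kernel]) (auto intro: fg_lm)

text \<open>A zero module gets a zero cover explicitly. An arbitrary cover from add M could be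
  nonzero, and covers taken in all degrees would then leave the bounded complexes.\<close>

lemma zero_cover:
  assumes M: "fg M" and H: "fg H" "zero_module H"
  shows "(\<lambda>x\<in>carrier zero_mod. \<zero>\<^bsub>H\<^esub>) \<in> lhom A zero_mod H" "lifts M zero_mod H (\<lambda>x\<in>carrier zero_mod. \<zero>\<^bsub>H\<^esub>)"
    "zero_module (kern zero_mod (\<lambda>x\<in>carrier zero_mod. \<zero>\<^bsub>H\<^esub>) H)"
proof -
  note z = fg_lm[OF fg_zero_mod]
  show "(\<lambda>x\<in>carrier zero_mod. \<zero>\<^bsub>H\<^esub>) \<in> lhom A zero_mod H" by (rule lh_0[OF z fg_lm[OF H(1)]])
  show "lifts M zero_mod H (\<lambda>x\<in>carrier zero_mod. \<zero>\<^bsub>H\<^esub>)"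
    unfolding lifts_def
  proof
    fix \<phi> assume \<phi>: "\<phi> \<in> lhom A M H"
    have "\<phi> x = \<zero>\<^bsub>H\<^esub>" if "x \<in> carrier M" for x using lh_closed[OF \<phi> that] H(2) by (simp add: zero_module_def)
    then show "\<exists>\<psi>\<in>lhom A M zero_mod. \<forall>x\<in>carrier M. (\<lambda>x\<in>carrier zero_mod. \<zero>\<^bsub>H\<^esub>) (\<psi> x) = \<phi> x"
      using z by (intro bexI[OF _ lh_0[OF fg_lm[OF M] z]]) simp
  qed
  show "zero_module (kern zero_mod (\<lambda>x\<in>carrier zero_mod. \<zero>\<^bsub>H\<^esub>) H)"
    using zero_zero_mod z by (auto simp: zero_module_def)
qed

lemma resolved_zero: "fg M \<Longrightarrow> fg H \<Longrightarrow> zero_module H \<Longrightarrow> resolved M n H"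
proof (induction n arbitrary: H)
  case (Suc n)
  note z = zero_cover[OF Suc.prems]
  have "resolved M n (kern zero_mod (\<lambda>x\<in>carrier zero_mod. \<zero>\<^bsub>H\<^esub>) H)"
    by (rule Suc.IH[OF Suc.prems(1) fg_kern[OF fg_zero_mod Suc.prems(2) z(1)] z(3)])
  then show ?case unfolding resolved.simps using z zero_addM[OF fg_zero_mod zero_zero_mod, of M] by blast
qed simp

lemma resolved_Suc: "fg M \<Longrightarrow> fg H \<Longrightarrow> resolved M n H \<Longrightarrow> resolved M (Suc n) H"
proof (induction n arbitrary: H)
  case 0
  then show ?case using resolved_zero[of M H "Suc 0"] by simp
next
  case (Suc n)
  then obtain P p where P: "P \<in> addM A M" "p \<in> lhom A P H" "lifts M P H p" "resolved M n (kern P p H)" by auto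
  have "resolved M (Suc n) (kern P p H)" by (rule Suc.IH[OF Suc.prems(1) fg_kern[OF addM_fg[OF P(1)] Suc.prems(2) P(2)] P(4)])
  then show ?case using P by (subst resolved.simps) blast
qed

text \<open>Short resolutions are padded by zero covers, so that one length serves all
  modules.\<close>

lemma resolved_mono: "fg M \<Longrightarrow> fg H \<Longrightarrow> resolved M n H \<Longrightarrow> n \<le> k \<Longrightarrow> resolved M k H"
  by (induction k) (auto simp: le_Suc_eq simp del: resolved.simps intro: resolved_Suc)

text \<open>A resolution of length n has n + 1 terms, hence the successor. The induction runs from
  the left end: the cycles in degree k - n are the kernel of the next differential restricted to
  cycles, and have k terms to their left.\<close>

lemma resolution_resolved:
  assumes M: "fg M" and R: "is_resolution A M X n C"
  shows "resolved M (Suc n) X"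
proof -
  have ex: "exact_complex A C" and he: "hom_from_exact A M C" and X: "cob C 1 = X"
    and ad: "\<And>i. i \<le> n \<Longrightarrow> cob C (- int i) \<in> addM A M" and z: "\<And>j. j > 1 \<or> j < - int n \<Longrightarrow> zero_module (cob C j)"
    using R by (auto simp: is_resolution_def)
  have C: "cx C" using ex by (simp add: exact_complex_def)
  have L: "lifts M (cob C (i - 1)) (cyc C i) (dif C (i - 1))" for i
    using he hom_from_exact_iff[OF C fg_lm[OF M]] by blast
  have k: "kern (cob C (i - 1)) (dif C (i - 1)) (cyc C i) = cyc C (i - 1)" for i
    by (simp add: cyc_def)
  have "resolved M k (cyc C (int k - int n))" if "k \<le> Suc n" for k
    using that
  proof (induction k)
    case 0
    \<comment> \<open>The cycles in degree -n are the image of a zero module.\<close>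
    have im: "carrier (cyc C (- int n)) = dif C (- int n - 1) ` carrier (cob C (- int n - 1))"
      using conjunct2[OF ex[unfolded exact_complex_def], rule_format, of "- int n"] unfolding cyc_def by simp
    have "carrier (cob C (- int n - 1)) = {\<zero>\<^bsub>cob C (- int n - 1)\<^esub>}" using z[of "- int n - 1"] by (simp add: zero_module_def)
    then have "carrier (cyc C (- int n)) = {\<zero>\<^bsub>cob C (- int n)\<^esub>}" unfolding im using cx_zero'[OF C, of "- int n"] by simp
    then show ?case by (simp add: zero_module_def del: cyc_carrier)
  next
    case (Suc k)
    let ?i = "int (Suc k) - int n"
    have i: "?i - 1 = int k - int n" "int k - int n = - int (n - k)" using Suc.prems by auto
    have "cob C (?i - 1) \<in> addM A M" unfolding i using ad[of "n - k"] by simp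
    moreover have "resolved M k (kern (cob C (?i - 1)) (dif C (?i - 1)) (cyc C ?i))" unfolding k unfolding i(1) using Suc by simp
    ultimately show ?case using L[of ?i] dif_lh_cyc[OF C, of ?i] unfolding resolved.simps by blast
  qed
  from this[of "Suc n"] have "resolved M (Suc n) (cyc C 1)" by simp
  \<comment> \<open>Degree 2 vanishes, so all of degree 1 consists of cycles.\<close>
  moreover have "cyc C 1 = X"
  proof -
    have "carrier (cob C 2) = {\<zero>\<^bsub>cob C 2\<^esub>}" using z[of 2] by (simp add: zero_module_def)
    then have "{x \<in> carrier (cob C 1). dif C 1 x = \<zero>\<^bsub>cob C (1 + 1)\<^esub>} = carrier (cob C 1)"
      using cx_closed[OF C, of _ 1] by auto
    then show ?thesis unfolding cyc_def X[symmetric] by simp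
  qed
  ultimately show ?thesis by simp
qed

text \<open>\<open>hom_cohomology M X i H \<theta>\<close>: the \<open>i\<close>-th cohomology of the complex \<open>Hom(M, X)\<close> is
  identified with \<open>Hom(M, H)\<close> by composition with \<open>\<theta>\<close>.\<close>

definition hom_cohomology :: "'a umod \<Rightarrow> 'a cochain \<Rightarrow> int \<Rightarrow> 'a umod \<Rightarrow> 'a umap \<Rightarrow> bool" where
  "hom_cohomology M X i H \<theta> \<longleftrightarrow> fg H \<and> \<theta> \<in> lhom A (cyc X i) H \<and>
     (zero_module (cob X i) \<longrightarrow> zero_module H) \<and> lifts M (cyc X i) H \<theta> \<and>
     (\<forall>z\<in>lhom A M (cyc X i). (\<forall>g\<in>carrier M. \<theta> (z g) = \<zero>\<^bsub>H\<^esub>) \<longrightarrow>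
        (\<exists>w\<in>lhom A M (cob X (i - 1)). \<forall>g\<in>carrier M. dif X (i - 1) (w g) = z g)) \<and>
     (\<forall>x\<in>carrier (cob X (i - 1)). \<theta> (dif X (i - 1) x) = \<zero>\<^bsub>H\<^esub>)"

text \<open>The index counts the covers still to be taken; at n = 0 the cohomology of Hom(M, X)
  vanishes. The clause on zero terms in \<open>hom_cohomology\<close> permits zero covers where X
  vanishes, which keeps all complexes bounded.\<close>

definition tame :: "'a umod \<Rightarrow> nat \<Rightarrow> 'a cochain \<Rightarrow> bool" where
  "tame M n X \<longleftrightarrow> bcx X \<and> (\<forall>i. \<exists>H \<theta>. resolved M n H \<and> hom_cohomology M X i H \<theta>)"

text \<open>A family of maps into the cycles is a chain map from a complex with zero differential,
  and the first component of the cone's differential is then zero. Both forms of that formula are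
  needed, for cocycles in degree i and for coboundaries from degree i - 1.\<close>

lemma covers_complex:
  assumes X: "bcx X" and P: "\<And>i. P i \<in> addM A M" "\<forall>i. zero_module (cob X i) \<longrightarrow> zero_module (P i)"
    and \<phi>: "\<And>i. \<phi> i \<in> lhom A (P i) (cyc X i)"
  shows "bcx (stalk_family P)" "\<phi> \<in> chain_maps A (stalk_family P) X"
    "q \<in> carrier (P (i + 1)) \<Longrightarrow> x \<in> carrier (cob X i) \<Longrightarrow>
      dif (cone (stalk_family P) X \<phi>) i (seq_pair q x) = seq_pair \<zero>\<^bsub>P (i + 2)\<^esub> (\<phi> (i + 1) q \<oplus>\<^bsub>cob X (i + 1)\<^esub> dif X i x)"
    "q \<in> carrier (P i) \<Longrightarrow> x \<in> carrier (cob X (i - 1)) \<Longrightarrow>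
      dif (cone (stalk_family P) X \<phi>) (i - 1) (seq_pair q x) = seq_pair \<zero>\<^bsub>P (i + 1)\<^esub> (\<phi> i q \<oplus>\<^bsub>cob X i\<^esub> dif X (i - 1) x)"
proof -
  note cX = bcx_cx[OF X]
  have fP: "fg (P i)" and lP: "lm (P i)" for i using addM_fg[OF P(1)] fg_lm by auto
  obtain r :: nat where "\<And>i. \<bar>i\<bar> > int r \<Longrightarrow> zero_module (cob X i)" using X by (auto simp: bounded_complexes_def)
  then show b: "bcx (stalk_family P)" using bcx_stalk[of P r] fP P(2) by blast
  show "\<phi> \<in> chain_maps A (stalk_family P) X"
  proof (rule cmI)
    fix i show "\<phi> i \<in> lhom A (cob (stalk_family P) i) (cob X i)" using \<phi>[of i] by (simp add: lh_cyc_iff)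
    fix x assume "x \<in> carrier (cob (stalk_family P) i)"
    then show "dif X i (\<phi> i x) = \<phi> (i + 1) (dif (stalk_family P) i x)"
      using lh_closed[OF \<phi>, of x i] lh_zero[OF \<phi> lP fg_lm[OF fg_cyc[OF cX]], of "i + 1"] by simp
  qed
  show "q \<in> carrier (P (i + 1)) \<Longrightarrow> x \<in> carrier (cob X i) \<Longrightarrow>
      dif (cone (stalk_family P) X \<phi>) i (seq_pair q x) = seq_pair \<zero>\<^bsub>P (i + 2)\<^esub> (\<phi> (i + 1) q \<oplus>\<^bsub>cob X (i + 1)\<^esub> dif X i x)" for q x i
    using lP lm_neg0[OF lP, of "i + 2"] by (simp add: add.assoc)
  from this[of q "i - 1" x] show "q \<in> carrier (P i) \<Longrightarrow> x \<in> carrier (cob X (i - 1)) \<Longrightarrow>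
      dif (cone (stalk_family P) X \<phi>) (i - 1) (seq_pair q x) = seq_pair \<zero>\<^bsub>P (i + 1)\<^esub> (\<phi> i q \<oplus>\<^bsub>cob X i\<^esub> dif X (i - 1) x)"
    by (simp add: int_plus_normal(1)[of i])
qed

context
  fixes M :: "'a umod" assumes M: "fg M"
begin

lemma lM: "lm M" by (rule fg_lm[OF M])

text \<open>Lift the cover P of H to the cycles of X. It induces a surjection on cohomology of
  Hom(M, -), so the cohomology of the cone in degree i is the kernel of Hom(M, P) -> Hom(M, H) in
  degree i + 1, that is, Hom(M, -) of the relative syzygy.\<close>

lemma tame_step:
  assumes X: "tame M (Suc n) X"
  shows "\<exists>P \<phi>. bcx P \<and> zero_dif P \<and> (\<forall>i. cob P i \<in> addM A M) \<and> \<phi> \<in> chain_maps A P X \<and> tame M n (cone P X \<phi>)"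
proof -
  have bX: "bcx X" using X by (simp add: tame_def)
  note cX = bcx_cx[OF bX]
  obtain H \<theta> where H0: "\<And>i. resolved M (Suc n) (H i)" "\<And>i. hom_cohomology M X i (H i) (\<theta> i)"
    using X unfolding tame_def by metis
  have H: "\<And>i. fg (H i)" "\<And>i. resolved M (Suc n) (H i)" "\<And>i. \<theta> i \<in> lhom A (cyc X i) (H i)"
     "\<And>i. zero_module (cob X i) \<Longrightarrow> zero_module (H i)" "\<And>i. lifts M (cyc X i) (H i) (\<theta> i)"
     "\<And>i z. z \<in> lhom A M (cyc X i) \<Longrightarrow> (\<And>g. g \<in> carrier M \<Longrightarrow> \<theta> i (z g) = \<zero>\<^bsub>H i\<^esub>) \<Longrightarrow>
        \<exists>w\<in>lhom A M (cob X (i - 1)). \<forall>g\<in>carrier M. dif X (i - 1) (w g) = z g"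
     "\<And>i x. x \<in> carrier (cob X (i - 1)) \<Longrightarrow> \<theta> i (dif X (i - 1) x) = \<zero>\<^bsub>H i\<^esub>"
    using H0 unfolding hom_cohomology_def by blast+
  note fc = fg_cyc[OF cX]
  have lH: "lm (H i)" and lc: "lm (cyc X i)" for i using fg_lm[OF H(1)] fg_lm[OF fc] by auto
  \<comment> \<open>Beside the cover itself, \<open>R\<close> demands a zero cover in degrees where
    X is zero.\<close>
  define R where "R i P p \<longleftrightarrow> P \<in> addM A M \<and> p \<in> lhom A P (H i) \<and> lifts M P (H i) p \<and> resolved M n (kern P p (H i)) \<and>
      (zero_module (cob X i) \<longrightarrow> zero_module P)" for i P p
  have "\<exists>P p. R i P p" for i
  proof (cases "zero_module (cob X i)")
    case True
    note z = zero_cover[OF M H(1) H(4)[OF True]]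
    show ?thesis unfolding R_def using z resolved_zero[OF M fg_kern[OF fg_zero_mod H(1) z(1)] z(3)] zero_addM[OF fg_zero_mod zero_zero_mod, of M] zero_zero_mod by blast
  next
    case False
    then show ?thesis unfolding R_def using H(2)[of i] by auto
  qed
  then obtain P p where "\<And>i. R i (P i) (p i)" by metis
  then have P: "\<And>i. P i \<in> addM A M" "\<And>i. p i \<in> lhom A (P i) (H i)" "\<And>i. lifts M (P i) (H i) (p i)"
    "\<And>i. resolved M n (kern (P i) (p i) (H i))" "\<forall>i. zero_module (cob X i) \<longrightarrow> zero_module (P i)" by (simp_all add: R_def)
  have fP: "fg (P i)" and lP: "lm (P i)" for i using addM_fg[OF P(1)] fg_lm by auto
  \<comment> \<open>The projection of the cycles onto H lifts maps from M, hence from P in add M; so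
    p factors through the cycles.\<close>
  have "\<exists>f. f \<in> lhom A (P i) (cyc X i) \<and> (\<forall>x\<in>carrier (P i). \<theta> i (f x) = p i x)" for i
    by (rule liftsE[OF lifts_addM[OF P(1)[of i] fc[of i] H(1)[of i] H(3)[of i] H(5)[of i]] P(2)[of i]]) blast
  then obtain \<phi> where \<phi>: "\<And>i. \<phi> i \<in> lhom A (P i) (cyc X i)" "\<And>i x. x \<in> carrier (P i) \<Longrightarrow> \<theta> i (\<phi> i x) = p i x" by metis
  let ?P = "stalk_family P"
  note Q = covers_complex[OF bX P(1,5) \<phi>(1)]
  let ?X = "cone ?P X \<phi>"
  have bX': "bcx ?X" by (rule bcx_cone[OF Q(1) bX Q(2)])
  note cX' = bcx_cx[OF bX']
  have \<phi>c: "\<phi> i x \<in> carrier (cob X i)" "dif X i (\<phi> i x) = \<zero>\<^bsub>cob X (i + 1)\<^esub>" if "x \<in> carrier (P i)" for i x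
    using lh_closed[OF \<phi>(1) that] by auto
  let ?H = "\<lambda>i. kern (P (i + 1)) (p (i + 1)) (H (i + 1))"
  let ?\<theta> = "\<lambda>i. \<lambda>w\<in>carrier (cyc ?X i). seq_fst w"
  \<comment> \<open>In a cocycle (q, x) of the cone, q lies in the syzygy: the map to H sends the
    image of q to p q and kills the coboundary d x.\<close>
  have cyc_mem: "q \<in> carrier (P (i + 1)) \<and> p (i + 1) q = \<zero>\<^bsub>H (i + 1)\<^esub> \<and> x \<in> carrier (cob X i) \<and> \<phi> (i + 1) q \<oplus>\<^bsub>cob X (i + 1)\<^esub> dif X i x = \<zero>\<^bsub>cob X (i + 1)\<^esub>"
    if "seq_pair q x \<in> carrier (cyc ?X i)" for q x i
  proof -
    have qx: "q \<in> carrier (P (i + 1))" "x \<in> carrier (cob X i)" using that by auto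
    have 1: "\<phi> (i + 1) q \<oplus>\<^bsub>cob X (i + 1)\<^esub> dif X i x = \<zero>\<^bsub>cob X (i + 1)\<^esub>" using that Q(3)[OF qx] by simp
    have "\<theta> (i + 1) (\<phi> (i + 1) q \<oplus>\<^bsub>cyc X (i + 1)\<^esub> dif X i x) = \<theta> (i + 1) (\<phi> (i + 1) q) \<oplus>\<^bsub>H (i + 1)\<^esub> \<theta> (i + 1) (dif X i x)"
      by (rule lh_add[OF H(3) lh_closed[OF \<phi>(1) qx(1)]]) (use qx cX in \<open>simp add: int_plus_normal(2)[of i]\<close>)
    moreover have "\<theta> (i + 1) (dif X i x) = \<zero>\<^bsub>H (i + 1)\<^esub>" using H(7)[of x "i + 1"] qx by simp
    ultimately have "p (i + 1) q = \<zero>\<^bsub>H (i + 1)\<^esub>"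
      using 1 \<phi>(2)[OF qx(1)] lh_zero[OF H(3) lc lH, of "i + 1"] lH[of "i + 1"] lh_closed[OF P(2) qx(1)] by simp
    then show ?thesis using qx 1 by simp
  qed
  have fH: "fg (?H i)" for i by (rule fg_kern[OF fP H(1) P(2)])
  have \<theta>l: "?\<theta> i \<in> lhom A (cyc ?X i) (?H i)" for i
  proof (rule lh_restrict[OF fg_lm[OF fg_cyc[OF cX']]])
    fix w assume w: "w \<in> carrier (cyc ?X i)"
    then show "seq_fst w \<in> carrier (?H i)" using cyc_mem[of "seq_fst w" "seq_snd w" i] by (simp del: cyc_carrier)
  qed (simp_all add: dsum_ops)
  \<comment> \<open>For q in the syzygy, the image of q under the lifted cover vanishes in H, hence
    equals some d w; then (q, -w) is a cocycle over q.\<close>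
  have L: "lifts M (cyc ?X i) (?H i) (?\<theta> i)" for i
    unfolding lifts_def
  proof
    fix q assume q: "q \<in> lhom A M (?H i)"
    then have ql: "q \<in> lhom A M (P (i + 1))" and pq: "\<And>g. g \<in> carrier M \<Longrightarrow> p (i + 1) (q g) = \<zero>\<^bsub>H (i + 1)\<^esub>"
      using lh_closed[OF q] by (auto simp: lhom_def PiE_iff)
    note [simp] = lh_closed[OF ql]
    have z: "compose (carrier M) (\<phi> (i + 1)) q \<in> lhom A M (cyc X (i + 1))" by (rule lh_comp[OF lM ql \<phi>(1)])
    have "\<exists>w\<in>lhom A M (cob X (i + 1 - 1)). \<forall>g\<in>carrier M. dif X (i + 1 - 1) (w g) = compose (carrier M) (\<phi> (i + 1)) q g"
      by (rule H(6)[OF z]) (use \<phi>(2) pq in \<open>simp add: compose_eq\<close>)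
    then obtain w where w: "w \<in> lhom A M (cob X i)" and dw: "\<And>g. g \<in> carrier M \<Longrightarrow> dif X i (w g) = \<phi> (i + 1) (q g)"
      by (auto simp: compose_eq)
    note [simp] = lh_closed[OF w]
    let ?v = "\<lambda>g\<in>carrier M. seq_pair (q g) ((\<lambda>g\<in>carrier M. \<ominus>\<^bsub>cob X i\<^esub> w g) g)"
    have "?v \<in> lhom A M (cob ?X i)"
      using lh_into_dsum[OF lM lP cx_lm[OF cX] ql lh_uminus[OF lM cx_lm[OF cX] w]] by simp
    then have vc: "?v \<in> lhom A M (cyc ?X i)"
      using Q(3)[of _ i] \<phi>c cX dw by (simp add: lh_cyc_iff add.assoc del: cone_dif)
    have "?\<theta> i (?v g) = q g" if g: "g \<in> carrier M" for g
      using lh_closed[OF vc g] g by (simp del: cyc_carrier)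
    then show "\<exists>v\<in>lhom A M (cyc ?X i). \<forall>g\<in>carrier M. ?\<theta> i (v g) = q g" using vc by blast
  qed
  \<comment> \<open>If q = 0 then x is a cocycle of X. Its class in H is p q1 for some q1, the
    difference from the image of q1 is some d v, and (q1, v) bounds (0, x).\<close>
  have B: "\<exists>v\<in>lhom A M (cob ?X (i - 1)). \<forall>g\<in>carrier M. dif ?X (i - 1) (v g) = w g"
    if w: "w \<in> lhom A M (cyc ?X i)" and w0: "\<forall>g\<in>carrier M. ?\<theta> i (w g) = \<zero>\<^bsub>?H i\<^esub>" for i w
  proof -
    have "w \<in> lhom A M (dsum (P (i + 1)) (cob X i))" using cocycleD(1)[OF w] by simp
    from lh_into_dsumE[OF lM lP cx_lm[OF cX] this] obtain q x where q: "q \<in> lhom A M (P (i + 1))" and x: "x \<in> lhom A M (cob X i)"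
      and wg: "\<And>g. g \<in> carrier M \<Longrightarrow> w g = seq_pair (q g) (x g)" by metis
    have q0: "q g = \<zero>\<^bsub>P (i + 1)\<^esub>" if "g \<in> carrier M" for g
      using w0[rule_format, OF that] lh_closed[OF w that] wg[OF that] by simp
    have "x g \<in> carrier (cyc X i)" if "g \<in> carrier M" for g
      using cyc_mem[of "q g" "x g" i] lh_closed[OF w that] wg[OF that] q0[OF that] lh_zero[OF \<phi>(1) lP lc] cX by simp
    then have xz: "x \<in> lhom A M (cyc X i)" using x by (simp add: lh_cyc_iff)
    note [simp] = cocycleD(2,3)[OF xz]
    have "compose (carrier M) (\<theta> i) x \<in> lhom A M (H i)" by (rule lh_comp[OF lM xz H(3)])
    from liftsE[OF P(3) this] obtain q1 where q1: "q1 \<in> lhom A M (P i)" and pq1: "\<And>g. g \<in> carrier M \<Longrightarrow> p i (q1 g) = \<theta> i (x g)"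
      by (auto simp: compose_eq)
    note [simp] = lh_closed[OF q1]
    have f1: "compose (carrier M) (\<phi> i) q1 \<in> lhom A M (cyc X i)" by (rule lh_comp[OF lM q1 \<phi>(1)])
    let ?z = "\<lambda>g\<in>carrier M. x g \<oplus>\<^bsub>cyc X i\<^esub> (\<lambda>g\<in>carrier M. \<ominus>\<^bsub>cyc X i\<^esub> compose (carrier M) (\<phi> i) q1 g) g"
    have z: "?z \<in> lhom A M (cyc X i)" by (rule lh_plus[OF lM lc xz lh_uminus[OF lM lc f1]])
    \<comment> \<open>Linearity of the map to H refers to negatives in the module of cycles, the
      differential to those in X; the two are different terms.\<close>
    have ncyc: "\<ominus>\<^bsub>cyc X i\<^esub> y = \<ominus>\<^bsub>cob X i\<^esub> y" if "y \<in> carrier (cyc X i)" for y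
      unfolding cyc_def by (rule submod_neg[OF cx_lm[OF cX] submod_kernel[OF cx_lm[OF cX] cx_lm[OF cX] cx_lh[OF cX]]]) (use that in simp)
    have "\<exists>v\<in>lhom A M (cob X (i - 1)). \<forall>g\<in>carrier M. dif X (i - 1) (v g) = ?z g"
    proof (rule H(6)[OF z])
      fix g assume g: "g \<in> carrier M"
      have m: "x g \<in> carrier (cyc X i)" "\<phi> i (q1 g) \<in> carrier (cyc X i)" using lh_closed[OF xz g] lh_closed[OF f1 g] g by (simp_all add: compose_eq)
      have "\<theta> i (x g \<oplus>\<^bsub>cyc X i\<^esub> \<ominus>\<^bsub>cyc X i\<^esub> \<phi> i (q1 g)) = \<theta> i (x g) \<oplus>\<^bsub>H i\<^esub> \<ominus>\<^bsub>H i\<^esub> \<theta> i (\<phi> i (q1 g))"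
        using lh_add[OF H(3) m(1) lm_neg[OF lc m(2)]] lh_neg[OF H(3) lc lH m(2)] by simp
      then show "\<theta> i (?z g) = \<zero>\<^bsub>H i\<^esub>"
        using g \<phi>(2) pq1[OF g] lh_closed[OF H(3) m(1)] lH by (simp add: compose_eq del: cyc_ops)
    qed
    then obtain v where v: "v \<in> lhom A M (cob X (i - 1))" and dv: "\<And>g. g \<in> carrier M \<Longrightarrow> dif X (i - 1) (v g) = x g \<oplus>\<^bsub>cob X i\<^esub> \<ominus>\<^bsub>cob X i\<^esub> \<phi> i (q1 g)"
      using ncyc lh_closed[OF f1] by (auto simp: compose_eq simp del: cyc_carrier)
    note [simp] = lh_closed[OF v]
    let ?u = "\<lambda>g\<in>carrier M. seq_pair (q1 g) (v g)"
    have "?u \<in> lhom A M (cob ?X (i - 1))"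
      using lh_into_dsum[OF lM lP cx_lm[OF cX] q1 v] by simp
    moreover have "dif ?X (i - 1) (?u g) = w g" if g: "g \<in> carrier M" for g
      using Q(4)[of "q1 g" i "v g"] g dv[OF g] \<phi>c[of "q1 g" i] cX wg[OF g] q0[OF g] by (simp add: lm_ac)
    ultimately show ?thesis by blast
  qed
  have E: "?\<theta> i (dif ?X (i - 1) w) = \<zero>\<^bsub>?H i\<^esub>" if w: "w \<in> carrier (cob ?X (i - 1))" for i w
  proof -
    obtain q x where qx: "w = seq_pair q x" "q \<in> carrier (P i)" "x \<in> carrier (cob X (i - 1))" using w by (auto elim: dsumE)
    have "dif ?X (i - 1) w \<in> carrier (cyc ?X i)" by (rule lh_closed[OF dif_lh_cyc[OF cX'] w])
    then have "?\<theta> i (dif ?X (i - 1) w) = seq_fst (dif ?X (i - 1) w)" by (rule restrict_apply')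
    also have "\<dots> = \<zero>\<^bsub>P (i + 1)\<^esub>" unfolding qx(1) Q(4)[OF qx(2,3)] by simp
    finally show ?thesis by simp
  qed
  \<comment> \<open>The syzygy in degree i sits inside P in degree i + 1, which is a component of
    the cone in degree i.\<close>
  have zH: "zero_module (?H i)" if "zero_module (cob ?X i)" for i
  proof -
    have "carrier (P (i + 1)) \<subseteq> {\<zero>\<^bsub>P (i + 1)\<^esub>}"
    proof
      fix q assume "q \<in> carrier (P (i + 1))"
      then have "seq_pair q \<zero>\<^bsub>cob X i\<^esub> \<in> carrier (cob ?X i)" using cX by simp
      then have "seq_pair q \<zero>\<^bsub>cob X i\<^esub> = \<zero>\<^bsub>cob ?X i\<^esub>" using that unfolding zero_module_def by blast
      then have "seq_fst (seq_pair q \<zero>\<^bsub>cob X i\<^esub>) = seq_fst \<zero>\<^bsub>cob ?X i\<^esub>" by (rule arg_cong)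
      then show "q \<in> {\<zero>\<^bsub>P (i + 1)\<^esub>}" by simp
    qed
    then show ?thesis using lm_zero[OF fg_lm[OF fH[of i]]] by (auto simp: zero_module_def)
  qed
  have "tame M n ?X"
    unfolding tame_def hom_cohomology_def
  proof (intro conjI allI)
    fix i show "\<exists>H \<theta>. resolved M n H \<and> fg H \<and> \<theta> \<in> lhom A (cyc ?X i) H \<and> (zero_module (cob ?X i) \<longrightarrow> zero_module H) \<and>
        lifts M (cyc ?X i) H \<theta> \<and> (\<forall>z\<in>lhom A M (cyc ?X i). (\<forall>g\<in>carrier M. \<theta> (z g) = \<zero>\<^bsub>H\<^esub>) \<longrightarrow>
          (\<exists>w\<in>lhom A M (cob ?X (i - 1)). \<forall>g\<in>carrier M. dif ?X (i - 1) (w g) = z g)) \<and>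
        (\<forall>x\<in>carrier (cob ?X (i - 1)). \<theta> (dif ?X (i - 1) x) = \<zero>\<^bsub>H\<^esub>)"
      by (rule exI[of _ "?H i"], rule exI[of _ "?\<theta> i"], intro conjI ballI impI)
        (rule zH B E, assumption+ | rule P(4) fH \<theta>l L)+
  qed (rule bX')
  then show ?thesis using Q(1,2) P(1) zero_dif_stalk by (intro exI[of _ ?P] exI[of _ \<phi>]) simp
qed

text \<open>The first term of a relative resolution of the cycles, with the zero cover where X
  vanishes.\<close>

lemma ex_covers:
  assumes R: "\<And>N. fg N \<Longrightarrow> resolved M (Suc d) N" and X: "bcx X"
  shows "\<exists>P p. (\<forall>i. P i \<in> addM A M) \<and> (\<forall>i. zero_module (cob X i) \<longrightarrow> zero_module (P i)) \<and> (\<forall>i. p i \<in> lhom A (P i) (cyc X i)) \<and>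
    (\<forall>i. lifts M (P i) (cyc X i) (p i))"
proof -
  note cX = bcx_cx[OF X]
  define S where "S i P p \<longleftrightarrow> P \<in> addM A M \<and> (zero_module (cob X i) \<longrightarrow> zero_module P) \<and> p \<in> lhom A P (cyc X i) \<and> lifts M P (cyc X i) p" for i P p
  have "\<exists>P p. S i P p" for i
  proof (cases "zero_module (cob X i)")
    case True
    then have "carrier (cyc X i) \<subseteq> {\<zero>\<^bsub>cob X i\<^esub>}" unfolding zero_module_def cyc_def by auto
    then have "zero_module (cyc X i)" using lm_zero[OF fg_lm[OF fg_cyc[OF cX, of i]]] by (auto simp: zero_module_def simp del: cyc_carrier)
    from zero_cover[OF M fg_cyc[OF cX] this] show ?thesis unfolding S_def using zero_addM[OF fg_zero_mod zero_zero_mod, of M] zero_zero_mod by blast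
  next
    case False
    then show ?thesis unfolding S_def using R[OF fg_cyc[OF cX, of i]] by auto
  qed
  then obtain P p where "\<And>i. S i (P i) (p i)" by metis
  then show ?thesis unfolding S_def by blast
qed

text \<open>Two cones suffice to make an arbitrary bounded complex tame: after the first one the
  coboundaries are representable, after the second one the cohomology is.\<close>

lemma ex_tame:
  assumes R: "\<And>N. fg N \<Longrightarrow> resolved M (Suc d) N" and X: "bcx X"
  shows "\<exists>P \<phi> Q \<psi>. bcx P \<and> zero_dif P \<and> (\<forall>i. cob P i \<in> addM A M) \<and> \<phi> \<in> chain_maps A P X \<and>
    bcx Q \<and> zero_dif Q \<and> (\<forall>i. cob Q i \<in> addM A M) \<and> \<psi> \<in> chain_maps A Q (cone P X \<phi>) \<and>
    tame M (Suc d) (cone Q (cone P X \<phi>) \<psi>)"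
proof -
  note cX = bcx_cx[OF X]
  obtain P \<phi> where P: "\<And>i. P i \<in> addM A M" "\<forall>i. zero_module (cob X i) \<longrightarrow> zero_module (P i)"
    and \<phi>: "\<And>i. \<phi> i \<in> lhom A (P i) (cyc X i)" "\<And>i. lifts M (P i) (cyc X i) (\<phi> i)" using ex_covers[OF R X] by blast
  let ?P = "stalk_family P"
  note CP = covers_complex[OF X P \<phi>(1)]
  let ?Y = "cone ?P X \<phi>"
  have Y: "bcx ?Y" by (rule bcx_cone[OF CP(1) X CP(2)])
  note cY = bcx_cx[OF Y]
  obtain Q \<psi> where Q: "\<And>i. Q i \<in> addM A M" "\<forall>i. zero_module (cob ?Y i) \<longrightarrow> zero_module (Q i)"
    and \<psi>: "\<And>i. \<psi> i \<in> lhom A (Q i) (cyc ?Y i)" "\<And>i. lifts M (Q i) (cyc ?Y i) (\<psi> i)" using ex_covers[OF R Y] by blast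
  let ?Q = "stalk_family Q"
  note CQ = covers_complex[OF Y Q \<psi>(1)]
  let ?Z = "cone ?Q ?Y \<psi>"
  have Z: "bcx ?Z" by (rule bcx_cone[OF CQ(1) Y CQ(2)])
  note cZ = bcx_cx[OF Z]
  have fP: "fg (P i)" and lP: "lm (P i)" for i using addM_fg[OF P(1)] fg_lm by auto
  have fQ: "fg (Q i)" and lQ: "lm (Q i)" for i using addM_fg[OF Q(1)] fg_lm by auto
  have lX: "lm (cob X i)" for i using cX by simp
  have lY: "lm (cob ?Y i)" for i by (rule cx_lm[OF cY])
  \<comment> \<open>The projection to P kills coboundaries of Y, and a cocycle with zero P-component
    is a coboundary because the first cover reaches all cocycles of X. So whether q dies in the
    cohomology of Y is decided by this map from Q to P, and H is its kernel.\<close>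
  let ?f = "\<lambda>i. compose (carrier (Q (i + 1))) (\<lambda>w\<in>carrier (cob ?Y (i + 1)). seq_fst w) (\<psi> (i + 1))"
  have \<psi>': "\<psi> i \<in> lhom A (Q i) (cob ?Y i)" for i using \<psi>(1)[of i] by (simp add: lh_cyc_iff)
  have i2: "i + 1 + 1 = i + (2::int)" for i by simp
  have f: "?f i \<in> lhom A (Q (i + 1)) (P (i + 2))" for i
  proof (rule lh_comp[OF lQ \<psi>'])
    show "(\<lambda>w\<in>carrier (cob ?Y (i + 1)). seq_fst w) \<in> lhom A (cob ?Y (i + 1)) (P (i + 2))"
      using lh_fst[OF lP lX, of "i + 2" "i + 1"] by (simp add: i2)
  qed
  have f_eq: "?f i q = seq_fst (\<psi> (i + 1) q)" if "q \<in> carrier (Q (i + 1))" for i q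
    using that lh_closed[OF \<psi>' that] by (simp add: compose_eq del: cone_cob)
  let ?H = "\<lambda>i. kern (Q (i + 1)) (?f i) (P (i + 2))"
  let ?\<theta> = "\<lambda>i. \<lambda>w\<in>carrier (cyc ?Z i). seq_fst w"
  have fH: "fg (?H i)" for i by (rule fg_kern[OF fQ fP f])
  \<comment> \<open>The differential of Y has zero component in P, so the cocycle condition forces
    the P-component of the image of q to vanish.\<close>
  have cyc_mem: "q \<in> carrier (?H i) \<and> y \<in> carrier (cob ?Y i) \<and> \<psi> (i + 1) q \<oplus>\<^bsub>cob ?Y (i + 1)\<^esub> dif ?Y i y = \<zero>\<^bsub>cob ?Y (i + 1)\<^esub>"
    if qy: "seq_pair q y \<in> carrier (cyc ?Z i)" for q y i
  proof -
    have q: "q \<in> carrier (Q (i + 1))" and y: "y \<in> carrier (cob ?Y i)" using qy by (auto simp del: cone_cob simp: cone_cob[of ?Q])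
    have e: "\<psi> (i + 1) q \<oplus>\<^bsub>cob ?Y (i + 1)\<^esub> dif ?Y i y = \<zero>\<^bsub>cob ?Y (i + 1)\<^esub>"
      using qy CQ(3)[OF q y] by (simp add: cone_cob[of ?Q] del: cone_cob cone_dif)
    obtain a x where ax: "y = seq_pair a x" "a \<in> carrier (P (i + 1))" "x \<in> carrier (cob X i)" using y by (auto elim: dsumE)
    have "seq_fst (\<psi> (i + 1) q \<oplus>\<^bsub>cob ?Y (i + 1)\<^esub> dif ?Y i y) = seq_fst (\<psi> (i + 1) q) \<oplus>\<^bsub>P (i + 2)\<^esub> \<zero>\<^bsub>P (i + 2)\<^esub>"
      unfolding ax(1) CP(3)[OF ax(2,3)] by (simp add: dsum_ops i2)
    moreover have "seq_fst (\<psi> (i + 1) q) \<in> carrier (P (i + 2))" using lh_closed[OF f q] f_eq[OF q] by simp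
    ultimately have "?f i q = \<zero>\<^bsub>P (i + 2)\<^esub>" unfolding e f_eq[OF q] using lP by (simp add: i2)
    then show ?thesis using q y e by simp
  qed
  have \<theta>l: "?\<theta> i \<in> lhom A (cyc ?Z i) (?H i)" for i
  proof (rule lh_restrict[OF fg_lm[OF fg_cyc[OF cZ]]])
    fix w assume w: "w \<in> carrier (cyc ?Z i)"
    then show "seq_fst w \<in> carrier (?H i)" using cyc_mem[of "seq_fst w" "seq_snd w" i] by (simp del: cyc_carrier)
  qed (simp_all add: dsum_ops)
  \<comment> \<open>For q in H the image in Y has the form (0, x) with x a cocycle of X. The first
    cover gives a over x, and (-a, 0) has differential (0, -x), so (q, (-a, 0)) is a cocycle of the
    second cone.\<close>
  have L: "lifts M (cyc ?Z i) (?H i) (?\<theta> i)" for i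
    unfolding lifts_def
  proof
    fix q assume q: "q \<in> lhom A M (?H i)"
    then have ql: "q \<in> lhom A M (Q (i + 1))" and fq: "\<And>g. g \<in> carrier M \<Longrightarrow> seq_fst (\<psi> (i + 1) (q g)) = \<zero>\<^bsub>P (i + 2)\<^esub>"
      using lh_closed[OF q] f_eq by (auto simp: lhom_def PiE_iff)
    note [simp] = lh_closed[OF ql]
    have pq: "compose (carrier M) (\<psi> (i + 1)) q \<in> lhom A M (cyc ?Y (i + 1))" by (rule lh_comp[OF lM ql \<psi>(1)])
    then have "compose (carrier M) (\<psi> (i + 1)) q \<in> lhom A M (dsum (P (i + 2)) (cob X (i + 1)))" by (simp add: lh_cyc_iff i2)
    from lh_into_dsumE[OF lM lP lX this] obtain b x where x: "x \<in> lhom A M (cob X (i + 1))"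
      and bx: "\<And>g. g \<in> carrier M \<Longrightarrow> compose (carrier M) (\<psi> (i + 1)) q g = seq_pair (b g) (x g)" by metis
    have px: "\<psi> (i + 1) (q g) = seq_pair \<zero>\<^bsub>P (i + 2)\<^esub> (x g)" if "g \<in> carrier M" for g
      using bx[OF that] fq[OF that] that by (simp add: compose_eq)
    have "dif X (i + 1) (x g) = \<zero>\<^bsub>cob X (i + 1 + 1)\<^esub>" if g: "g \<in> carrier M" for g
    proof -
      have "dif ?Y (i + 1) (seq_pair \<zero>\<^bsub>P (i + 2)\<^esub> (x g)) = \<zero>\<^bsub>cob ?Y (i + 1 + 1)\<^esub>"
        using cocycleD(3)[OF pq g] px[OF g] g by (simp add: compose_eq)
      moreover have "dif ?Y (i + 1) (seq_pair \<zero>\<^bsub>P (i + 2)\<^esub> (x g)) =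
          seq_pair \<zero>\<^bsub>P (i + 1 + 2)\<^esub> (\<phi> (i + 2) \<zero>\<^bsub>P (i + 2)\<^esub> \<oplus>\<^bsub>cob X (i + 2)\<^esub> dif X (i + 1) (x g))"
        using CP(3)[of "\<zero>\<^bsub>P (i + 2)\<^esub>" "i + 1" "x g"] lP lh_closed[OF x g] by (simp add: i2)
      ultimately have "\<phi> (i + 2) \<zero>\<^bsub>P (i + 2)\<^esub> \<oplus>\<^bsub>cob X (i + 2)\<^esub> dif X (i + 1) (x g) = \<zero>\<^bsub>cob X (i + 2)\<^esub>" by (simp add: i2)
      then show ?thesis using lh_zero[OF \<phi>(1) lP fg_lm[OF fg_cyc[OF cX]], of "i + 2"] lh_closed[OF x g] cX by (simp add: i2)
    qed
    then have "x \<in> lhom A M (cyc X (i + 1))" using x by (simp add: lh_cyc_iff)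
    from liftsE[OF \<phi>(2) this] obtain a where a: "a \<in> lhom A M (P (i + 1))" and ax: "\<And>g. g \<in> carrier M \<Longrightarrow> \<phi> (i + 1) (a g) = x g" by blast
    note [simp] = lh_closed[OF a] lh_closed[OF x]
    let ?y = "\<lambda>g\<in>carrier M. seq_pair ((\<lambda>g\<in>carrier M. \<ominus>\<^bsub>P (i + 1)\<^esub> a g) g) ((\<lambda>g\<in>carrier M. \<zero>\<^bsub>cob X i\<^esub>) g)"
    have y: "?y \<in> lhom A M (cob ?Y i)"
      using lh_into_dsum[OF lM lP lX lh_uminus[OF lM lP a] lh_0[OF lM lX]] by simp
    have nx: "\<ominus>\<^bsub>cyc X (i + 1)\<^esub> x g = \<ominus>\<^bsub>cob X (i + 1)\<^esub> x g" if g: "g \<in> carrier M" for g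
      using submod_neg(1)[OF cx_lm[OF cX] submod_kernel[OF cx_lm[OF cX] cx_lm[OF cX] cx_lh[OF cX]], of "x g" "i + 1"]
        lh_closed[OF \<phi>(1) lh_closed[OF a g]] ax[OF g] by (simp add: cyc_def)
    have dy: "dif ?Y i (?y g) = seq_pair \<zero>\<^bsub>P (i + 2)\<^esub> (\<ominus>\<^bsub>cob X (i + 1)\<^esub> x g)" if g: "g \<in> carrier M" for g
      using CP(3)[of "\<ominus>\<^bsub>P (i + 1)\<^esub> a g" i "\<zero>\<^bsub>cob X i\<^esub>"] g lP lX cX ax[OF g] lh_neg[OF \<phi>(1) lP fg_lm[OF fg_cyc[OF cX]], of "a g" "i + 1"]
        nx[OF g]
        lh_closed[OF \<phi>(1), of "a g" "i + 1"]
      by (simp add: i2 del: cone_dif)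
    let ?v = "\<lambda>g\<in>carrier M. seq_pair (q g) (?y g)"
    have v: "?v \<in> lhom A M (cob ?Z i)"
      using lh_into_dsum[OF lM lQ lY ql y] by (simp add: cone_cob[of ?Q] del: cone_cob)
    have "dif ?Z i (?v g) = \<zero>\<^bsub>cob ?Z (i + 1)\<^esub>" if g: "g \<in> carrier M" for g
    proof -
      have "?v g = seq_pair (q g) (?y g)" using g by simp
      then have "dif ?Z i (?v g) = seq_pair \<zero>\<^bsub>Q (i + 2)\<^esub> (\<psi> (i + 1) (q g) \<oplus>\<^bsub>cob ?Y (i + 1)\<^esub> dif ?Y i (?y g))"
        using CQ(3)[OF _ lh_closed[OF y g], of "q g"] g by simp
      also have "\<psi> (i + 1) (q g) \<oplus>\<^bsub>cob ?Y (i + 1)\<^esub> dif ?Y i (?y g) = \<zero>\<^bsub>cob ?Y (i + 1)\<^esub>"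
        unfolding dy[OF g] px[OF g] using lP lX g by (simp add: i2)
      finally show ?thesis by (simp add: cone_cob[of ?Q] i2 del: cone_cob)
    qed
    then have vc: "?v \<in> lhom A M (cyc ?Z i)" using v by (simp only: lh_cyc_iff) blast
    have "?\<theta> i (?v g) = q g" if g: "g \<in> carrier M" for g
      using lh_closed[OF vc g] g by (simp del: cyc_carrier)
    then show "\<exists>v\<in>lhom A M (cyc ?Z i). \<forall>g\<in>carrier M. ?\<theta> i (v g) = q g" using vc by blast
  qed
  \<comment> \<open>With q = 0, y is a cocycle of Y. The second cover gives q1 over it, and (q1, 0)
    bounds (0, y).\<close>
  have B: "\<exists>v\<in>lhom A M (cob ?Z (i - 1)). \<forall>g\<in>carrier M. dif ?Z (i - 1) (v g) = w g"
    if w: "w \<in> lhom A M (cyc ?Z i)" and w0: "\<forall>g\<in>carrier M. ?\<theta> i (w g) = \<zero>\<^bsub>?H i\<^esub>" for i w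
  proof -
    have "w \<in> lhom A M (dsum (Q (i + 1)) (cob ?Y i))" using cocycleD(1)[OF w] by (simp add: cone_cob[of ?Q] del: cone_cob)
    from lh_into_dsumE[OF lM lQ lY this] obtain q y where q: "q \<in> lhom A M (Q (i + 1))" and y: "y \<in> lhom A M (cob ?Y i)"
      and wg: "\<And>g. g \<in> carrier M \<Longrightarrow> w g = seq_pair (q g) (y g)" by metis
    have q0: "q g = \<zero>\<^bsub>Q (i + 1)\<^esub>" if "g \<in> carrier M" for g
      using w0[rule_format, OF that] lh_closed[OF w that] wg[OF that] by (simp del: cyc_carrier)
    have "dif ?Y i (y g) = \<zero>\<^bsub>cob ?Y (i + 1)\<^esub>" if g: "g \<in> carrier M" for g
    proof -
      have "\<psi> (i + 1) (q g) \<oplus>\<^bsub>cob ?Y (i + 1)\<^esub> dif ?Y i (y g) = \<zero>\<^bsub>cob ?Y (i + 1)\<^esub>"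
        using cyc_mem[of "q g" "y g" i] lh_closed[OF w g] wg[OF g] by simp
      moreover have "\<psi> (i + 1) (q g) = \<zero>\<^bsub>cob ?Y (i + 1)\<^esub>" unfolding q0[OF g] by (rule lh_zero[OF \<psi>' lQ lY])
      ultimately show ?thesis using lm_l0[OF lY cx_closed[OF cY lh_closed[OF y g]]] by simp
    qed
    then have "y \<in> lhom A M (cyc ?Y i)" using y by (simp only: lh_cyc_iff) blast
    from liftsE[OF \<psi>(2) this] obtain q1 where q1: "q1 \<in> lhom A M (Q i)" and pq1: "\<And>g. g \<in> carrier M \<Longrightarrow> \<psi> i (q1 g) = y g" by blast
    let ?u = "\<lambda>g\<in>carrier M. seq_pair (q1 g) ((\<lambda>g\<in>carrier M. \<zero>\<^bsub>cob ?Y (i - 1)\<^esub>) g)"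
    have "?u \<in> lhom A M (cob ?Z (i - 1))"
      using lh_into_dsum[OF lM lQ lY q1 lh_0[OF lM lY]] by (simp add: cone_cob[of ?Q] del: cone_cob)
    moreover have "dif ?Z (i - 1) (?u g) = w g" if g: "g \<in> carrier M" for g
    proof -
      have "dif ?Z (i - 1) (?u g) = seq_pair \<zero>\<^bsub>Q (i + 1)\<^esub> (\<psi> i (q1 g) \<oplus>\<^bsub>cob ?Y i\<^esub> dif ?Y (i - 1) \<zero>\<^bsub>cob ?Y (i - 1)\<^esub>)"
        using CQ(4)[OF lh_closed[OF q1 g] lm_zero[OF lY]] g by simp
      then show ?thesis unfolding cx_zero'[OF cY] wg[OF g] q0[OF g] pq1[OF g] using lm_r0[OF lY lh_closed[OF y g]] by simp
    qed
    ultimately show ?thesis by blast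
  qed
  have E: "?\<theta> i (dif ?Z (i - 1) w) = \<zero>\<^bsub>?H i\<^esub>" if w: "w \<in> carrier (cob ?Z (i - 1))" for i w
  proof -
    have "w \<in> carrier (dsum (Q i) (cob ?Y (i - 1)))" using w by (simp add: cone_cob[of ?Q] del: cone_cob)
    then obtain q y where qy: "w = seq_pair q y" "q \<in> carrier (Q i)" "y \<in> carrier (cob ?Y (i - 1))" by (rule dsumE)
    have "dif ?Z (i - 1) w \<in> carrier (cyc ?Z i)" by (rule lh_closed[OF dif_lh_cyc[OF cZ] w])
    then have "?\<theta> i (dif ?Z (i - 1) w) = seq_fst (dif ?Z (i - 1) w)" by (rule restrict_apply')
    also have "\<dots> = \<zero>\<^bsub>Q (i + 1)\<^esub>" unfolding qy(1) CQ(4)[OF qy(2,3)] by simp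
    finally show ?thesis by simp
  qed
  have zH: "zero_module (?H i)" if "zero_module (cob ?Z i)" for i
  proof -
    have "carrier (Q (i + 1)) \<subseteq> {\<zero>\<^bsub>Q (i + 1)\<^esub>}"
    proof
      fix q assume "q \<in> carrier (Q (i + 1))"
      then have "seq_pair q \<zero>\<^bsub>cob ?Y i\<^esub> \<in> carrier (cob ?Z i)" using lm_zero[OF lY] by (simp add: cone_cob[of ?Q] del: cone_cob)
      then have "seq_pair q \<zero>\<^bsub>cob ?Y i\<^esub> = \<zero>\<^bsub>cob ?Z i\<^esub>" using that unfolding zero_module_def by blast
      then have "seq_fst (seq_pair q \<zero>\<^bsub>cob ?Y i\<^esub>) = seq_fst \<zero>\<^bsub>cob ?Z i\<^esub>" by (rule arg_cong)
      then show "q \<in> {\<zero>\<^bsub>Q (i + 1)\<^esub>}" by (simp add: cone_cob[of ?Q] del: cone_cob)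
    qed
    then show ?thesis using lm_zero[OF fg_lm[OF fH[of i]]] by (auto simp: zero_module_def)
  qed
  have "tame M (Suc d) ?Z"
    unfolding tame_def hom_cohomology_def
  proof (intro conjI allI)
    fix i show "\<exists>H \<theta>. resolved M (Suc d) H \<and> fg H \<and> \<theta> \<in> lhom A (cyc ?Z i) H \<and> (zero_module (cob ?Z i) \<longrightarrow> zero_module H) \<and>
        lifts M (cyc ?Z i) H \<theta> \<and> (\<forall>z\<in>lhom A M (cyc ?Z i). (\<forall>g\<in>carrier M. \<theta> (z g) = \<zero>\<^bsub>H\<^esub>) \<longrightarrow>
          (\<exists>w\<in>lhom A M (cob ?Z (i - 1)). \<forall>g\<in>carrier M. dif ?Z (i - 1) (w g) = z g)) \<and>
        (\<forall>x\<in>carrier (cob ?Z (i - 1)). \<theta> (dif ?Z (i - 1) x) = \<zero>\<^bsub>H\<^esub>)"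
      by (rule exI[of _ "?H i"], rule exI[of _ "?\<theta> i"], intro conjI ballI impI)
        (rule zH B E, assumption+ | rule R[OF fH] fH \<theta>l L)+
  qed (rule Z)
  then show ?thesis using CP(1,2) CQ(1,2) P(1) Q(1) zero_dif_stalk
    by (intro exI[of _ ?P] exI[of _ \<phi>] exI[of _ ?Q] exI[of _ \<psi>]) (simp del: cone_cob)
qed

end

end

text \<open>A finite infimum comes from a nonempty set of extended naturals and is attained there;
  the empty set has infimum infinity.\<close>

lemma Inf_enat_mem: "Inf S \<noteq> \<infinity> \<Longrightarrow> Inf S \<in> S" for S :: "enat set"
  by (cases "S = {}") (auto simp: Inf_enat_def intro: LeastI)

lemma tri_gen_subset: "tri_gen T M n \<subseteq> Ob T"
  by (cases n) (auto simp: add_closure_def)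

section \<open>The dimension bound\<close>

context fda
begin

text \<open>X is the middle term of the triangle P -> X -> cone f, which is the shape of the
  recursive clause of \<open>tri_gen\<close>.\<close>

lemma cone_tri_gen:
  assumes P: "bcx P" and X: "bcx X" and f: "f \<in> chain_maps A P X"
    and PM: "P \<in> add_closure DK {shift_cx i N | i. True}" and C: "cone P X f \<in> tri_gen (Dbgp A) N n"
  shows "X \<in> tri_gen (Dbgp A) N (Suc n)"
proof -
  note c = bcx_cx[OF P] bcx_cx[OF X]
  let ?C = "cone P X f"
  let ?r = "roof_image (Kb A) Nac"
  have bC: "bcx ?C" by (rule bcx_cone[OF P X f])
  have "arr (Kb A) P X (hclass A P X f)" "arr (Kb A) X ?C (hclass A X ?C (cone_inj P X))"
    "arr (Kb A) ?C (shift_cx 1 P) (hclass A ?C (shift_cx 1 P) (cone_proj P X))"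
    using P X bC f bcx_shift[OF P] cone_inj_cm[OF c f] cone_proj_cm[OF c f] by (auto simp: arr_Kb)
  from Kf.Tri_image[unfolded Kb_simps(4), OF Tri_cone[OF P X f] this]
  have "\<exists>M' M'' u v w. (M', X, M'', u, v, w) \<in> Tri (Dbgp A) \<and>
      M' \<in> add_closure (Dbgp A) {shO (Dbgp A) i N | i. True} \<and> M'' \<in> tri_gen (Dbgp A) N n"
    using PM C unfolding Dbgp_def Kf.add_closure_VQ Kf.VQ_simps Kb_simps by blast
  then show ?thesis
    using Kf.D.add_closure_incl[OF _ _ initial_DK] X
    by (simp add: Dbgp_def Kf.add_closure_VQ verdier_shift_cat_def)
qed

text \<open>\<open>GM\<close> is the only consequence of G lying in add M that the generation
  argument uses: Hom(M, -)-exact complexes become zero in the derived category.\<close>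

context
  fixes M :: "'a umod"
  assumes M: "fg M"
    and GM: "\<And>C. cx C \<Longrightarrow> hom_from_exact A M C \<Longrightarrow> \<forall>G'\<in>AGproj A. hom_from_exact A G' C"
begin

text \<open>With index n + 1 there are n + 1 covers, but the last cone is acyclic. The last complex
  is therefore isomorphic to its cover, and only n triangles are counted.\<close>

lemma tame_tri_gen: "tame M (Suc n) X \<Longrightarrow> X \<in> tri_gen (Dbgp A) (stalk M) n"
proof (induction n arbitrary: X)
  case (0 X)
  then have X: "bcx X" by (simp add: tame_def)
  obtain P \<phi> where P: "bcx P" "zero_dif P" "\<And>i. cob P i \<in> addM A M" "\<phi> \<in> chain_maps A P X" and t: "tame M 0 (cone P X \<phi>)"
    using tame_step[OF M 0] by blast
  let ?C = "cone P X \<phi>"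
  have C: "bcx ?C" by (rule bcx_cone[OF P(1) X P(4)])
  have "lifts M (cob ?C (i - 1)) (cyc ?C i) (dif ?C (i - 1))" for i
    unfolding lifts_def
  proof
    fix z assume z: "z \<in> lhom A M (cyc ?C i)"
    obtain H \<theta> where H: "zero_module H" "hom_cohomology M ?C i H \<theta>" using t unfolding tame_def resolved.simps by blast
    have "\<theta> (z g) = \<zero>\<^bsub>H\<^esub>" if "g \<in> carrier M" for g
    proof -
      have "\<theta> \<in> lhom A (cyc ?C i) H" using H(2) by (simp add: hom_cohomology_def)
      from lh_closed[OF this lh_closed[OF z that]] show ?thesis using H(1) by (simp add: zero_module_def)
    qed
    then show "\<exists>\<psi>\<in>lhom A M (cob ?C (i - 1)). \<forall>x\<in>carrier M. dif ?C (i - 1) (\<psi> x) = z x"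
      using H(2) z unfolding hom_cohomology_def by blast
  qed
  then have "hom_from_exact A M ?C" using hom_from_exact_iff[OF bcx_cx[OF C] fg_lm[OF M]] by blast
  then have "?C \<in> Nac" unfolding Gproj_acyclic_iff using C GM[OF bcx_cx[OF C]] by blast
  then have "weq (Kb A) Nac P X (hclass A P X \<phi>)" unfolding weq_iff using gqis_iff_cone[OF P(1) X P(4)] P X by blast
  from Kf.image_iso[OF this] have iso: "is_iso DK P X (roof_image (Kb A) Nac P X (hclass A P X \<phi>))" .
  have ob: "P \<in> Ob DK" "X \<in> Ob DK" using P X by (simp_all add: verdier_shift_cat_def)
  obtain \<alpha> where "is_iso DK X P \<alpha>" using Kf.D.is_isoE[OF iso ob] Kf.D.is_isoI by metis
  from add_closure_iso[OF zero_dif_add_closure[OF M P(1-3)] this X]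
  show ?case by (simp add: Dbgp_def Kf.add_closure_VQ)
next
  case (Suc n X)
  then have X: "bcx X" by (simp add: tame_def)
  obtain P \<phi> where P: "bcx P" "zero_dif P" "\<And>i. cob P i \<in> addM A M" "\<phi> \<in> chain_maps A P X" and t: "tame M (Suc n) (cone P X \<phi>)"
    using tame_step[OF M Suc.prems] by blast
  show ?case by (rule cone_tri_gen[OF P(1) X P(4) zero_dif_add_closure[OF M P(1-3)] Suc.IH[OF t]])
qed

text \<open>\<open>ex_tame\<close> contributes two triangles and \<open>tame_tri_gen\<close>
  contributes d, since resolutions of length d have d + 1 terms.\<close>

lemma tri_gen_all:
  assumes R: "\<And>N. fg N \<Longrightarrow> resolved M (Suc d) N" and X: "bcx X"
  shows "X \<in> tri_gen (Dbgp A) (stalk M) (d + 2)"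
proof -
  obtain P \<phi> Q \<psi> where P: "bcx P" "zero_dif P" "\<And>i. cob P i \<in> addM A M" "\<phi> \<in> chain_maps A P X"
    and Q: "bcx Q" "zero_dif Q" "\<And>i. cob Q i \<in> addM A M" "\<psi> \<in> chain_maps A Q (cone P X \<phi>)"
    and t: "tame M (Suc d) (cone Q (cone P X \<phi>) \<psi>)"
    using ex_tame[OF M R X] by blast
  have Y: "bcx (cone P X \<phi>)" by (rule bcx_cone[OF P(1) X P(4)])
  have "X \<in> tri_gen (Dbgp A) (stalk M) (Suc (Suc d))"
    by (rule cone_tri_gen[OF P(1) X P(4) zero_dif_add_closure[OF M P(1-3)]
        cone_tri_gen[OF Q(1) Y Q(4) zero_dif_add_closure[OF M Q(1-3)] tame_tri_gen[OF t]]])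
  then show ?thesis by simp
qed

lemma tri_dim_le:
  assumes R: "\<And>N. fg N \<Longrightarrow> resolved M (Suc d) N"
  shows "tri_dim (Dbgp A) \<le> enat d + 2"
proof -
  have ob: "Ob (Dbgp A) = bounded_complexes A" by (simp add: Dbgp_def)
  have "tri_gen (Dbgp A) (stalk M) (d + 2) = Ob (Dbgp A)"
    using tri_gen_subset[of "Dbgp A"] tri_gen_all[OF R] unfolding ob by blast
  then have "tri_dim (Dbgp A) \<le> enat (d + 2)"
    unfolding tri_dim_def using stalk_shift(1)[OF M] by (intro Inf_lower CollectI exI[of _ "d + 2"]) (auto simp: ob)
  then show ?thesis by (simp add: numeral_eq_enat)
qed

end

lemma Grepdim_ge:
  assumes rep: "Gproj_representatives A m Gs" and ds: "direct_sum (Amod A) {..<m} Gs G \<iota>"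
  shows "tri_dim (Dbgp A) \<le> Grepdim K A G"
proof -
  let ?S = "{resol_dim_mod A M | M. M \<in> Ob (Amod A) \<and> (\<exists>N\<in>Ob (Amod A). lmod_iso A N (nakayama K A G) \<and>
        (\<exists>S\<in>addM A M. direct_sum2 (Amod A) G N S))}"
  show ?thesis
  proof (cases "Inf ?S = \<infinity>")
    case False
    then have "Inf ?S \<in> ?S" by (rule Inf_enat_mem)
    then obtain M N S where "M \<in> Ob (Amod A)" and S: "S \<in> addM A M" "direct_sum2 (Amod A) G N S" and e: "Inf ?S = resol_dim_mod A M"
      by blast
    then have M: "fg M" by (simp add: Amod_def)
    obtain d where d: "resol_dim_mod A M = enat d" using False e by auto
    have G: "fg G" using ds by (auto simp: direct_sum_def Amod_def)
    \<comment> \<open>Exactness is a lifting property; it passes from M to S in add M, to the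
      summand G of S, and from G to every Gorenstein projective module.\<close>
    have "hom_from_exact A G' C" if C: "cx C" "hom_from_exact A M C" and G': "G' \<in> AGproj A" for C G'
    proof -
      have "lifts G' (cob C (i - 1)) (cyc C i) (dif C (i - 1))" for i
      proof (rule AGproj_lifts[OF rep ds _ fg_cyc[OF C(1)] dif_lh_cyc[OF C(1)] _ G'])
        show "fg (cob C (i - 1))" by (rule cx_fg[OF C(1)])
        then show "lifts G (cob C (i - 1)) (cyc C i) (dif C (i - 1))"
          using hom_from_exact_iff[OF C(1) fg_lm[OF M]] C(2) lifts_addM[OF S(1) _ fg_cyc[OF C(1)] dif_lh_cyc[OF C(1)]]
            lifts_retract[OF direct_sum2_retract(1,3,5)[OF S(2)]] by blast
      qed
      then show ?thesis using hom_from_exact_iff[OF C(1) AGproj_lm[OF G']] by blast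
    qed
    \<comment> \<open>The supremum d bounds every single resolution dimension, so each is finite and
      attained; shorter resolutions are padded to the common length.\<close>
    moreover have "resolved M (Suc d) X" if X: "fg X" for X
    proof -
      have "resol_dim A M X \<le> enat d" unfolding d[symmetric] resol_dim_mod_def using X by (intro SUP_upper) (simp add: Amod_def)
      moreover have "resol_dim A M X \<in> {enat n | n. \<exists>C. is_resolution A M X n C}" if "resol_dim A M X \<noteq> \<infinity>"
        unfolding resol_dim_def by (rule Inf_enat_mem) (use that in \<open>simp add: resol_dim_def\<close>)
      ultimately obtain n C where "is_resolution A M X n C" "n \<le> d" by force
      then show ?thesis using resolved_mono[OF M X resolution_resolved[OF M], of n C "Suc d"] by simp
    qed
    ultimately have "tri_dim (Dbgp A) \<le> enat d + 2" using tri_dim_le[OF M] by blast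
    then show ?thesis unfolding Grepdim_def e d .
  qed (simp add: Grepdim_def)
qed

end

text \<open>A bound instead of an equality, because a zero module has empty support and then the
  supremum is minus infinity. Otherwise the zero ideal is the only prime, so chains have length
  0.\<close>

lemma krull_dim_field_le:
  assumes "field K" shows "krull_dim K M \<le> 0"
proof -
  interpret field K by fact
  have 0: "P = {\<zero>\<^bsub>K\<^esub>}" if "P \<in> support K M" for P
  proof -
    have p: "primeideal P K" using that by (simp add: support_def)
    from primeideal.axioms(1)[OF p] have "P \<in> {{\<zero>\<^bsub>K\<^esub>}, carrier K}" unfolding all_ideals[symmetric] by simp
    then show ?thesis using primeideal.I_notcarr[OF p] by blast
  qed
  have "n = 0" if "\<forall>i\<le>n. P i \<in> support K M" "\<forall>i<n. P i \<subset> P (Suc i)" for n :: nat and P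
  proof (rule ccontr)
    assume "n \<noteq> 0"
    then have "P 0 \<subset> P (Suc 0)" "P 0 \<in> support K M" "P (Suc 0) \<in> support K M" using that by auto
    then show False using 0 by blast
  qed
  then show ?thesis unfolding krull_dim_def by (intro Sup_least) auto
qed

theorem theorem4p6:
  fixes K :: "'k ring" and A :: "('k, 'a) module"
    and m :: nat and Gs :: "nat \<Rightarrow> ('a, nat \<Rightarrow> 'a) module"
    and G :: "('a, nat \<Rightarrow> 'a) module" and \<iota> :: "nat \<Rightarrow> (nat \<Rightarrow> 'a) \<Rightarrow> (nat \<Rightarrow> 'a)"
  assumes "fin_dim_algebra K A"
    and "finite_CM_type A"
    and "Gproj_representatives A m Gs"
    and "direct_sum (Amod A) {..<m} Gs G \<iota>"
  shows "Grepdim K A G \<ge> tri_dim (Dbgp A) \<and>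
         ereal_of_enat (tri_dim (Dbgp A)) \<ge> krull_dim K (rel_auslander A G) - 1"
proof
  interpret fda K A by unfold_locales fact
  show "Grepdim K A G \<ge> tri_dim (Dbgp A)" by (rule Grepdim_ge[OF assms(3,4)])
  have "field K" using assms(1) by (simp add: fin_dim_algebra_def)
  then have "krull_dim K (rel_auslander A G) - 1 \<le> 0 - 1" by (intro ereal_minus_mono krull_dim_field_le) simp_all
  also have "\<dots> \<le> (0::ereal)" by simp
  also have "\<dots> \<le> ereal_of_enat (tri_dim (Dbgp A))" by (rule ereal_of_enat_nonneg)
  finally show "ereal_of_enat (tri_dim (Dbgp A)) \<ge> krull_dim K (rel_auslander A G) - 1" .
qed

end
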